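(* Let $\mathcal X$ be an admissible interpolation family on $\partial\mathbb U$ with intersection space $\Delta$ and containing space $\Sigma$. For every $n,k\ge1$ and each $z\in\mathbb U$ there is a commutative diagram $$\begin{array}{ccccccccc}0&\to&(\mathscr F^\bigstar)^{(n)}_z&\xrightarrow{\jmath_{n,n+k}}&(\mathscr F^\bigstar)^{(n+k)}_z&\xrightarrow{\varpi_{n+k,k}}&(\mathscr F^\bigstar)^{(k)}_z&\to&0\\&&\downarrow T_n&&\downarrow T_{n+k}&&\downarrow T_k&&\\0&\to&(X^{(n)}_z)^*&\xrightarrow{\pi_{n+k,n}^*}&(X^{(n+k)}_z)^*&\xrightarrow{\imath_{k,n+k}^*}&(X^{(k)}_z)^*&\to&0\end{array}$$ in which the vertical arrows are linear homeomorphisms and the rows are exact.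
   Context: Let $\mathbb U\subset\mathbb C$ be a domain conformally equivalent to the unit disc $\mathbb D$, $\mathbb T=\partial\mathbb D$, and fix a conformal map $\varphi:\mathbb D\to\mathbb U$, assumed to extend to a continuous surjection $\tilde{\mathbb D}\to\overline{\mathbb U}$, where $\tilde{\mathbb D}\subset\overline{\mathbb D}$ contains $\mathbb D$ and almost every point of $\mathbb T$; $\partial\mathbb U$ carries the image of arc length $d|z|$ under $\varphi$. $N^+$ is the Smirnov class on $\mathbb D$. An interpolation family $\mathcal X=\{X_\omega:\omega\in\partial\mathbb U\}$ of Banach spaces, with containing space $\Sigma$, intersection space $\Delta$ and containing function $k$, is a family such that: $\Sigma$ is a Banach space into which every $X_\omega$ embeds linearly and continuously; $\Delta$ is a subspace of $\bigcap_\omega X_\omega$ such that for every $x\in\Delta$ the function $z\in\mathbb T\cap\tilde{\mathbb D}\mapsto\|x\|_{\varphi(z)}$ is measurable and $\int_{\mathbb T}\log^+\|x\|_{\varphi(z)}\,d|z|<\infty$ (here $\|\cdot\|_\omega$ is the norm of $X_\omega$); $k:\partial\mathbb U\to(0,\infty)$ is measurable, $\int_{\mathbb T}\log^+k(\varphi(z))\,d|z|<\infty$ and $\|x\|_\Sigma\le k(u)\|x\|_u$ for all $u\in\partial\mathbb U$, $x\in\Delta$. $\mathscr G=\mathscr G(\mathcal X)$ is the space of functions on $\mathbb U$ of the form $g=\sum_{j=1}^Ng_jx_j$ with $g_j\circ\varphi\in N^+$, $x_j\in\Delta$, and $\|g\|=\operatorname{ess\,sup}_{u\in\partial\mathbb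 U}\|g(u)\|_u<\infty$ (boundary values are nontangential limits). $\mathscr F=\mathscr F(\mathcal X)$ is its completion, identified with a Banach space of analytic functions $\mathbb U\to\Sigma$ with bounded evaluations $\delta_z:\mathscr F\to\Sigma$. The family $\mathcal X$ is admissible if for every $z\in\mathbb U$ the space $\ker\delta_z\cap\mathscr G$ is dense in $\ker\delta_z$ (equivalently, $\ker\delta_z=h\cdot\mathscr F$ whenever $h:\mathbb U\to\mathbb D$ is a conformal map vanishing at $z$). The Rochberg spaces are $X^{(n)}_z=\left\{\left(\frac{f^{(n-1)}(z)}{(n-1)!},\dots,f'(z),f(z)\right):f\in\mathscr F\right\}\subset\Sigma^n$ with the quotient norm; $X_z=X^{(1)}_z$; $\Delta^n$ is dense in $X^{(n)}_z$. Let $\Delta^\star$ be the algebraic dual of $\Delta$. $\mathscr F^\bigstar$ is the space of functions $h:\mathbb U\to\Delta^\star$ such that $z\mapsto\langle h(\varphi(z)),x\rangle$ belongs to $N^+$ for every $x\in\Delta$, and there is $C>0$ such that for each $x\in\Delta$ one has $\lim_{w\to z}|\langle h(\varphi(w)),x\rangle|\le C\|x\|_{\varphi(z)}$ for almost every $z\in\mathbb T$ (nontangential limit); $\|h\|_{\mathscr F^\bigstar}$ is the infimum of such $C$. For $h\in\mathscr F^\bigstar$, $h^{(i)}:\mathbb U\to\Delta^\star$ is given by $\langle h^{(i)}(z),x\rangle=\frac{d^i}{dz^i}\langle h(z),x\rangle$. Then $(\mathscr F^\bigstar)^{(n)}_z=\left\{\left(\frac{h^{(n-1)}(z)}{(n-1)!},\dots,h'(z),h(z)\right):h\in\mathscr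 F^\bigstar\right\}\subset(\Delta^\star)^n$ with the quotient norm. The paper takes as its starting point the known fact (Coifman, Cwikel, Rochberg, Sagher, Weiss) that for $n=1$ the pairing gives an isometry of $(\mathscr F^\bigstar)_z^{(1)}$ onto $X_z^*$. Maps: $T_n(\xi_{n-1},\dots,\xi_0)(x_{n-1},\dots,x_0)=\sum_{j=0}^{n-1}\langle\xi_j,x_{n-j-1}\rangle$ for $x_j\in\Delta$, extended by density to $X^{(n)}_z$. $\jmath_{n,n+k}:(\Delta^\star)^n\to(\Delta^\star)^{n+k}$ and $\imath_{n,n+k}:\Sigma^n\to\Sigma^{n+k}$ append $k$ zeros on the right: $(x_{n-1},\dots,x_0)\mapsto(x_{n-1},\dots,x_0,0,\dots,0)$. $\varpi_{n+k,k}:(\Delta^\star)^{n+k}\to(\Delta^\star)^k$ and $\pi_{n+k,k}:\Sigma^{n+k}\to\Sigma^k$ keep the last $k$ coordinates: $(x_{n+k-1},\dots,x_0)\mapsto(x_{k-1},\dots,x_0)$. These restrict to bounded operators $\imath_{k,n+k}:X^{(k)}_z\to X^{(n+k)}_z$ and $\pi_{n+k,n}:X^{(n+k)}_z\to X^{(n)}_z$, and $^*$ denotes the Banach space adjoint. *)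

theory Defs
  imports
    "HOL-Analysis.Analysis"
    "HOL-Library.Function_Algebras"
    "HOL-Probability.Essential_Supremum"
begin

section \<open>Complex vector spaces and complex normed spaces\<close>

text \<open>The libraries have only real normed spaces, so complex scalars are added on top of them.
  Function types carry the pointwise structure, so that tuples, algebraic duals and spaces of
  functionals are all subsets of types of class \<open>complex_vector\<close>.\<close>

class complex_vector = ab_group_add +
  fixes scaleC :: "complex \<Rightarrow> 'a \<Rightarrow> 'a" (infixr "*\<^sub>C" 75)
  assumes scaleC_add_right: "a *\<^sub>C (x + y) = a *\<^sub>C x + a *\<^sub>C y"
    and scaleC_add_left: "(a + b) *\<^sub>C x = a *\<^sub>C x + b *\<^sub>C x"
    and scaleC_scaleC: "a *\<^sub>C (b *\<^sub>C x) = (a * b) *\<^sub>C x"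
    and scaleC_one: "1 *\<^sub>C x = x"

global_interpretation complex_vector: vector_space "scaleC :: complex \<Rightarrow> 'a \<Rightarrow> 'a::complex_vector"
  by standard (rule scaleC_add_right scaleC_add_left scaleC_scaleC scaleC_one)+

class complex_banach = complex_vector + banach +
  assumes scaleC_of_real: "complex_of_real r *\<^sub>C x = r *\<^sub>R x"
    and norm_scaleC: "norm (a *\<^sub>C x) = cmod a * norm x"

instantiation complex :: complex_banach
begin
definition "scaleC_complex a (x::complex) = a * x"
instance
  by standard (simp_all add: scaleC_complex_def algebra_simps norm_mult scaleR_conv_of_real)
end

instantiation "fun" :: (type, complex_vector) complex_vector
begin
definition "scaleC_fun a (f :: 'a \<Rightarrow> 'b) = (\<lambda>x. a *\<^sub>C f x)"
instance
  by standard
    (simp_all add: scaleC_fun_def fun_eq_iff scaleC_add_right scaleC_add_left scaleC_scaleC scaleC_one)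
end

text \<open>A normed space given by an underlying set of vectors and a norm, whose values outside that
  set are irrelevant.\<close>

record 'v nspace =
  points :: "'v set"
  nrm :: "'v \<Rightarrow> real"

definition normed_space_on :: "'v::complex_vector nspace \<Rightarrow> bool" where
  "normed_space_on V \<longleftrightarrow>
     complex_vector.subspace (points V) \<and>
     (\<forall>x\<in>points V. 0 \<le> nrm V x \<and> (nrm V x = 0 \<longleftrightarrow> x = 0)) \<and>
     (\<forall>x\<in>points V. \<forall>a. nrm V (a *\<^sub>C x) = cmod a * nrm V x) \<and>
     (\<forall>x\<in>points V. \<forall>y\<in>points V. nrm V (x + y) \<le> nrm V x + nrm V y)"

text \<open>The locale \<open>Metric_space\<close> requires nonnegativity and symmetry also
  outside the underlying set; hence the value \<open>0\<close> there.\<close>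

definition norm_dist :: "'v::complex_vector nspace \<Rightarrow> 'v \<Rightarrow> 'v \<Rightarrow> real" where
  "norm_dist V x y = (if x \<in> points V \<and> y \<in> points V then nrm V (x - y) else 0)"

lemma Metric_space_norm_dist:
  assumes "normed_space_on V"
  shows "Metric_space (points V) (norm_dist V)"
proof -
  have sub: "complex_vector.subspace (points V)"
    and pos: "\<And>x. x \<in> points V \<Longrightarrow> 0 \<le> nrm V x \<and> (nrm V x = 0 \<longleftrightarrow> x = 0)"
    and scale: "\<And>x a. x \<in> points V \<Longrightarrow> nrm V (a *\<^sub>C x) = cmod a * nrm V x"
    and tri: "\<And>x y. x \<in> points V \<Longrightarrow> y \<in> points V \<Longrightarrow> nrm V (x + y) \<le> nrm V x + nrm V y"
    using assms unfolding normed_space_on_def by blast+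
  have diff: "x - y \<in> points V" if "x \<in> points V" "y \<in> points V" for x y
    using complex_vector.subspace_diff[OF sub that] .
  have sym: "nrm V (x - y) = nrm V (y - x)" if "x \<in> points V" "y \<in> points V" for x y
    using scale[of "x - y" "-1"] diff[OF that] by simp
  show ?thesis
  proof
    show "0 \<le> norm_dist V x y" for x y
      using pos diff by (simp add: norm_dist_def)
    show "norm_dist V x y = norm_dist V y x" for x y
      using sym by (simp add: norm_dist_def)
    show "norm_dist V x y = 0 \<longleftrightarrow> x = y" if "x \<in> points V" "y \<in> points V" for x y
      using pos diff that by (simp add: norm_dist_def)
    show "norm_dist V x z \<le> norm_dist V x y + norm_dist V y z"
      if "x \<in> points V" "y \<in> points V" "z \<in> points V" for x y z
      using tri[of "x - y" "y - z"] diff that by (simp add: norm_dist_def)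
  qed
qed

definition norm_topology :: "'v::complex_vector nspace \<Rightarrow> 'v topology" where
  "norm_topology V = Metric_space.mtopology (points V) (norm_dist V)"

definition banach_space_on :: "'v::complex_vector nspace \<Rightarrow> bool" where
  "banach_space_on V \<longleftrightarrow>
     normed_space_on V \<and> Metric_space.mcomplete (points V) (norm_dist V)"

definition linear_between ::
    "'v::complex_vector nspace \<Rightarrow> 'w::complex_vector nspace \<Rightarrow> ('v \<Rightarrow> 'w) \<Rightarrow> bool" where
  "linear_between V W f \<longleftrightarrow>
     f ` points V \<subseteq> points W \<and>
     (\<forall>x\<in>points V. \<forall>y\<in>points V. f (x + y) = f x + f y) \<and>
     (\<forall>a. \<forall>x\<in>points V. f (a *\<^sub>C x) = a *\<^sub>C f x)"

definition bounded_operator ::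
    "'v::complex_vector nspace \<Rightarrow> 'w::complex_vector nspace \<Rightarrow> ('v \<Rightarrow> 'w) \<Rightarrow> bool" where
  "bounded_operator V W f \<longleftrightarrow>
     linear_between V W f \<and> (\<exists>C. \<forall>x\<in>points V. nrm W (f x) \<le> C * nrm V x)"

definition linear_homeomorphism ::
    "'v::complex_vector nspace \<Rightarrow> 'w::complex_vector nspace \<Rightarrow> ('v \<Rightarrow> 'w) \<Rightarrow> bool" where
  "linear_homeomorphism V W f \<longleftrightarrow>
     normed_space_on V \<and> normed_space_on W \<and> linear_between V W f \<and>
     homeomorphic_map (norm_topology V) (norm_topology W) f"

text \<open>Exactness of \<open>0 \<rightarrow> V \<rightarrow> W \<rightarrow> Z \<rightarrow> 0\<close>, with bounded operators as arrows.\<close>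

definition short_exact ::
    "'v::complex_vector nspace \<Rightarrow> ('v \<Rightarrow> 'w) \<Rightarrow> 'w::complex_vector nspace \<Rightarrow> ('w \<Rightarrow> 'u) \<Rightarrow>
      'u::complex_vector nspace \<Rightarrow> bool" where
  "short_exact V f W g Z \<longleftrightarrow>
     bounded_operator V W f \<and> bounded_operator W Z g \<and>
     inj_on f (points V) \<and>
     f ` points V = {w \<in> points W. g w = 0} \<and>
     g ` points W = points Z"

text \<open>Functionals on \<open>V\<close> are represented by functions vanishing outside \<open>points V\<close>.\<close>

definition dual_space :: "'v::complex_vector nspace \<Rightarrow> ('v \<Rightarrow> complex) nspace" where
  "dual_space V =
     \<lparr>points = {\<psi>. bounded_operator V \<lparr>points = UNIV, nrm = cmod\<rparr> \<psi> \<and> (\<forall>x. x \<notin> points V \<longrightarrow> \<psi> x = 0)},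
      nrm = (\<lambda>\<psi>. Sup {cmod (\<psi> x) | x. x \<in> points V \<and> nrm V x \<le> 1})\<rparr>"

definition banach_adjoint ::
    "'v::complex_vector nspace \<Rightarrow> ('v \<Rightarrow> 'w) \<Rightarrow> ('w \<Rightarrow> complex) \<Rightarrow> 'v \<Rightarrow> complex" where
  "banach_adjoint V A \<psi> = (\<lambda>x. if x \<in> points V then \<psi> (A x) else 0)"


section \<open>Boundary values and the Smirnov class\<close>

text \<open>The unit circle with arc length, parametrised by \<open>cis\<close>.\<close>

abbreviation arc :: "real measure" where
  "arc \<equiv> lebesgue_on {0..2 * pi}"

definition stolz :: "real \<Rightarrow> complex \<Rightarrow> complex set" where
  "stolz \<alpha> \<zeta> = {w. cmod w < 1 \<and> cmod (w - \<zeta>) < \<alpha> * (1 - cmod w)}"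

definition has_nt_limit :: "(complex \<Rightarrow> 'b::t2_space) \<Rightarrow> complex \<Rightarrow> 'b \<Rightarrow> bool" where
  "has_nt_limit f \<zeta> l \<longleftrightarrow> (\<forall>\<alpha>>1. (f \<longlongrightarrow> l) (at \<zeta> within stolz \<alpha> \<zeta>))"

definition nt_limit :: "(complex \<Rightarrow> 'b::t2_space) \<Rightarrow> complex \<Rightarrow> 'b" where
  "nt_limit f \<zeta> = (THE l. has_nt_limit f \<zeta> l)"

text \<open>With \<open>ln 0 = 0\<close> this gives the usual value \<open>0\<close> of \<open>log\<^sup>+\<close> at \<open>0\<close>.\<close>

definition log_plus :: "real \<Rightarrow> real" where
  "log_plus x = max 0 (ln x)"

definition nevanlinna :: "(complex \<Rightarrow> complex) set" where
  "nevanlinna = {f. f holomorphic_on ball 0 1 \<and>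
     bdd_above ((\<lambda>r. \<integral>t. log_plus (cmod (f (of_real r * cis t))) \<partial>arc) ` {0<..<1})}"

text \<open>Functions in the Nevanlinna class have nontangential limits almost everywhere (Fatou), whose
  \<open>log\<^sup>+\<close> is integrable, so that the integral on the right below is meaningful.\<close>

definition smirnov :: "(complex \<Rightarrow> complex) set" where
  "smirnov = {f \<in> nevanlinna.
     ((\<lambda>r. \<integral>t. log_plus (cmod (f (of_real r * cis t))) \<partial>arc) \<longlongrightarrow>
       (\<integral>t. log_plus (cmod (nt_limit f (cis t))) \<partial>arc)) (at_left 1)}"


section \<open>Interpolation families\<close>

text \<open>The type \<open>'a\<close> is the containing space. The boundary spaces are identified with their images
  in it, so they are subspaces with their own norms. \<open>conf\<close> is the conformal map from the disc onto
  \<open>region\<close>, together with its boundary extension.\<close>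

record 'a interp_family =
  region :: "complex set"
  conf :: "complex \<Rightarrow> complex"
  bspace :: "complex \<Rightarrow> 'a nspace"
  inter :: "'a set"
  contf :: "complex \<Rightarrow> real"

text \<open>Measurability and null sets on the boundary of the region refer to the image of arc length,
  hence are expressed on the circle through \<open>conf\<close>. The points of the circle outside the
  extended domain \<open>E\<close> form a null set and play no role, as the measure \<open>arc\<close> is complete.\<close>

locale interpolation_family =
  fixes X :: "'a::complex_banach interp_family"
  assumes conf_holomorphic: "conf X holomorphic_on ball 0 1"
    and conf_bij: "bij_betw (conf X) (ball 0 1) (region X)"
    and conf_extends:
      "\<exists>E. ball 0 1 \<subseteq> E \<and> E \<subseteq> cball 0 1 \<and> (AE t in arc. cis t \<in> E) \<and>
           continuous_on E (conf X) \<and> conf X ` E = closure (region X)"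
    and space_banach: "u \<in> frontier (region X) \<Longrightarrow> banach_space_on (bspace X u)"
    and space_embeds:
      "u \<in> frontier (region X) \<Longrightarrow> \<exists>C. \<forall>x\<in>points (bspace X u). norm x \<le> C * nrm (bspace X u) x"
    and inter_subspace: "complex_vector.subspace (inter X)"
    and inter_subset: "u \<in> frontier (region X) \<Longrightarrow> inter X \<subseteq> points (bspace X u)"
    and nrm_measurable:
      "x \<in> inter X \<Longrightarrow> (\<lambda>t. nrm (bspace X (conf X (cis t))) x) \<in> borel_measurable arc"
    and nrm_log_integrable:
      "x \<in> inter X \<Longrightarrow> integrable arc (\<lambda>t. log_plus (nrm (bspace X (conf X (cis t))) x))"
    and contf_pos: "u \<in> frontier (region X) \<Longrightarrow> 0 < contf X u"
    and contf_measurable: "(\<lambda>t. contf X (conf X (cis t))) \<in> borel_measurable arc"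
    and contf_log_integrable: "integrable arc (\<lambda>t. log_plus (contf X (conf X (cis t))))"
    and norm_le_contf:
      "u \<in> frontier (region X) \<Longrightarrow> x \<in> inter X \<Longrightarrow> norm x \<le> contf X u * nrm (bspace X u) x"

text \<open>Functions on the region are represented by total functions; only their values on the region
  are ever used. The boundary value is the nontangential limit in the containing space, which for
  \<open>g = (\<Sum>j. c\<^sub>j x\<^sub>j)\<close> is \<open>\<Sum>j. c\<^sub>j\<^sup>* x\<^sub>j\<close> with \<open>c\<^sub>j\<^sup>*\<close> the boundary values of the coefficients.\<close>

definition G_esssup :: "'a::complex_banach interp_family \<Rightarrow> (complex \<Rightarrow> 'a) \<Rightarrow> ereal" where
  "G_esssup X g = esssup arc
     (\<lambda>t. ereal (nrm (bspace X (conf X (cis t))) (nt_limit (\<lambda>w. g (conf X w)) (cis t))))"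

definition G_space :: "'a::complex_banach interp_family \<Rightarrow> (complex \<Rightarrow> 'a) nspace" where
  "G_space X =
     \<lparr>points = {g. (\<exists>(N::nat) c x.
          (\<forall>j<N. (\<lambda>w. c j (conf X w)) \<in> smirnov \<and> x j \<in> inter X) \<and>
          (\<forall>z\<in>region X. g z = (\<Sum>j<N. c j z *\<^sub>C x j))) \<and> G_esssup X g < \<infinity>},
      nrm = (\<lambda>g. real_of_ereal (G_esssup X g))\<rparr>"

text \<open>The completion of \<open>G_space X\<close> as a space of functions on the region: its elements are the
  pointwise limits of Cauchy sequences, and the norm is the limit of the norms. The limit of the
  norms does not depend on the sequence (evaluations are bounded and jointly injective on the
  abstract completion), so the infimum below is over a singleton.\<close>

definition represents ::
    "'a::complex_banach interp_family \<Rightarrow> (nat \<Rightarrow> complex \<Rightarrow> 'a) \<Rightarrow> (complex \<Rightarrow> 'a) \<Rightarrow> bool" where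
  "represents X gs f \<longleftrightarrow>
     (\<forall>m. gs m \<in> points (G_space X)) \<and>
     (\<forall>\<epsilon>>0. \<exists>M. \<forall>l\<ge>M. \<forall>m\<ge>M. nrm (G_space X) (gs l - gs m) < \<epsilon>) \<and>
     (\<forall>z\<in>region X. (\<lambda>m. gs m z) \<longlonglongrightarrow> f z)"

definition F_space :: "'a::complex_banach interp_family \<Rightarrow> (complex \<Rightarrow> 'a) nspace" where
  "F_space X =
     \<lparr>points = {f. \<exists>gs. represents X gs f},
      nrm = (\<lambda>f. Inf {r. \<exists>gs. represents X gs f \<and> (\<lambda>m. nrm (G_space X) (gs m)) \<longlonglongrightarrow> r})\<rparr>"

definition admissible :: "'a::complex_banach interp_family \<Rightarrow> bool" where
  "admissible X \<longleftrightarrow>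
     (\<forall>z\<in>region X. \<forall>f\<in>points (F_space X). f z = 0 \<longrightarrow>
        (\<forall>\<epsilon>>0. \<exists>g\<in>points (G_space X). g z = 0 \<and> nrm (F_space X) (f - g) < \<epsilon>))"


section \<open>Rochberg spaces\<close>

text \<open>The analogue of \<open>deriv\<close> for vector-valued functions of a complex variable.\<close>

definition vderiv :: "(complex \<Rightarrow> 'a::complex_banach) \<Rightarrow> complex \<Rightarrow> 'a" where
  "vderiv f z = (SOME d. (f has_derivative (\<lambda>h. h *\<^sub>C d)) (at z))"

text \<open>A tuple \<open>(x\<^sub>n\<^sub>-\<^sub>1, \<dots>, x\<^sub>0)\<close> is represented by the function \<open>x\<close> with \<open>x i = x\<^sub>i\<close> for \<open>i < n\<close> and
  \<open>x i = 0\<close> for \<open>i \<ge> n\<close>. The last coordinates are thus those of smallest index.\<close>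

definition jet :: "nat \<Rightarrow> complex \<Rightarrow> (complex \<Rightarrow> 'a::complex_banach) \<Rightarrow> nat \<Rightarrow> 'a" where
  "jet n z f = (\<lambda>i. if i < n then (1 / fact i) *\<^sub>R (vderiv ^^ i) f z else 0)"

definition rochberg :: "'a::complex_banach interp_family \<Rightarrow> nat \<Rightarrow> complex \<Rightarrow> (nat \<Rightarrow> 'a) nspace" where
  "rochberg X n z =
     \<lparr>points = jet n z ` points (F_space X),
      nrm = (\<lambda>x. Inf {nrm (F_space X) f | f. f \<in> points (F_space X) \<and> jet n z f = x})\<rparr>"

text \<open>Elements of the algebraic dual are represented by functions vanishing outside the given
  subspace.\<close>

definition algebraic_dual :: "'a::complex_vector set \<Rightarrow> ('a \<Rightarrow> complex) set" where
  "algebraic_dual D =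
     {\<xi>. (\<forall>x\<in>D. \<forall>y\<in>D. \<xi> (x + y) = \<xi> x + \<xi> y) \<and> (\<forall>a. \<forall>x\<in>D. \<xi> (a *\<^sub>C x) = a * \<xi> x) \<and>
         (\<forall>x. x \<notin> D \<longrightarrow> \<xi> x = 0)}"

definition Fstar_bound ::
    "'a::complex_banach interp_family \<Rightarrow> (complex \<Rightarrow> 'a \<Rightarrow> complex) \<Rightarrow> real \<Rightarrow> bool" where
  "Fstar_bound X h C \<longleftrightarrow>
     (\<forall>x\<in>inter X. AE t in arc.
        nt_limit (\<lambda>w. cmod (h (conf X w) x)) (cis t) \<le> C * nrm (bspace X (conf X (cis t))) x)"

definition Fstar_space ::
    "'a::complex_banach interp_family \<Rightarrow> (complex \<Rightarrow> 'a \<Rightarrow> complex) nspace" where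
  "Fstar_space X =
     \<lparr>points = {h. (\<forall>z\<in>region X. h z \<in> algebraic_dual (inter X)) \<and>
                   (\<forall>x\<in>inter X. (\<lambda>w. h (conf X w) x) \<in> smirnov) \<and>
                   (\<exists>C>0. Fstar_bound X h C)},
      nrm = (\<lambda>h. Inf {C. C > 0 \<and> Fstar_bound X h C})\<rparr>"

text \<open>Derivatives are taken after pairing with a vector; for vectors outside the intersection
  space they vanish at points of the region, in accordance with the convention above.\<close>

definition weak_jet ::
    "nat \<Rightarrow> complex \<Rightarrow> (complex \<Rightarrow> 'a \<Rightarrow> complex) \<Rightarrow> nat \<Rightarrow> 'a \<Rightarrow> complex" where
  "weak_jet n z h = (\<lambda>i x. if i < n then (deriv ^^ i) (\<lambda>w. h w x) z / fact i else 0)"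

definition rochberg_star ::
    "'a::complex_banach interp_family \<Rightarrow> nat \<Rightarrow> complex \<Rightarrow> (nat \<Rightarrow> 'a \<Rightarrow> complex) nspace" where
  "rochberg_star X n z =
     \<lparr>points = weak_jet n z ` points (Fstar_space X),
      nrm = (\<lambda>\<xi>. Inf {nrm (Fstar_space X) h | h. h \<in> points (Fstar_space X) \<and> weak_jet n z h = \<xi>})\<rparr>"


section \<open>The maps of the diagram\<close>

text \<open>\<open>(x\<^sub>n\<^sub>-\<^sub>1, \<dots>, x\<^sub>0) \<mapsto> (x\<^sub>n\<^sub>-\<^sub>1, \<dots>, x\<^sub>0, 0, \<dots>, 0)\<close> with \<open>k\<close> zeros appended, which shifts indices by \<open>k\<close>.\<close>

definition append_zeros :: "nat \<Rightarrow> (nat \<Rightarrow> 'b::zero) \<Rightarrow> nat \<Rightarrow> 'b" where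
  "append_zeros k x = (\<lambda>i. if i < k then 0 else x (i - k))"

definition last_coords :: "nat \<Rightarrow> (nat \<Rightarrow> 'b::zero) \<Rightarrow> nat \<Rightarrow> 'b" where
  "last_coords k x = (\<lambda>i. if i < k then x i else 0)"

definition tuples :: "nat \<Rightarrow> 'b::zero set \<Rightarrow> (nat \<Rightarrow> 'b) set" where
  "tuples n D = {x. (\<forall>i<n. x i \<in> D) \<and> (\<forall>i\<ge>n. x i = 0)}"

text \<open>The bounded functional \<open>\<psi>\<close> on the Rochberg space extends the functional on tuples from the
  intersection space which is given by \<open>\<xi>\<close>.\<close>

definition extends_pairing ::
    "'a::complex_banach interp_family \<Rightarrow> nat \<Rightarrow> complex \<Rightarrow> (nat \<Rightarrow> 'a \<Rightarrow> complex) \<Rightarrow>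
      ((nat \<Rightarrow> 'a) \<Rightarrow> complex) \<Rightarrow> bool" where
  "extends_pairing X n z \<xi> \<psi> \<longleftrightarrow>
     \<psi> \<in> points (dual_space (rochberg X n z)) \<and>
     (\<forall>x\<in>tuples n (inter X). \<psi> x = (\<Sum>j<n. \<xi> j (x (n - j - 1))))"

definition duality_map ::
    "'a::complex_banach interp_family \<Rightarrow> nat \<Rightarrow> complex \<Rightarrow> (nat \<Rightarrow> 'a \<Rightarrow> complex) \<Rightarrow>
      (nat \<Rightarrow> 'a) \<Rightarrow> complex" where
  "duality_map X n z \<xi> = (THE \<psi>. extends_pairing X n z \<xi> \<psi>)"

end

theory Submission
  imports Defs "HOL-Complex_Analysis.Complex_Analysis"
begin

text \<open>Work on the disc, through the inverse \<open>psi\<close> of the conformal map \<open>phi\<close>. A bounded functional on the \<open>n\<close>-th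
Rochberg space at \<open>z\<close> lifts to the space of test functions. Dividing a test function by an outer function with the
same boundary modulus leaves a function of norm at most one, and the first \<open>n\<close> Taylor coefficients of the outer
function are controlled by its mean, so the functional is controlled by an \<open>L\<^sup>1\<close> norm of the boundary values. Extend
it by Hahn-Banach to an \<open>L\<^sup>1\<close> space and take its Cauchy transform: because the functional kills functions vanishing
to order \<open>n\<close>, the Cauchy kernel may be traded for the Poisson kernel, and this yields an element of the dual family
inducing the functional. Admissibility lets one divide by \<open>(psi - psi z)\<^sup>n\<close>, which gives exactness of the bottom
row; exactness of the top row follows from the commuting squares.\<close>

text \<open>A vector \<open>x\<close> of \<open>Delta\<close> need not be a constant member of the
  space of simple functions: its boundary norm is only log-integrable. Hence all constructions pass
  through \<open>outer (wt x) *C x\<close>, and the element of the dual family is defined by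
  dividing the weight out again; independence of the weight is what makes it linear in
  \<open>x\<close>. Multipliers that prescribe Taylor coefficients are entire functions of
  \<open>psi w\<close>, not of \<open>w\<close>, since the region may be unbounded while the disc is
  not; \<open>taylor_multiplier\<close> exchanges the two without changing jets, and
  \<open>coordinate_change\<close> does the same for the pairing. The definition of
  \<open>smirnov\<close> by convergence of means is hard to compute with, so it is replaced by
  \<open>quasi_bounded\<close>: the logarithm of the modulus lies below the Poisson integral of an
  integrable function. Sums, products, division at a zero and a maximum principle follow from that
  form. The inverse of \<open>duality_map\<close> is bounded by the norm control in
  \<open>functional_representation\<close>, which takes the place of the open mapping
  theorem.\<close>

notation (input) scaleC  (infixr "*C" 75)

subsection \<open>Poisson and Herglotz integrals\<close>

lemma finite_measure_arc: "finite_measure arc" by (rule finite_measure_lebesgue_on) simp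

interpretation arc: finite_measure arc by (rule finite_measure_arc)

abbreviation disc_hol :: "(complex => complex) => bool" where
 "disc_hol f == f holomorphic_on ball 0 1"

abbreviation arc_meas :: "(real => 'b::topological_space) => bool" where
 "arc_meas f == f : borel_measurable arc"

abbreviation (input) tends :: "(nat => 'b::topological_space) => 'b => bool"  (infix "---->" 60) where
 "s ----> l == s \<longlonglongrightarrow> l"

lemma space_arc [simp]: "space arc = {0..2 * pi}" by (simp add: space_restrict_space)

lemma measure_arc: "measure arc {0..2 * pi} = 2 * pi" by (subst measure_restrict_space) auto

lemma arc_measurable_continuous [intro]:
 "continuous_on UNIV f ==> arc_meas f" for f :: "real => 'b::topological_space"
 by (intro measurable_restrict_space1 measurable_completion) (simp add: borel_measurable_continuous_onI)

lemma integrable_bdd_mult: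
 fixes f g :: "'c => 'b::{real_normed_algebra, second_countable_topology, banach}"
 assumes "f : borel_measurable M" "!!t. t : space M ==> norm (f t) <= B" "integrable M g"
 shows "integrable M (%t. f t * g t)"
proof (rule Bochner_Integration.integrable_bound)
 show "integrable M (%t. B * norm (g t))" using assms(3) by auto
 show "(%t. f t * g t) : borel_measurable M" using assms by auto
 show "AE t in M. norm (f t * g t) <= norm (B * norm (g t))"
 proof (rule AE_I2)
  fix t assume "t : space M"
  then have "norm (f t) * norm (g t) <= B * norm (g t)" using assms(2) by (intro mult_right_mono) auto
  then show "norm (f t * g t) <= norm (B * norm (g t))" using norm_mult_ineq[of "f t" "g t"] by (simp add: abs_if)
 qed
qed

text \<open>The Poisson kernel with total mass \<open>2 * pi\<close>; the factor
  \<open>1 / (2 * pi)\<close> is put into \<open>pois\<close> and \<open>herg\<close>.\<close>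

definition PK :: "complex => real => real" where
 "PK a t = (1 - (cmod a)\<^sup>2) / (cmod (cis t - a))\<^sup>2"

lemma cmod_cis_diff_ge: "1 - cmod a <= cmod (cis t - a)" using norm_triangle_ineq2[of "cis t" a] by simp

lemma cis_neq_in_ball: "cmod a < 1 ==> cis t ~= a" by auto

lemma PK_pos: "cmod a < 1 ==> 0 < PK a t"
 using cis_neq_in_ball[of a t] by (simp add: PK_def power_less_one_iff abs_square_less_1)

lemma PK_le:
 assumes "cmod a < 1" shows "PK a t <= 2 / (1 - cmod a)"
proof -
 have "PK a t <= (1 - (cmod a)\<^sup>2) / (1 - cmod a)\<^sup>2" unfolding PK_def using assms cmod_cis_diff_ge[of a t]
  by (intro divide_left_mono power_mono mult_pos_pos zero_less_power)
  (auto simp: abs_square_le_1 power_le_one less_imp_le cis_neq_in_ball)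
 also have "... = (1 + cmod a) / (1 - cmod a)"
 proof -
  have "(1 - (cmod a)\<^sup>2) / (1 - cmod a)\<^sup>2 = ((1 + cmod a) * (1 - cmod a)) / ((1 - cmod a) * (1 - cmod a))"
  by (simp add: power2_eq_square algebra_simps)
  then show ?thesis using assms by simp
 qed
 also have "... <= 2 / (1 - cmod a)" using assms by (intro divide_right_mono) auto
 finally show ?thesis .
qed

lemma PK_eq_Re:
 assumes "cmod a < 1" shows "PK a t = Re ((cis t + a) / (cis t - a))"
proof -
 have "Re ((cis t + a) / (cis t - a)) = Re ((cis t + a) * cnj (cis t - a)) / (cmod (cis t - a))\<^sup>2"
  by (subst complex_div_cnj) (simp add: complex_mult_cnj cmod_power2 Re_divide_of_real flip: of_real_power of_real_add)
 also have "Re ((cis t + a) * cnj (cis t - a)) = 1 - (cmod a)\<^sup>2"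
  using sin_cos_squared_add3[of t] cmod_power2[of a] by (simp add: algebra_simps power2_eq_square)
 finally show ?thesis by (simp add: PK_def)
qed

lemma continuous_cis_within [continuous_intros]:
 "continuous_on S f ==> continuous_on S (%t. cis (f t))" unfolding cis_conv_exp by (intro continuous_intros)

lemma continuous_on_PK: "cmod a < 1 ==> continuous_on UNIV (PK a)"
 unfolding PK_def using cis_neq_in_ball[of a] by (intro continuous_intros) auto

lemma PK_measurable: "cmod a < 1 ==> PK a : borel_measurable arc" using continuous_on_PK by blast

definition pois :: "(real => real) => complex => real" where
 "pois u a = (LINT t|arc. PK a t * u t) / (2 * pi)"

text \<open>The Herglotz integral: holomorphic, with the Poisson integral as real part, so that its
  exponential yields outer functions.\<close>

definition herg :: "(real => real) => complex => complex" where
 "herg u a = (LINT t|arc. (cis t + a) / (cis t - a) * of_real (u t)) / (2 * pi)"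

lemma integrable_PK:
 assumes "cmod a < 1" "integrable arc u" shows "integrable arc (%t. PK a t * u t)"
 by (rule integrable_bdd_mult[where B="2 / (1 - cmod a)"])
  (use assms PK_measurable PK_le PK_pos[OF assms(1)] in "auto simp: less_imp_le")

lemma integrable_continuous_arc:
 "continuous_on UNIV f ==> integrable arc f" for f :: "real => 'b::euclidean_space"
 by (rule continuous_imp_integrable_real) (rule continuous_on_subset, auto)

text \<open>Cauchy's formula at \<open>a\<close> for
  \<open>g w = f w * (1 - |a|^2) / (1 - cnj a * w)\<close>: the extra factor equals 1 at
  \<open>a\<close>, and on the circle \<open>1 - cnj a * w\<close> is
  \<open>w * cnj (w - a)\<close>, which turns the Cauchy kernel into the Poisson kernel.\<close>

lemma poisson_formula:
 fixes f :: "complex => complex"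
 assumes f: "f holomorphic_on ball 0 R" and R: "R > 1" and a: "cmod a < 1"
 shows "(LINT t|arc. of_real (PK a t) * f (cis t)) = 2 * pi * f a"
proof -
 \<comment> \<open>The pole of \<open>g\<close> at \<open>1 / cnj a\<close> must stay outside the
   disc of radius \<open>R'\<close>.\<close>
 obtain R' where R': "1 < R'" "R' <= R" "cmod a * R' < 1"
 proof (cases "a = 0")
  case True then show ?thesis using that[of R] R by auto
 next
  case False
  have "1 < min R (1 / cmod a)" using False a R by auto
  then obtain r where r: "1 < r" "r < min R (1 / cmod a)" using dense by blast
  then have "cmod a * r < 1" using False by (simp add: field_simps)
  then show ?thesis using r that[of r] by auto
 qed
 define g where "g = (%w. f w * (1 - (cmod a)\<^sup>2) / (1 - cnj a * w))"
 have nz: "1 - cnj a * w ~= 0" if "w : ball 0 R'" for w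
 proof -
  have "cmod (cnj a * w) <= cmod a * R'" using that by (auto simp: norm_mult intro!: mult_left_mono)
  then have "cmod (cnj a * w) < 1" using R' by linarith
  then show ?thesis by auto
 qed
 have g: "g holomorphic_on ball 0 R'"
  unfolding g_def using nz R' by (intro holomorphic_intros holomorphic_on_subset[OF f]) auto
 have "cball 0 1 \<subseteq> ball (0::complex) R'" using R' by auto
 then have "((%u. g u / (u - a)) has_contour_integral (2 * of_real pi * \<i> * g a)) (circlepath 0 1)"
  using g a by (intro Cauchy_integral_circlepath_simple holomorphic_on_subset[OF g]) auto
 then have "((%t. g (cis t) / (cis t - a) * \<i> * cis t) has_integral (2 * of_real pi * \<i> * g a)) {0..2 * pi}"
  unfolding circlepath_def by (subst (asm) has_contour_integral_part_circlepath_iff) auto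
 moreover have "g (cis t) / (cis t - a) * \<i> * cis t = \<i> * (of_real (PK a t) * f (cis t))" for t
 proof -
  have n0: "cis t - a ~= 0" using cis_neq_in_ball[OF a, of t] by simp
  have "1 - cnj a * cis t = cis t * cnj (cis t - a)" by (simp add: algebra_simps cis_cnj cis_mult)
  then have "g (cis t) / (cis t - a) * cis t = f (cis t) * ((1 - (cmod a)\<^sup>2) / ((cis t - a) * cnj (cis t - a)))"
  using n0 unfolding g_def \<open>1 - cnj a * cis t = _\<close> by (simp del: complex_cnj_diff)
  also have "... = f (cis t) * of_real (PK a t)"
  unfolding PK_def by (simp del: complex_cnj_diff flip: complex_norm_square)
  finally have e: "g (cis t) / (cis t - a) * cis t = f (cis t) * of_real (PK a t)" .
  have "g (cis t) / (cis t - a) * \<i> * cis t = \<i> * (g (cis t) / (cis t - a) * cis t)" by (simp add: mult_ac)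
  then show ?thesis unfolding e by (simp add: mult_ac)
 qed
 moreover have "g a = f a"
 proof -
  have "1 - cnj a * a ~= 0" using nz[of a] a R' by simp
  then show ?thesis unfolding g_def using complex_norm_square[of a] by (simp add: mult.commute)
 qed
 ultimately have i1: "((%t. \<i> * (of_real (PK a t) * f (cis t))) has_integral (\<i> * (2 * of_real pi * f a))) {0..2 * pi}"
  by (simp add: mult_ac)
 have hi: "((%t. of_real (PK a t) * f (cis t)) has_integral (2 * of_real pi * f a)) {0..2 * pi}"
  using has_integral_mult_right[OF i1, of "-\<i>"] by (simp flip: mult.assoc)
 have "continuous_on (sphere 0 1) f"
  using R by (intro holomorphic_on_imp_continuous_on holomorphic_on_subset[OF f]) auto
 then have "continuous_on UNIV (%t. f (cis t))"
  by (rule continuous_on_compose2) (auto intro: continuous_cis_within[OF continuous_on_id])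
 then have "continuous_on UNIV (%t. of_real (PK a t) * f (cis t))"
  by (rule continuous_on_mult[OF continuous_on_of_real[OF continuous_on_PK[OF a]]])
 then have "integrable arc (%t. of_real (PK a t) * f (cis t))" by (rule integrable_continuous_arc)
 then show ?thesis using hi by (subst lebesgue_integral_eq_integral) (auto simp: integral_unique)
qed

lemma integral_PK:
 assumes "cmod a < 1" shows "(LINT t|arc. PK a t) = 2 * pi"
proof -
 have "of_real (LINT t|arc. PK a t) = (LINT t|arc. of_real (PK a t) * 1 :: complex)" by simp
 also have "... = of_real (2 * pi)" by (subst poisson_formula[of "%_. 1" 2 a]) (use assms in auto)
 finally show ?thesis by (simp only: of_real_eq_iff)
qed

lemma pois_const: "cmod a < 1 ==> pois (%_. c) a = c" by (simp add: pois_def integral_PK)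

lemma pois_add:
 assumes "cmod a < 1" "integrable arc u" "integrable arc v" shows "pois (%t. u t + v t) a = pois u a + pois v a"
 using assms by (simp add: pois_def distrib_left integrable_PK add_divide_distrib)

lemma pois_diff:
 assumes "cmod a < 1" "integrable arc u" "integrable arc v" shows "pois (%t. u t - v t) a = pois u a - pois v a"
 using assms by (simp add: pois_def right_diff_distrib integrable_PK diff_divide_distrib)

lemma pois_minus: "pois (%t. - u t) a = - pois u a" by (simp add: pois_def)

lemma pois_mono_AE:
 assumes "cmod a < 1" "integrable arc u" "integrable arc v" "AE t in arc. u t <= v t" shows "pois u a <= pois v a"
 unfolding pois_def by (intro divide_right_mono integral_mono_AE integrable_PK assms)
  (use assms(4) PK_pos[OF assms(1)] in "auto simp: less_imp_le intro: mult_left_mono elim: eventually_mono")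

lemma pois_nonneg:
 assumes "cmod a < 1" "!!t. 0 <= u t" shows "0 <= pois u a"
 unfolding pois_def using PK_pos[OF assms(1)] assms(2) by (intro divide_nonneg_pos integral_nonneg) (auto simp: less_imp_le)

lemma herg_kernel_measurable:
 assumes "cmod a < 1" shows "arc_meas (%t. (cis t + a) / (cis t - a))"
 using cis_neq_in_ball[OF assms] by (intro arc_measurable_continuous continuous_intros) auto

lemma Re_herg:
 assumes a: "cmod a < 1" and u: "integrable arc u" shows "Re (herg u a) = pois u a"
proof -
 have "integrable arc (%t. (cis t + a) / (cis t - a) * of_real (u t))"
 proof (rule integrable_bdd_mult[where B="2 / (1 - cmod a)"])
  fix t
  have "cmod (cis t + a) <= 2" using norm_triangle_ineq[of "cis t" a] a by simp
  then show "cmod ((cis t + a) / (cis t - a)) <= 2 / (1 - cmod a)"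
  unfolding norm_divide using cmod_cis_diff_ge[of a t] a by (intro frac_le) auto
 qed (use herg_kernel_measurable[OF a] u in auto)
 then have "Re (LINT t|arc. (cis t + a) / (cis t - a) * of_real (u t))
  = (LINT t|arc. Re ((cis t + a) / (cis t - a) * of_real (u t)))" by (rule integral_Re[symmetric])
 also have "... = (LINT t|arc. PK a t * u t)"
 proof -
  have "Re (z * of_real r) = Re z * r" for z r by simp
  then show ?thesis unfolding PK_eq_Re[OF a] by presburger
 qed
 finally have e: "Re (LINT t|arc. (cis t + a) / (cis t - a) * of_real (u t)) = (LINT t|arc. PK a t * u t)" .
 have "herg u a = (LINT t|arc. (cis t + a) / (cis t - a) * of_real (u t)) / of_real (2 * pi)" by (simp add: herg_def)
 then show ?thesis unfolding pois_def by (simp only: Re_divide_of_real e)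
qed

text \<open>The geometric series of the Cauchy kernel, pushed through a functional which is bounded for
  the supremum norm.\<close>

lemma cauchy_functional_sums:
 fixes T :: "(real => complex) => complex"
 assumes add: "!!f g. continuous_on UNIV f ==> continuous_on UNIV g ==> T (%t. f t + g t) = T f + T g"
  and scale: "!!f c. continuous_on UNIV f ==> T (%t. c * f t) = c * T f"
  and bound: "!!f s. continuous_on UNIV f ==> (!!t. cmod (f t) <= s) ==> cmod (T f) <= C * s"
  and a: "cmod a < 1" and w: "cmod (w - a) < 1 - cmod a"
 shows "(%m. T (%t. 1 / (cis t - a) ^ (m + 1)) * (w - a) ^ m) sums T (%t. 1 / (cis t - w))"
proof -
 have w1: "cmod w < 1" using w norm_triangle_ineq[of a "w - a"] by simp
 have na: "cis t - a ~= 0" "cis t - w ~= 0" for t using cis_neq_in_ball[OF a] cis_neq_in_ball[OF w1] by auto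
 define K where "K m t = 1 / (cis t - a) ^ (m + 1)" for m t
 have cont: "continuous_on UNIV (K m)" for m unfolding K_def using na by (intro continuous_intros) auto
 have contw: "continuous_on UNIV (%t. 1 / (cis t - w))" using na by (intro continuous_intros) auto
 define S where "S M t = (SUM m<M. (w - a) ^ m * K m t)" for M t
 have contS: "continuous_on UNIV (S M)" for M unfolding S_def by (intro continuous_intros cont)
 have TS: "T (S M) = (SUM m<M. T (K m) * (w - a) ^ m)" for M
 proof (induction M)
  case 0
  have "T (%t. 0 * 0) = 0" by (subst scale) auto
  moreover have "S 0 = (%t. 0)" by (rule ext) (simp add: S_def)
  ultimately show ?case by simp
 next
  case (Suc M)
  have "S (Suc M) = (%t. S M t + (w - a) ^ M * K M t)" by (rule ext) (simp add: S_def)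
  then have "T (S (Suc M)) = T (S M) + T (%t. (w - a) ^ M * K M t)"
  using add[OF contS[of M] continuous_on_mult_left[OF cont, of "(w - a) ^ M"]] by simp
  then show ?case using Suc scale[OF cont, of "(w - a) ^ M"] by simp
 qed
 \<comment> \<open>Uniform ratio of the geometric series, as
   \<open>|cis t - a| >= 1 - |a|\<close>.\<close>
 define q where "q = cmod (w - a) / (1 - cmod a)"
 have q: "0 <= q" "q < 1" using a w by (auto simp: q_def)
 have rem: "1 / (cis t - w) - S M t = ((w - a) / (cis t - a)) ^ M / (cis t - w)" for M t
 proof (induction M)
  case 0 show ?case by (simp add: S_def)
 next
  case (Suc M)
  define p where "p = ((w - a) / (cis t - a)) ^ M"
  have "S (Suc M) t = S M t + p / (cis t - a)" by (simp add: S_def K_def p_def power_divide mult.commute)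
  then have "1 / (cis t - w) - S (Suc M) t = p / (cis t - w) - p / (cis t - a)" using Suc by (simp add: p_def)
  also have "... = p * ((w - a) / (cis t - a)) / (cis t - w)" using na[of t] by (simp add: field_simps)
  finally show ?case by (simp add: p_def mult_ac)
 qed
 have bd: "cmod (1 / (cis t - w) - S M t) <= q ^ M / (1 - cmod w)" for M t unfolding rem norm_divide norm_power
 proof (intro frac_le power_mono)
  show "cmod (w - a) / cmod (cis t - a) <= q" unfolding q_def using cmod_cis_diff_ge[of a t] a by (intro frac_le) auto
  show "1 - cmod w <= cmod (cis t - w)" by (rule cmod_cis_diff_ge)
  show "0 < 1 - cmod w" using w1 by simp
 qed (use q in auto)
 have "cmod (T (%t. 1 / (cis t - w)) - T (S M)) <= C * (q ^ M / (1 - cmod w))" for M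
 proof -
  have "T (%t. (1 / (cis t - w) - S M t) + S M t) = T (%t. 1 / (cis t - w) - S M t) + T (S M)"
  by (rule add) (intro continuous_intros contw contS)+
  then have "T (%t. 1 / (cis t - w)) - T (S M) = T (%t. 1 / (cis t - w) - S M t)" by simp
  then show ?thesis using bound[OF continuous_on_diff[OF contw contS] bd] by simp
 qed
 moreover have "(%M. C * (q ^ M / (1 - cmod w))) ----> 0"
  using q w1 by (auto intro!: tendsto_eq_intros LIMSEQ_realpow_zero)
 ultimately have "(%M. T (%t. 1 / (cis t - w)) - T (S M)) ----> 0"
  by - (rule Lim_null_comparison[OF always_eventually, OF allI])
 from tendsto_diff[OF tendsto_const[of "T (%t. 1 / (cis t - w))"] this]
 show ?thesis unfolding sums_def TS unfolding K_def by simp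
qed

text \<open>Since \<open>(x + w) / (x - w) = 2 * x / (x - w) - 1\<close>, the Herglotz integral is
  an affine function of a Cauchy transform, which has a power series at 0 by
  \<open>cauchy_functional_sums\<close>.\<close>

lemma herg_holomorphic:
 assumes u: "integrable arc u" shows "herg u holomorphic_on ball 0 1"
proof -
 define T where "T f = (LINT t|arc. f t * (cis t * of_real (u t)))" for f :: "real => complex"
 have uc: "integrable arc (%t. cis t * complex_of_real (u t))"
  by (rule integrable_bdd_mult[where B=1]) (use u in "auto intro!: continuous_intros")
 have int: "integrable arc (%t. f t * (cis t * of_real (u t)))" if f: "continuous_on UNIV f" for f :: "real => complex"
 proof -
  have "compact (f ` {0..2*pi})" using f by (intro compact_continuous_image continuous_on_subset[OF f]) auto
  then obtain B where "ALL x:f ` {0..2*pi}. norm x <= B" using compact_imp_bounded bounded_iff by metis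
  then show ?thesis using f by (intro integrable_bdd_mult[where B=B] uc) auto
 qed
 define C where "C = (LINT t|arc. \<bar>u t\<bar>)"
 have bound: "cmod (T f) <= C * s" if f: "continuous_on UNIV f" "!!t. cmod (f t) <= s" for f s
 proof -
  have "cmod (T f) <= (LINT t|arc. cmod (f t * (cis t * of_real (u t))))" unfolding T_def by (rule integral_norm_bound)
  also have "... <= (LINT t|arc. s * \<bar>u t\<bar>)"
  using int[OF f(1)] u f(2) by (intro integral_mono integrable_norm) (auto simp: norm_mult intro: mult_right_mono)
  finally show ?thesis by (simp add: C_def mult.commute)
 qed
 have sums: "(%m. T (%t. 1 / (cis t - a) ^ (m + 1)) * (w - a) ^ m) sums T (%t. 1 / (cis t - w))"
  if "cmod a < 1" "cmod (w - a) < 1 - cmod a" for a w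
 proof (rule cauchy_functional_sums[where C=C])
  show "T (%t. f t + g t) = T f + T g" if "continuous_on UNIV f" "continuous_on UNIV g" for f g
  using int that by (simp add: T_def distrib_right)
  show "T (%t. c * f t) = c * T f" for f c by (simp add: T_def mult.assoc)
 qed (use bound that in auto)
 have "disc_hol (%w. T (%t. 1 / (cis t - w)))"
  using sums[of 0] by (intro power_series_holomorphic[where a="%m. T (%t. 1 / (cis t - 0) ^ (m + 1))"]) auto
 moreover have "herg u w = (2 * T (%t. 1 / (cis t - w)) - (LINT t|arc. of_real (u t))) / (2 * pi)"
  if w: "w : ball 0 1" for w
 proof -
  have "continuous_on UNIV (%t. 1 / (cis t - w))" using cis_neq_in_ball[of w] w by (intro continuous_intros) auto
  from int[OF this] have i: "integrable arc (%t. 1 / (cis t - w) * (cis t * of_real (u t)))" .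
  have "(cis t + w) / (cis t - w) = 2 * (1 / (cis t - w) * cis t) - 1" for t
  using cis_neq_in_ball[of w t] w by (simp add: field_simps)
  then have "(cis t + w) / (cis t - w) * of_real (u t)
  = 2 * (1 / (cis t - w) * (cis t * of_real (u t))) - of_real (u t)" for t
  by (simp only: left_diff_distrib mult.assoc mult_1_left)
  then have "(LINT t|arc. (cis t + w) / (cis t - w) * of_real (u t))
  = (LINT t|arc. 2 * (1 / (cis t - w) * (cis t * of_real (u t))) - of_real (u t))" by presburger
  also have "... = (LINT t|arc. 2 * (1 / (cis t - w) * (cis t * of_real (u t)))) - (LINT t|arc. of_real (u t))"
  using i u by (intro Bochner_Integration.integral_diff integrable_mult_right) auto
  finally show ?thesis unfolding herg_def T_def by (simp only: integral_mult_right_zero)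
 qed
 ultimately show ?thesis
  by (intro holomorphic_transform[where g="herg u" and f="%w. (2 * T (%t. 1 / (cis t - w)) - (LINT t|arc. of_real (u t))) / (2 * pi)"])
  (auto intro!: holomorphic_intros)
qed

subsection \<open>Nontangential limits of Poisson integrals\<close>

lemma radial_in_stolz:
 assumes "cmod zeta = 1" "1 < alpha" "0 < r" "r < 1" shows "of_real r * zeta : stolz alpha zeta"
proof -
 have "of_real r * zeta - zeta = of_real (r - 1) * zeta" by (simp add: algebra_simps)
 moreover have "cmod (of_real (r - 1)) = 1 - r" using assms by (simp only: norm_of_real)
 ultimately have "cmod (of_real r * zeta - zeta) = 1 - r" using assms by (simp only: norm_mult mult_1_right)
 then show ?thesis using assms by (simp add: stolz_def norm_mult)
qed

lemma filterlim_radial_stolz: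
 assumes "cmod zeta = 1" "1 < alpha"
 shows "filterlim (%r. of_real r * zeta) (at zeta within stolz alpha zeta) (at_left 1)" unfolding filterlim_at
proof
 have "((%r. of_real r * zeta) \<longlongrightarrow> of_real 1 * zeta) (at_left 1)" by (intro tendsto_intros)
 then show "((%r. of_real r * zeta) \<longlongrightarrow> zeta) (at_left 1)" by simp
 have "\<forall>\<^sub>F r in at_left (1::real). 0 < r & r < 1" by (rule eventually_at_leftI[of 0]) auto
 then show "\<forall>\<^sub>F r in at_left 1. of_real r * zeta : stolz alpha zeta & of_real r * zeta ~= zeta"
  by eventually_elim (use assms radial_in_stolz in "auto simp: stolz_def")
qed

lemma has_nt_limit_radial:
 assumes "has_nt_limit f zeta l" "cmod zeta = 1"
 shows "((%r. f (of_real r * zeta)) \<longlongrightarrow> l) (at_left 1)"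
proof -
 have "(f \<longlongrightarrow> l) (at zeta within stolz 2 zeta)" using assms(1) by (simp add: has_nt_limit_def)
 from filterlim_compose[OF this filterlim_radial_stolz[OF assms(2)]] show ?thesis by simp
qed

text \<open>The radius lies in every Stolz angle, so nontangential limits are unique because radial
  limits are; this gives the \<open>THE\<close> in \<open>nt_limit\<close> a meaning.\<close>

lemma nt_limit_eqI:
 assumes "has_nt_limit f zeta l" "cmod zeta = 1" shows "nt_limit f zeta = l" unfolding nt_limit_def
proof (rule the_equality)
 show "has_nt_limit f zeta l" by fact
 show "l' = l" if "has_nt_limit f zeta l'" for l'
  using has_nt_limit_radial[OF that assms(2)] has_nt_limit_radial[OF assms] by (rule tendsto_unique[rotated]) simp
qed

lemma has_nt_limit_cong:
 assumes "!!w. w : ball 0 1 ==> f w = g w" shows "has_nt_limit f zeta l \<longleftrightarrow> has_nt_limit g zeta l"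
 unfolding has_nt_limit_def using assms
 by (intro all_cong1 imp_cong refl tendsto_cong) (auto simp: eventually_at_filter stolz_def)

lemma nt_limit_cong:
 assumes "!!w. w : ball 0 1 ==> f w = g w" shows "nt_limit f zeta = nt_limit g zeta"
proof -
 have "has_nt_limit f zeta = has_nt_limit g zeta" using has_nt_limit_cong[of f g zeta] assms by (intro ext) auto
 then show ?thesis by (simp add: nt_limit_def)
qed

lemma has_nt_limit_compose:
 assumes "has_nt_limit f zeta l" "isCont g l" shows "has_nt_limit (%w. g (f w)) zeta (g l)"
 using assms unfolding has_nt_limit_def by (auto intro: isCont_tendsto_compose)

lemma has_nt_limit_const: "has_nt_limit (%w. c) zeta c" by (simp add: has_nt_limit_def)

lemma has_nt_limit_add:
 fixes f g :: "complex => 'b::real_normed_vector"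
 assumes "has_nt_limit f zeta l" "has_nt_limit g zeta m" shows "has_nt_limit (%w. f w + g w) zeta (l + m)"
 using assms unfolding has_nt_limit_def by (auto intro: tendsto_add)

lemma has_nt_limit_mult:
 fixes f g :: "complex => 'b::real_normed_algebra"
 assumes "has_nt_limit f zeta l" "has_nt_limit g zeta m" shows "has_nt_limit (%w. f w * g w) zeta (l * m)"
 using assms unfolding has_nt_limit_def by (auto intro: tendsto_mult)

lemma has_nt_limit_isCont:
 assumes "isCont f zeta" shows "has_nt_limit f zeta (f zeta)"
 using assms unfolding has_nt_limit_def isCont_def by (auto intro: tendsto_within_subset)

section \<open>Primitives of integrable functions, Lebesgue differentiation and integration by
  parts\<close>

definition prim :: "(real => real) => real => real" where
 "prim v s = (LINT r|arc. indicator {..s} r * v r)"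

lemma integrable_indicator_arc:
 assumes "integrable arc v" "A : sets borel" shows "integrable arc (%r. indicator A r * (v r :: real))"
proof (rule integrable_bdd_mult[where B=1])
 have "(indicator A :: real => real) : borel_measurable lebesgue" using assms(2) by (intro measurable_completion) simp
 then show "arc_meas (indicator A :: real => real)" by (rule measurable_restrict_space1)
qed (use assms in "auto simp: indicator_def")

lemma prim_diff:
 assumes v: "integrable arc v" and "s <= t" shows "prim v t - prim v s = (LINT r|arc. indicator {s<..t} r * v r)"
proof -
 have "prim v t - prim v s = (LINT r|arc. indicator {..t} r * v r - indicator {..s} r * v r)"
  unfolding prim_def using v by (intro Bochner_Integration.integral_diff[symmetric] integrable_indicator_arc) auto
 also have "... = (LINT r|arc. indicator {s<..t} r * v r)"
  using \<open>s <= t\<close> by (intro Bochner_Integration.integral_cong) (auto simp: indicator_def)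
 finally show ?thesis .
qed

text \<open>Bridge from the Lebesgue integral on \<open>arc\<close> to the gauge integral, in which
  the differentiation theorem is phrased.\<close>

lemma prim_diff_HK:
 assumes v: "integrable arc v" and st: "0 <= s" "s <= t" "t <= 2 * pi"
 shows "prim v t - prim v s = integral {s..t} (%r. if r : {0..2*pi} then v r else 0)"
proof -
 have i: "integrable arc (%r. indicator {s<..t} r * v r)" by (rule integrable_indicator_arc[OF v]) simp
 have "prim v t - prim v s = integral {0..2*pi} (%r. indicator {s<..t} r * v r)"
  unfolding prim_diff[OF v st(2)] by (rule lebesgue_integral_eq_integral[OF i]) simp
 also have "... = integral UNIV (%r. if r : {0..2*pi} then indicator {s<..t} r * v r else 0)"
  by (simp only: integral_restrict_UNIV)
 also have "... = integral UNIV (%r. if r : {s..t} then (if r : {0..2*pi} then v r else 0) else 0)"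
  by (rule integral_spike[of "{s}"]) (use st in "auto simp: indicator_def")
 also have "... = integral {s..t} (%r. if r : {0..2*pi} then v r else 0)" by (simp only: integral_restrict_UNIV)
 finally show ?thesis .
qed

lemma AE_arc_I:
 assumes "negligible N" "!!t. [|0 < t; t < 2 * pi; t ~: N|] ==> P t" shows "AE t in arc. P t"
proof -
 have "N \<union> {0, 2 * pi} : null_sets lebesgue"
  using assms(1) by (simp add: negligible_Un flip: negligible_iff_null_sets)
 then have "AE t in lebesgue. t ~: N \<union> {0, 2 * pi}" by (rule AE_not_in)
 then have "AE t in lebesgue. t : {0..2*pi} --> P t" by eventually_elim (use assms(2) in "auto simp: less_le")
 then show ?thesis by (subst AE_restrict_space_iff) auto
qed

text \<open>Lebesgue differentiation in dimension one:
  \<open>integrable_ccontinuous_explicit\<close> averages over boxes with lower corner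
  \<open>x\<close>, that is, over intervals to the right of \<open>x\<close>. Left derivatives come
  from reflecting the function.\<close>

lemma AE_prim_right_derivative:
 assumes v: "!!a b. v integrable_on cbox a (b::real)" obtains N where "negligible N" "!!x e. x ~: N ==> 0 < e ==>
  EX d>0. ALL h. 0 < h & h < d --> \<bar>integral {x..x + h} v - v x * h\<bar> <= e * (h::real)" proof -
 obtain N where N: "negligible N" "!!x e. [|x ~: N; 0 < e|] ==>
  EX d>0. ALL h. 0 < h & h < d --> norm (integral (cbox x (x + h *\<^sub>R One)) v /\<^sub>R h ^ DIM(real) - v x) < e"
  using integrable_ccontinuous_explicit[of v] v by blast
 show ?thesis
 proof (rule that[OF N(1)])
  fix x e :: real assume "x ~: N" "0 < e"
  then obtain d where d: "d > 0" "!!h. 0 < h ==> h < d ==> \<bar>integral {x..x + h} v / h - v x\<bar> < e"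
  using N(2)[of x e] by (auto simp: divide_inverse mult.commute)
  have "\<bar>integral {x..x + h} v - v x * h\<bar> <= e * h" if "0 < h" "h < d" for h
  proof -
  have "integral {x..x + h} v - v x * h = (integral {x..x + h} v / h - v x) * h" using that by (simp add: field_simps)
  then have "\<bar>integral {x..x + h} v - v x * h\<bar> = \<bar>integral {x..x + h} v / h - v x\<bar> * h"
  using that by (simp add: abs_mult)
  then show ?thesis using d(2)[OF that] that by (simp add: less_imp_le mult_right_mono)
  qed
  then show "EX d>0. ALL h. 0 < h & h < d --> \<bar>integral {x..x + h} v - v x * h\<bar> <= e * h" using d(1) by blast
 qed
qed

lemma AE_prim_derivative:
 assumes u: "integrable arc u" shows "AE t in arc. 0 < t & t < 2 * pi &
  (ALL e>0. EX d>0. ALL s:{0..2*pi}. \<bar>s - t\<bar> < d --> \<bar>prim u s - prim u t - u t * (s - t)\<bar> <= e * \<bar>s - t\<bar>)"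
proof -
 define v where "v = (%r. if r : {0..2*pi} then u r else 0)"
 have "u absolutely_integrable_on {0..2*pi}" using u by (simp add: integrable_restrict_space set_integrable_def)
 then have "v absolutely_integrable_on UNIV" unfolding v_def by (simp only: absolutely_integrable_restrict_UNIV)
 then have "v integrable_on UNIV" by (simp add: absolutely_integrable_on_def)
 then have v: "v integrable_on cbox a b" for a b by (rule integrable_on_subcbox) simp
 \<comment> \<open>The reflected function, for the left derivative.\<close>
 have v': "(%x. v (- x)) integrable_on cbox a b" for a b
  using v[of "-b" "-a"] Henstock_Kurzweil_Integration.integrable_reflect_real[where f=v and a="-b" and b="-a"] by simp
 obtain N where N: "negligible N" "!!x e. x ~: N ==> 0 < e ==>
  EX d>0. ALL h. 0 < h & h < d --> \<bar>integral {x..x + h} v - v x * h\<bar> <= e * h"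
  using AE_prim_right_derivative[of v] v by blast
 obtain N' where N': "negligible N'" "!!x e. x ~: N' ==> 0 < e ==>
  EX d>0. ALL h. 0 < h & h < d --> \<bar>integral {x..x + h} (%x. v (- x)) - v (- x) * h\<bar> <= e * h"
  using AE_prim_right_derivative[of "%x. v (- x)"] v' by blast
 have "negligible (uminus ` N')"
  using N'(1) by (intro negligible_differentiable_image_negligible) (auto simp: differentiable_on_def)
 then have neg: "negligible (N \<union> uminus ` N')" using N(1) by (simp add: negligible_Un)
 show ?thesis
 proof (rule AE_arc_I[OF neg], intro conjI allI impI)
  fix t e :: real assume t: "0 < t" "t < 2 * pi" "t ~: N \<union> uminus ` N'" and e: "0 < e"
  have "- t ~: N'" using t(3) by force
  then obtain d' where d': "d' > 0" "!!h. 0 < h ==> h < d' ==>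
  \<bar>integral {-t..-t + h} (%x. v (- x)) - v t * h\<bar> <= e * h" using N'(2)[of "-t" e] e by auto
  obtain d where d: "d > 0" "!!h. 0 < h ==> h < d ==> \<bar>integral {t..t + h} v - v t * h\<bar> <= e * h"
  using N(2)[of t e] t e by auto
  have vt: "v t = u t" using t by (simp add: v_def)
  have "\<bar>prim u s - prim u t - u t * (s - t)\<bar> <= e * \<bar>s - t\<bar>"
  if s: "s : {0..2*pi}" "\<bar>s - t\<bar> < min d d'" for s
  proof (cases s t rule: linorder_cases)
  case less
  have "prim u t - prim u s = integral {s..t} v" unfolding v_def using less s t by (intro prim_diff_HK[OF u]) auto
  also have "... = integral {-t..-t + (t - s)} (%x. v (- x))"
  using Henstock_Kurzweil_Integration.integral_reflect_real[of "-s" "-t" "v"] by simp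
  finally show ?thesis using d'(2)[of "t - s"] less s vt by (simp add: abs_if algebra_simps split: if_splits)
  next
  case greater
  have "prim u s - prim u t = integral {t..s} v" unfolding v_def using greater s t by (intro prim_diff_HK[OF u]) auto
  then show ?thesis using d(2)[of "s - t"] greater s vt by simp
  qed simp
  then show "EX d>0. ALL s:{0..2*pi}. \<bar>s - t\<bar> < d --> \<bar>prim u s - prim u t - u t * (s - t)\<bar> <= e * \<bar>s - t\<bar>"
  using d(1) d'(1) by (intro exI[of _ "min d d'"]) auto
 qed auto
qed

interpretation arcarc: pair_sigma_finite arc arc by (intro pair_sigma_finite.intro) (unfold_locales)

lemma id_measurable_arc: "arc_meas (%t. t)" by (intro arc_measurable_continuous continuous_intros)

lemma arc_pair_measurable [measurable]:
 "fst : borel_measurable (arc \<Otimes>\<^sub>M arc)" "snd : borel_measurable (arc \<Otimes>\<^sub>M arc)"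
 using measurable_compose[OF measurable_fst id_measurable_arc] measurable_compose[OF measurable_snd id_measurable_arc] by auto

text \<open>Fubini on the triangle \<open>r <= s\<close>, after writing \<open>g r\<close> as
  \<open>g (2 * pi)\<close> minus the integral of \<open>g'\<close> from \<open>r\<close> to
  \<open>2 * pi\<close>. The function \<open>v\<close> is merely integrable, and the only boundary
  term sits at \<open>2 * pi\<close> because the primitive starts at 0.\<close>

lemma integral_by_parts_arc:
 assumes v: "integrable arc v" and g: "!!s. (g has_real_derivative g' s) (at s)" and g': "continuous_on UNIV g'"
 shows "integrable arc (%s. prim v s * g' s)"
  "(LINT s|arc. v s * g s) = g (2 * pi) * prim v (2 * pi) - (LINT s|arc. prim v s * g' s)"
proof -
 have ig: "integrable arc g'" by (rule integrable_continuous_arc[OF g'])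
 have contg: "continuous_on UNIV g" using g by (auto intro: DERIV_isCont simp: continuous_on_eq_continuous_at)
 have gr: "g r = g (2 * pi) - (LINT s|arc. indicator {r..} s * g' s)" if r: "r : {0..2*pi}" for r
 proof -
  have "(g' has_integral (g (2*pi) - g r)) {r..2*pi}" using r g by (intro fundamental_theorem_of_calculus)
  (auto simp: has_real_derivative_iff_has_vector_derivative intro: has_vector_derivative_at_within)
  moreover have "(LINT s|arc. indicator {r..} s * g' s) = integral {0..2*pi} (%s. indicator {r..} s * g' s)"
  by (rule lebesgue_integral_eq_integral[OF integrable_indicator_arc[OF ig]]) auto
  moreover have "integral {0..2*pi} (%s. indicator {r..} s * g' s) = integral {r..2*pi} g'"
  unfolding integral_restrict_UNIV[of "{0..2*pi}", symmetric] integral_restrict_UNIV[of "{r..2*pi}", symmetric]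
  by (rule arg_cong[where f="integral UNIV"]) (use r in "auto simp: fun_eq_iff indicator_def")
  ultimately show ?thesis by (simp add: integral_unique)
 qed
 define F where "F = (%r s. v r * (indicator {r..} s * g' s))"
 have ind: "indicator {r..} s = (indicator {..s} r :: real)" for r s :: real by (auto simp: indicator_def)
 have [measurable]: "arc_meas v" "arc_meas g'" using v ig by auto
 note [measurable] = id_measurable_arc
 have Fm: "case_prod F : borel_measurable (arc \<Otimes>\<^sub>M arc)"
 proof -
  have "(%p. v (fst p) * ((if fst p <= snd p then 1 else 0) * g' (snd p))) : borel_measurable (arc \<Otimes>\<^sub>M arc)"
  proof -
  have [measurable]: "(%p. v (fst p)) : borel_measurable (arc \<Otimes>\<^sub>M arc)"
  "(%p. g' (snd p)) : borel_measurable (arc \<Otimes>\<^sub>M arc)"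
  by (rule measurable_compose[OF measurable_fst] measurable_compose[OF measurable_snd], measurable)+
  show ?thesis by measurable
  qed
  then show ?thesis by (simp add: F_def split_beta indicator_def)
 qed
 have Fi: "integrable arc (%s. F r s)" for r
  unfolding F_def by (intro integrable_mult_right integrable_indicator_arc ig) auto
 have "integrable (arc \<Otimes>\<^sub>M arc) (case_prod F)"
 proof (rule arcarc.Fubini_integrable[OF Fm])
  show "AE r in arc. integrable arc (%s. case_prod F (r, s))" using Fi by simp
  have "(%r. LINT s|arc. norm (case_prod F (r, s))) = (%r. \<bar>v r\<bar> * (LINT s|arc. \<bar>indicator {r..} s * g' s\<bar>))"
  by (simp add: F_def abs_mult mult.assoc)
  moreover have "integrable arc (%r. (LINT s|arc. \<bar>indicator {r..} s * g' s\<bar>) * \<bar>v r\<bar>)"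
  proof (rule integrable_bdd_mult[where B="LINT s|arc. \<bar>g' s\<bar>"])
  have "arc_meas (%r. LINT s|arc. \<bar>(if r <= s then 1 else 0) * g' s\<bar>)"
  proof (rule arc.borel_measurable_lebesgue_integral)
  have [measurable]: "(%p. g' (snd p)) : borel_measurable (arc \<Otimes>\<^sub>M arc)"
  by (rule measurable_compose[OF measurable_snd], measurable)
  have "(%p. \<bar>(if fst p <= snd p then 1 else 0) * g' (snd p)\<bar>) : borel_measurable (arc \<Otimes>\<^sub>M arc)"
  by measurable
  then show "(%(r, s). \<bar>(if r <= s then 1 else 0) * g' s\<bar>) : borel_measurable (arc \<Otimes>\<^sub>M arc)"
  by (simp add: split_beta)
  qed
  then show "arc_meas (%r. LINT s|arc. \<bar>indicator {r..} s * g' s\<bar>)" by (simp add: indicator_def)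
  show "norm (LINT s|arc. \<bar>indicator {r..} s * g' s\<bar>) <= (LINT s|arc. \<bar>g' s\<bar>)" for r
  proof -
  have "(LINT s|arc. \<bar>indicator {r..} s * g' s\<bar>) <= (LINT s|arc. \<bar>g' s\<bar>)"
  by (intro integral_mono integrable_abs integrable_indicator_arc ig) (auto simp: indicator_def)
  then show ?thesis by (simp add: integral_nonneg)
  qed
  qed (use v in auto)
  ultimately show "integrable arc (%r. LINT s|arc. norm (case_prod F (r, s)))" by (simp add: mult.commute)
 qed
 then have fub: "(LINT s|arc. (LINT r|arc. F r s)) = (LINT r|arc. (LINT s|arc. F r s))"
  and i2: "integrable arc (%r. LINT s|arc. F r s)" and i1: "integrable arc (%s. LINT r|arc. F r s)"
  using arcarc.Fubini_integral[of F] arcarc.integrable_fst'[of "case_prod F"] arcarc.integrable_snd[of F] by auto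
 have inner: "(LINT r|arc. F r s) = prim v s * g' s" for s
 proof -
  have "(%r. F r s) = (%r. (indicator {..s} r * v r) * g' s)" unfolding F_def ind by (simp add: fun_eq_iff)
  then show ?thesis by (simp add: prim_def)
 qed
 show "integrable arc (%s. prim v s * g' s)" using i1 by (simp add: inner)
 have "(LINT r|arc. v r * g r) = (LINT r|arc. g (2*pi) * v r - (LINT s|arc. F r s))"
 proof (rule Bochner_Integration.integral_cong[OF refl])
  fix r assume "r : space arc"
  then have "g r = g (2 * pi) - (LINT s|arc. indicator {r..} s * g' s)" by (intro gr) simp
  moreover have "(LINT s|arc. F r s) = v r * (LINT s|arc. indicator {r..} s * g' s)"
  unfolding F_def by (rule integral_mult_right_zero)
  ultimately show "v r * g r = g (2*pi) * v r - (LINT s|arc. F r s)"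
  by (simp only: right_diff_distrib mult.commute[of "g (2 * pi)"])
 qed
 also have "... = (LINT r|arc. g (2*pi) * v r) - (LINT r|arc. (LINT s|arc. F r s))"
  using v i2 by (intro Bochner_Integration.integral_diff) auto
 also have "(LINT r|arc. (LINT s|arc. F r s)) = (LINT s|arc. prim v s * g' s)" by (simp add: inner flip: fub)
 also have "(LINT r|arc. g (2*pi) * v r) = g (2*pi) * prim v (2*pi)"
  unfolding prim_def by (subst integral_mult_right_zero[symmetric], rule Bochner_Integration.integral_cong) auto
 finally show "(LINT s|arc. v s * g s) = g (2 * pi) * prim v (2 * pi) - (LINT s|arc. prim v s * g' s)" .
qed

section \<open>Chords and arcs; the derivative of the Poisson kernel along the circle\<close>

lemma abs_le_cis:
 assumes "\<bar>x\<bar> <= 1" shows "\<bar>x\<bar> <= 2 * cmod (cis x - 1)"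
proof -
 \<comment> \<open>As \<open>1 <= pi / 3\<close>, the cosine is at least 1/2 on the unit interval,
   so the sine grows there at rate at least 1/2.\<close>
 have c: "cos y >= 1 / 2" if "0 <= y" "y <= 1" for y :: real
 proof -
  have "cos (pi / 3) <= cos y" using that pi_gt3 by (intro cos_monotone_0_pi_le) auto
  then show ?thesis by (simp add: cos_60)
 qed
 have s: "y / 2 <= sin y" if "0 <= y" "y <= 1" for y :: real
 proof (cases "y = 0")
  case False
  have "EX z>0. z < y & sin y - sin 0 = (y - 0) * cos z" using that False by (intro MVT2 DERIV_sin) auto
  then obtain z where "z > 0" "z < y" "sin y - sin 0 = (y - 0) * cos z" by blast
  then show ?thesis using c[of z] that mult_left_mono[of "1/2" "cos z" y] by simp
 qed simp
 have "\<bar>x\<bar> / 2 <= \<bar>sin x\<bar>" using s[of "\<bar>x\<bar>"] assms by (auto simp: abs_if split: if_splits)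
 also have "... <= cmod (cis x - 1)" using abs_Im_le_cmod[of "cis x - 1"] by simp
 finally show ?thesis by simp
qed

lemma abs_diff_le_cis:
 assumes "\<bar>s - t\<bar> <= 1" shows "\<bar>s - t\<bar> <= 2 * cmod (cis s - cis t)"
proof -
 have "cis s - cis t = cis t * (cis (s - t) - 1)" by (simp add: algebra_simps cis_mult)
 then show ?thesis using abs_le_cis[OF assms] by (simp add: norm_mult)
qed

text \<open>The derivative of the kernel in the angle; the term \<open>2 * Re (...)\<close> is the
  derivative of \<open>|cis s - w|^2\<close>.\<close>

definition PK' :: "complex => real => real" where
 "PK' w s = - (1 - (cmod w)\<^sup>2) * (2 * Re (\<i> * cis s * cnj (cis s - w))) / (cmod (cis s - w)) ^ 4"

lemma PK_derivative:
 assumes w: "cmod w < 1" shows "(PK w has_real_derivative PK' w s) (at s)"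
proof -
 have D: "(cmod (cis s - w))\<^sup>2 = (cos s - Re w)\<^sup>2 + (sin s - Im w)\<^sup>2" for s by (simp add: cmod_power2)
 have nz: "(cos s - Re w)\<^sup>2 + (sin s - Im w)\<^sup>2 ~= 0"
  unfolding D[symmetric] using cis_neq_in_ball[OF w, of s] by simp
 have Dd: "((%s. (cos s - Re w)\<^sup>2 + (sin s - Im w)\<^sup>2) has_real_derivative
  2 * (cos s - Re w) * - sin s + 2 * (sin s - Im w) * cos s) (at s)"
  by (auto intro!: derivative_eq_intros simp: algebra_simps)
 have "((%s. (1 - (cmod w)\<^sup>2) / ((cos s - Re w)\<^sup>2 + (sin s - Im w)\<^sup>2)) has_real_derivative
  - (1 - (cmod w)\<^sup>2) * (2 * (cos s - Re w) * - sin s + 2 * (sin s - Im w) * cos s) /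
  ((cos s - Re w)\<^sup>2 + (sin s - Im w)\<^sup>2)\<^sup>2) (at s)"
  using DERIV_divide[OF DERIV_const[of "1 - (cmod w)\<^sup>2"] Dd nz]
  by (simp only: power2_eq_square mult_zero_left diff_0 minus_mult_left)
 moreover have "2 * Re (\<i> * cis s * cnj (cis s - w)) = 2 * (cos s - Re w) * - sin s + 2 * (sin s - Im w) * cos s"
  by (simp add: algebra_simps)
 moreover have "(cmod (cis s - w)) ^ 4 = ((cos s - Re w)\<^sup>2 + (sin s - Im w)\<^sup>2)\<^sup>2"
  unfolding D[symmetric] by simp
 moreover have "PK w = (%s. (1 - (cmod w)\<^sup>2) / ((cos s - Re w)\<^sup>2 + (sin s - Im w)\<^sup>2))"
  by (rule ext) (simp add: PK_def D)
 ultimately show ?thesis by (simp only: PK'_def)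
qed

lemma continuous_on_PK': "cmod w < 1 ==> continuous_on UNIV (PK' w)"
 unfolding PK'_def using cis_neq_in_ball[of w] by (intro continuous_intros) auto

lemma abs_PK'_le:
 assumes w: "cmod w < 1" shows "\<bar>PK' w s\<bar> <= PK w s * (2 / cmod (cis s - w))"
proof -
 define d where "d = cmod (cis s - w)"
 have d: "d > 0" using cis_neq_in_ball[OF w, of s] by (simp add: d_def)
 have "\<bar>Re (\<i> * cis s * cnj (cis s - w))\<bar> <= cmod (\<i> * cis s * cnj (cis s - w))"
  by (rule abs_Re_le_cmod)
 also have "... = d" unfolding norm_mult complex_mod_cnj by (simp add: d_def)
 finally have r: "\<bar>Re (\<i> * cis s * cnj (cis s - w))\<bar> <= d" .
 have p: "0 <= 1 - (cmod w)\<^sup>2" using w by (simp add: power_le_one)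
 have "\<bar>PK' w s\<bar> = (1 - (cmod w)\<^sup>2) * (2 * \<bar>Re (\<i> * cis s * cnj (cis s - w))\<bar>) / d ^ 4"
  unfolding PK'_def d_def[symmetric] abs_mult abs_divide abs_minus using p d by (simp add: abs_mult)
 also have "... <= (1 - (cmod w)\<^sup>2) * (2 * d) / d ^ 4"
  using r p d by (intro divide_right_mono mult_left_mono) auto
 also have "... = (1 - (cmod w)\<^sup>2) / d\<^sup>2 * (2 / d)" using d by (simp add: power2_eq_square power4_eq_xxxx)
 finally show ?thesis by (simp add: PK_def d_def)
qed

lemma integral_PK':
 assumes w: "cmod w < 1" shows "(LINT s|arc. PK' w s) = 0"
proof -
 have "(PK' w has_integral (PK w (2 * pi) - PK w 0)) {0..2 * pi}"
  using PK_derivative[OF w] by (intro fundamental_theorem_of_calculus)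
  (auto simp: has_real_derivative_iff_has_vector_derivative intro: has_vector_derivative_at_within)
 then show ?thesis using lebesgue_integral_eq_integral[OF integrable_continuous_arc[OF continuous_on_PK'[OF w]]]
  by (simp add: integral_unique PK_def)
qed

lemma cis_inj_arc:
 assumes "cis s = cis t" "0 <= s" "s <= 2 * pi" "0 < t" "t < 2 * pi" shows "s = t"
proof -
 have "cos s = cos t" "sin s = sin t" using assms(1) by (simp_all add: complex_eq_iff)
 then obtain n :: int where n: "s = t + 2 * pi * n" using sin_cos_eq_iff[of s t] by auto
 have "n < 1"
 proof (rule ccontr)
  assume "~ n < 1"
  then have "2 * pi * 1 <= 2 * pi * real_of_int n" by (intro mult_left_mono) auto
  then show False using n assms by linarith
 qed
 moreover have "-1 < n"
 proof (rule ccontr)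
  assume "~ -1 < n"
  then have "2 * pi * real_of_int n <= 2 * pi * (-1)" by (intro mult_left_mono) auto
  then show False using n assms by linarith
 qed
 ultimately have "n = 0" by linarith
 then show ?thesis using n by simp
qed

text \<open>Compactness of the part of the interval away from \<open>t\<close>. Both endpoints of
  the interval have the same image under \<open>cis\<close>, and \<open>0 < t < 2 * pi\<close> keeps
  \<open>t\<close> away from them.\<close>

lemma cis_separation:
 assumes "0 < t" "t < 2 * pi" "eta > 0"
 obtains m where "m > 0" "!!s. s : {0..2 * pi} ==> eta <= \<bar>s - t\<bar> ==> m <= cmod (cis s - cis t)"
proof -
 define S where "S = {0..2 * pi} \<inter> {s. eta <= \<bar>s - t\<bar>}"
 have "closed {s. eta <= \<bar>s - t\<bar>}" by (intro closed_Collect_le continuous_intros)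
 then have "compact S" unfolding S_def by (intro compact_Int_closed) auto
 show ?thesis
 proof (cases "S = {}")
  case True
  then have "~ eta <= \<bar>s - t\<bar>" if "s : {0..2 * pi}" for s using that unfolding S_def by blast
  then show ?thesis using that[of 1] by force
 next
  case False
  have "continuous_on S (%s. cmod (cis s - cis t))" by (intro continuous_intros)
  then obtain s0 where s0: "s0 : S" "ALL s:S. cmod (cis s0 - cis t) <= cmod (cis s - cis t)"
  using continuous_attains_inf[OF \<open>compact S\<close> False] by blast
  have "cis s0 ~= cis t" using cis_inj_arc[of s0 t] s0(1) assms by (auto simp: S_def)
  then show ?thesis using s0 that[of "cmod (cis s0 - cis t)"] by (auto simp: S_def)
 qed
qed

lemma abs_prim_le:
 assumes "integrable arc v" shows "\<bar>prim v s\<bar> <= (LINT r|arc. \<bar>v r\<bar>)"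
proof -
 have i: "integrable arc (%r. indicator {..s} r * v r)" using assms by (rule integrable_indicator_arc) simp
 have "\<bar>prim v s\<bar> <= (LINT r|arc. \<bar>indicator {..s} r * v r\<bar>)"
  unfolding prim_def by (rule integral_abs_bound)
 also have "... <= (LINT r|arc. \<bar>v r\<bar>)"
  by (intro integral_mono integrable_abs i assms) (auto simp: indicator_def)
 finally show ?thesis .
qed

lemma prim_const_diff:
 assumes "s : {0..2 * pi}" "t : {0..2 * pi}" shows "prim (%_. c) s - prim (%_. c) t = c * (s - t)"
proof -
 have *: "prim (%_. c) t - prim (%_. c) s = c * (t - s)" if "0 <= s" "s <= t" "t <= 2 * pi" for s t
 proof -
  have "prim (%_. c) t - prim (%_. c) s = integral {s..t} (%r. if r : {0..2*pi} then c else 0)"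
  by (rule prim_diff_HK) (use that in auto)
  also have "... = integral {s..t} (%r. c)" by (rule Henstock_Kurzweil_Integration.integral_cong) (use that in auto)
  finally show ?thesis using that by (simp add: mult.commute)
 qed
 show ?thesis using *[of s t] *[of t s] assms by (cases "s <= t") (auto simp: algebra_simps)
qed

lemma prim_sub:
 assumes "integrable arc u" "integrable arc v" shows "prim (%r. u r - v r) s = prim u s - prim v s"
 unfolding prim_def right_diff_distrib by (intro Bochner_Integration.integral_diff integrable_indicator_arc assms) auto

abbreviation bdry :: "(complex => 'b::t2_space) => real => 'b" where
 "bdry f t == nt_limit f (cis t)"

text \<open>Integrating by parts against the Poisson kernel, the error is controlled by the derivative of
  the primitive at the boundary point, because \<open>\<bar>s - t\<bar> \<bar>\<partial>PK\<bar>\<close> is dominated by the kernel itself inside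
  a Stolz angle.\<close>

lemma pois_nt_limit_point:
 assumes u: "integrable arc u" and t: "0 < t" "t < 2 * pi"
  and der: "!!e. e > 0 ==> EX d>0. ALL s:{0..2*pi}. \<bar>s - t\<bar> < d -->
  \<bar>prim u s - prim u t - u t * (s - t)\<bar> <= e * \<bar>s - t\<bar>" shows "has_nt_limit (pois u) (cis t) (u t)"
 unfolding has_nt_limit_def
proof (intro allI impI)
 fix alpha :: real assume alpha: "1 < alpha"
 \<comment> \<open>Subtracting the value at \<open>t\<close> makes the primitive of \<open>v\<close>
   have derivative 0 at \<open>t\<close>.\<close>
 define v where "v = (%s. u s - u t)"
 have v: "integrable arc v" unfolding v_def using u by auto
 define M where "M = (LINT r|arc. \<bar>v r\<bar>)"
 have M0: "0 <= M" by (simp add: M_def integral_nonneg)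
 define R where "R s = prim v s - prim v t" for s
 have RM: "\<bar>R s\<bar> <= 2 * M" for s
  using abs_prim_le[OF v, of s] abs_prim_le[OF v, of t] by (simp add: R_def M_def)
 have R_eq: "R s = prim u s - prim u t - u t * (s - t)" if "s : {0..2*pi}" for s
 proof -
  have "prim (%_. u t) s - prim (%_. u t) t = u t * (s - t)" by (rule prim_const_diff) (use that t in auto)
  then show ?thesis using u by (simp add: R_def v_def prim_sub)
 qed
 define K where "K = 4 * (1 + alpha)"
 have K: "K > 0" using alpha by (simp add: K_def)
 show "(pois u \<longlongrightarrow> u t) (at (cis t) within stolz alpha (cis t))"
 proof (rule tendstoI)
  fix e :: real assume e: "e > 0"
  define epsilon where "epsilon = e / (2 * K)"
  have epsilon: "epsilon > 0" using e K by (simp add: epsilon_def)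
  obtain d where d: "d > 0" "!!s. s : {0..2*pi} ==> \<bar>s - t\<bar> < d ==> \<bar>R s\<bar> <= epsilon * \<bar>s - t\<bar>"
  using der[OF epsilon] R_eq by metis
  define eta where "eta = min (min d 1) t"
  have eta: "eta > 0" "eta <= d" "eta <= 1" "eta <= t" using d(1) t by (auto simp: eta_def)
  obtain m where m: "m > 0" "!!s. s : {0..2 * pi} ==> eta <= \<bar>s - t\<bar> ==> m <= cmod (cis s - cis t)"
  using cis_separation[OF t eta(1)] by blast
  \<comment> \<open>Everything away from \<open>t\<close> carries the factor
    \<open>1 - |w|^2\<close>, which tends to 0; \<open>B\<close> collects the coefficients, from the
    boundary term of the integration by parts and from the far part of the integral.\<close>
  define B where "B = 4 / m\<^sup>2 * M + 2 * pi * (2 * M * (16 / m ^ 3))"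
  have est: "\<bar>2 * pi * (pois u w - u t)\<bar> <= pi * e + (1 - (cmod w)\<^sup>2) * B"
  if w: "w : stolz alpha (cis t)" and near: "cmod (w - cis t) < m / 2" for w
  proof -
  have w1: "cmod w < 1" and wS: "cmod (w - cis t) < alpha * (1 - cmod w)" using w by (auto simp: stolz_def)
  define q where "q = 1 - (cmod w)\<^sup>2"
  have q: "0 <= q" using w1 by (simp add: q_def power_le_one)
  have far: "m / 2 <= cmod (cis s - w)" if "s : {0..2 * pi}" "eta <= \<bar>s - t\<bar>" for s
  proof -
  have "cmod (cis s - cis t) <= cmod (cis s - w) + cmod (w - cis t)"
  by (metis norm_triangle_ineq diff_add_cancel add_diff_eq)
  then show ?thesis using m(2)[OF that] near by simp
  qed
  have PKfar: "PK w s <= q * (4 / m\<^sup>2)" if "s : {0..2 * pi}" "eta <= \<bar>s - t\<bar>" for s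
  proof -
  have "PK w s <= q / (m / 2)\<^sup>2" unfolding PK_def q_def[symmetric] using far[OF that] m(1) q
  by (intro divide_left_mono power_mono mult_pos_pos zero_less_power) auto
  then show ?thesis by (simp add: power_divide)
  qed
  have bound: "\<bar>R s * PK' w s\<bar> <= epsilon * K * PK w s + 2 * M * (q * (16 / m ^ 3))"
  if s: "s : {0..2*pi}" for s
  proof (cases "\<bar>s - t\<bar> < eta")
  case True
  \<comment> \<open>Inside the Stolz angle \<open>|s - t| <= 2 * (1 + alpha) * |cis s - w|\<close>,
    so the factor \<open>|s - t|\<close> in the bound for \<open>R\<close> cancels the factor
    \<open>2 / |cis s - w|\<close> of the derivative. This is the origin of
    \<open>K = 4 * (1 + alpha)\<close>.\<close>
  define dd where "dd = cmod (cis s - w)"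
  have dd: "dd >= 1 - cmod w" "dd > 0" using cmod_cis_diff_ge[of w s] w1 by (auto simp: dd_def)
  have "\<bar>s - t\<bar> <= 2 * cmod (cis s - cis t)" using True eta by (intro abs_diff_le_cis) auto
  also have "cmod (cis s - cis t) <= dd + cmod (w - cis t)"
  unfolding dd_def by (metis norm_triangle_ineq diff_add_cancel add_diff_eq)
  also have "... <= dd + alpha * dd"
  proof -
  have "alpha * (1 - cmod w) <= alpha * dd" using dd alpha by (intro mult_left_mono) auto
  then show ?thesis using wS by linarith
  qed
  finally have st: "\<bar>s - t\<bar> <= 2 * ((1 + alpha) * dd)" by (simp add: algebra_simps)
  have "\<bar>R s * PK' w s\<bar> <= (epsilon * (2 * ((1 + alpha) * dd))) * (PK w s * (2 / dd))" unfolding abs_mult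
  proof (rule mult_mono)
  have "\<bar>R s\<bar> <= epsilon * \<bar>s - t\<bar>" using d(2)[OF s] True eta by simp
  also have "... <= epsilon * (2 * ((1 + alpha) * dd))" using st epsilon by (intro mult_left_mono) auto
  finally show "\<bar>R s\<bar> <= epsilon * (2 * ((1 + alpha) * dd))" .
  show "\<bar>PK' w s\<bar> <= PK w s * (2 / dd)" unfolding dd_def by (rule abs_PK'_le[OF w1])
  show "0 <= epsilon * (2 * ((1 + alpha) * dd))" using epsilon alpha dd by simp
  qed simp
  also have "... = epsilon * K * PK w s" using dd by (simp add: K_def)
  finally have "\<bar>R s * PK' w s\<bar> <= epsilon * K * PK w s" .
  moreover have "0 <= 2 * M * (q * (16 / m ^ 3))" using M0 q m(1) by simp
  ultimately show ?thesis by linarith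
  next
  case False
  define dd where "dd = cmod (cis s - w)"
  have dd: "m / 2 <= dd" unfolding dd_def using far[OF s] False by simp
  have "\<bar>PK' w s\<bar> <= PK w s * (2 / dd)" unfolding dd_def by (rule abs_PK'_le[OF w1])
  also have "... <= (q * (4 / m\<^sup>2)) * (2 / (m / 2))" using PKfar[OF s] False dd m(1) q PK_pos[OF w1, of s]
  by (intro mult_mono divide_left_mono mult_pos_pos) auto
  also have "... = q * (16 / m ^ 3)" using m(1) by (simp add: power2_eq_square power3_eq_cube)
  finally have "\<bar>R s * PK' w s\<bar> <= 2 * M * (q * (16 / m ^ 3))"
  unfolding abs_mult using RM[of s] M0 by (intro mult_mono) auto
  moreover have "0 <= epsilon * K * PK w s" using epsilon K PK_pos[OF w1, of s] by simp
  ultimately show ?thesis by linarith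
  qed
  have iPK: "integrable arc (PK w)" by (rule integrable_continuous_arc[OF continuous_on_PK[OF w1]])
  have iPK': "integrable arc (PK' w)" by (rule integrable_continuous_arc[OF continuous_on_PK'[OF w1]])
  define Z where "Z = 2 * M * (q * (16 / m ^ 3))"
  have iZ: "integrable arc (%s. epsilon * K * PK w s + Z)" using iPK by auto
  have intb: "(LINT s|arc. epsilon * K * PK w s + Z) = 2 * pi * (epsilon * K) + 2 * pi * Z"
  using iPK integral_PK[OF w1] by (simp add: measure_arc)
  note parts = integral_by_parts_arc[OF v PK_derivative[OF w1] continuous_on_PK'[OF w1]]
  have RP: "integrable arc (%s. R s * PK' w s)"
  using Bochner_Integration.integrable_diff[OF parts(1) integrable_mult_right[OF iPK', of "prim v t"]]
  by (simp add: R_def left_diff_distrib)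
  have IR: "\<bar>LINT s|arc. R s * PK' w s\<bar> <= 2 * pi * (epsilon * K) + 2 * pi * Z"
  unfolding intb[symmetric] using bound RP iZ
  by (intro order_trans[OF integral_abs_bound] integral_mono integrable_abs) (auto simp: Z_def)
  have "2 * pi * (pois u w - u t) = (LINT s|arc. PK w s * u s) - (LINT s|arc. PK w s * u t)"
  using integral_PK[OF w1] by (simp add: pois_def right_diff_distrib)
  also have "... = (LINT s|arc. v s * PK w s)" unfolding v_def left_diff_distrib using integrable_PK[OF w1 u] iPK
  by (subst Bochner_Integration.integral_diff) (auto simp: mult.commute)
  also have "... = PK w (2 * pi) * prim v (2 * pi) - (LINT s|arc. prim v s * PK' w s)" by (rule parts(2))
  \<comment> \<open>The derivative of the kernel has mean 0, so the primitive may be replaced by its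
    increment \<open>R\<close> from \<open>t\<close>.\<close>
  also have "(LINT s|arc. prim v s * PK' w s) = (LINT s|arc. R s * PK' w s + prim v t * PK' w s)"
  by (simp add: R_def left_diff_distrib)
  also have "... = (LINT s|arc. R s * PK' w s) + (LINT s|arc. prim v t * PK' w s)"
  using RP iPK' by (intro Bochner_Integration.integral_add) auto
  also have "... = (LINT s|arc. R s * PK' w s)" using integral_PK'[OF w1] by simp
  finally have eq: "2 * pi * (pois u w - u t) = PK w (2 * pi) * prim v (2 * pi) - (LINT s|arc. R s * PK' w s)" .
  have "PK w (2 * pi) = PK w 0" by (simp add: PK_def)
  then have "\<bar>PK w (2 * pi) * prim v (2 * pi)\<bar> <= q * (4 / m\<^sup>2) * M"
  unfolding abs_mult using PKfar[of 0] eta(4) t PK_pos[OF w1, of 0] abs_prim_le[OF v, of "2 * pi"] q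
  by (intro mult_mono) (auto simp: M_def)
  then have "\<bar>2 * pi * (pois u w - u t)\<bar> <= q * (4 / m\<^sup>2) * M + (2 * pi * (epsilon * K) + 2 * pi * Z)"
  using IR unfolding eq by linarith
  also have "... = pi * e + q * B" using K by (simp add: epsilon_def B_def Z_def algebra_simps)
  finally show ?thesis by (simp add: q_def)
  qed
  have "((%w. (1 - (cmod w)\<^sup>2) * B) \<longlongrightarrow> (1 - (cmod (cis t))\<^sup>2) * B) (at (cis t) within stolz alpha (cis t))"
  by (intro tendsto_intros)
  then have "\<forall>\<^sub>F w in at (cis t) within stolz alpha (cis t). (1 - (cmod w)\<^sup>2) * B < pi * e"
  using e by (auto dest: order_tendstoD(2)[where a="pi * e"])
  moreover have "\<forall>\<^sub>F w in at (cis t) within stolz alpha (cis t). cmod (w - cis t) < m / 2"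
  using m(1) unfolding eventually_at dist_norm by (intro exI[of _ "m/2"]) auto
  moreover have "\<forall>\<^sub>F w in at (cis t) within stolz alpha (cis t). w : stolz alpha (cis t)"
  by (simp add: eventually_at_filter)
  ultimately show "\<forall>\<^sub>F w in at (cis t) within stolz alpha (cis t). dist (pois u w) (u t) < e"
  proof eventually_elim
  case (elim w)
  then have "\<bar>2 * pi * (pois u w - u t)\<bar> < 2 * pi * e" using est[of w] by linarith
  then have "2 * pi * \<bar>pois u w - u t\<bar> < 2 * pi * e" by (simp add: abs_mult)
  then show ?case by (simp add: dist_real_def)
  qed
 qed
qed

text \<open>Fatou's theorem: convergence holds at each point where the primitive of \<open>u\<close>
  has derivative \<open>u t\<close>, hence almost everywhere.\<close>

theorem pois_nt_limit:
 assumes "integrable arc u" shows "AE t in arc. has_nt_limit (pois u) (cis t) (u t)"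
 using AE_prim_derivative[OF assms] by eventually_elim (use pois_nt_limit_point[OF assms] in blast)

subsection \<open>Boundary values of bounded holomorphic functions\<close>

lemma PK_0 [simp]: "PK 0 t = 1" by (simp add: PK_def)

lemma integral_cis_power: "(LINT t|arc. cis t ^ n * cnj (cis t ^ m)) = (if n = m then 2 * pi else 0)"
proof -
 have aux: "(LINT t|arc. cis t ^ j) = (if j = 0 then 2 * pi else 0)" for j
 proof -
  have "(%w::complex. w ^ j) holomorphic_on ball 0 2" by (intro holomorphic_intros)
  from poisson_formula[OF this, of 0] show ?thesis by (cases "j = 0") auto
 qed
 have one: "cis t ^ m * cnj (cis t ^ m) = 1" for t m unfolding complex_norm_square[symmetric] by (simp add: norm_power)
 have le: "(LINT t|arc. cis t ^ n * cnj (cis t ^ m)) = (if n = m then 2 * pi else 0)" if "m <= n" for n m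
 proof -
  have "cis t ^ n * cnj (cis t ^ m) = cis t ^ (n - m)" for t
  proof -
  have "cis t ^ n = cis t ^ (n - m) * cis t ^ m" using that by (simp flip: power_add)
  then show ?thesis using one[of t m] by (simp only: mult.assoc mult_1_right)
  qed
  then show ?thesis using aux[of "n - m"] that by simp
 qed
 show ?thesis
 proof (cases "m <= n")
  case False
  have "(LINT t|arc. cis t ^ n * cnj (cis t ^ m)) = (LINT t|arc. cnj (cis t ^ m * cnj (cis t ^ n)))"
  by (simp add: mult.commute)
  also have "... = cnj (LINT t|arc. cis t ^ m * cnj (cis t ^ n))" by (rule Bochner_Integration.integral_cnj)
  finally show ?thesis using le[of n m] False by simp
 qed (rule le)
qed

text \<open>Orthogonality of the powers of \<open>cis t\<close> gives the identity for partial sums;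
  absolute summability provides the dominating constant for the passage to the limit.\<close>

lemma parseval_disc:
 fixes a :: "nat => complex"
 assumes a: "summable (%n. cmod (a n))"
 shows "(%n. (cmod (a n))\<^sup>2) sums ((LINT t|arc. (cmod (\<Sum>n. a n * cis t ^ n))\<^sup>2) / (2 * pi))"
proof -
 define S where "S N t = (SUM n<N. a n * cis t ^ n)" for N t
 define G where "G t = (\<Sum>n. a n * cis t ^ n)" for t
 have contS: "continuous_on UNIV (S N)" for N unfolding S_def by (intro continuous_intros)
 have sm: "summable (%n. norm (a n * cis t ^ n))" for t using a by (simp add: norm_mult norm_power)
 have lim: "(%N. S N t) ----> G t" for t unfolding S_def G_def using summable_LIMSEQ[OF summable_norm_cancel[OF sm]] .
 have bd: "cmod (S N t) <= (\<Sum>n. cmod (a n))" for N t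
 proof -
  have "cmod (S N t) <= (SUM n<N. cmod (a n))"
  unfolding S_def by (rule order.trans[OF norm_sum]) (simp add: norm_mult norm_power)
  also have "... <= (\<Sum>n. cmod (a n))" by (rule sum_le_suminf[OF a]) auto
  finally show ?thesis .
 qed
 have Sm: "S N : borel_measurable arc" for N using contS by blast
 have Gm: "arc_meas G" by (rule borel_measurable_LIMSEQ_metric[OF Sm]) (use lim in auto)
 have conv: "(%N. LINT t|arc. (cmod (S N t))\<^sup>2) ----> (LINT t|arc. (cmod (G t))\<^sup>2)"
 proof (rule integral_dominated_convergence[where w="%_. (\<Sum>n. cmod (a n))\<^sup>2"])
  show "AE t in arc. (%N. (cmod (S N t))\<^sup>2) ----> (cmod (G t))\<^sup>2" using lim by (intro AE_I2 tendsto_intros)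
  show "AE t in arc. norm ((cmod (S N t))\<^sup>2) <= (\<Sum>n. cmod (a n))\<^sup>2" for N
  using bd by (auto intro!: AE_I2 power_mono)
 qed (use Sm Gm in auto)
 have "(LINT t|arc. (cmod (S N t))\<^sup>2) = 2 * pi * (SUM n<N. (cmod (a n))\<^sup>2)" for N
 proof -
  have "complex_of_real (LINT t|arc. (cmod (S N t))\<^sup>2) = (LINT t|arc. S N t * cnj (S N t))"
  by (simp only: complex_norm_square flip: integral_complex_of_real)
  also have "... = (LINT t|arc. (SUM n<N. SUM m<N. (a n * cnj (a m)) * (cis t ^ n * cnj (cis t ^ m))))"
  unfolding S_def cnj_sum sum_product by (simp add: mult_ac)
  also have "... = (SUM n<N. SUM m<N. (a n * cnj (a m)) * (LINT t|arc. cis t ^ n * cnj (cis t ^ m)))"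
  proof -
  have "integrable arc (%t. (a n * cnj (a m)) * (cis t ^ n * cnj (cis t ^ m)))" for n m
  by (intro integrable_continuous_arc continuous_intros)
  then show ?thesis
  by (simp only: Bochner_Integration.integral_sum Bochner_Integration.integrable_sum integral_mult_right_zero)
  qed
  also have "... = (SUM n<N. SUM m<N. if n = m then 2 * pi * (a n * cnj (a m)) else 0)"
  unfolding integral_cis_power by (intro sum.cong refl) auto
  also have "... = of_real (2 * pi * (SUM n<N. (cmod (a n))\<^sup>2))"
  by (simp add: sum_distrib_left flip: complex_norm_square)
  finally show ?thesis by (simp only: of_real_eq_iff)
 qed
 then have "(%N. 2 * pi * (SUM n<N. (cmod (a n))\<^sup>2)) ----> (LINT t|arc. (cmod (G t))\<^sup>2)" using conv by simp
 from tendsto_divide[OF this tendsto_const[of "2*pi"]] show ?thesis unfolding sums_def G_def by simp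
qed

lemma holomorphic_dilate:
 fixes f :: "complex => complex"
 assumes "disc_hol f" "0 < r" "r < 1" shows "(%w. f (of_real r * w)) holomorphic_on ball 0 (1 / r)"
proof -
 have "(f \<circ> (%w. of_real r * w)) holomorphic_on ball 0 (1 / r)"
  by (rule holomorphic_on_compose_gen[OF _ assms(1)])
  (use assms in "auto intro!: holomorphic_intros simp: norm_mult field_simps")
 then show ?thesis by (simp add: o_def)
qed

lemma continuous_dilate:
 fixes f :: "complex => complex"
 assumes "disc_hol f" "0 < r" "r < 1" shows "continuous_on UNIV (%t. f (of_real r * cis t))"
proof -
 have "continuous_on (ball 0 1) f" using assms(1) by (rule holomorphic_on_imp_continuous_on)
 then show ?thesis by (rule continuous_on_compose2) (use assms in "auto intro!: continuous_intros simp: norm_mult")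
qed

text \<open>Along a suitable sequence of radii the dilates are a fast Cauchy sequence in \<open>L\<^sup>2\<close>, because the
  quadratic means increase to a finite limit.\<close>

lemma bounded_radial_limit:
 fixes f :: "complex => complex"
 assumes f: "disc_hol f" and B: "!!w. w : ball 0 1 ==> cmod (f w) <= B"
 shows "EX r. (ALL k::nat. 0 < r k & r k < 1) & r ----> 1 & (AE t in arc. convergent (%k. f (of_real (r k) * cis t)))"
proof -
 define c where "c n = (deriv ^^ n) f 0 / fact n" for n
 have ps: "(%n. c n * w ^ n) sums f w" if "cmod w < 1" for w
  using holomorphic_power_series[OF f, of w] that by (simp add: c_def)
 have abs: "summable (%n. cmod (c n * of_real r ^ n))" if "0 <= r" "r < 1" for r
 proof -
  note h = that
  obtain x where x: "r < x" "x < 1" using dense[OF h(2)] by blast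
  have "summable (%n. c n * of_real x ^ n)" using ps[of "of_real x"] x that by (intro sums_summable) auto
  from powser_insidea[OF this, of "of_real r"] show ?thesis using x that by simp
 qed
 define A where "A r = (LINT t|arc. (cmod (f (of_real r * cis t)))\<^sup>2) / (2 * pi)" for r
 have ser: "f (of_real r * cis t) = (\<Sum>n. (c n * of_real r ^ n) * cis t ^ n)" if "0 <= r" "r < 1" for r t
  using ps[of "of_real r * cis t"] that by (simp add: norm_mult power_mult_distrib sums_iff mult.assoc)
 have Asum: "(%n. (cmod (c n * of_real r ^ n))\<^sup>2) sums A r" if "0 <= r" "r < 1" for r
  unfolding A_def ser[OF that] by (rule parseval_disc[OF abs[OF that]])
 have Amono: "A r <= A s" if "0 <= r" "r <= s" "s < 1" for r s by (rule sums_le[OF _ Asum[of r] Asum[of s]])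
  (use that in "auto simp: norm_mult norm_power intro!: mult_left_mono power_mono")
 have AB: "A r <= B\<^sup>2" if "0 < r" "r < 1" for r
 proof -
  have "(LINT t|arc. (cmod (f (of_real r * cis t)))\<^sup>2) <= (LINT t|arc. B\<^sup>2)"
  proof (rule integral_mono)
  show "integrable arc (%t. (cmod (f (of_real r * cis t)))\<^sup>2)"
  by (intro integrable_continuous_arc continuous_intros continuous_dilate f that)
  show "(cmod (f (of_real r * cis t)))\<^sup>2 <= B\<^sup>2" for t
  using that by (intro power_mono B) (auto simp: norm_mult)
  qed auto
  also have "(LINT t|arc. B\<^sup>2) = 2 * pi * B\<^sup>2" by (simp add: measure_arc)
  finally show ?thesis by (simp add: A_def divide_le_eq mult.commute)
 qed
 define rho where "rho k = 1 - 1 / (real k + 2)" for k :: nat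
 have rho: "0 < rho k" "rho k < 1" for k by (auto simp: rho_def field_simps)
 have rhomono: "rho j <= rho k" if "j <= k" for j k using that by (auto simp: rho_def field_simps)
 have "incseq (%k. A (rho k))" unfolding incseq_def
 proof (intro allI impI Amono)
  show "0 <= rho k" "rho k < 1" for k using rho[of k] by auto
 qed (rule rhomono)
 then obtain L where L: "(%k. A (rho k)) ----> L"
  using incseq_convergent[of "%k. A (rho k)" "B\<^sup>2"] AB rho by metis
 \<comment> \<open>Radii are selected so that the quadratic mean is within \<open>4 ^ -k\<close> of
   its limit; consecutive dilates are then close enough for the differences to be summable.\<close>
 have "EX j>=k. \<bar>A (rho j) - L\<bar> <= (1/4) ^ k" for k
 proof -
  obtain N where "ALL n>=N. \<bar>A (rho n) - L\<bar> < (1/4) ^ k" using LIMSEQ_D[OF L, of "(1/4) ^ k"] by auto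
  then show ?thesis by (intro exI[of _ "max N k"]) (auto simp: less_imp_le)
 qed
 then obtain J where J: "!!k. k <= J k" "!!k. \<bar>A (rho (J k)) - L\<bar> <= (1/4) ^ k" by metis
 define r where "r k = rho (J k)" for k
 have r01: "0 < r k" "r k < 1" for k using rho by (auto simp: r_def)
 have r1: "r ----> 1"
 proof (rule tendsto_sandwich)
  show "\<forall>\<^sub>F k in sequentially. 1 - 1 / (real k + 2) <= r k"
  using rhomono[OF J(1)] unfolding r_def rho_def by (auto intro!: always_eventually)
  show "\<forall>\<^sub>F k in sequentially. r k <= 1" using r01 by (auto intro!: always_eventually less_imp_le)
  show "(%k. 1 - 1 / (real k + 2)) ----> 1" by real_asymp
 qed auto
 define g where "g k t = f (of_real (r k) * cis t)" for k t
 have contg: "continuous_on UNIV (g k)" for k unfolding g_def using r01 by (intro continuous_dilate f) auto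
 have L2: "(LINT t|arc. (cmod (g j t - g k t))\<^sup>2) <= 2 * pi * \<bar>A (r j) - A (r k)\<bar>" for j k
 proof -
  define b where "b n = c n * of_real (r j) ^ n - c n * of_real (r k) ^ n" for n
  have sb: "summable (%n. cmod (b n))" unfolding b_def
  by (rule summable_comparison_test'[OF summable_add[OF abs[of "r j"] abs[of "r k"]], of 0])
  (use r01 in "auto simp: less_imp_le intro: norm_triangle_ineq4")
  have "g j t - g k t = (\<Sum>n. b n * cis t ^ n)" for t
  proof -
  have "summable (%n. (c n * of_real (r k) ^ n) * cis t ^ n)" for k
  proof (rule summable_norm_cancel)
  show "summable (%n. norm (c n * of_real (r k) ^ n * cis t ^ n))"
  using abs[of "r k"] r01[of k] by (simp add: norm_mult norm_power)
  qed
  then show ?thesis unfolding g_def b_def using r01 by (simp add: ser less_imp_le suminf_diff left_diff_distrib)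
  qed
  then have s1: "(%n. (cmod (b n))\<^sup>2) sums ((LINT t|arc. (cmod (g j t - g k t))\<^sup>2) / (2 * pi))"
  using parseval_disc[OF sb] by simp
  \<comment> \<open>Applied to \<open>s ^ n\<close> and \<open>r ^ n\<close> in each Taylor
    coefficient, this bounds the squared \<open>L^2\<close> distance of two dilates by the
    difference of their quadratic means.\<close>
  have key: "(x - y)\<^sup>2 <= x\<^sup>2 - y\<^sup>2" if "0 <= y" "y <= x" for x y :: real
  using mult_left_mono[OF that(2) that(1)] by (simp add: power2_eq_square algebra_simps)
  have le: "(LINT t|arc. (cmod (g j t - g k t))\<^sup>2) / (2 * pi) <= A s - A r"
  if *: "0 < r" "r <= s" "s < 1" and bb: "!!n. cmod (b n) = cmod (c n) * (s ^ n - r ^ n)" for r s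
  proof -
  have AA: "(%n. (cmod (c n * of_real s ^ n))\<^sup>2 - (cmod (c n * of_real r ^ n))\<^sup>2) sums (A s - A r)"
  using * by (intro sums_diff Asum) auto
  show ?thesis
  proof (rule sums_le[OF _ s1 AA])
  fix n
  have "(cmod (b n))\<^sup>2 = (cmod (c n))\<^sup>2 * (s ^ n - r ^ n)\<^sup>2" by (simp add: bb power_mult_distrib)
  also have "... <= (cmod (c n))\<^sup>2 * ((s ^ n)\<^sup>2 - (r ^ n)\<^sup>2)"
  using * by (intro mult_left_mono key power_mono) auto
  finally show "(cmod (b n))\<^sup>2 <= (cmod (c n * of_real s ^ n))\<^sup>2 - (cmod (c n * of_real r ^ n))\<^sup>2"
  using * by (simp add: norm_mult norm_power power_mult_distrib right_diff_distrib)
  qed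
  qed
  have nb: "cmod (b n) = cmod (c n) * \<bar>r j ^ n - r k ^ n\<bar>" for n
  proof -
  have "b n = c n * of_real (r j ^ n - r k ^ n)" by (simp add: b_def right_diff_distrib)
  then show ?thesis by (simp only: norm_mult norm_of_real)
  qed
  have "(LINT t|arc. (cmod (g j t - g k t))\<^sup>2) / (2 * pi) <= \<bar>A (r j) - A (r k)\<bar>"
  proof (cases "r j <= r k")
  case True
  have "\<bar>r j ^ n - r k ^ n\<bar> = r k ^ n - r j ^ n" for n using power_mono[OF True, of n] r01[of j] by auto
  then show ?thesis using le[of "r j" "r k"] True r01 nb by force
  next
  case False
  have "\<bar>r j ^ n - r k ^ n\<bar> = r j ^ n - r k ^ n" for n
  using power_mono[of "r k" "r j" n] r01[of k] False by auto
  then show ?thesis using le[of "r k" "r j"] False r01 nb by force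
  qed
  then show ?thesis by (simp add: divide_le_eq mult.commute)
 qed
 define h where "h k t = cmod (g (Suc k) t - g k t)" for k t
 have conth: "continuous_on UNIV (h k)" for k unfolding h_def by (intro continuous_intros contg)
 have ih: "integrable arc (h k)" "integrable arc (%t. (h k t)\<^sup>2)" for k
  by (intro integrable_continuous_arc continuous_intros conth)+
 have L1: "(LINT t|arc. h k t) <= (6 * pi) * (1/2) ^ k" for k
 proof -
  \<comment> \<open>Arithmetic-geometric mean inequality with weight \<open>2 ^ k\<close>: it
    converts the bound of order \<open>4 ^ -k\<close> for the square into one of order
    \<open>2 ^ -k\<close> for the first power.\<close>
  have "h k t <= 2 ^ k * (h k t)\<^sup>2 / 2 + (1/2) ^ k / 2" for t
  proof -
  have "0 <= (2 ^ k * h k t - 1)\<^sup>2 * (1/2) ^ k" by simp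
  also have "... = (2 ^ k * (1/2) ^ k) * (2 ^ k * (h k t)\<^sup>2 - 2 * h k t) + (1/2) ^ k"
  by (simp add: power2_eq_square algebra_simps)
  also have "(2::real) ^ k * (1/2) ^ k = 1" by (simp add: power_mult_distrib[symmetric])
  finally show ?thesis by simp
  qed
  then have "(LINT t|arc. h k t) <= (LINT t|arc. 2 ^ k * (h k t)\<^sup>2 / 2 + (1/2) ^ k / 2)"
  using ih[of k] by (intro integral_mono) auto
  also have "... = 2 ^ k / 2 * (LINT t|arc. (h k t)\<^sup>2) + pi * (1/2) ^ k" using ih[of k] by (simp add: measure_arc)
  also have "(LINT t|arc. (h k t)\<^sup>2) <= 2 * pi * \<bar>A (r (Suc k)) - A (r k)\<bar>" unfolding h_def by (rule L2)
  also have "\<bar>A (r (Suc k)) - A (r k)\<bar> <= 2 * (1/4) ^ k"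
  proof -
  have "(1/4::real) ^ Suc k <= (1/4) ^ k" by (rule power_decreasing) auto
  then show ?thesis using J(2)[of k] J(2)[of "Suc k"] unfolding r_def by linarith
  qed
  finally have "(LINT t|arc. h k t) <= 2 ^ k / 2 * (2 * pi * (2 * (1/4) ^ k)) + pi * (1/2) ^ k"
  by (simp add: mult_left_mono)
  also have "(2::real) ^ k / 2 * (2 * pi * (2 * (1/4) ^ k)) = 2 * pi * (1/2) ^ k"
  proof -
  have "(2::real) ^ k * (1/4) ^ k = (1/2) ^ k" by (simp add: power_mult_distrib[symmetric])
  then show ?thesis by (simp add: mult_ac)
  qed
  finally have "(LINT t|arc. h k t) <= 3 * (pi * (1/2) ^ k)" by simp
  moreover have "0 <= pi * (1/2) ^ k" by simp
  ultimately show ?thesis by linarith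
 qed
 have "(\<integral>\<^sup>+t. (\<Sum>k. ennreal (h k t)) \<partial>arc) = (\<Sum>k. \<integral>\<^sup>+t. ennreal (h k t) \<partial>arc)"
  by (rule nn_integral_suminf) (use ih in auto)
 also have "... = (\<Sum>k. ennreal (LINT t|arc. h k t))" using ih by (subst nn_integral_eq_integral) (auto simp: h_def)
 also have "... <= (\<Sum>k. ennreal ((6 * pi) * (1/2) ^ k))" using L1 by (intro suminf_le) (auto intro: ennreal_leI)
 also have "... = ennreal (\<Sum>k. (6 * pi) * (1/2) ^ k)" by (rule suminf_ennreal2) (auto intro!: summable_mult)
 finally have "(\<integral>\<^sup>+t. (\<Sum>k. ennreal (h k t)) \<partial>arc) ~= \<infinity>"
  by (auto simp: top_unique)
 then have "AE t in arc. (\<Sum>k. ennreal (h k t)) ~= \<infinity>" using ih by (intro nn_integral_PInf_AE) auto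
 then have "AE t in arc. convergent (%k. f (of_real (r k) * cis t))"
 proof eventually_elim
  case (elim t)
  then have "summable (%k. h k t)" by (intro summable_suminf_not_top) (auto simp: h_def)
  then have "summable (%k. g (Suc k) t - g k t)" unfolding h_def by (rule summable_norm_cancel)
  then have "convergent (%n. SUM k<n. g (Suc k) t - g k t)" by (simp add: summable_iff_convergent)
  have e: "(SUM k<n. g (Suc k) t - g k t) + g 0 t = g n t" for n
  by (simp only: sum_lessThan_telescope[of "%k. g k t" n] diff_add_cancel)
  from convergent_add[OF \<open>convergent (%n. SUM k<n. g (Suc k) t - g k t)\<close> convergent_const[of "g 0 t"]]
  show ?case unfolding e by (simp add: g_def)
 qed
 then show ?thesis using r01 r1 by blast
qed

lemma dilate_tendsto:
 fixes f :: "complex => complex"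
 assumes f: "disc_hol f" and r: "r ----> 1" and a: "cmod a < 1" shows "(%k. f (of_real (r k) * a)) ----> f a"
proof -
 have c: "isCont f a" using a holomorphic_on_imp_continuous_on[OF f] by (simp add: continuous_on_eq_continuous_at)
 have "(%k. of_real (r k) * a) ----> a" using tendsto_mult[OF tendsto_of_real[OF r] tendsto_const[of a]] by simp
 from isCont_tendsto_compose[OF c this] show ?thesis .
qed

text \<open>The limit along one sequence of radii already represents \<open>f\<close> by its Poisson
  integral, by dominated convergence; \<open>pois_nt_limit\<close> for the real and imaginary parts
  then gives convergence in every Stolz angle.\<close>

theorem bounded_boundary_function:
 fixes f :: "complex => complex"
 assumes f: "disc_hol f" and B: "!!w. w : ball 0 1 ==> cmod (f w) <= B"
 obtains fs :: "real => complex" where "arc_meas fs" "!!t. cmod (fs t) <= B"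
  "!!a. cmod a < 1 ==> (LINT t|arc. of_real (PK a t) * fs t) = 2 * pi * f a"
  "AE t in arc. has_nt_limit f (cis t) (fs t)"
proof -
 have B0: "0 <= B" using B[of 0] norm_ge_zero[of "f 0"] by (simp del: norm_ge_zero)
 obtain r where r: "!!k::nat. 0 < r k" "!!k. r k < 1" "r ----> 1"
  "AE t in arc. convergent (%k. f (of_real (r k) * cis t))" using bounded_radial_limit[OF f B] by blast
 define g where "g k t = f (of_real (r k) * cis t)" for k t
 have gm: "g k : borel_measurable arc" for k
  unfolding g_def using r(1,2) by (intro arc_measurable_continuous continuous_dilate f) auto
 have gB: "cmod (g k t) <= B" for k t unfolding g_def using r(1)[of k] r(2)[of k] by (intro B) (simp add: norm_mult)
 define fs where "fs t = (if cmod (lim (%k. g k t)) <= B then lim (%k. g k t) else 0)" for t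
 have [measurable]: "arc_meas (%t. lim (%k. g k t))" by (rule borel_measurable_lim_metric[OF gm])
 have fsm: "arc_meas fs" unfolding fs_def by measurable
 have fsB: "cmod (fs t) <= B" for t using B0 by (simp add: fs_def)
 have conv: "AE t in arc. (%k. g k t) ----> fs t" using r(4)
 proof eventually_elim
  case (elim t)
  then have l: "(%k. g k t) ----> lim (%k. g k t)" by (simp add: g_def convergent_LIMSEQ_iff)
  have "cmod (lim (%k. g k t)) <= B" by (rule tendsto_upperbound[OF tendsto_norm[OF l]]) (use gB in auto)
  then show ?case using l by (simp add: fs_def)
 qed
 have P: "(LINT t|arc. of_real (PK a t) * fs t) = 2 * pi * f a" if a: "cmod a < 1" for a
 proof -
  have C1: "(%k. LINT t|arc. of_real (PK a t) * g k t) ----> (LINT t|arc. of_real (PK a t) * fs t)"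
  proof (rule integral_dominated_convergence[where w="%t. PK a t * B"])
  show "integrable arc (%t. PK a t * B)" using a by (intro integrable_PK) auto
  show "AE t in arc. (%k. of_real (PK a t) * g k t) ----> of_real (PK a t) * fs t"
  using conv by eventually_elim (intro tendsto_intros)
  show "AE t in arc. norm (of_real (PK a t) * g k t) <= PK a t * B" for k
  using gB PK_pos[OF a] by (auto intro!: AE_I2 mult_left_mono simp: norm_mult less_imp_le)
  qed (use gm fsm PK_measurable[OF a] in auto)
  have C2: "(LINT t|arc. of_real (PK a t) * g k t) = 2 * pi * f (of_real (r k) * a)" for k
  unfolding g_def using r(1,2)[of k] a by (intro poisson_formula[OF holomorphic_dilate[OF f]]) auto
  have C3: "(%k. 2 * pi * f (of_real (r k) * a)) ----> 2 * pi * f a"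
  by (intro tendsto_mult tendsto_const dilate_tendsto f r(3) a)
  from LIMSEQ_unique[OF C1[unfolded C2] C3] show ?thesis .
 qed
 define u v where "u = (%t. Re (fs t))" and "v = (%t. Im (fs t))"
 have ifs: "integrable arc fs" by (rule arc.integrable_const_bound[of _ B]) (use fsm fsB in auto)
 have iu: "integrable arc u" "integrable arc v" unfolding u_def v_def using ifs by auto
 have fuv: "f a = Complex (pois u a) (pois v a)" if a: "a : ball 0 1" for a
 proof -
  have i: "integrable arc (%t. of_real (PK a t) * fs t)"
  proof (rule integrable_bdd_mult[where B="2 / (1 - cmod a)"])
  show "norm (complex_of_real (PK a t)) <= 2 / (1 - cmod a)" for t using PK_le[of a t] PK_pos[of a t] a by simp
  show "arc_meas (%t. complex_of_real (PK a t))" using PK_measurable[of a] a by simp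
  qed (rule ifs)
  have "Re (2 * pi * f a) = (LINT t|arc. Re (of_real (PK a t) * fs t))"
  "Im (2 * pi * f a) = (LINT t|arc. Im (of_real (PK a t) * fs t))"
  using P[of a] a integral_Re[OF i] integral_Im[OF i] by auto
  then show ?thesis by (simp add: complex_eq_iff pois_def u_def v_def eq_divide_eq mult.commute)
 qed
 have "AE t in arc. has_nt_limit f (cis t) (fs t)" using pois_nt_limit[OF iu(1)] pois_nt_limit[OF iu(2)]
 proof eventually_elim
  case (elim t)
  then have "has_nt_limit (%w. Complex (pois u w) (pois v w)) (cis t) (Complex (u t) (v t))"
  unfolding has_nt_limit_def by (auto intro: tendsto_Complex)
  then show ?case by (subst has_nt_limit_cong[OF fuv]) (auto simp: u_def v_def)
 qed
 then show ?thesis using that fsm fsB P by blast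
qed

text \<open>The kernel is positive with mean 1, so the Poisson representation turns an almost
  everywhere bound of the boundary modulus into a bound inside.\<close>

lemma bounded_max_principle:
 fixes f :: "complex => complex"
 assumes f: "disc_hol f" and B: "!!w. w : ball 0 1 ==> cmod (f w) <= B"
  and M: "AE t in arc. EX l. has_nt_limit (%w. cmod (f w)) (cis t) l & l <= M" and a: "cmod a < 1"
 shows "cmod (f a) <= M"
proof -
 obtain fs where fs: "arc_meas fs" "!!t. cmod (fs t) <= B"
  "!!a. cmod a < 1 ==> (LINT t|arc. of_real (PK a t) * fs t) = 2 * pi * f a"
  "AE t in arc. has_nt_limit f (cis t) (fs t)" using bounded_boundary_function[OF f B] by blast
 have le: "AE t in arc. cmod (fs t) <= M" using M fs(4)
 proof eventually_elim
  case (elim t)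
  then obtain l where l: "has_nt_limit (%w. cmod (f w)) (cis t) l" "l <= M" by blast
  have "has_nt_limit (%w. cmod (f w)) (cis t) (cmod (fs t))" using elim(2) by (rule has_nt_limit_compose) simp
  then have "l = cmod (fs t)" using nt_limit_eqI[OF l(1)] nt_limit_eqI[of "%w. cmod (f w)" "cis t"] by simp
  then show ?case using l by simp
 qed
 have i: "integrable arc (%t. PK a t * cmod (fs t))"
  by (intro integrable_PK a arc.integrable_const_bound[of _ B]) (use fs(1,2) in auto)
 have "2 * pi * cmod (f a) = cmod (LINT t|arc. of_real (PK a t) * fs t)" unfolding fs(3)[OF a] by (simp add: norm_mult)
 also have "... <= (LINT t|arc. cmod (of_real (PK a t) * fs t))" by (rule integral_norm_bound)
 also have "... = (LINT t|arc. PK a t * cmod (fs t))"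
  using PK_pos[OF a] by (intro Bochner_Integration.integral_cong) (auto simp: norm_mult less_imp_le)
 also have "... <= (LINT t|arc. PK a t * M)"
  using le PK_pos[OF a] a by (intro integral_mono_AE i integrable_PK) (auto elim!: eventually_mono intro!: mult_left_mono simp: less_imp_le)
 also have "... = 2 * pi * M" using integral_PK[OF a] by simp
 finally show ?thesis by simp
qed

subsection \<open>Outer functions and quasi-bounded majorants\<close>

text \<open>The sign is such that a weight \<open>u >= 0\<close> gives a function bounded by 1: the
  boundary modulus is \<open>exp (- u t)\<close>.\<close>

definition outer :: "(real => real) => complex => complex" where
 "outer u a = exp (- herg u a)"

lemma outer_holomorphic: "integrable arc u ==> outer u holomorphic_on ball 0 1"
 unfolding outer_def by (intro holomorphic_intros herg_holomorphic)

lemma cmod_outer: "cmod a < 1 ==> integrable arc u ==> cmod (outer u a) = exp (- pois u a)"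
 by (simp add: outer_def Re_herg)

lemma outer_nonzero: "outer u a ~= 0" by (simp add: outer_def)

lemma inverse_outer: "cmod a < 1 ==> inverse (outer u a) = outer (%t. - u t) a"
 by (simp add: outer_def herg_def exp_minus)

text \<open>By \<open>smirnov_iff_quasi_bounded\<close> this is the Smirnov class. Nonnegativity of
  \<open>u\<close> is a normalisation, obtained by passing to the absolute value, and serves when
  majorants are added.\<close>

definition quasi_bounded :: "(complex => complex) => bool" where
 "quasi_bounded f \<longleftrightarrow> f holomorphic_on ball 0 1 &
  (EX u. integrable arc u & (ALL t. 0 <= u t) & (ALL a:ball 0 1. cmod (f a) <= exp (pois u a)))"

lemma quasi_boundedI:
 assumes "disc_hol f" "integrable arc u" "!!a. cmod a < 1 ==> cmod (f a) <= exp (pois u a)" shows "quasi_bounded f"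
 unfolding quasi_bounded_def
proof (intro conjI exI[of _ "%t. \<bar>u t\<bar>"] ballI)
 fix a :: complex assume a: "a : ball 0 1"
 have "pois u a <= pois (%t. \<bar>u t\<bar>) a" using a assms by (intro pois_mono_AE) auto
 then show "cmod (f a) <= exp (pois (%t. \<bar>u t\<bar>) a)" using assms(3)[of a] a
  by (meson exp_le_cancel_iff mem_ball_0 order_trans)
qed (use assms in auto)

lemma outer_nt_modulus:
 assumes u: "integrable arc u" shows "AE t in arc. has_nt_limit (%w. cmod (outer u w)) (cis t) (exp (- u t))"
 using pois_nt_limit[OF u]
proof eventually_elim
 case (elim t)
 have "has_nt_limit (%w. exp (- pois u w)) (cis t) (exp (- u t))" by (rule has_nt_limit_compose[OF elim]) simp
 then show ?case by (subst has_nt_limit_cong[OF cmod_outer[OF _ u]]) auto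
qed

lemma bounded_nt_limit:
 fixes f :: "complex => complex"
 assumes f: "disc_hol f" and B: "!!w. cmod w < 1 ==> cmod (f w) <= B"
 shows "AE t in arc. has_nt_limit f (cis t) (bdry f t)"
proof -
 obtain fs where "AE t in arc. has_nt_limit f (cis t) (fs t)"
  by (rule bounded_boundary_function[OF f, of B]) (use B in auto)
 then show ?thesis by eventually_elim (simp add: nt_limit_eqI)
qed

text \<open>\<open>f\<close> is the quotient of the bounded functions \<open>f * outer u\<close> and
  \<open>outer u\<close>, and the boundary value of the latter has modulus
  \<open>exp (- u t)\<close>, hence is not 0.\<close>

lemma quasi_bounded_nt_limit:
 assumes "quasi_bounded f" shows "AE t in arc. has_nt_limit f (cis t) (bdry f t)"
proof -
 obtain u where f: "disc_hol f" and u: "integrable arc u" "!!t. 0 <= u t"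
  "!!a. cmod a < 1 ==> cmod (f a) <= exp (pois u a)" using assms by (auto simp: quasi_bounded_def)
 define H where "H = (%a. f a * outer u a)"
 have Hh: "disc_hol H" unfolding H_def by (intro holomorphic_intros f outer_holomorphic u)
 have H1: "cmod (H a) <= 1" if a: "cmod a < 1" for a
 proof -
  have "cmod (H a) <= exp (pois u a) * exp (- pois u a)"
  unfolding H_def norm_mult cmod_outer[OF a u(1)] by (intro mult_right_mono u a) simp
  then show ?thesis by (simp flip: exp_add)
 qed
 have O1: "cmod (outer u a) <= 1" if a: "cmod a < 1" for a
  using cmod_outer[OF a u(1)] pois_nonneg[OF a, of u] u(2) by simp
 have n1: "AE t in arc. has_nt_limit H (cis t) (bdry H t)" by (rule bounded_nt_limit[OF Hh H1])
 have n2: "AE t in arc. has_nt_limit (outer u) (cis t) (bdry (outer u) t)"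
  by (rule bounded_nt_limit[OF outer_holomorphic[OF u(1)] O1])
 show ?thesis using n1 n2 outer_nt_modulus[OF u(1)]
 proof eventually_elim
  case (elim t)
  define h l where "h = bdry H t" and "l = bdry (outer u) t"
  have "has_nt_limit (%w. cmod (outer u w)) (cis t) (cmod l)"
  using elim(2) unfolding l_def by (rule has_nt_limit_compose) simp
  then have "cmod l = exp (- u t)"
  using nt_limit_eqI[OF elim(3)] nt_limit_eqI[of "%w. cmod (outer u w)" "cis t"] by simp
  then have "l ~= 0" by auto
  then have "isCont inverse l" unfolding isCont_def by (intro tendsto_inverse tendsto_ident_at)
  then have "has_nt_limit (%w. inverse (outer u w)) (cis t) (inverse l)"
  by (rule has_nt_limit_compose[OF elim(2)[folded l_def]])
  then have "has_nt_limit (%w. H w * inverse (outer u w)) (cis t) (h * inverse l)"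
  unfolding h_def by (rule has_nt_limit_mult[OF elim(1)])
  moreover have "(%w. H w * inverse (outer u w)) = f" by (rule ext) (simp add: H_def outer_nonzero)
  ultimately have "has_nt_limit f (cis t) (h * inverse l)" by simp
  then show ?case using nt_limit_eqI[of f "cis t"] by simp
 qed
qed

text \<open>The product of \<open>f\<close> and \<open>outer u'\<close> is bounded, with boundary
  modulus at most \<open>exp (- v t)\<close>. Dividing by \<open>outer v\<close> would give the
  claim at once, but the quotient need not be bounded; so \<open>v\<close> is truncated at
  \<open>k\<close>, the bounded maximum principle is applied, and \<open>k\<close> tends to
  infinity.\<close>

theorem quasi_bounded_max_principle:
 assumes "quasi_bounded f" and w: "integrable arc w"
  and le: "AE t in arc. cmod (bdry f t) <= exp (w t)" and a: "cmod a < 1" shows "cmod (f a) <= exp (pois w a)"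
proof -
 obtain u where f: "disc_hol f" and u: "integrable arc u" "!!t. 0 <= u t"
  "!!a. cmod a < 1 ==> cmod (f a) <= exp (pois u a)" using assms(1) by (auto simp: quasi_bounded_def)
 define u' where "u' = (%t. max (u t) (w t))"
 have u': "integrable arc u'" unfolding u'_def using u w by auto
 define v where "v = (%t. u' t - w t)"
 have v: "integrable arc v" "!!t. 0 <= v t" unfolding v_def using u' w by (auto simp: u'_def)
 define vk where "vk k t = min (v t) (real k)" for k t
 have vk: "integrable arc (vk k)" for k unfolding vk_def using v by auto
 have main: "cmod (f a) * exp (- pois u' a) * exp (pois (vk k) a) <= 1" for k
 proof -
  define H where "H = (%a. f a * outer u' a * inverse (outer (vk k) a))"
  have cH: "cmod (H a) = cmod (f a) * exp (- pois u' a) * exp (pois (vk k) a)" if "cmod a < 1" for a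
  using that u' vk by (simp add: H_def norm_mult norm_inverse cmod_outer exp_minus)
  have Hh: "disc_hol H" unfolding H_def using outer_nonzero by (intro holomorphic_intros f outer_holomorphic u' vk) auto
  have "cmod (H a) <= 1"
  proof (rule bounded_max_principle[OF Hh _ _ a])
  fix b :: complex assume "b : ball 0 1"
  then have b: "cmod b < 1" by simp
  have "pois u b <= pois u' b" by (rule pois_mono_AE[OF b u(1) u']) (auto simp: u'_def)
  then have "cmod (f b) <= exp (pois u' b)" using u(3)[OF b] by (meson exp_le_cancel_iff order_trans)
  then have 1: "cmod (f b) * exp (- pois u' b) <= 1" by (simp add: exp_minus field_simps)
  have "pois (vk k) b <= pois (%_. real k) b" by (rule pois_mono_AE[OF b vk]) (auto simp: vk_def)
  then have 2: "exp (pois (vk k) b) <= exp (real k)" by (simp add: pois_const[OF b])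
  show "cmod (H b) <= 1 * exp (real k)" unfolding cH[OF b] using 1 2 by (intro mult_mono) auto
  next
  show "AE t in arc. EX l. has_nt_limit (%w. cmod (H w)) (cis t) l & l <= 1"
  using quasi_bounded_nt_limit[OF assms(1)] le pois_nt_limit[OF u'] pois_nt_limit[OF vk[of k]]
  proof eventually_elim
  case (elim t)
  have "has_nt_limit (%w. cmod (f w) * exp (- pois u' w) * exp (pois (vk k) w)) (cis t)
  (cmod (bdry f t) * exp (- u' t) * exp (vk k t))" by (intro has_nt_limit_mult has_nt_limit_compose[OF elim(1), of cmod]
  has_nt_limit_compose[OF elim(3), of "%x. exp (- x)"] has_nt_limit_compose[OF elim(4), of exp]) auto
  then have "has_nt_limit (%w. cmod (H w)) (cis t) (cmod (bdry f t) * exp (- u' t) * exp (vk k t))"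
  by (subst has_nt_limit_cong[OF cH]) auto
  moreover have "cmod (bdry f t) * exp (- u' t) * exp (vk k t) <= exp (w t) * exp (- u' t) * exp (v t)"
  using elim(2) by (intro mult_mono) (auto simp: vk_def)
  moreover have "exp (w t) * exp (- u' t) * exp (v t) = 1" by (simp add: v_def flip: exp_add)
  ultimately show ?case by force
  qed
  qed
  then show ?thesis by (simp add: cH[OF a])
 qed
 have "(%k. pois (vk k) a) ----> pois v a" unfolding pois_def
 proof (intro tendsto_divide tendsto_const integral_dominated_convergence[where w="%t. PK a t * v t"])
  show "AE t in arc. (%k. PK a t * vk k t) ----> PK a t * v t"
  proof (intro AE_I2 tendsto_mult tendsto_const)
  fix t
  obtain n where "v t <= real n" using real_arch_simple by blast
  then have "\<forall>\<^sub>F k in sequentially. vk k t = v t"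
  by (intro eventually_sequentiallyI[of n]) (simp add: vk_def)
  then show "(%k. vk k t) ----> v t" by (rule tendsto_eventually)
  qed
  show "AE t in arc. norm (PK a t * vk k t) <= PK a t * v t" for k
  using PK_pos[OF a] v(2) by (auto intro!: AE_I2 mult_left_mono simp: vk_def abs_mult less_imp_le)
 qed (use v vk integrable_PK[OF a] PK_measurable[OF a] in auto)
 then have "(%k. cmod (f a) * exp (- pois u' a) * exp (pois (vk k) a)) ---->
  cmod (f a) * exp (- pois u' a) * exp (pois v a)" by (intro tendsto_intros)
 then have "cmod (f a) * exp (- pois u' a) * exp (pois v a) <= 1" by (rule tendsto_upperbound) (use main in auto)
 moreover have "pois v a = pois u' a - pois w a" unfolding v_def by (rule pois_diff[OF a u' w])
 ultimately show ?thesis by (simp add: exp_diff exp_minus field_simps)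
qed

subsection \<open>The Smirnov class\<close>

lemma log_plus_eq: "0 <= x ==> log_plus x = ln (max 1 x)"
 by (cases "x = 0") (auto simp: log_plus_def max_def ln_less_zero_iff)

lemma log_plus_nonneg: "0 <= log_plus x" by (simp add: log_plus_def)

lemma le_exp_log_plus: "0 <= x ==> x <= exp (log_plus x)" by (auto simp: log_plus_eq max_def)

lemma log_plus_le_iff:
 assumes "0 <= x" "0 <= y" shows "log_plus x <= y \<longleftrightarrow> x <= exp y"
proof -
 have "ln (max 1 x) <= y \<longleftrightarrow> max 1 x <= exp y"
  by (metis exp_ln exp_le_cancel_iff less_max_iff_disj zero_less_one)
 then show ?thesis using assms by (simp add: log_plus_eq)
qed

lemma continuous_log_plus_cmod: "continuous_on UNIV (%z. log_plus (cmod z))"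
proof -
 have "continuous_on UNIV (%z::complex. ln (max 1 (cmod z)))" by (intro continuous_intros) (auto simp: max_def)
 then show ?thesis by (simp add: log_plus_eq)
qed

lemma log_plus_measurable [measurable]: "log_plus : borel_measurable borel"
 unfolding log_plus_def[abs_def] by measurable

lemma continuous_log_plus_dilate:
 assumes "disc_hol f" "0 < r" "r < 1" shows "continuous_on UNIV (%t. log_plus (cmod (f (of_real r * cis t))))"
 using continuous_on_compose2[OF continuous_log_plus_cmod continuous_dilate[OF assms]] by simp

lemma PK_symmetric: "PK (of_real r * cis t) s = PK (of_real r * cis s) t"
proof -
 have "cis s - of_real r * cis t = cis s * cis t * cnj (cis t - of_real r * cis s)"
  by (simp add: right_diff_distrib cis_cnj cis_mult mult_ac)
 then have "cmod (cis s - of_real r * cis t) = cmod (cis s * cis t * cnj (cis t - of_real r * cis s))" by simp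
 also have "... = cmod (cis t - of_real r * cis s)" unfolding norm_mult complex_mod_cnj by simp
 finally have "cmod (cis s - of_real r * cis t) = cmod (cis t - of_real r * cis s)" .
 then show ?thesis by (simp add: PK_def norm_mult)
qed

text \<open>By \<open>PK_symmetric\<close> the kernel has integral \<open>2 * pi\<close> in the
  other variable as well, so Fubini shows that the circle means of a Poisson integral do not depend
  on the radius.\<close>

lemma integral_pois_circle:
 assumes u: "integrable arc u" and r: "0 <= r" "r < 1" shows "integrable arc (%t. pois u (of_real r * cis t))"
  and "(LINT t|arc. pois u (of_real r * cis t)) = (LINT t|arc. u t)"
proof -
 have r1: "cmod (of_real r * cis t) < 1" for t using r by (simp add: norm_mult)
 define F where "F t s = PK (of_real r * cis t) s * u s" for t s
 have um: "arc_meas u" using u by auto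
 have Fm: "case_prod F : borel_measurable (arc \<Otimes>\<^sub>M arc)"
 proof -
  have [measurable]: "(%p. u (snd p)) : borel_measurable (arc \<Otimes>\<^sub>M arc)"
  by (rule measurable_compose[OF measurable_snd um])
  have cm: "cis : borel_measurable borel" by (intro borel_measurable_continuous_onI continuous_intros)
  have [measurable]: "(%p. cis (fst p)) : borel_measurable (arc \<Otimes>\<^sub>M arc)"
  "(%p. cis (snd p)) : borel_measurable (arc \<Otimes>\<^sub>M arc)" by (rule measurable_compose[OF _ cm], measurable)+
  show ?thesis unfolding F_def PK_def split_beta by measurable
 qed
 have iF: "integrable arc (F t)" for t unfolding F_def by (rule integrable_PK[OF r1 u])
 have "integrable (arc \<Otimes>\<^sub>M arc) (case_prod F)"
 proof (rule Bochner_Integration.integrable_bound)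
  have "integrable (arc \<Otimes>\<^sub>M arc) (%p. u (snd p))"
  proof (rule arcarc.Fubini_integrable)
  show "(%p. u (snd p)) : borel_measurable (arc \<Otimes>\<^sub>M arc)"
  by (rule measurable_compose[OF measurable_snd um])
  qed (use u in auto)
  then show "integrable (arc \<Otimes>\<^sub>M arc) (%p. 2 / (1 - r) * u (snd p))" by simp
  show "AE p in arc \<Otimes>\<^sub>M arc. norm (case_prod F p) <= norm (2 / (1 - r) * u (snd p))"
  proof (rule AE_I2)
  fix p
  have "PK (of_real r * cis (fst p)) (snd p) <= 2 / (1 - r)" "0 <= PK (of_real r * cis (fst p)) (snd p)"
  using PK_le[OF r1, of "fst p" "snd p"] PK_pos[OF r1, of "fst p" "snd p"] r by (auto simp: norm_mult)
  then show "norm (case_prod F p) <= norm (2 / (1 - r) * u (snd p))"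
  using r mult_right_mono[OF _ abs_ge_zero[of "u (snd p)"]] by (fastforce simp: F_def split_beta abs_mult)
  qed
 qed (rule Fm)
 then have fub: "(LINT s|arc. (LINT t|arc. F t s)) = (LINT t|arc. (LINT s|arc. F t s))"
  and i2: "integrable arc (%t. LINT s|arc. F t s)"
  using arcarc.Fubini_integral[of F] arcarc.integrable_fst'[of "case_prod F"] by auto
 have p: "pois u (of_real r * cis t) = (LINT s|arc. F t s) / (2 * pi)" for t by (simp add: pois_def F_def)
 show "integrable arc (%t. pois u (of_real r * cis t))" unfolding p using i2 by simp
 have "(LINT t|arc. F t s) = 2 * pi * u s" for s unfolding F_def using integral_PK[OF r1] by (subst PK_symmetric) simp
 then show "(LINT t|arc. pois u (of_real r * cis t)) = (LINT t|arc. u t)" unfolding p by (simp flip: fub)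
qed

lemma arc_measurable_AE:
 fixes f g :: "real => complex"
 assumes f: "arc_meas f" and "AE t in arc. f t = g t" shows "arc_meas g"
proof -
 have "(%t. if t : {0..2*pi} then f t else 0) : borel_measurable lebesgue" by (rule borel_measurable_if_I[OF f]) simp
 moreover have "AE t in lebesgue. t : {0..2*pi} --> f t = g t"
  using assms(2) by (subst (asm) AE_restrict_space_iff) auto
 then have "AE t in lebesgue. (if t : {0..2*pi} then f t else 0) = (if t : {0..2*pi} then g t else 0)"
  by eventually_elim auto
 ultimately have "(%t. if t : {0..2*pi} then g t else 0) : borel_measurable lebesgue" by (rule borel_measurable_AE)
 then show ?thesis by (rule borel_measurable_if_D)
qed

text \<open>Almost everywhere the boundary value is the limit along one fixed sequence of radii, and
  the functions on these circles are continuous.\<close>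

lemma borel_measurable_nt_limit:
 fixes f :: "complex => complex"
 assumes f: "disc_hol f" and nt: "AE t in arc. has_nt_limit f (cis t) (bdry f t)" shows "arc_meas (%t. bdry f t)"
proof -
 define r where "r k = 1 - 1 / (real k + 2)" for k :: nat
 have r: "0 < r k" "r k < 1" for k by (auto simp: r_def field_simps)
 have rl: "filterlim r (at_left 1) sequentially" unfolding r_def by real_asymp
 have gm: "arc_meas (%t. f (of_real (r k) * cis t))" for k by (intro arc_measurable_continuous continuous_dilate f r)
 have lm: "arc_meas (%t. lim (%k. f (of_real (r k) * cis t)))" by (rule borel_measurable_lim_metric[OF gm])
 have ae: "AE t in arc. lim (%k. f (of_real (r k) * cis t)) = bdry f t" using nt
 proof eventually_elim
  case (elim t)
  have "(%k. f (of_real (r k) * cis t)) ----> bdry f t"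
  using filterlim_compose[OF has_nt_limit_radial[OF elim] rl] by simp
  then show ?case by (rule limI)
 qed
 show ?thesis by (rule arc_measurable_AE[OF lm ae])
qed

lemma pois_tendsto_L1:
 assumes a: "cmod a < 1" and u: "!!k::nat. integrable arc (u k)" "integrable arc w"
  and L: "(%k. LINT t|arc. \<bar>u k t - w t\<bar>) ----> 0" shows "(%k. pois (u k) a) ----> pois w a"
proof -
 have bd: "\<bar>pois (u k) a - pois w a\<bar> <= 2 / (1 - cmod a) / (2 * pi) * (LINT t|arc. \<bar>u k t - w t\<bar>)" for k
 proof -
  have i: "integrable arc (%t. u k t - w t)" using u by auto
  have "pois (u k) a - pois w a = pois (%t. u k t - w t) a" using pois_diff[OF a u(1) u(2)] by simp
  then have "\<bar>pois (u k) a - pois w a\<bar> = \<bar>LINT t|arc. PK a t * (u k t - w t)\<bar> / (2 * pi)"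
  by (simp add: pois_def abs_divide)
  also have "... <= (LINT t|arc. \<bar>PK a t * (u k t - w t)\<bar>) / (2 * pi)"
  by (intro divide_right_mono integral_abs_bound) auto
  also have "... <= (LINT t|arc. 2 / (1 - cmod a) * \<bar>u k t - w t\<bar>) / (2 * pi)"
  proof (intro divide_right_mono integral_mono integrable_abs integrable_PK[OF a i])
  show "\<bar>PK a t * (u k t - w t)\<bar> <= 2 / (1 - cmod a) * \<bar>u k t - w t\<bar>" for t
  using mult_right_mono[OF PK_le[OF a, of t] abs_ge_zero[of "u k t - w t"]] PK_pos[OF a, of t] by (simp add: abs_mult)
  qed (use i in auto)
  finally show ?thesis by simp
 qed
 have "(%k. 2 / (1 - cmod a) / (2 * pi) * (LINT t|arc. \<bar>u k t - w t\<bar>)) ----> 0"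
  using tendsto_mult_left[OF L, of "2 / (1 - cmod a) / (2 * pi)"] by (simp only: mult_zero_right)
 then have "(%k. pois (u k) a - pois w a) ----> 0"
  by (rule Lim_null_comparison[OF always_eventually, rotated]) (use bd in simp)
 then show ?thesis by (simp add: LIM_zero_iff)
qed

lemma bounded_quasi_bounded:
 assumes "disc_hol f" "!!w. cmod w < 1 ==> cmod (f w) <= B" shows "quasi_bounded f"
proof (rule quasi_boundedI[OF assms(1), of "%_. ln (max 1 B)"])
 fix a :: complex assume a: "cmod a < 1"
 have "B <= exp (ln (max 1 B))" by (auto simp: max_def)
 then show "cmod (f a) <= exp (pois (%_. ln (max 1 B)) a)" using assms(2)[OF a] by (simp add: pois_const[OF a])
qed auto

text \<open>By the maximum principle \<open>log_plus (cmod (f a))\<close> lies below the Poisson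
  integral of its own boundary values \<open>w\<close>, so the means never exceed the integral of
  \<open>w\<close>. Together with pointwise convergence this forces the means to converge, by
  Scheffe's lemma.\<close>

lemma quasi_bounded_smirnov:
 assumes qb: "quasi_bounded f" shows "f : smirnov"
proof -
 obtain u where f: "disc_hol f" and u: "integrable arc u" "!!t. 0 <= u t"
  "!!a. cmod a < 1 ==> cmod (f a) <= exp (pois u a)" using qb by (auto simp: quasi_bounded_def)
 note nt = quasi_bounded_nt_limit[OF qb]
 define w where "w t = log_plus (cmod (bdry f t))" for t
 have wm: "arc_meas w" unfolding w_def using borel_measurable_nt_limit[OF f nt] by measurable
 have w0: "0 <= w t" for t by (simp add: w_def log_plus_nonneg)
 have "AE t in arc. w t <= u t" using nt pois_nt_limit[OF u(1)]
 proof eventually_elim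
  case (elim t)
  have "cmod (bdry f t) <= exp (u t)"
  proof (rule tendsto_le)
  show "((%r. cmod (f (of_real r * cis t))) \<longlongrightarrow> cmod (bdry f t)) (at_left 1)"
  by (intro tendsto_norm has_nt_limit_radial[OF elim(1)]) simp
  show "((%r. exp (pois u (of_real r * cis t))) \<longlongrightarrow> exp (u t)) (at_left 1)"
  by (intro tendsto_exp has_nt_limit_radial[OF elim(2)]) simp
  show "\<forall>\<^sub>F r in at_left 1. cmod (f (of_real r * cis t)) <= exp (pois u (of_real r * cis t))"
  by (rule eventually_at_leftI[of 0]) (auto intro!: u simp: norm_mult)
  qed simp
  then show ?case unfolding w_def by (subst log_plus_le_iff) (auto simp: u)
 qed
 then have wi: "integrable arc w"
  using w0 u(2) by (intro Bochner_Integration.integrable_bound[OF u(1) wm]) (auto elim!: eventually_mono)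
 have "AE t in arc. cmod (bdry f t) <= exp (w t)" unfolding w_def by (simp add: le_exp_log_plus)
 note mp = quasi_bounded_max_principle[OF qb wi this]
 have lp: "log_plus (cmod (f a)) <= pois w a" if "cmod a < 1" for a
  using mp[OF that] pois_nonneg[OF that, of w] w0 by (subst log_plus_le_iff) auto
 have ci: "integrable arc (%t. log_plus (cmod (f (of_real r * cis t))))" if "0 < r" "r < 1" for r
  by (intro integrable_continuous_arc continuous_log_plus_dilate f that)
 have le: "(LINT t|arc. log_plus (cmod (f (of_real r * cis t)))) <= (LINT t|arc. w t)" if r: "0 < r" "r < 1" for r
 proof -
  have "(LINT t|arc. log_plus (cmod (f (of_real r * cis t)))) <= (LINT t|arc. pois w (of_real r * cis t))"
  using r by (intro integral_mono ci integral_pois_circle wi lp) (auto simp: norm_mult)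
  also have "... = (LINT t|arc. w t)" using r by (intro integral_pois_circle wi) auto
  finally show ?thesis .
 qed
 have nev: "f : nevanlinna" unfolding nevanlinna_def using f le by (auto intro!: bdd_aboveI2)
 have "((%r. LINT t|arc. log_plus (cmod (f (of_real r * cis t)))) \<longlongrightarrow> (LINT t|arc. w t)) (at_left 1)"
 proof (rule tendsto_at_left_sequentially[of 0])
  fix S :: "nat => real" assume S: "!!n. S n < 1" "!!n. 0 < S n" "incseq S" "S ----> 1"
  have Sl: "filterlim S (at_left 1) sequentially"
  using S by (auto simp: filterlim_at intro!: always_eventually less_imp_neq)
  define F where "F n t = log_plus (cmod (f (of_real (S n) * cis t)))" for n t
  have Fi: "integrable arc (F n)" for n unfolding F_def using S by (intro ci) auto
  have F0: "0 <= F n t" for n t by (simp add: F_def log_plus_nonneg)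
  have "(%n. \<integral>\<^sup>+t. norm (F n t - w t) \<partial>arc) ----> 0"
  proof (rule Scheffe_lemma2)
  show "AE t in arc. (%n. F n t) ----> w t" using nt
  proof eventually_elim
  case (elim t)
  have "(%n. f (of_real (S n) * cis t)) ----> bdry f t"
  using filterlim_compose[OF has_nt_limit_radial[OF elim] Sl] by simp
  moreover have "isCont (%z. log_plus (cmod z)) (bdry f t)"
  using continuous_log_plus_cmod by (simp add: continuous_on_eq_continuous_at)
  ultimately show ?case unfolding F_def w_def using isCont_tendsto_compose by fast
  qed
  show "(\<integral>\<^sup>+t. norm (F n t) \<partial>arc) <= (\<integral>\<^sup>+t. norm (w t) \<partial>arc)" for n
  using le[of "S n"] S Fi wi F0 w0 by (simp add: nn_integral_eq_integral F_def[symmetric] ennreal_leI)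
  qed (use Fi wi in auto)
  then show "(%n. LINT t|arc. log_plus (cmod (f (of_real (S n) * cis t)))) ----> (LINT t|arc. w t)"
  unfolding F_def[symmetric] by (rule tendsto_L1_int[OF Fi wi])
 qed simp
 then show ?thesis using nev by (simp add: smirnov_def w_def)
qed

text \<open>Dividing the dilates by outer functions with the modulus of their positive logarithmic parts
  gives bounded families, whose limits represent \<open>f\<close> as a quotient of bounded functions.\<close>

lemma dilate_majorant:
 assumes f: "disc_hol f" and r: "0 < r" "r < 1" and a: "cmod a < 1"
 shows "cmod (f (of_real r * a)) <= exp (pois (%t. log_plus (cmod (f (of_real r * cis t)))) a)"
proof -
 have h: "(%w. f (of_real r * w)) holomorphic_on ball 0 (1 / r)" by (rule holomorphic_dilate[OF f r])
 have r1: "1 < 1 / r" using r by simp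
 have h1: "disc_hol (%w. f (of_real r * w))" by (rule holomorphic_on_subset[OF h]) (use r1 in auto)
 have cont: "continuous_on (cball 0 1) (%w. f (of_real r * w))"
  using r1 by (intro holomorphic_on_imp_continuous_on holomorphic_on_subset[OF h]) auto
 then have "compact ((%w. f (of_real r * w)) ` cball 0 1)" by (intro compact_continuous_image) auto
 then obtain B where B: "!!w. w : cball 0 1 ==> cmod (f (of_real r * w)) <= B"
  using compact_imp_bounded bounded_iff by (metis imageI)
 have nt: "has_nt_limit (%w. f (of_real r * w)) (cis t) (f (of_real r * cis t))" for t
 proof (rule has_nt_limit_isCont)
  have "continuous_on (ball 0 (1/r)) (%w. f (of_real r * w))" by (rule holomorphic_on_imp_continuous_on[OF h])
  then show "isCont (%w. f (of_real r * w)) (cis t)"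
  by (rule continuous_on_interior) (use r1 in "auto simp: interior_open")
 qed
 show ?thesis
 proof (rule quasi_bounded_max_principle[OF _ _ _ a])
  show "quasi_bounded (%w. f (of_real r * w))" by (rule bounded_quasi_bounded[OF h1, of B]) (use B in auto)
  show "integrable arc (%t. log_plus (cmod (f (of_real r * cis t))))"
  by (intro integrable_continuous_arc continuous_log_plus_dilate f r)
  show "AE t in arc. cmod (bdry (%w. f (of_real r * w)) t) <= exp (log_plus (cmod (f (of_real r * cis t))))"
  using nt_limit_eqI[OF nt] by (simp add: le_exp_log_plus)
 qed
qed

text \<open>\<open>F\<close>, a Montel limit of the outer functions of the dilates, satisfies
  \<open>|F| <= 1\<close> and \<open>|f * F| <= 1\<close>, so \<open>f\<close> has a limit wherever
  the boundary value of \<open>F\<close> exists and is not 0. That the zero set of this boundary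
  value is null is the purpose of the truncated logarithms.\<close>

lemma nevanlinna_nt_limit:
 assumes nev: "f : nevanlinna" shows "AE t in arc. has_nt_limit f (cis t) (bdry f t)"
proof -
 have f: "disc_hol f" using nev by (simp add: nevanlinna_def)
 obtain M where M: "ALL r:{0<..<1}. (LINT t|arc. log_plus (cmod (f (of_real r * cis t)))) <= M"
  using nev by (auto simp: nevanlinna_def bdd_above_def)
 define r where "r k = 1 - 1 / (real k + 2)" for k :: nat
 have r: "0 < r k" "r k < 1" for k by (auto simp: r_def field_simps)
 have r1: "r ----> 1" unfolding r_def by real_asymp
 have rl: "filterlim r (at_left 1) sequentially" unfolding r_def by real_asymp
 define u where "u k t = log_plus (cmod (f (of_real (r k) * cis t)))" for k t
 have ui: "integrable arc (u k)" for k
  unfolding u_def by (intro integrable_continuous_arc continuous_log_plus_dilate f r)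
 have u0: "0 <= u k t" for k t by (simp add: u_def log_plus_nonneg)
 have uM: "(LINT t|arc. u k t) <= M" for k using M r[of k] unfolding u_def by auto
 have O1: "cmod (outer (u k) a) <= 1" if "cmod a < 1" for k a
  using cmod_outer[OF that ui] pois_nonneg[OF that, of "u k"] u0 by simp
 define S where "S = {h. disc_hol h & (ALL a:ball 0 1. cmod (h a) <= 1)}"
 have bS: "EX B. ALL h:S. ALL z:K. cmod (h z) <= B" if "K \<subseteq> ball 0 1" for K
  using that by (auto simp: S_def intro!: exI[of _ 1])
 have rS: "range (%k. outer (u k)) \<subseteq> S" using O1 ui by (auto simp: S_def intro: outer_holomorphic)
 obtain F q where F: "disc_hol F" and q: "strict_mono (q :: nat => nat)"
  and lim: "!!x. x : ball 0 1 ==> (%n. outer (u (q n)) x) ----> F x"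
 proof (rule Montel[of "ball 0 1" S "%k. outer (u k)"])
  show "disc_hol h" if "h : S" for h using that by (simp add: S_def)
 qed (use bS rS in auto)
 have F1: "cmod (F a) <= 1" if a: "cmod a < 1" for a
  by (rule tendsto_upperbound[OF tendsto_norm[OF lim]]) (use a O1 in auto)
 \<comment> \<open>The bounded means of \<open>log_plus (cmod (f w))\<close> keep the outer
   functions away from 0 at each point, uniformly in \<open>k\<close>.\<close>
 have Fnz: "F a ~= 0" if a: "cmod a < 1" for a
 proof -
  define C where "C = 2 / (1 - cmod a) * M / (2 * pi)"
  have "pois (u k) a <= C" for k
  proof -
  have "(LINT t|arc. PK a t * u k t) <= (LINT t|arc. 2 / (1 - cmod a) * u k t)"
  using ui u0 PK_le[OF a] by (intro integral_mono integrable_PK a mult_right_mono) auto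
  also have "... <= 2 / (1 - cmod a) * M" using uM[of k] a by (simp add: divide_right_mono)
  finally show ?thesis unfolding pois_def C_def by (intro divide_right_mono) auto
  qed
  then have "exp (- C) <= cmod (outer (u k) a)" for k by (simp add: cmod_outer[OF a ui])
  then have "exp (- C) <= cmod (F a)" by (intro tendsto_lowerbound[OF tendsto_norm[OF lim[of a]]]) (use a in auto)
  then show ?thesis by auto
 qed
 have fF1: "cmod (f a * F a) <= 1" if a: "cmod a < 1" for a
 proof -
  have fl: "(%n. f (of_real (r (q n)) * a)) ----> f a"
  by (rule dilate_tendsto[OF f LIMSEQ_subseq_LIMSEQ[OF r1 q, unfolded o_def] a])
  have "cmod (f (of_real (r k) * a) * outer (u k) a) <= 1" for k
  proof -
  have "cmod (f (of_real (r k) * a)) <= exp (pois (u k) a)" unfolding u_def by (rule dilate_majorant[OF f r a])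
  then have "cmod (f (of_real (r k) * a)) * exp (- pois (u k) a) <= exp (pois (u k) a) * exp (- pois (u k) a)"
  by (rule mult_right_mono) simp
  then show ?thesis by (simp add: norm_mult cmod_outer[OF a ui] flip: exp_add)
  qed
  then show ?thesis by (intro tendsto_upperbound[OF tendsto_norm[OF tendsto_mult[OF fl lim[of a]]]]) (use a in auto)
 qed
 \<comment> \<open>For \<open>x <= 1\<close> this is \<open>- ln x\<close> truncated to values
   between 0 and \<open>K\<close>; it is continuous also at \<open>x = 0\<close>, so that dominated
   convergence applies.\<close>
 define L where "L K x = min (- ln (max x (exp (- K)))) K" for K x :: real
 have Lcont: "continuous_on UNIV (%z::complex. L K (cmod z))" for K
  unfolding L_def by (intro continuous_intros) (auto simp: max_def not_le)
 have L0: "0 <= L K x" "L K x <= K" if "0 <= K" "x <= 1" for K x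
 proof -
  have "max x (exp (- K)) <= 1" using that by simp
  moreover have "0 < max x (exp (- K))" by (simp add: less_max_iff_disj)
  ultimately show "0 <= L K x" using that by (simp add: L_def ln_le_zero_iff)
 qed (simp add: L_def)
 have Lexp: "L K (exp (- p)) <= p" if "0 <= p" for K p
 proof -
  have "- p <= ln (max (exp (- p)) (exp (- K)))" by (subst ln_ge_iff) (auto simp: less_max_iff_disj)
  then show ?thesis by (simp add: L_def min_def)
 qed
 define Fs where "Fs t = bdry F t" for t
 have ntF: "AE t in arc. has_nt_limit F (cis t) (Fs t)" unfolding Fs_def by (rule bounded_nt_limit[OF F F1])
 have Fsm: "arc_meas Fs" unfolding Fs_def by (rule borel_measurable_nt_limit[OF F ntF[unfolded Fs_def]])
 have LFm: "arc_meas (%t. L K (cmod (Fs t)))" for K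
  using measurable_compose[OF Fsm borel_measurable_continuous_onI[OF Lcont]] .
 obtain G where G: "disc_hol G" "!!w. w : ball 0 1 ==> exp (G w) = F w"
  by (rule holomorphic_logarithm_exists[of "ball 0 1" F 0]) (use F Fnz in auto)
 \<comment> \<open>\<open>G\<close> is a logarithm of \<open>F\<close>, so by the mean value
   property the integral of \<open>- ln |F|\<close> over every circle is this number: a bound
   independent of the radius and of \<open>K\<close>.\<close>
 define N where "N = - (2 * pi * Re (G 0))"
 have LM: "(LINT t|arc. L K (cmod (Fs t))) <= N" if K: "0 <= K" for K
 proof -
  have inner: "(LINT t|arc. L K (cmod (F (of_real rho * cis t)))) <= N" if rho: "0 < rho" "rho < 1" for rho
  proof -
  have c: "cmod (of_real rho * cis t) < 1" for t using rho by (simp add: norm_mult)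
  have FG: "cmod (F (of_real rho * cis t)) = exp (Re (G (of_real rho * cis t)))" for t
  using G(2)[of "of_real rho * cis t"] c by (simp flip: norm_exp_eq_Re)
  have iG: "integrable arc (%t. G (of_real rho * cis t))" by (intro integrable_continuous_arc continuous_dilate G rho)
  have "(LINT t|arc. L K (cmod (F (of_real rho * cis t)))) <= (LINT t|arc. - Re (G (of_real rho * cis t)))"
  proof (rule integral_mono)
  show "integrable arc (%t. L K (cmod (F (of_real rho * cis t))))"
  by (rule integrable_continuous_arc[OF continuous_on_compose2[OF Lcont continuous_dilate[OF F rho]]]) simp
  show "L K (cmod (F (of_real rho * cis t))) <= - Re (G (of_real rho * cis t))" for t
  using Lexp[of "- Re (G (of_real rho * cis t))" K] F1[OF c, of t] by (simp add: FG)
  qed (use iG in auto)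
  also have "... = - Re (LINT t|arc. G (of_real rho * cis t))" using iG by simp
  also have "(LINT t|arc. G (of_real rho * cis t)) = 2 * pi * G 0"
  using poisson_formula[OF holomorphic_dilate[OF G(1) rho], of 0] rho by (simp add: PK_def)
  finally show ?thesis by (simp add: N_def)
  qed
  have "(%k. LINT t|arc. L K (cmod (F (of_real (r k) * cis t)))) ----> (LINT t|arc. L K (cmod (Fs t)))"
  proof (rule integral_dominated_convergence[where w="%_. K"])
  show "AE t in arc. (%k. L K (cmod (F (of_real (r k) * cis t)))) ----> L K (cmod (Fs t))" using ntF
  proof eventually_elim
  case (elim t)
  have "isCont (%z. L K (cmod z)) (Fs t)" using Lcont by (simp add: continuous_on_eq_continuous_at)
  moreover have "(%k. F (of_real (r k) * cis t)) ----> Fs t"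
  using filterlim_compose[OF has_nt_limit_radial[OF elim] rl] by simp
  ultimately show ?case by (rule isCont_tendsto_compose)
  qed
  show "AE t in arc. norm (L K (cmod (F (of_real (r k) * cis t)))) <= K" for k
  using L0[OF K F1] r[of k] by (intro AE_I2) (simp add: norm_mult)
  show "arc_meas (%t. L K (cmod (F (of_real (r k) * cis t))))" for k
  using continuous_on_compose2[OF Lcont continuous_dilate[OF F r]] by (intro arc_measurable_continuous) simp
  qed (use LFm in auto)
  then show ?thesis by (rule tendsto_upperbound) (use inner r in auto)
 qed
 define Z where "Z = {t : space arc. Fs t = 0}"
 have Zm: "Z : sets arc" unfolding Z_def using Fsm by measurable
 \<comment> \<open>On the zero set the truncated logarithm equals \<open>K\<close>; letting
   \<open>K\<close> grow shows that the set is null.\<close>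
 have KZ: "K * measure arc Z <= N" if K: "0 <= K" for K
 proof -
  have Fs1: "AE t in arc. cmod (Fs t) <= 1" using ntF
  proof eventually_elim
  case (elim t)
  show ?case
  proof (rule tendsto_upperbound[OF tendsto_norm[OF has_nt_limit_radial[OF elim]]])
  show "\<forall>\<^sub>F r in at_left 1. cmod (F (of_real r * cis t)) <= 1"
  by (rule eventually_at_leftI[of 0]) (auto intro!: F1 simp: norm_mult)
  qed auto
  qed
  have "K * measure arc Z = (LINT t|arc. K * indicator Z t)"
  using Zm sets.sets_into_space[OF Zm] by (simp add: Int_absorb2)
  also have "... <= (LINT t|arc. L K (cmod (Fs t)))"
  proof (rule integral_mono_AE)
  show "integrable arc (%t. K * indicator Z t)" using Zm by (simp add: arc.emeasure_finite less_top[symmetric])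
  have "AE t in arc. norm (L K (cmod (Fs t))) <= K" using Fs1 by eventually_elim (use L0[OF K] in auto)
  then show "integrable arc (%t. L K (cmod (Fs t)))" by (rule arc.integrable_const_bound[OF _ LFm])
  show "AE t in arc. K * indicator Z t <= L K (cmod (Fs t))" using Fs1
  proof eventually_elim
  case (elim t)
  then show ?case using L0[OF K elim] by (cases "t : Z") (auto simp: Z_def L_def)
  qed
  qed
  also have "... <= N" by (rule LM[OF K])
  finally show ?thesis .
 qed
 have "measure arc Z = 0"
 proof (rule ccontr)
  assume "measure arc Z ~= 0"
  then have p: "0 < measure arc Z" by (simp add: zero_less_measure_iff)
  have "(\<bar>N\<bar> + 1) / measure arc Z * measure arc Z <= N" using p by (intro KZ) auto
  then show False using p by simp
 qed
 then have "Z : null_sets arc" using Zm by (auto simp: arc.emeasure_eq_measure)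
 then have "AE t in arc. t ~: Z" by (rule AE_not_in)
 then have nz: "AE t in arc. Fs t ~= 0" by (rule AE_mp) (auto intro!: AE_I2 simp: Z_def)
 have n1: "AE t in arc. has_nt_limit (%a. f a * F a) (cis t) (bdry (%a. f a * F a) t)"
  by (rule bounded_nt_limit[of _ 1]) (use fF1 f F in "auto intro!: holomorphic_intros")
 show ?thesis using n1 ntF nz
 proof eventually_elim
  case (elim t)
  have "isCont inverse (Fs t)" unfolding isCont_def using elim(3) by (intro tendsto_inverse tendsto_ident_at)
  from has_nt_limit_mult[OF elim(1) has_nt_limit_compose[OF elim(2) this]]
  have "has_nt_limit (%a. f a * F a * inverse (F a)) (cis t) (bdry (%a. f a * F a) t * inverse (Fs t))" .
  then have "has_nt_limit f (cis t) (bdry (%a. f a * F a) t * inverse (Fs t))"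
  by (subst has_nt_limit_cong[of f "%a. f a * F a * inverse (F a)"]) (auto simp: Fnz)
  then show ?case using nt_limit_eqI[of f "cis t"] by simp
 qed
qed

text \<open>The convergence of the means in the definition improves the pointwise convergence of
  \<open>u k\<close> to convergence in \<open>L^1\<close>, by Scheffe's lemma. The majorants
  \<open>pois (u k)\<close> of the dilates then converge, and their limit is a majorant of
  \<open>f\<close>.\<close>

theorem smirnov_iff_quasi_bounded: "f : smirnov \<longleftrightarrow> quasi_bounded f"
proof
 assume sm: "f : smirnov"
 then have nev: "f : nevanlinna" by (simp add: smirnov_def)
 then have f: "disc_hol f" by (simp add: nevanlinna_def)
 note nt = nevanlinna_nt_limit[OF nev]
 obtain M where M: "ALL r:{0<..<1}. (LINT t|arc. log_plus (cmod (f (of_real r * cis t)))) <= M"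
  using nev by (auto simp: nevanlinna_def bdd_above_def)
 define r where "r k = 1 - 1 / (real k + 2)" for k :: nat
 have r: "0 < r k" "r k < 1" for k by (auto simp: r_def field_simps)
 have r1: "r ----> 1" unfolding r_def by real_asymp
 have rl: "filterlim r (at_left 1) sequentially" unfolding r_def by real_asymp
 define u where "u k t = log_plus (cmod (f (of_real (r k) * cis t)))" for k t
 define w where "w t = log_plus (cmod (bdry f t))" for t
 have ui: "integrable arc (u k)" for k
  unfolding u_def by (intro integrable_continuous_arc continuous_log_plus_dilate f r)
 have u0: "0 <= u k t" and w0: "0 <= w t" for k t by (simp_all add: u_def w_def log_plus_nonneg)
 have uM: "(LINT t|arc. u k t) <= M" for k using M r[of k] unfolding u_def by auto
 have wm: "arc_meas w" unfolding w_def using borel_measurable_nt_limit[OF f nt] by measurable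
 have lim: "AE t in arc. (%k. u k t) ----> w t" using nt
 proof eventually_elim
  case (elim t)
  have "(%k. f (of_real (r k) * cis t)) ----> bdry f t"
  using filterlim_compose[OF has_nt_limit_radial[OF elim] rl] by simp
  moreover have "isCont (%z. log_plus (cmod z)) (bdry f t)"
  using continuous_log_plus_cmod by (simp add: continuous_on_eq_continuous_at)
  ultimately show ?case unfolding u_def w_def using isCont_tendsto_compose by fast
 qed
 \<comment> \<open>Fatou's lemma with the uniform bound \<open>M\<close> of the means.\<close>
 have wi: "integrable arc w"
 proof (rule integrableI_nonneg[OF wm])
  have "(\<integral>\<^sup>+t. ennreal (w t) \<partial>arc) = (\<integral>\<^sup>+t. liminf (%k. ennreal (u k t)) \<partial>arc)"
  proof (rule nn_integral_cong_AE)
  show "AE t in arc. ennreal (w t) = liminf (%k. ennreal (u k t))"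
  using lim by eventually_elim (metis lim_imp_Liminf tendsto_ennrealI trivial_limit_sequentially)
  qed
  also have "... <= liminf (%k. \<integral>\<^sup>+t. ennreal (u k t) \<partial>arc)"
  using ui by (intro nn_integral_liminf) auto
  also have "... <= ennreal M"
  using ui u0 uM by (intro Liminf_le always_eventually) (auto simp: nn_integral_eq_integral ennreal_leI)
  finally show "(\<integral>\<^sup>+t. ennreal (w t) \<partial>arc) < \<infinity>" by (simp add: order_le_less_trans)
 qed (simp add: w0)
 have "((%r. LINT t|arc. log_plus (cmod (f (of_real r * cis t)))) \<longlongrightarrow> (LINT t|arc. w t)) (at_left 1)"
  using sm by (simp add: smirnov_def w_def)
 from filterlim_compose[OF this rl]
 have conv: "(%k. LINT t|arc. u k t) ----> (LINT t|arc. w t)" by (simp add: u_def)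
 have "(%k. \<integral>\<^sup>+t. norm (u k t - w t) \<partial>arc) ----> 0"
 proof (rule Scheffe_lemma1[OF ui wi lim])
  have "(%k. ennreal (LINT t|arc. u k t)) ----> ennreal (LINT t|arc. w t)" using conv by (rule tendsto_ennrealI)
  then have "limsup (%k. ennreal (LINT t|arc. u k t)) = ennreal (LINT t|arc. w t)" by (intro lim_imp_Limsup) auto
  then show "limsup (%k. \<integral>\<^sup>+t. norm (u k t) \<partial>arc) <= (\<integral>\<^sup>+t. norm (w t) \<partial>arc)"
  using ui wi u0 w0 by (simp add: nn_integral_eq_integral)
 qed
 moreover have "(\<integral>\<^sup>+t. norm (u k t - w t) \<partial>arc) = ennreal (LINT t|arc. \<bar>u k t - w t\<bar>)" for k
  using ui wi by (subst nn_integral_eq_integral) auto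
 ultimately have "(%k. ennreal (LINT t|arc. \<bar>u k t - w t\<bar>)) ----> ennreal 0" by simp
 then have L1: "(%k. LINT t|arc. \<bar>u k t - w t\<bar>) ----> 0"
  by (subst (asm) tendsto_ennreal_iff) (auto intro!: always_eventually integral_nonneg)
 show "quasi_bounded f"
 proof (rule quasi_boundedI[OF f wi])
  fix a :: complex assume a: "cmod a < 1"
  note fl = dilate_tendsto[OF f r1 a]
  show "cmod (f a) <= exp (pois w a)"
  proof (rule tendsto_le[OF trivial_limit_sequentially _ tendsto_norm[OF fl]])
  show "(%k. exp (pois (u k) a)) ----> exp (pois w a)" by (intro tendsto_exp pois_tendsto_L1[OF a ui wi L1])
  show "\<forall>\<^sub>F k in sequentially. cmod (f (of_real (r k) * a)) <= exp (pois (u k) a)"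
  unfolding u_def by (intro always_eventually allI dilate_majorant f r a)
  qed
 qed
qed (rule quasi_bounded_smirnov)

section \<open>Algebra, maximum principle and division in the Smirnov class\<close>

lemma smirnov_holomorphic: "f : smirnov ==> disc_hol f" by (simp add: smirnov_iff_quasi_bounded quasi_bounded_def)

lemma smirnov_nt_limit: "f : smirnov ==> AE t in arc. has_nt_limit f (cis t) (bdry f t)"
 by (simp add: smirnov_iff_quasi_bounded quasi_bounded_nt_limit)

lemma smirnov_measurable: "f : smirnov ==> arc_meas (%t. bdry f t)"
 by (rule borel_measurable_nt_limit[OF smirnov_holomorphic smirnov_nt_limit])

lemma smirnovE:
 assumes "f : smirnov"
 obtains u where "integrable arc u" "!!t. 0 <= u t" "!!a. cmod a < 1 ==> cmod (f a) <= exp (pois u a)"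
 using assms by (auto simp: smirnov_iff_quasi_bounded quasi_bounded_def)

lemma smirnovI:
 assumes "disc_hol f" "integrable arc u" "!!a. cmod a < 1 ==> cmod (f a) <= exp (pois u a)" shows "f : smirnov"
 unfolding smirnov_iff_quasi_bounded by (rule quasi_boundedI[OF assms])

lemma smirnov_cong:
 assumes "f : smirnov" "!!a. cmod a < 1 ==> f a = g a" shows "g : smirnov"
proof -
 obtain u where u: "integrable arc u" "!!a. cmod a < 1 ==> cmod (f a) <= exp (pois u a)"
  using smirnovE[OF assms(1)] by metis
 have "disc_hol g" using smirnov_holomorphic[OF assms(1)] by (rule holomorphic_transform) (simp add: assms(2))
 then show ?thesis by (rule smirnovI[OF _ u(1)]) (use u(2) assms(2) in force)
qed

lemma smirnov_bounded:
 assumes "disc_hol f" "!!w. cmod w < 1 ==> cmod (f w) <= B" shows "f : smirnov"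
 unfolding smirnov_iff_quasi_bounded by (rule bounded_quasi_bounded[OF assms])

lemma smirnov_const: "(%_. c) : smirnov" by (rule smirnov_bounded[of _ "cmod c"]) auto

lemma smirnov_mult:
 assumes "f : smirnov" "g : smirnov" shows "(%w. f w * g w) : smirnov"
proof -
 obtain u where u: "integrable arc u" "!!a. cmod a < 1 ==> cmod (f a) <= exp (pois u a)"
  using smirnovE[OF assms(1)] by metis
 obtain v where v: "integrable arc v" "!!a. cmod a < 1 ==> cmod (g a) <= exp (pois v a)"
  using smirnovE[OF assms(2)] by metis
 show ?thesis
 proof (rule smirnovI)
  fix a :: complex assume a: "cmod a < 1"
  show "cmod (f a * g a) <= exp (pois (%t. u t + v t) a)"
  unfolding norm_mult pois_add[OF a u(1) v(1)] exp_add by (intro mult_mono u v a) auto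
 qed (use u v assms smirnov_holomorphic in "auto intro!: holomorphic_intros")
qed

lemma smirnov_add:
 assumes "f : smirnov" "g : smirnov" shows "(%w. f w + g w) : smirnov"
proof -
 obtain u where u: "integrable arc u" "!!t. 0 <= u t" "!!a. cmod a < 1 ==> cmod (f a) <= exp (pois u a)"
  using smirnovE[OF assms(1)] by metis
 obtain v where v: "integrable arc v" "!!t. 0 <= v t" "!!a. cmod a < 1 ==> cmod (g a) <= exp (pois v a)"
  using smirnovE[OF assms(2)] by metis
 show ?thesis
 proof (rule smirnovI)
  show "integrable arc (%t. (u t + v t) + ln 2)" using u v by auto
  fix a :: complex assume a: "cmod a < 1"
  have i: "integrable arc (%t. u t + v t)" using u v by auto
  have "cmod (f a + g a) <= exp (pois u a) + exp (pois v a)"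
  using norm_triangle_ineq[of "f a" "g a"] u(3)[OF a] v(3)[OF a] by linarith
  \<comment> \<open>Both Poisson integrals are nonnegative, so each exponential is at most that of
    the sum; the resulting factor 2 is the constant \<open>ln 2\<close> in the majorant.\<close>
  also have "... <= exp (pois u a + pois v a) + exp (pois u a + pois v a)"
  using pois_nonneg[OF a, of u] pois_nonneg[OF a, of v] u(2) v(2) by (intro add_mono) auto
  also have "... = exp (pois (%t. (u t + v t) + ln 2) a)"
  using pois_add[OF a i, of "%_. ln 2"] by (simp add: pois_add[OF a u(1) v(1)] pois_const[OF a] exp_add)
  finally show "cmod (f a + g a) <= exp (pois (%t. (u t + v t) + ln 2) a)" .
 qed (use assms smirnov_holomorphic in "auto intro!: holomorphic_intros")
qed

lemma smirnov_cmult: "f : smirnov ==> (%w. c * f w) : smirnov" by (rule smirnov_mult[OF smirnov_const])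

lemma smirnov_diff:
 assumes "f : smirnov" "g : smirnov" shows "(%w. f w - g w) : smirnov"
 using smirnov_add[OF assms(1) smirnov_cmult[OF assms(2), of "-1"]] by simp

lemma smirnov_sum: "(!!j. j : A ==> f j : smirnov) ==> (%w. SUM j:A. f j w) : smirnov"
 by (induction A rule: infinite_finite_induct) (auto intro: smirnov_add smirnov_const)

lemma smirnov_outer: "integrable arc u ==> outer u : smirnov"
 by (rule smirnovI[of _ "%t. - u t"]) (auto simp: outer_holomorphic cmod_outer pois_minus)

lemma cmod_nt_limit_outer:
 assumes "integrable arc u" shows "AE t in arc. cmod (bdry (outer u) t) = exp (- u t)"
 using smirnov_nt_limit[OF smirnov_outer[OF assms]] outer_nt_modulus[OF assms]
proof eventually_elim
 case (elim t)
 have "has_nt_limit (%w. cmod (outer u w)) (cis t) (cmod (bdry (outer u) t))"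
  using elim(1) by (rule has_nt_limit_compose) simp
 then show ?case using nt_limit_eqI[OF elim(2)] nt_limit_eqI[of "%w. cmod (outer u w)" "cis t"] by simp
qed

lemma smirnov_le_exp:
 assumes "f : smirnov" "integrable arc w" "AE t in arc. cmod (bdry f t) <= exp (w t)" "cmod a < 1"
 shows "cmod (f a) <= exp (pois w a)"
 using quasi_bounded_max_principle[OF _ assms(2-4)] assms(1) by (simp add: smirnov_iff_quasi_bounded)

lemma smirnov_le:
 assumes f: "f : smirnov" and C: "AE t in arc. cmod (bdry f t) <= C" and a: "cmod a < 1" shows "cmod (f a) <= C"
proof -
 \<comment> \<open>An almost everywhere bound on a set of positive measure holds at some point,
   hence \<open>C\<close> is nonnegative; adding \<open>e\<close> then makes
   \<open>ln (C + e)\<close> available.\<close>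
 have "EX t. cmod (bdry f t) <= C"
 proof (rule ccontr)
  assume "\<nexists>t. cmod (bdry f t) <= C"
  then have "AE t in arc. False" using C by simp
  then have "(LINT t|arc. (1::real)) = (LINT t|arc. 0)" by (intro integral_cong_AE) auto
  then show False by (simp add: measure_arc)
 qed
 then have C0: "0 <= C" using norm_ge_zero order_trans by blast
 have "cmod (f a) <= C + e" if "e > 0" for e
 proof -
  have "AE t in arc. cmod (bdry f t) <= exp (ln (C + e))" using C by eventually_elim (use C0 that in simp)
  from smirnov_le_exp[OF f _ this a] show ?thesis using C0 that by (simp add: pois_const[OF a])
 qed
 then show ?thesis by (rule field_le_epsilon)
qed

lemma cball_half_subset:
 fixes a :: complex
 assumes "cmod a < 1" shows "cball a ((1 - cmod a) / 2) \<subseteq> ball 0 1"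
proof
 fix w assume "w : cball a ((1 - cmod a) / 2)"
 then have "cmod w <= cmod a + (1 - cmod a) / 2"
  using norm_triangle_sub[of w a] by (simp add: dist_norm norm_minus_commute field_simps)
 also have "... < 1" using assms by (simp add: field_simps)
 finally show "w : ball 0 1" by simp
qed

text \<open>Near \<open>a\<close> the quotient is bounded by compactness, away from \<open>a\<close>
  the divisor is at least \<open>rho\<close> in modulus; the constant \<open>ln K\<close> in the
  majorant absorbs both cases.\<close>

lemma smirnov_div:
 assumes f: "f : smirnov" and a: "cmod a < 1" "f a = 0"
 obtains g where "g : smirnov" "!!w. cmod w < 1 ==> f w = (w - a) * g w"
proof -
 define g where "g w = (if w = a then deriv f a else (f w - f a) / (w - a))" for w
 have gh: "disc_hol g" by (rule pole_theorem_open_0[OF smirnov_holomorphic[OF f]]) (use a in "auto simp: g_def")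
 have fg: "f w = (w - a) * g w" for w using a(2) by (simp add: g_def)
 obtain u where u: "integrable arc u" "!!t. 0 <= u t" "!!w. cmod w < 1 ==> cmod (f w) <= exp (pois u w)"
  using smirnovE[OF f] by metis
 define rho where "rho = (1 - cmod a) / 2"
 have rho: "rho > 0" using a by (simp add: rho_def)
 have sub: "cball a rho \<subseteq> ball 0 1" unfolding rho_def using a(1) by (rule cball_half_subset)
 have "compact (g ` cball a rho)"
  using gh sub by (intro compact_continuous_image holomorphic_on_imp_continuous_on holomorphic_on_subset[OF gh]) auto
 then obtain B where B: "!!w. w : cball a rho ==> cmod (g w) <= B"
  using compact_imp_bounded bounded_iff by (metis imageI)
 define K where "K = max 1 (max B (1 / rho))"
 have K: "K >= 1" "B <= K" "1 / rho <= K" by (auto simp: K_def)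
 have "g : smirnov"
 proof (rule smirnovI[OF gh])
  show "integrable arc (%t. u t + ln K)" using u by auto
  fix w :: complex assume w: "cmod w < 1"
  have e: "exp (pois (%t. u t + ln K) w) = exp (pois u w) * K"
  using K u(1) by (subst pois_add[OF w]) (auto simp: pois_const[OF w] exp_add)
  have p: "1 <= exp (pois u w)" using pois_nonneg[OF w, of u] u(2) by simp
  show "cmod (g w) <= exp (pois (%t. u t + ln K) w)"
  proof (cases "w : cball a rho")
  case True
  then have "cmod (g w) <= 1 * K" using B[OF True] K by simp
  also have "... <= exp (pois u w) * K" using p K by (intro mult_right_mono) auto
  finally show ?thesis unfolding e .
  next
  case False
  then have d: "rho <= cmod (w - a)" by (simp add: dist_norm norm_minus_commute)
  have "cmod (g w) = cmod (f w) / cmod (w - a)" using False rho a(2) by (auto simp: g_def norm_divide)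
  also have "... <= exp (pois u w) / rho" using u(3)[OF w] d rho by (intro frac_le) auto
  also have "... <= exp (pois u w) * K" using K(3) mult_left_mono[of "1 / rho" K "exp (pois u w)"] by simp
  finally show ?thesis unfolding e .
  qed
 qed
 then show ?thesis using that fg by blast
qed

text \<open>Cauchy's estimate on the circle about \<open>a\<close> with half the distance to the
  boundary as radius; there the Poisson kernel is at most \<open>2 / rho\<close>, which brings in
  the mean of \<open>v\<close>. The bound \<open>B\<close> serves only to obtain the boundary
  function and does not enter the estimate.\<close>

lemma coefficient_le_integral:
 fixes f :: "complex => complex"
 assumes f: "disc_hol f" and B: "!!w. cmod w < 1 ==> cmod (f w) <= B"
  and v: "integrable arc v" "AE t in arc. cmod (bdry f t) <= v t" and a: "cmod a < 1"
 shows "cmod ((deriv ^^ j) f a / fact j) <= (2 / (1 - cmod a)) ^ (j + 1) * (LINT t|arc. v t)"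
proof -
 obtain fs where fs: "arc_meas fs" "!!t. cmod (fs t) <= B"
  "!!a. cmod a < 1 ==> (LINT t|arc. of_real (PK a t) * fs t) = 2 * pi * f a"
  "AE t in arc. has_nt_limit f (cis t) (fs t)" by (rule bounded_boundary_function[OF f, of B]) (use B in auto)
 have le: "AE t in arc. cmod (fs t) <= v t" using v(2) fs(4) by eventually_elim (simp add: nt_limit_eqI)
 have v0: "AE t in arc. 0 <= v t" using le by eventually_elim (meson norm_ge_zero order_trans)
 have I0: "0 <= (LINT t|arc. v t)" using v0 by (rule integral_nonneg_AE)
 define rho where "rho = (1 - cmod a) / 2"
 have rho: "rho > 0" using a by (simp add: rho_def)
 have bd: "cmod (f w) <= 1 / rho * (LINT t|arc. v t)" if "cmod (w - a) <= rho" for w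
 proof -
  have wr: "cmod w <= 1 - rho" using that norm_triangle_sub[of w a] by (simp add: rho_def field_simps)
  then have w: "cmod w < 1" using rho by simp
  have "2 * pi * cmod (f w) = cmod (LINT t|arc. of_real (PK w t) * fs t)" unfolding fs(3)[OF w] by (simp add: norm_mult)
  also have "... <= (LINT t|arc. cmod (of_real (PK w t) * fs t))" by (rule integral_norm_bound)
  also have "... <= (LINT t|arc. 2 / rho * v t)"
  proof (rule integral_mono_AE)
  show "integrable arc (%t. cmod (of_real (PK w t) * fs t))"
  using integrable_PK[OF w, of "%t. cmod (fs t)"] arc.integrable_const_bound[of fs B] fs(1,2) PK_pos[OF w]
  by (simp add: norm_mult less_imp_le)
  show "AE t in arc. cmod (of_real (PK w t) * fs t) <= 2 / rho * v t" using le
  proof eventually_elim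
  case (elim t)
  have "PK w t <= 2 / (1 - cmod w)" by (rule PK_le[OF w])
  also have "... <= 2 / rho" using wr rho by (intro divide_left_mono mult_pos_pos) auto
  finally have "PK w t * cmod (fs t) <= 2 / rho * v t" using elim rho by (intro mult_mono) auto
  then show ?case using PK_pos[OF w, of t] by (simp add: norm_mult)
  qed
  qed (use v in auto)
  also have "... = 2 * (1 / rho * (LINT t|arc. v t))" by simp
  also have "... <= 2 * pi * (1 / rho * (LINT t|arc. v t))"
  using pi_ge_two I0 rho mult_right_mono[of 1 pi "2 * (1 / rho * (LINT t|arc. v t))"] by (simp add: mult_ac)
  finally show ?thesis by (rule mult_left_le_imp_le) simp
 qed
 have sub: "cball a rho \<subseteq> ball 0 1" unfolding rho_def using a by (rule cball_half_subset)
 have "cmod ((deriv ^^ j) f a) <= fact j * (1 / rho * (LINT t|arc. v t)) / rho ^ j"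
 proof (rule Cauchy_inequality)
  show "f holomorphic_on ball a rho" using sub ball_subset_cball[of a rho] by (intro holomorphic_on_subset[OF f]) auto
  show "continuous_on (cball a rho) f" using sub by (intro holomorphic_on_imp_continuous_on holomorphic_on_subset[OF f])
  show "cmod (f x) <= 1 / rho * (LINT t|arc. v t)" if "cmod (a - x) = rho" for x
  using that by (intro bd) (simp add: norm_minus_commute)
 qed (rule rho)
 then have "cmod ((deriv ^^ j) f a / fact j) <= (1 / rho) ^ (j + 1) * (LINT t|arc. v t)"
  using rho by (simp add: norm_divide field_simps)
 then show ?thesis by (simp add: rho_def)
qed

subsection \<open>The Hahn--Banach theorem\<close>

lemma Inf_add_le:
 fixes A B C :: "real set"
 assumes "A ~= {}" "B ~= {}" "bdd_below C" "!!u v. u : A ==> v : B ==> EX w:C. w <= u + v"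
 shows "Inf C <= Inf A + Inf B"
proof -
 have le: "Inf C <= u + v" if "u : A" "v : B" for u v using assms(4)[OF that] cInf_lower[OF _ assms(3)] by fastforce
 have "Inf C - u <= Inf B" if "u : A" for u
  by (rule cInf_greatest[OF assms(2)]) (use le[OF that] in "simp add: algebra_simps")
 then have "Inf C - Inf B <= Inf A" by (intro cInf_greatest[OF assms(1)]) (simp add: algebra_simps)
 then show ?thesis by simp
qed

lemma Inf_scale_le:
 fixes A C :: "real set"
 assumes "A ~= {}" "bdd_below C" "0 <= r" "!!u. u : A ==> EX w:C. w <= r * u" shows "Inf C <= r * Inf A"
proof -
 have le: "Inf C <= r * u" if "u : A" for u using assms(4)[OF that] cInf_lower[OF _ assms(2)] by fastforce
 show ?thesis
 proof (cases "r = 0")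
  case True then show ?thesis using le assms(1) by auto
 next
  case False
  then have "Inf C / r <= Inf A"
  using assms(3) le by (intro cInf_greatest[OF assms(1)]) (simp add: divide_le_eq mult.commute)
  then show ?thesis using False assms(3) by (simp add: divide_le_eq mult.commute)
 qed
qed

text \<open>Homogeneity is demanded as an inequality only, a form that passes to infima; equality
  for \<open>r > 0\<close> follows by applying it to \<open>1 / r\<close>.\<close>

definition sublinear_on :: "'v::complex_vector set => ('v => real) => bool" where
 "sublinear_on V q \<longleftrightarrow> (ALL x:V. ALL y:V. q (x + y) <= q x + q y) &
  (ALL x:V. ALL r>=0. q (complex_of_real r *C x) <= r * q x)"

lemma sublinear_on_zero:
 assumes "sublinear_on V q" "complex_vector.subspace V" shows "q 0 = 0"
proof -
 have z: "0 : V" using assms(2) by (rule complex_vector.subspace_0)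
 have "q (0 + 0) <= q 0 + q 0" "q (complex_of_real 0 *C 0) <= 0 * q 0"
  using assms(1) z unfolding sublinear_on_def by blast+
 then show ?thesis by simp
qed

text \<open>A minimal sublinear functional is additive: otherwise lowering it along one direction would
  give a smaller one.\<close>

lemma minimal_sublinear:
 fixes V :: "'v::complex_vector set"
 assumes V: "complex_vector.subspace V" and p: "sublinear_on V p"
 obtains q where "sublinear_on V q" "!!x. x : V ==> q x <= p x" "!!x y. x : V ==> y : V ==> q (x + y) = q x + q y"
  "!!x r. x : V ==> q (complex_of_real r *C x) = r * q x"
proof -
 note sub = complex_vector.subspace_add[OF V] complex_vector.subspace_scale[OF V]
  complex_vector.subspace_0[OF V] complex_vector.subspace_neg[OF V]
 define S where "S = {q. sublinear_on V q & (ALL x:V. q x <= p x) & (ALL x. x ~: V --> q x = 0)}"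
 define P where "P = (%(a :: 'v => real) b. ALL x. b x <= a x)"
 \<comment> \<open>A common lower bound for the members of \<open>S\<close>, so that the infimum of
   a chain is finite.\<close>
 have lower: "- p (- x) <= q x" if q: "q : S" and x: "x : V" for q x
 proof -
  have "q (x + - x) <= q x + q (- x)" using q x sub unfolding S_def sublinear_on_def by blast
  moreover have "q 0 = 0" using q V by (intro sublinear_on_zero) (auto simp: S_def)
  moreover have "q (- x) <= p (- x)" using q x sub unfolding S_def by blast
  ultimately show ?thesis by simp
 qed
 have "EX m:S. ALL a:S. P m a --> a = m"
 proof (rule predicate_Zorn)
  show "partial_order_on S (relation_of P S)"
  by (rule partial_order_on_relation_ofI) (auto simp: P_def fun_eq_iff intro: order.trans antisym)
  fix C assume C: "C : Chains (relation_of P S)"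
  then have CS: "C \<subseteq> S" and tot: "!!a b. a : C ==> b : C ==> P a b | P b a"
  by (auto simp: Chains_def relation_of_def)
  show "EX u:S. ALL a:C. P a u"
  proof (cases "C = {}")
  case True
  have "(%x. if x : V then p x else 0) : S" using p sub unfolding S_def sublinear_on_def by simp
  then show ?thesis using True by blast
  next
  case False
  define u where "u x = (if x : V then Inf ((%q. q x) ` C) else 0)" for x
  have bdd: "bdd_below ((%q. q x) ` C)" if "x : V" for x using lower[OF _ that] CS by (auto intro!: bdd_belowI2)
  have ule: "u x <= q x" if "q : C" for q x
  proof (cases "x : V")
  case True
  then show ?thesis unfolding u_def using that by (auto intro: cInf_lower bdd)
  next
  case False
  then show ?thesis using that CS by (auto simp: u_def S_def)
  qed
  have sl: "sublinear_on V u" unfolding sublinear_on_def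
  proof (intro conjI ballI allI impI)
  fix x y assume xy: "x : V" "y : V"
  have "Inf ((%q. q (x + y)) ` C) <= Inf ((%q. q x) ` C) + Inf ((%q. q y) ` C)"
  proof (rule Inf_add_le)
  show "bdd_below ((%q. q (x + y)) ` C)" using xy sub by (intro bdd) auto
  fix a b assume "a : (%q. q x) ` C" "b : (%q. q y) ` C"
  then obtain q q' where q: "q : C" "q' : C" "a = q x" "b = q' y" by auto
  have s: "sublinear_on V q" "sublinear_on V q'" using q CS by (auto simp: S_def)
  \<comment> \<open>Of two members of the chain the smaller one lies below both, and its own
    subadditivity suffices.\<close>
  consider "P q q'" | "P q' q" using tot q by blast
  then show "EX w:(%q. q (x + y)) ` C. w <= a + b"
  proof cases
  case 1
  have "q' (x + y) <= q' x + q' y" using s xy by (auto simp: sublinear_on_def)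
  moreover have "q' x <= q x" using 1 by (simp add: P_def)
  ultimately show ?thesis using q by (intro bexI[of _ "q' (x + y)"]) auto
  next
  case 2
  have "q (x + y) <= q x + q y" using s xy by (auto simp: sublinear_on_def)
  moreover have "q y <= q' y" using 2 by (simp add: P_def)
  ultimately show ?thesis using q by (intro bexI[of _ "q (x + y)"]) auto
  qed
  qed (use False in auto)
  then show "u (x + y) <= u x + u y" using xy sub by (simp add: u_def)
  next
  fix x and r :: real assume x: "x : V" and r: "0 <= r"
  have "Inf ((%q. q (complex_of_real r *C x)) ` C) <= r * Inf ((%q. q x) ` C)"
  proof (rule Inf_scale_le)
  show "bdd_below ((%q. q (complex_of_real r *C x)) ` C)" using x sub by (intro bdd) auto
  fix a assume "a : (%q. q x) ` C"
  then obtain q where q: "q : C" "a = q x" by auto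
  have "q (complex_of_real r *C x) <= r * q x" using q CS x r by (auto simp: S_def sublinear_on_def)
  then show "EX w:(%q. q (complex_of_real r *C x)) ` C. w <= r * a" using q by auto
  qed (use False r in auto)
  then show "u (complex_of_real r *C x) <= r * u x" using x sub by (simp add: u_def)
  qed
  obtain q where q: "q : C" using False by blast
  have "u x <= p x" if "x : V" for x using ule[OF q, of x] q CS that by (force simp: S_def)
  then have "u : S" using sl by (auto simp: S_def u_def)
  then show ?thesis using ule by (auto simp: P_def)
  qed
 qed
 then obtain q where q: "q : S" and min: "!!a. a : S ==> (!!x. a x <= q x) ==> a = q" by (auto simp: P_def)
 have sq: "sublinear_on V q" and qp: "!!x. x : V ==> q x <= p x" and q0: "!!x. x ~: V ==> q x = 0"
  using q by (auto simp: S_def)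
 have qadd: "q (x + y) <= q x + q y" if "x : V" "y : V" for x y using sq that by (auto simp: sublinear_on_def)
 have qsc: "q (complex_of_real r *C x) <= r * q x" if "x : V" "0 <= r" for x r using sq that by (auto simp: sublinear_on_def)
 have super: "q x + q y <= q (x + y)" if x: "x : V" and y: "y : V" for x y
 proof -
  \<comment> \<open>The infimum \<open>a\<close> lowers \<open>q\<close> along the direction
    \<open>y\<close>. By minimality it equals \<open>q\<close>, and the member with
    \<open>t = 1\<close> then gives \<open>q x <= q (x + y) - q y\<close>.\<close>
  define A where "A x = {q (x + complex_of_real t *C y) - t * q y | t. 0 <= t}" for x
  define a where "a x = (if x : V then Inf (A x) else 0)" for x
  have mem: "q (x + complex_of_real t *C y) - t * q y : A x" if "0 <= t" for x t using that by (auto simp: A_def)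
  have ne: "A x ~= {}" for x using mem[of 0 x] by auto
  have bdd: "bdd_below (A x)" if x: "x : V" for x
  proof (rule bdd_belowI[of _ "- q (- x)"])
  fix b assume "b : A x"
  then obtain t where t: "0 <= t" "b = q (x + complex_of_real t *C y) - t * q y" by (auto simp: A_def)
  have "t * q y <= q (complex_of_real t *C y)"
  proof (cases "t = 0")
  case True then show ?thesis using sublinear_on_zero[OF sq V] by simp
  next
  case False
  have "q (complex_of_real (1 / t) *C (complex_of_real t *C y)) <= 1 / t * q (complex_of_real t *C y)"
  using t y sub by (intro qsc) auto
  moreover have "complex_of_real (1 / t) *C (complex_of_real t *C y) = y"
  using False by (simp add: scaleC_scaleC scaleC_one)
  ultimately show ?thesis using False t by (simp add: field_simps)
  qed
  also have "q (complex_of_real t *C y) = q ((x + complex_of_real t *C y) + - x)" by simp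
  also have "... <= q (x + complex_of_real t *C y) + q (- x)" using x y sub by (intro qadd) auto
  finally show "- q (- x) <= b" using t by simp
  qed
  have al: "a x <= q (x + complex_of_real t *C y) - t * q y" if "x : V" "0 <= t" for x t
  using that mem[of t x] bdd by (auto simp: a_def intro: cInf_lower)
  have aq: "a x <= q x" for x using al[of x 0] q0 by (cases "x : V") (auto simp: a_def)
  have "sublinear_on V a" unfolding sublinear_on_def
  proof (intro conjI ballI allI impI)
  fix x x' assume xx: "x : V" "x' : V"
  have "Inf (A (x + x')) <= Inf (A x) + Inf (A x')"
  proof (rule Inf_add_le[OF ne ne bdd])
  fix b b' assume "b : A x" "b' : A x'"
  then obtain t t' where t: "0 <= t" "b = q (x + complex_of_real t *C y) - t * q y"
  "0 <= t'" "b' = q (x' + complex_of_real t' *C y) - t' * q y" by (auto simp: A_def)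
  have "q ((x + x') + complex_of_real (t + t') *C y)
  = q ((x + complex_of_real t *C y) + (x' + complex_of_real t' *C y))"
  by (simp add: scaleC_add_left algebra_simps)
  also have "... <= q (x + complex_of_real t *C y) + q (x' + complex_of_real t' *C y)"
  using xx y sub by (intro qadd) auto
  finally show "EX w:A (x + x'). w <= b + b'"
  using t mem[of "t + t'" "x + x'"] by (intro bexI) (auto simp: distrib_right)
  qed (use xx sub in auto)
  then show "a (x + x') <= a x + a x'" using xx sub by (simp add: a_def)
  next
  fix x and r :: real assume xr: "x : V" "0 <= r"
  have "Inf (A (complex_of_real r *C x)) <= r * Inf (A x)"
  proof (rule Inf_scale_le[OF ne bdd])
  fix b assume "b : A x"
  then obtain t where t: "0 <= t" "b = q (x + complex_of_real t *C y) - t * q y" by (auto simp: A_def)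
  have "q (complex_of_real r *C x + complex_of_real (r * t) *C y)
  = q (complex_of_real r *C (x + complex_of_real t *C y))" by (simp add: scaleC_add_right scaleC_scaleC)
  also have "... <= r * q (x + complex_of_real t *C y)" using xr y sub by (intro qsc) auto
  finally show "EX w:A (complex_of_real r *C x). w <= r * b"
  using t xr mem[of "r * t" "complex_of_real r *C x"] by (intro bexI) (auto simp: right_diff_distrib)
  qed (use xr sub in auto)
  then show "a (complex_of_real r *C x) <= r * a x" using xr sub by (simp add: a_def)
  qed
  moreover have "a x <= p x" if "x : V" for x using aq[of x] qp[OF that] by simp
  ultimately have "a : S" by (auto simp: S_def a_def)
  then have "a = q" by (rule min) (rule aq)
  then show ?thesis using al[OF x, of 1] by (simp add: scaleC_one)
 qed
 have add: "q (x + y) = q x + q y" if "x : V" "y : V" for x y using super[OF that] qadd[OF that] by simp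
 have sc0: "q (complex_of_real r *C x) = r * q x" if x: "x : V" and r: "0 <= r" for x r
 proof (cases "r = 0")
  case True then show ?thesis using sublinear_on_zero[OF sq V] by simp
 next
  case False
  have "q (complex_of_real (1 / r) *C (complex_of_real r *C x)) <= 1 / r * q (complex_of_real r *C x)"
  using x r sub by (intro qsc) auto
  moreover have "complex_of_real (1 / r) *C (complex_of_real r *C x) = x"
  using False by (simp add: scaleC_scaleC scaleC_one)
  ultimately show ?thesis using False r qsc[OF x r] by (simp add: field_simps)
 qed
 have "q (complex_of_real r *C x) = r * q x" if x: "x : V" for x r
 proof (cases "0 <= r")
  case True then show ?thesis by (rule sc0[OF x])
 next
  case False
  have "q (complex_of_real r *C x + complex_of_real (- r) *C x) = q (complex_of_real r *C x) + q (complex_of_real (- r) *C x)"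
  using x sub by (intro add) auto
  then show ?thesis using sc0[OF x, of "- r"] False sublinear_on_zero[OF sq V] by (simp flip: scaleC_add_left)
 qed
 then show ?thesis using that sq qp add by blast
qed

text \<open>The functional \<open>q0\<close> already encodes \<open>L\<close>: a linear functional
  below it is at most \<open>Re (L g)\<close> on \<open>G\<close>, hence equal to it, by the same
  bound for \<open>- g\<close>. So an additive functional below \<open>q0\<close>, which
  \<open>minimal_sublinear\<close> provides, extends the real part of \<open>L\<close>, and
  \<open>F x = q x - i * q (i * x)\<close> is its complexification.\<close>

theorem hahn_banach:
 fixes V G :: "'v::complex_vector set" and p :: "'v => real" and L :: "'v => complex"
 assumes V: "complex_vector.subspace V" and G: "complex_vector.subspace G" and GV: "G \<subseteq> V"
  and padd: "!!x y. x : V ==> y : V ==> p (x + y) <= p x + p y"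
  and psc: "!!x a. x : V ==> p (a *C x) = cmod a * p x"
  and Ladd: "!!x y. x : G ==> y : G ==> L (x + y) = L x + L y" and Lsc: "!!x a. x : G ==> L (a *C x) = a * L x"
  and Lp: "!!x. x : G ==> cmod (L x) <= p x" obtains F where "!!x y. x : V ==> y : V ==> F (x + y) = F x + F y"
  "!!x a. x : V ==> F (a *C x) = a * F x" "!!x. x : V ==> cmod (F x) <= p x" "!!x. x : G ==> F x = L x"
proof -
 note sub = complex_vector.subspace_add[OF V] complex_vector.subspace_scale[OF V]
  complex_vector.subspace_0[OF V] complex_vector.subspace_neg[OF V] complex_vector.subspace_diff[OF V]
 note subG = complex_vector.subspace_add[OF G] complex_vector.subspace_scale[OF G]
  complex_vector.subspace_0[OF G] complex_vector.subspace_neg[OF G] complex_vector.subspace_diff[OF G]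
 have pneg: "p (- x) = p x" if "x : V" for x using psc[OF that, of "-1"] by simp
 define A where "A x = {p (x - g) + Re (L g) | g. g : G}" for x
 have mem: "p (x - g) + Re (L g) : A x" if "g : G" for x g using that by (auto simp: A_def)
 have ne: "A x ~= {}" for x using mem[OF subG(3)] by auto
 have bdd: "bdd_below (A x)" if x: "x : V" for x
 proof (rule bdd_belowI[of _ "- p x"])
  fix b assume "b : A x"
  then obtain g where g: "g : G" "b = p (x - g) + Re (L g)" by (auto simp: A_def)
  have "- Re (L g) <= p g" using Lp[OF g(1)] abs_Re_le_cmod[of "L g"] by linarith
  also have "p g = p (- (x - g) + x)" by simp
  also have "... <= p (- (x - g)) + p x" using x g GV sub by (intro padd) auto
  also have "p (- (x - g)) = p (x - g)" using x g GV sub by (intro pneg) auto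
  finally show "- p x <= b" using g by simp
 qed
 define q0 where "q0 x = Inf (A x)" for x
 have q0le: "q0 x <= p (x - g) + Re (L g)" if "x : V" "g : G" for x g
  unfolding q0_def using mem[OF that(2)] bdd[OF that(1)] by (rule cInf_lower)
 have L0: "L 0 = 0" using Lsc[OF subG(3), of 0] by simp
 have p0: "p 0 = 0" using psc[OF sub(3), of 0] by simp
 have "sublinear_on V q0" unfolding sublinear_on_def
 proof (intro conjI ballI allI impI)
  fix x y assume xy: "x : V" "y : V"
  show "q0 (x + y) <= q0 x + q0 y" unfolding q0_def
  proof (rule Inf_add_le[OF ne ne bdd])
  fix u v assume "u : A x" "v : A y"
  then obtain g h where g: "g : G" "u = p (x - g) + Re (L g)" "h : G" "v = p (y - h) + Re (L h)" by (auto simp: A_def)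
  have "p (x + y - (g + h)) <= p (x - g) + p (y - h)"
  proof -
  have eq: "x + y - (g + h) = (x - g) + (y - h)" by (simp add: algebra_simps)
  show ?thesis unfolding eq by (rule padd[OF sub(5)[OF xy(1) subsetD[OF GV g(1)]] sub(5)[OF xy(2) subsetD[OF GV g(3)]]])
  qed
  then show "EX w:A (x + y). w <= u + v"
  using g mem[of "g + h" "x + y"] subG Ladd[of g h] by (intro bexI[of _ "p (x + y - (g + h)) + Re (L (g + h))"]) auto
  qed (use xy sub in auto)
 next
  fix x and r :: real assume x: "x : V" and r: "0 <= r"
  show "q0 (complex_of_real r *C x) <= r * q0 x" unfolding q0_def
  proof (rule Inf_scale_le[OF ne bdd])
  fix u assume "u : A x"
  then obtain g where g: "g : G" "u = p (x - g) + Re (L g)" by (auto simp: A_def)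
  have "p (complex_of_real r *C x - complex_of_real r *C g) = r * p (x - g)"
  using psc[of "x - g" "complex_of_real r"] x g GV sub r by (auto simp: complex_vector.scale_right_diff_distrib)
  then show "EX w:A (complex_of_real r *C x). w <= r * u"
  using g mem[of "complex_of_real r *C g" "complex_of_real r *C x"] subG Lsc[of g]
  by (intro bexI[of _ "p (complex_of_real r *C x - complex_of_real r *C g) + Re (L (complex_of_real r *C g))"])
  (auto simp: distrib_left)
  qed (use x r sub in auto)
 qed
 then obtain q where q: "!!x. x : V ==> q x <= q0 x" "!!x y. x : V ==> y : V ==> q (x + y) = q x + q y"
  "!!x r. x : V ==> q (complex_of_real r *C x) = r * q x" using minimal_sublinear[OF V] by metis
 have qp: "q x <= p x" if x: "x : V" for x using q(1)[OF x] q0le[OF x subG(3)] L0 by simp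
 have qle: "q g <= Re (L g)" if g: "g : G" for g using q(1)[of g] q0le[of g g] g GV p0 by auto
 have qneg: "q (- x) = - q x" if "x : V" for x using q(3)[OF that, of "-1"] by simp
 have qG: "q g = Re (L g)" if g: "g : G" for g
 proof -
  have "q (- g) <= Re (L (- g))" using g subG by (intro qle) auto
  moreover have "L (- g) = - L g" using Lsc[OF g, of "-1"] by simp
  ultimately show ?thesis using qle[OF g] qneg[of g] g GV by auto
 qed
 define F where "F x = Complex (q x) (- q (\<i> *C x))" for x
 have Fadd: "F (x + y) = F x + F y" if "x : V" "y : V" for x y
  using that sub by (simp add: F_def scaleC_add_right q(2) complex_eq_iff)
 have Fsc: "F (a *C x) = a * F x" if x: "x : V" for x a
 proof -
  have dec: "q (b *C x) = Re b * q x + Im b * q (\<i> *C x)" for b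
  proof -
  have eq: "b *C x = complex_of_real (Re b) *C x + complex_of_real (Im b) *C (\<i> *C x)"
  by (metis complex_eq mult.commute scaleC_add_left scaleC_scaleC)
  have "q (b *C x) = q (complex_of_real (Re b) *C x) + q (complex_of_real (Im b) *C (\<i> *C x))"
  by (subst eq, rule q(2)) (use x sub in auto)
  then show ?thesis using q(3)[OF x] q(3)[OF sub(2)[OF x]] by (simp only:)
  qed
  have "F (a *C x) = Complex (q (a *C x)) (- q ((\<i> * a) *C x))" by (simp add: F_def scaleC_scaleC)
  then show ?thesis unfolding dec[of a] dec[of "\<i> * a"] by (simp add: F_def complex_eq_iff algebra_simps)
 qed
 have Fp: "cmod (F x) <= p x" if x: "x : V" for x
 proof (cases "F x = 0")
  case True
  have "p (x + - x) <= p x + p (- x)" using x sub by (intro padd) auto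
  then show ?thesis using True pneg[OF x] p0 by simp
 next
  case False
  define theta where "theta = of_real (cmod (F x)) / F x"
  have theta: "cmod theta = 1" using False by (simp add: theta_def norm_divide)
  have "F (theta *C x) = of_real (cmod (F x))" using Fsc[OF x] False by (simp add: theta_def)
  then have "cmod (F x) = Re (F (theta *C x))" by simp
  also have "... = q (theta *C x)" by (simp add: F_def)
  also have "... <= p (theta *C x)" using x sub by (intro qp) auto
  also have "... = p x" using psc[OF x] theta by simp
  finally show ?thesis .
 qed
 have FG: "F g = L g" if g: "g : G" for g
  using qG[OF g] qG[of "\<i> *C g"] Lsc[OF g, of \<i>] g subG by (simp add: F_def complex_eq_iff)
 show ?thesis using that Fadd Fsc Fp FG by blast
qed

subsection \<open>Functionals on complex Banach spaces and complete normed spaces\<close>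

lemma bounded_linear_scaleC_left: "bounded_linear (%c. c *C (y :: 'b::complex_banach))"
proof (rule bounded_linear_intro)
 fix r and c :: complex
 show "(r *\<^sub>R c) *C y = r *\<^sub>R (c *C y)"
  by (simp add: scaleR_conv_of_real scaleC_of_real flip: scaleC_scaleC)
 show "norm (c *C y) <= norm c * norm y" by (simp add: norm_scaleC)
qed (simp add: scaleC_add_left)

lemmas tendsto_scaleC_left = bounded_linear.tendsto[OF bounded_linear_scaleC_left]

lemma norming_functional:
 fixes v :: "'b::complex_banach"
 obtains l :: "'b => complex" where "!!x y. l (x + y) = l x + l y" "!!a x. l (a *C x) = a * l x"
  "!!x. cmod (l x) <= norm x" "l v = of_real (norm v)"
proof (cases "v = 0")
 case True
 then show ?thesis using that[of "%_. 0"] by simp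
next
 case False
 define L where "L x = (THE c. x = c *C v) * of_real (norm v)" for x
 have Lc: "L (c *C v) = c * of_real (norm v)" for c
 proof -
  have "(THE d. c *C v = d *C v) = c"
  using False by (intro the_equality) (auto simp: complex_vector.scale_cancel_right)
  then show ?thesis by (simp add: L_def)
 qed
 define G where "G = range (%c. c *C v)"
 have G: "complex_vector.subspace G" unfolding complex_vector.subspace_def G_def
 proof (intro conjI ballI allI)
  have "0 = 0 *C v" by simp
  then show "0 : range (%c. c *C v)" by blast
  fix x y assume "x : range (%c. c *C v)" "y : range (%c. c *C v)"
  then show "x + y : range (%c. c *C v)" by (auto simp flip: scaleC_add_left)
 next
  fix c x assume "x : range (%c. c *C v)"
  then show "c *C x : range (%c. c *C v)" by (auto simp: scaleC_scaleC)
 qed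
 obtain F where F: "!!x y. x : UNIV ==> y : UNIV ==> F (x + y) = F x + F y"
  "!!x a. x : UNIV ==> F (a *C x) = a * F x" "!!x. x : UNIV ==> cmod (F x) <= norm x" "!!x. x : G ==> F x = L x"
 proof (rule hahn_banach[of UNIV G norm L])
  show "L (x + y) = L x + L y" if "x : G" "y : G" for x y
  using that by (auto simp: G_def Lc distrib_right simp flip: scaleC_add_left)
  show "L (a *C x) = a * L x" if "x : G" for x a using that by (auto simp: G_def Lc scaleC_scaleC)
  show "cmod (L x) <= norm x" if "x : G" for x using that by (auto simp: G_def Lc norm_scaleC norm_mult)
 qed (use G in "auto simp: norm_triangle_ineq norm_scaleC")
 have "v : G" unfolding G_def by (rule range_eqI[of _ _ 1]) (simp add: scaleC_one)
 then have "F v = of_real (norm v)" using F(4) Lc[of 1] by (simp add: scaleC_one)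
 then show ?thesis using that F(1-3) by blast
qed

lemma banach_space_on_limit:
 assumes V: "banach_space_on V" and s: "!!n::nat. s n : points V"
  and C: "!!e. e > 0 ==> EX M. ALL l>=M. ALL m>=M. nrm V (s l - s m) < e"
 obtains y where "y : points V" "(%n. nrm V (s n - y)) ----> 0"
proof -
 have nV: "normed_space_on V" and mc: "Metric_space.mcomplete (points V) (norm_dist V)"
  using V by (auto simp: banach_space_on_def)
 interpret M: Metric_space "points V" "norm_dist V" by (rule Metric_space_norm_dist[OF nV])
 have "M.MCauchy s" unfolding M.MCauchy_def using s C by (fastforce simp: norm_dist_def)
 then obtain y where y: "limitin M.mtopology s y sequentially" using mc M.mcomplete_def by blast
 then have yV: "y : points V" by (simp add: M.limitin_metric)
 have "(%n. nrm V (s n - y)) ----> 0"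
 proof (rule LIMSEQ_I)
  fix e :: real assume "e > 0"
  then have "\<forall>\<^sub>F n in sequentially. s n : points V & norm_dist V (s n) y < e"
  using y by (simp add: M.limitin_metric)
  then obtain N where N: "!!n. n >= N ==> norm_dist V (s n) y < e" by (auto simp: eventually_sequentially)
  have "0 <= nrm V (s n - y)" for n using M.nonneg[of "s n" y] s yV by (simp add: norm_dist_def)
  then show "EX N. ALL n>=N. norm (nrm V (s n - y) - 0) < e"
  using N s yV by (intro exI[of _ N]) (auto simp: norm_dist_def)
 qed
 then show ?thesis using that yV by blast
qed

lemma arc_measurable_AE_real:
 fixes f g :: "real => real"
 assumes f: "arc_meas f" and "AE t in arc. f t = g t" shows "arc_meas g"
proof -
 have "arc_meas (%t. complex_of_real (f t))" using f by simp
 then have "arc_meas (%t. complex_of_real (g t))" by (rule arc_measurable_AE) (use assms(2) in auto)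
 then have "arc_meas (%t. Re (complex_of_real (g t)))" by measurable
 then show ?thesis by simp
qed

subsection \<open>Boundary norms of an interpolation family\<close>

context interpolation_family
begin

abbreviation "phi == conf X"
abbreviation "Omega == region X"
abbreviation "Delta == inter X"

definition "psi = inv_into (ball 0 1) phi"

lemma inj_conf: "inj_on phi (ball 0 1)" using conf_bij by (simp add: bij_betw_def)

lemma conf_image: "phi ` ball 0 1 = Omega" using conf_bij by (simp add: bij_betw_def)

lemma open_region: "open Omega"
 using open_mapping_thm3[OF conf_holomorphic open_ball inj_conf] by (simp add: conf_image)

lemma conf_in [simp]: "cmod w < 1 ==> phi w : Omega" using conf_image by auto

lemma psi_conf [simp]: "cmod w < 1 ==> psi (phi w) = w" unfolding psi_def by (rule inv_into_f_f[OF inj_conf]) simp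

lemma conf_psi [simp]: "z : Omega ==> phi (psi z) = z" unfolding psi_def by (rule f_inv_into_f) (simp add: conf_image)

lemma psi_ball [simp]: "z : Omega ==> cmod (psi z) < 1"
 unfolding psi_def using inv_into_into[of z phi "ball 0 1"] by (simp add: conf_image)

lemma psi_holomorphic: "psi holomorphic_on Omega" and deriv_psi_nonzero: "z : Omega ==> deriv psi z ~= 0"
proof -
 obtain g where g: "g holomorphic_on Omega" "!!z. z : ball 0 1 ==> deriv phi z * deriv g (phi z) = 1"
  "!!z. z : ball 0 1 ==> g (phi z) = z"
  using holomorphic_has_inverse[OF conf_holomorphic open_ball inj_conf] conf_image by metis
 have eq: "g z = psi z" if "z : Omega" for z using g(3)[of "psi z"] that by simp
 show h: "psi holomorphic_on Omega" by (rule holomorphic_transform[OF g(1)]) (simp add: eq)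
 show "deriv psi z ~= 0" if z: "z : Omega"
 proof -
  have "deriv g z = deriv psi z"
  by (rule complex_derivative_transform_within_open[OF g(1) h open_region z]) (simp add: eq)
  then show ?thesis using g(2)[of "psi z"] z by auto
 qed
qed

text \<open>If \<open>phi (cis t)\<close> were in the region, continuity of \<open>psi\<close> there
  would give \<open>cis t = psi (phi (cis t))\<close> by radial approach, a point of the open
  disc.\<close>

lemma AE_frontier: "AE t in arc. phi (cis t) : frontier Omega"
proof -
 obtain E where E: "ball 0 1 \<subseteq> E" "E \<subseteq> cball 0 1" "AE t in arc. cis t : E" "continuous_on E phi"
  "phi ` E = closure Omega" using conf_extends by blast
 show ?thesis using E(3)
 proof eventually_elim
  case (elim t)
  have "phi (cis t) ~: Omega"
  proof
  assume i: "phi (cis t) : Omega"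
  define r where "r k = of_real (1 - 1 / (real k + 2)) * cis t" for k :: nat
  have r: "cmod (r k) < 1" for k unfolding r_def norm_mult norm_of_real by (simp add: field_simps)
  have "(%k. 1 - 1 / (real k + 2)) ----> 1" by real_asymp
  then have "r ----> of_real 1 * cis t" unfolding r_def by (intro tendsto_intros)
  then have rl: "r ----> cis t" by simp
  have "(%k. phi (r k)) ----> phi (cis t)"
  by (rule continuous_on_tendsto_compose[OF E(4) rl elim]) (use r E(1) in "auto intro!: always_eventually")
  then have "(%k. psi (phi (r k))) ----> psi (phi (cis t))"
  by (rule continuous_on_tendsto_compose[OF holomorphic_on_imp_continuous_on[OF psi_holomorphic] _ i]) (simp add: r)
  then have "r ----> psi (phi (cis t))" using r by simp
  then have eq: "cis t = psi (phi (cis t))" using rl LIMSEQ_unique by blast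
  have "cmod (psi (phi (cis t))) = 1" by (simp only: eq[symmetric] norm_cis)
  then show False using psi_ball[OF i] by simp
  qed
  then show ?case using elim E(5) open_region by (auto simp: frontier_def interior_open)
 qed
qed

definition "bnorm t x = nrm (bspace X (phi (cis t))) x"

text \<open>The parameters at which the axioms on the boundary spaces are available.\<close>

definition "good t \<longleftrightarrow> phi (cis t) : frontier Omega"

lemma AE_good: "AE t in arc. good t" using AE_frontier by (simp add: good_def)

lemmas Delta_add = complex_vector.subspace_add[OF inter_subspace]
lemmas Delta_scale = complex_vector.subspace_scale[OF inter_subspace]
lemmas Delta_0 = complex_vector.subspace_0[OF inter_subspace]
lemmas Delta_diff = complex_vector.subspace_diff[OF inter_subspace]
lemmas Delta_sum = complex_vector.subspace_sum[OF inter_subspace]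

lemma Delta_comb: "(!!j. j < (n::nat) ==> x j : Delta) ==> (SUM j<n. v j *C x j) : Delta"
 by (intro Delta_sum Delta_scale) auto

lemma bnorm_props:
 assumes g: "good t" shows "x : points (bspace X (phi (cis t))) ==> 0 <= bnorm t x"
  and "x : points (bspace X (phi (cis t))) ==> bnorm t (a *C x) = cmod a * bnorm t x"
  and "x : points (bspace X (phi (cis t))) ==> y : points (bspace X (phi (cis t))) ==> bnorm t (x + y) <= bnorm t x + bnorm t y"
  and "x : Delta ==> x : points (bspace X (phi (cis t)))"
  and "complex_vector.subspace (points (bspace X (phi (cis t))))"
 using space_banach[of "phi (cis t)"] inter_subset[of "phi (cis t)"] g
 unfolding good_def bnorm_def banach_space_on_def normed_space_on_def by blast+

lemma bnorm_nonneg: "good t ==> x : Delta ==> 0 <= bnorm t x"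
 and bnorm_scale: "good t ==> x : Delta ==> bnorm t (a *C x) = cmod a * bnorm t x"
 and bnorm_add: "good t ==> x : Delta ==> y : Delta ==> bnorm t (x + y) <= bnorm t x + bnorm t y"
 using bnorm_props by blast+

lemma bnorm_zero: "good t ==> bnorm t 0 = 0" using bnorm_scale[of t 0 0] Delta_0 by simp

lemma bnorm_comb:
 fixes n :: nat
 assumes g: "good t" and x: "!!j. j < n ==> x j : Delta"
 shows "bnorm t (SUM j<n. v j *C x j) <= (SUM j<n. cmod (v j) * bnorm t (x j))" using x
proof (induction n)
 case 0 then show ?case using bnorm_zero[OF g] by simp
next
 case (Suc n)
 have "bnorm t ((SUM j<n. v j *C x j) + v n *C x n) <= bnorm t (SUM j<n. v j *C x j) + bnorm t (v n *C x n)"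
  using Suc.prems by (intro bnorm_add[OF g] Delta_comb Delta_scale) auto
 then show ?case using Suc bnorm_scale[OF g, of "x n" "v n"] by fastforce
qed

lemma bnorm_comb_diff:
 fixes n :: nat
 assumes g: "good t" and x: "!!j. j < n ==> x j : Delta"
 shows "bnorm t (SUM j<n. v j *C x j) <= bnorm t (SUM j<n. w j *C x j) + (SUM j<n. cmod (v j - w j) * bnorm t (x j))"
proof -
 have "(SUM j<n. v j *C x j) = (SUM j<n. w j *C x j) + (SUM j<n. (v j - w j) *C x j)"
  by (simp add: complex_vector.scale_left_diff_distrib flip: sum.distrib)
 also have "bnorm t ... <= bnorm t (SUM j<n. w j *C x j) + bnorm t (SUM j<n. (v j - w j) *C x j)"
  using x by (intro bnorm_add[OF g] Delta_comb)
 also have "bnorm t (SUM j<n. (v j - w j) *C x j) <= (SUM j<n. cmod (v j - w j) * bnorm t (x j))"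
  by (rule bnorm_comb[OF g x])
 finally show ?thesis by simp
qed

lemma dense_close:
 fixes n :: nat and D :: "(nat => complex) set" and k :: "nat => real"
 assumes D: "!!U. open U ==> U ~= {} ==> EX d:D. d : U" and e: "e > 0"
 shows "EX d:D. (SUM j<n. cmod (c j - d j) * k j) < e"
proof -
 define U where "U = {d. (SUM j<n. cmod (c j - d j) * k j) < e}"
 have "continuous_on UNIV (%d::nat => complex. SUM j<n. cmod (c j - d j) * k j)"
  by (intro continuous_on_sum continuous_on_mult continuous_on_norm continuous_on_diff continuous_on_const) simp_all
 then have "open U" unfolding U_def by (intro open_Collect_less[OF _ continuous_on_const])
 moreover have "c : U" using e by (simp add: U_def)
 ultimately obtain d where "d : D" "d : U" using D[of U] by blast
 then show ?thesis by (auto simp: U_def)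
qed

text \<open>A Caratheodory argument: the norm of a combination with variable coefficients is an infimum
  over a countable dense set of constant coefficients.\<close>

lemma bnorm_measurable:
 fixes n :: nat
 assumes c: "!!j. j < n ==> c j : borel_measurable arc" and x: "!!j. j < n ==> x j : Delta"
 shows "arc_meas (%t. bnorm t (SUM j<n. c j t *C x j))"
proof -
 obtain D :: "(nat => complex) set" where D: "countable D" "!!U. open U ==> U ~= {} ==> EX d:D. d : U"
  using countable_dense_setE by blast
 have bm: "arc_meas (%t. bnorm t y)" if "y : Delta" for y unfolding bnorm_def by (rule nrm_measurable[OF that])
 \<comment> \<open>By the triangle inequality \<open>K d t\<close> is at least the norm in question
   for every constant choice \<open>d\<close>, with near equality when \<open>d\<close> is close to
   the coefficients at \<open>t\<close>.\<close>
 define K where "K d t = bnorm t (SUM j<n. d j *C x j) + (SUM j<n. cmod (c j t - d j) * bnorm t (x j))" for d t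
 have Km: "K d : borel_measurable arc" for d
  unfolding K_def using c bm x Delta_comb[of n x d] by (intro borel_measurable_add borel_measurable_sum borel_measurable_times) auto
 define F where "F t = real_of_ereal (INF d\<in>D. ereal (K d t))" for t
 have "arc_meas F" unfolding F_def using D(1) Km by measurable
 moreover have "AE t in arc. F t = bnorm t (SUM j<n. c j t *C x j)" using AE_good
 proof eventually_elim
  case (elim t)
  define b where "b = bnorm t (SUM j<n. c j t *C x j)"
  have "(INF d\<in>D. ereal (K d t)) = ereal b"
  proof (rule antisym)
  show "ereal b <= (INF d\<in>D. ereal (K d t))"
  using bnorm_comb_diff[OF elim x, where v="%j. c j t"] by (auto intro!: INF_greatest simp: b_def K_def)
  show "(INF d\<in>D. ereal (K d t)) <= ereal b"
  proof (rule ereal_le_epsilon2)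
  fix e :: real assume e: "0 < e"
  \<comment> \<open>The factor 2 occurs because the triangle inequality is used once inside
    \<open>K\<close> and once in the opposite direction.\<close>
  have "EX d:D. (SUM j<n. cmod (c j t - d j) * (2 * bnorm t (x j))) < e" by (rule dense_close[OF _ e]) (rule D(2))
  then obtain d where d: "d : D" "(SUM j<n. cmod (c j t - d j) * (2 * bnorm t (x j))) < e" by blast
  have "bnorm t (SUM j<n. d j *C x j) <= b + (SUM j<n. cmod (d j - c j t) * bnorm t (x j))"
  unfolding b_def by (rule bnorm_comb_diff[OF elim x])
  then have "K d t <= b + (SUM j<n. cmod (c j t - d j) * (2 * bnorm t (x j)))"
  by (simp add: K_def norm_minus_commute sum_distrib_left[symmetric] mult.left_commute[of _ 2])
  then have "ereal (K d t) <= ereal b + ereal e" using d(2) by simp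
  then show "(INF d\<in>D. ereal (K d t)) <= ereal b + ereal e" using d(1) by (meson INF_lower2)
  qed
  qed
  then show ?case by (simp add: F_def b_def)
 qed
 ultimately show ?thesis by (rule arc_measurable_AE_real)
qed

subsection \<open>The space of simple analytic functions\<close>

definition bval :: "(complex => 'a) => real => 'a" where "bval g t = bdry (%w. g (phi w)) t"

text \<open>The coefficients live on the disc: \<open>c j\<close> stands for a coefficient on the
  region composed with \<open>phi\<close>.\<close>

definition comb_rep :: "(complex => 'a) => nat => (nat => complex => complex) => (nat => 'a) => bool" where
 "comb_rep g n c x \<longleftrightarrow> (ALL j<n. c j : smirnov & x j : Delta) &
 (ALL w. cmod w < 1 --> g (phi w) = (SUM j<n. c j w *C x j))"

text \<open>The simple analytic functions before finiteness of the boundary norm is imposed.\<close>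

definition "G0 = {g. EX (n::nat) c x. comb_rep g n c x}"

lemma comb_repD:
 assumes "comb_rep g n c x" shows "j < n ==> c j : smirnov" "j < n ==> x j : Delta"
  "cmod w < 1 ==> g (phi w) = (SUM j<n. c j w *C x j)" using assms unfolding comb_rep_def by blast+

lemma G0E:
 assumes "g : G0" obtains n c x where "comb_rep g n c x" using assms unfolding G0_def by blast

lemma G0I:
 assumes "!!j. j < (n::nat) ==> c j : smirnov" "!!j. j < n ==> x j : Delta"
  "!!w. cmod w < 1 ==> g (phi w) = (SUM j<n. c j w *C x j)" shows "g : G0"
 unfolding G0_def comb_rep_def using assms by blast

lemma has_nt_limit_comb:
 fixes n :: nat and x :: "nat => 'b::complex_banach"
 assumes "!!j. j < n ==> has_nt_limit (c j) zeta (l j)"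
 shows "has_nt_limit (%w. SUM j<n. c j w *C x j) zeta (SUM j<n. l j *C x j)"
 using assms unfolding has_nt_limit_def by (intro allI impI tendsto_sum tendsto_scaleC_left) auto

lemma AE_all_less: "(!!j. j < (n::nat) ==> AE t in M. P j t) ==> AE t in M. ALL j<n. P j t"
 by (simp add: AE_all_countable)

lemma bval_comb:
 fixes n :: nat
 assumes c: "!!j. j < n ==> c j : smirnov" and "!!w. cmod w < 1 ==> g (phi w) = (SUM j<n. c j w *C x j)"
 shows "AE t in arc. has_nt_limit (%w. g (phi w)) (cis t) (bval g t) & bval g t = (SUM j<n. bdry (c j) t *C x j)"
proof -
 have "AE t in arc. ALL j<n. has_nt_limit (c j) (cis t) (bdry (c j) t)"
  by (rule AE_all_less) (rule smirnov_nt_limit[OF c])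
 then show ?thesis
 proof eventually_elim
  case (elim t)
  have "has_nt_limit (%w. SUM j<n. c j w *C x j) (cis t) (SUM j<n. bdry (c j) t *C x j)"
  by (rule has_nt_limit_comb[where c=c and x=x and n=n and l="%j. bdry (c j) t"]) (use elim in auto)
  then have "has_nt_limit (%w. g (phi w)) (cis t) (SUM j<n. bdry (c j) t *C x j)"
  by (subst has_nt_limit_cong[OF assms(2)]) auto
  then show ?case using nt_limit_eqI[of "%w. g (phi w)" "cis t"] by (simp add: bval_def)
 qed
qed

lemma G0_bval:
 assumes "g : G0" shows "AE t in arc. has_nt_limit (%w. g (phi w)) (cis t) (bval g t) & bval g t : Delta"
proof -
 obtain n c x where r0: "comb_rep g n c x" by (rule G0E[OF assms])
 note r = comb_repD[OF r0]
 have b: "AE t in arc. has_nt_limit (%w. g (phi w)) (cis t) (bval g t) &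
  bval g t = (SUM j<n. bdry (c j) t *C x j)" by (rule bval_comb[OF r(1,3)]) show ?thesis using b
 proof eventually_elim
  case (elim t)
  then have "bval g t : Delta" by (auto intro!: Delta_comb r(2))
  then show ?case using elim by blast
 qed
qed

lemma bnorm_bval_measurable:
 assumes "g : G0" shows "arc_meas (%t. bnorm t (bval g t))"
proof -
 obtain n c x where r0: "comb_rep g n c x" by (rule G0E[OF assms])
 note r = comb_repD[OF r0]
 have "arc_meas (%t. bnorm t (SUM j<n. bdry (c j) t *C x j))"
  by (rule bnorm_measurable) (auto intro: smirnov_measurable r)
 moreover have b: "AE t in arc. has_nt_limit (%w. g (phi w)) (cis t) (bval g t) &
  bval g t = (SUM j<n. bdry (c j) t *C x j)" by (rule bval_comb[OF r(1,3)])
 then have "AE t in arc. bnorm t (SUM j<n. bdry (c j) t *C x j) = bnorm t (bval g t)" by eventually_elim simp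
 ultimately show ?thesis by (rule arc_measurable_AE_real)
qed

lemma G0_add:
 assumes "g : G0" "h : G0" shows "(%z. g z + h z) : G0"
proof -
 obtain n c x where g0: "comb_rep g n c x" by (rule G0E[OF assms(1)])
 note g = comb_repD[OF g0]
 obtain m d y where h0: "comb_rep h m d y" by (rule G0E[OF assms(2)])
 note h = comb_repD[OF h0]
 show ?thesis
 proof (rule G0I[of "n + m" "%j. if j < n then c j else d (j - n)" "%j. if j < n then x j else y (j - n)"])
  fix w :: complex assume w: "cmod w < 1"
  have "(SUM j<n + m. (if j < n then c j else d (j - n)) w *C (if j < n then x j else y (j - n)))
  = (SUM j<n. c j w *C x j) + (SUM j<m. d j w *C y j)" by (induction m) (simp_all add: add.assoc)
  then show "g (phi w) + h (phi w) = (SUM j<n + m. (if j < n then c j else d (j - n)) w *C (if j < n then x j else y (j - n)))"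
  by (simp add: g(3) h(3) w)
 qed (use g h in auto)
qed

lemma G0_mult:
 assumes "q : smirnov" "g : G0" "!!w. cmod w < 1 ==> h (phi w) = q w *C g (phi w)" shows "h : G0"
proof -
 obtain n c x where g0: "comb_rep g n c x" by (rule G0E[OF assms(2)])
 note g = comb_repD[OF g0]
 show ?thesis by (rule G0I[of n "%j w. q w * c j w" x])
  (use g assms in "auto intro: smirnov_mult simp: complex_vector.scale_sum_right scaleC_scaleC")
qed

lemma G0_scale: "g : G0 ==> (%z. a *C g z) : G0" by (rule G0_mult[OF smirnov_const]) auto

lemma bval_add:
 assumes "g : G0" "h : G0" shows "AE t in arc. bval (%z. g z + h z) t = bval g t + bval h t"
 using G0_bval[OF assms(1)] G0_bval[OF assms(2)]
proof eventually_elim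
 case (elim t)
 then show ?case unfolding bval_def[of "%z. g z + h z"] by (intro nt_limit_eqI has_nt_limit_add) auto
qed

lemma bval_mult:
 assumes "q : smirnov" "g : G0" "!!w. cmod w < 1 ==> h (phi w) = q w *C g (phi w)"
 shows "AE t in arc. bval h t = bdry q t *C bval g t"
proof -
 obtain n c x where g0: "comb_rep g n c x" by (rule G0E[OF assms(2)])
 note g = comb_repD[OF g0]
 have b1: "AE t in arc. has_nt_limit (%w. h (phi w)) (cis t) (bval h t) &
  bval h t = (SUM j<n. bdry (%w. q w * c j w) t *C x j)"
  by (rule bval_comb) (use g assms in "auto intro: smirnov_mult simp: complex_vector.scale_sum_right scaleC_scaleC")
 have b2: "AE t in arc. has_nt_limit (%w. g (phi w)) (cis t) (bval g t) &
  bval g t = (SUM j<n. bdry (c j) t *C x j)" by (rule bval_comb) (use g in auto)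
 have b3: "AE t in arc. ALL j<n. has_nt_limit (c j) (cis t) (bdry (c j) t)"
  by (rule AE_all_less) (rule smirnov_nt_limit[OF g(1)])
 show ?thesis using b1 b2 b3 smirnov_nt_limit[OF assms(1)]
 proof eventually_elim
  case (elim t)
  have "bdry (%w. q w * c j w) t = bdry q t * bdry (c j) t" if "j < n" for j
  by (rule nt_limit_eqI[OF has_nt_limit_mult]) (use elim that in auto)
  then show ?case using elim by (simp add: complex_vector.scale_sum_right scaleC_scaleC)
 qed
qed

lemma bval_scale: "g : G0 ==> AE t in arc. bval (%z. a *C g z) t = a *C bval g t"
 using bval_mult[OF smirnov_const, of g "%z. a *C g z" a] nt_limit_eqI[OF has_nt_limit_const[of a]] by simp

lemma bval_diff:
 assumes "g : G0" "h : G0" shows "AE t in arc. bval (%z. g z - h z) t = bval g t - bval h t"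
 using bval_add[OF assms(1) G0_scale[OF assms(2), of "-1"]] bval_scale[OF assms(2), of "-1"] by eventually_elim simp

abbreviation "GX == points (G_space X)"
abbreviation "gnorm == nrm (G_space X)"

lemma G_esssup_eq: "G_esssup X g = esssup arc (%t. ereal (bnorm t (bval g t)))"
 by (simp add: G_esssup_def bnorm_def bval_def)

lemma GX_eq: "GX = {g : G0. G_esssup X g < \<infinity>}"
proof -
 have "(EX (N::nat) c x. (ALL j<N. (%w. c j (phi w)) : smirnov & x j : Delta) & (ALL z:Omega. g z = (SUM j<N. c j z *C x j))) \<longleftrightarrow> g : G0" for g
 proof
  assume "EX (N::nat) c x. (ALL j<N. (%w. c j (phi w)) : smirnov & x j : Delta) & (ALL z:Omega. g z = (SUM j<N. c j z *C x j))"
  then obtain N :: nat and c x where "ALL j<N. (%w. c j (phi w)) : smirnov & x j : Delta" "ALL z:Omega. g z = (SUM j<N. c j z *C x j)"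
  by blast
  then show "g : G0" by (intro G0I[of N "%j w. c j (phi w)" x]) auto
 next
  assume "g : G0"
  then obtain n c x where g0: "comb_rep g n c x" by (rule G0E)
  note g = comb_repD[OF g0]
  have "g z = (SUM j<n. c j (psi z) *C x j)" if "z : Omega" for z using g(3)[of "psi z"] that by simp
  moreover have "(%w. c j (psi (phi w))) : smirnov" if "j < n" for j by (rule smirnov_cong[OF g(1)[OF that]]) simp
  ultimately show "EX (N::nat) c x. (ALL j<N. (%w. c j (phi w)) : smirnov & x j : Delta) & (ALL z:Omega. g z = (SUM j<N. c j z *C x j))"
  using g(2) by (intro exI[of _ n] exI[of _ "%j z. c j (psi z)"] exI[of _ x]) auto
 qed
 then show ?thesis by (simp add: G_space_def)
qed

text \<open>Excludes the value minus infinity, so that on \<open>GX\<close> the conversion of the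
  essential supremum to a real number is faithful.\<close>

lemma G_esssup_nonneg:
 assumes "g : G0" shows "0 <= G_esssup X g"
proof -
 have "AE t in arc. 0 <= bnorm t (bval g t)" using AE_good G0_bval[OF assms] by eventually_elim (simp add: bnorm_nonneg)
 then have "esssup arc (%t. 0 :: ereal) <= esssup arc (%t. ereal (bnorm t (bval g t)))" by (intro esssup_AE_mono) auto
 moreover have "emeasure arc (space arc) ~= 0" using measure_arc by (auto simp: arc.emeasure_eq_measure)
 ultimately show ?thesis by (simp add: G_esssup_eq esssup_const)
qed

lemma GXI:
 assumes "g : G0" "AE t in arc. bnorm t (bval g t) <= C" shows "g : GX" "gnorm g <= C"
proof -
 have "esssup arc (%t. ereal (bnorm t (bval g t))) <= ereal C"
  using bnorm_bval_measurable[OF assms(1)] assms(2) by (intro esssup_I) auto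
 then have le: "G_esssup X g <= ereal C" by (simp add: G_esssup_eq)
 then show "g : GX" using assms(1) by (auto simp: GX_eq)
 show "gnorm g <= C" using le G_esssup_nonneg[OF assms(1)] by (cases "G_esssup X g") (auto simp: G_space_def)
qed

lemma GX_G0: "g : GX ==> g : G0" by (simp add: GX_eq)

lemma gnorm_eq: "gnorm g = real_of_ereal (G_esssup X g)" by (simp add: G_space_def)

lemma gnorm_nonneg: "g : GX ==> 0 <= gnorm g" unfolding gnorm_eq by (intro real_of_ereal_pos G_esssup_nonneg GX_G0)

lemma gnorm_AE:
 assumes "g : GX" shows "AE t in arc. bnorm t (bval g t) <= gnorm g"
proof -
 have "G_esssup X g = ereal (gnorm g)" using assms G_esssup_nonneg[OF GX_G0[OF assms]] unfolding gnorm_eq GX_eq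
  by (cases "G_esssup X g") auto
 then show ?thesis using esssup_AE[of "%t. ereal (bnorm t (bval g t))" arc] by (simp add: G_esssup_eq)
qed

lemma GX_add:
 assumes "g : GX" "h : GX" shows "(%z. g z + h z) : GX" "gnorm (%z. g z + h z) <= gnorm g + gnorm h"
proof -
 have "AE t in arc. bnorm t (bval (%z. g z + h z) t) <= gnorm g + gnorm h"
  using gnorm_AE[OF assms(1)] gnorm_AE[OF assms(2)] bval_add[OF assms[THEN GX_G0]] AE_good
  G0_bval[OF GX_G0[OF assms(1)]] G0_bval[OF GX_G0[OF assms(2)]] by eventually_elim (smt (verit) bnorm_add)
 with GXI[OF G0_add[OF assms[THEN GX_G0]]]
 show "(%z. g z + h z) : GX" "gnorm (%z. g z + h z) <= gnorm g + gnorm h" by auto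
qed

lemma GX_mult:
 assumes q: "q : smirnov" "AE t in arc. cmod (bdry q t) <= C" and g: "g : GX"
  and h: "!!w. cmod w < 1 ==> h (phi w) = q w *C g (phi w)" shows "h : GX" "gnorm h <= C * gnorm g"
proof -
 have "AE t in arc. bnorm t (bval h t) <= C * gnorm g"
 proof -
  have "AE t in arc. bval h t = bdry q t *C bval g t" by (rule bval_mult[OF q(1) GX_G0[OF g] h])
  then show ?thesis using gnorm_AE[OF g] q(2) AE_good G0_bval[OF GX_G0[OF g]]
  by eventually_elim (simp add: bnorm_scale bnorm_nonneg mult_mono')
 qed
 moreover have "h : G0" by (rule G0_mult[OF q(1) GX_G0[OF g] h])
 ultimately show "h : GX" "gnorm h <= C * gnorm g" using GXI by auto
qed

lemma GX_scale:
 assumes g: "g : GX" shows "(%z. a *C g z) : GX" "gnorm (%z. a *C g z) = cmod a * gnorm g"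
proof -
 have le: "(%z. a *C g z) : GX & gnorm (%z. a *C g z) <= cmod a * gnorm g" if "g : GX" for a g
  using GX_mult[OF smirnov_const[of a] _ that, of "cmod a" "%z. a *C g z"]
  by (simp add: nt_limit_eqI[OF has_nt_limit_const])
 then show m: "(%z. a *C g z) : GX" using g by blast
 show "gnorm (%z. a *C g z) = cmod a * gnorm g"
 proof (cases "a = 0")
  case True
  then show ?thesis using le[OF g, of a] gnorm_nonneg[OF m] by simp
 next
  case False
  have "gnorm (%z. inverse a *C (a *C g z)) <= cmod (inverse a) * gnorm (%z. a *C g z)" using le[OF m] by blast
  then have "gnorm g <= gnorm (%z. a *C g z) / cmod a"
  using False by (simp add: scaleC_scaleC scaleC_one norm_inverse divide_inverse mult.commute)
  then show ?thesis using le[OF g, of a] False by (simp add: field_simps)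
 qed
qed

lemma GX_diff:
 assumes "g : GX" "h : GX" shows "(%z. g z - h z) : GX" "gnorm (%z. g z - h z) <= gnorm g + gnorm h"
 using GX_add[OF assms(1) GX_scale(1)[OF assms(2), of "-1"]] GX_scale(2)[OF assms(2), of "-1"] by auto

end

lemma bounded_linear_functional:
 fixes l :: "'b::complex_banach => complex"
 assumes "!!x y. l (x + y) = l x + l y" "!!a x. l (a *C x) = a * l x" "!!x. cmod (l x) <= norm x"
 shows "bounded_linear l"
proof (rule bounded_linear_intro[where K=1])
 show "l (r *\<^sub>R x) = r *\<^sub>R l x" for r x
  using assms(2)[of "of_real r" x] by (simp add: scaleC_of_real scaleR_conv_of_real)
qed (use assms in auto)

lemma vderiv_eqI:
 fixes f :: "complex => 'b::complex_banach"
 assumes "(f has_derivative (%h. h *C d)) (at z)" shows "vderiv f z = d"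
proof -
 have "(f has_derivative (%h. h *C vderiv f z)) (at z)"
  unfolding vderiv_def by (rule someI[where P="%d. (f has_derivative (%h. h *C d)) (at z)", OF assms])
 from has_derivative_unique[OF this assms] have "1 *C vderiv f z = 1 *C d" by (rule fun_cong)
 then show ?thesis by (simp add: scaleC_one)
qed

subsection \<open>Point evaluations and the completion\<close>

context interpolation_family
begin

text \<open>An integrable exponent above the logarithm of the containing function; its Poisson
  integral controls the point evaluations.\<close>

definition "kk t = log_plus (contf X (phi (cis t)))"

lemma kk_integrable: "integrable arc kk" unfolding kk_def[abs_def] by (rule contf_log_integrable)

lemma norm_le_kk: "good t ==> x : Delta ==> norm x <= exp (kk t) * bnorm t x"
proof -
 assume t: "good t" and x: "x : Delta"
 have "norm x <= contf X (phi (cis t)) * bnorm t x"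
  unfolding bnorm_def by (rule norm_le_contf) (use t x in "auto simp: good_def")
 also have "... <= exp (kk t) * bnorm t x" unfolding kk_def using contf_pos[of "phi (cis t)"] t
  by (intro mult_right_mono le_exp_log_plus bnorm_nonneg x) (auto simp: good_def)
 finally show ?thesis .
qed

lemma functional_comp_smirnov:
 assumes l: "!!x y. l (x + y) = l x + l y" "!!a x. l (a *C x) = a * l x" and g: "g : G0"
 shows "(%w. l (g (phi w))) : smirnov"
proof -
 obtain n c x where g0: "comb_rep g n c x" by (rule G0E[OF g])
 note g = comb_repD[OF g0]
 have l0: "l 0 = 0" using l(2)[of 0 0] by simp
 have ls: "l (SUM j<m. f j) = (SUM j<m. l (f j))" for f and m :: nat by (induction m) (simp_all add: l0 l(1))
 show ?thesis
 proof (rule smirnov_cong)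
  show "(%w. SUM j<n. c j w * l (x j)) : smirnov" by (intro smirnov_sum smirnov_mult smirnov_const g) auto
 qed (simp add: g(3) ls l(2))
qed

text \<open>A norming functional for the value at \<open>phi w\<close> leads to a scalar Smirnov
  function with boundary modulus at most \<open>exp (kk t) * C\<close>, to which the maximum
  principle applies.\<close>

lemma G0_eval_bound:
 assumes g: "g : G0" and C: "AE t in arc. bnorm t (bval g t) <= C" "0 <= C" and w: "cmod w < 1"
 shows "norm (g (phi w)) <= exp (pois kk w) * C"
proof -
 obtain l :: "'a => complex" where l: "!!x y. l (x + y) = l x + l y" "!!a x. l (a *C x) = a * l x"
  "!!x. cmod (l x) <= norm x" "l (g (phi w)) = of_real (norm (g (phi w)))"
  using norming_functional[of "g (phi w)"] by blast
 have lc: "isCont l y" for y using bounded_linear_functional[OF l(1-3)] by (rule linear_continuous_at)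
 have sm: "(%w. l (g (phi w))) : smirnov" by (rule functional_comp_smirnov[OF l(1,2) g])
 \<comment> \<open>\<open>C\<close> may be 0, so \<open>ln (C + e)\<close> is used in place of
   \<open>ln C\<close>.\<close>
 have "norm (g (phi w)) <= exp (pois kk w) * (C + e)" if e: "e > 0" for e
 proof -
  have "AE t in arc. cmod (bdry (%w. l (g (phi w))) t) <= exp (kk t + ln (C + e))" using C(1) G0_bval[OF g] AE_good
  proof eventually_elim
  case (elim t)
  have "bdry (%w. l (g (phi w))) t = l (bval g t)"
  by (rule nt_limit_eqI[OF has_nt_limit_compose[OF _ lc]]) (use elim in auto)
  moreover have "cmod (l (bval g t)) <= exp (kk t) * bnorm t (bval g t)"
  using l(3)[of "bval g t"] norm_le_kk[of t "bval g t"] elim by linarith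
  moreover have "exp (kk t) * bnorm t (bval g t) <= exp (kk t) * (C + e)" using elim e by (intro mult_left_mono) auto
  moreover have "exp (kk t) * (C + e) = exp (kk t + ln (C + e))" using C(2) e by (simp add: exp_add)
  ultimately show ?case by (metis order_trans)
  qed
  moreover have "integrable arc (%t. kk t + ln (C + e))" using kk_integrable by auto
  ultimately have "cmod (l (g (phi w))) <= exp (pois (%t. kk t + ln (C + e)) w)"
  using smirnov_le_exp[OF sm _ _ w] by blast
  then show ?thesis
  using C(2) e l(4) pois_add[OF w kk_integrable, of "%_. ln (C + e)"] by (simp add: pois_const[OF w] exp_add)
 qed
 then have "ALL e>0. norm (g (phi w)) <= exp (pois kk w) * C + exp (pois kk w) * e" by (simp add: distrib_left)
 then have "norm (g (phi w)) <= exp (pois kk w) * C + e" if "e > 0" for e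
  using that by (auto dest: spec[of _ "e / exp (pois kk w)"])
 then show ?thesis by (rule field_le_epsilon)
qed

lemma GX_eval_bound:
 assumes "g : GX" "cmod w < 1" shows "norm (g (phi w)) <= exp (pois kk w) * gnorm g"
 by (rule G0_eval_bound[OF GX_G0[OF assms(1)] gnorm_AE[OF assms(1)] gnorm_nonneg[OF assms(1)] assms(2)])

lemma GX_minus:
 assumes "g : GX" "h : GX" shows "g - h : GX" "gnorm (g - h) <= gnorm g + gnorm h"
 using GX_diff[OF assms] by (simp_all add: fun_diff_def)

lemma GX_plus:
 assumes "g : GX" "h : GX" shows "g + h : GX" "gnorm (g + h) <= gnorm g + gnorm h"
 using GX_add[OF assms] by (simp_all add: plus_fun_def)

lemma GX_scaleC:
 assumes "g : GX" shows "a *C g : GX" "gnorm (a *C g) = cmod a * gnorm g"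
 using GX_scale[OF assms, of a] by (simp_all add: scaleC_fun_def)

lemma gnorm_triangle:
 assumes "g : GX" "h : GX" shows "\<bar>gnorm g - gnorm h\<bar> <= gnorm (g - h)"
proof -
 have "gnorm ((g - h) + h) <= gnorm (g - h) + gnorm h" by (intro GX_plus GX_minus assms)
 moreover have "gnorm ((-1) *C (g - h) + g) <= gnorm ((-1) *C (g - h)) + gnorm g"
  by (intro GX_plus GX_minus GX_scaleC assms)
 moreover have "(-1) *C (g - h) + g = h" by simp
 moreover have "gnorm ((-1) *C (g - h)) = gnorm (g - h)"
  using GX_scaleC(2)[OF GX_minus(1)[OF assms], of "-1"] by simp
 ultimately show ?thesis by simp
qed

text \<open>Completeness and the injectivity of the embeddings of the boundary spaces show that the
  evaluations separate the points of the completion.\<close>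

lemma cauchy_null:
 assumes gs: "!!m::nat. gs m : GX" and C: "!!e. e > 0 ==> EX M. ALL l>=M. ALL m>=M. gnorm (gs l - gs m) < e"
  and z: "!!w. cmod w < 1 ==> (%m. gs m (phi w)) ----> 0" shows "(%m. gnorm (gs m)) ----> 0"
proof -
 have "EX M. ALL l>=M. ALL m>=M. gnorm (gs l - gs m) < inverse (real (Suc n))" for n by (rule C) simp
 then obtain M where M: "!!n l m. l >= M n ==> m >= M n ==> gnorm (gs l - gs m) < inverse (real (Suc n))" by metis
 \<comment> \<open>The evaluation bound for \<open>gs l - gs m\<close>, with \<open>m\<close>
   tending to infinity.\<close>
 have in1: "norm (gs l (phi w)) <= exp (pois kk w) * inverse (real (Suc n))" if l: "l >= M n" and w: "cmod w < 1" for l n w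
 proof (rule tendsto_upperbound)
  show "(%m. norm (gs l (phi w) - gs m (phi w))) ----> norm (gs l (phi w))"
  using tendsto_norm[OF tendsto_diff[OF tendsto_const z[OF w]], of "gs l (phi w)"] by simp
  show "\<forall>\<^sub>F m in sequentially. norm (gs l (phi w) - gs m (phi w)) <= exp (pois kk w) * inverse (real (Suc n))"
  proof (rule eventually_sequentiallyI[of "M n"])
  fix m assume "M n <= m"
  then have "exp (pois kk w) * gnorm (gs l - gs m) <= exp (pois kk w) * inverse (real (Suc n))"
  using M[OF l, of m] by (intro mult_left_mono) auto
  from order_trans[OF GX_eval_bound[OF GX_minus(1)[OF gs gs] w] this]
  show "norm (gs l (phi w) - gs m (phi w)) <= exp (pois kk w) * inverse (real (Suc n))" by simp
  qed
 qed simp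
 have A1: "AE t in arc. ALL l m. bnorm t (bval (gs l) t - bval (gs m) t) <= gnorm (gs l - gs m)"
  unfolding AE_all_countable
 proof (intro allI)
  fix l m
  have "gs l - gs m : GX" by (intro GX_minus gs)
  then have "AE t in arc. bnorm t (bval (gs l - gs m) t) <= gnorm (gs l - gs m)" by (rule gnorm_AE)
  moreover have "AE t in arc. bval (gs l - gs m) t = bval (gs l) t - bval (gs m) t"
  using bval_diff[OF GX_G0[OF gs] GX_G0[OF gs], of l m] by (simp add: fun_diff_def)
  ultimately show "AE t in arc. bnorm t (bval (gs l) t - bval (gs m) t) <= gnorm (gs l - gs m)" by eventually_elim simp
 qed
 have A2: "AE t in arc. ALL l. has_nt_limit (%w. gs l (phi w)) (cis t) (bval (gs l) t) & bval (gs l) t : Delta"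
  unfolding AE_all_countable by (intro allI G0_bval GX_G0 gs)
 have main: "AE t in arc. ALL n. ALL l>=M n. bnorm t (bval (gs l) t) <= inverse (real (Suc n))"
  using A1 A2 AE_good pois_nt_limit[OF kk_integrable]
 proof eventually_elim
  case (elim t)
  define b where "b l = bval (gs l) t" for l
  have bDelta: "b l : Delta" for l using elim(2) by (simp add: b_def)
  have dl: "bnorm t (b l - b m) <= gnorm (gs l - gs m)" for l m using elim(1) by (simp add: b_def)
  \<comment> \<open>Radial limits carry the interior estimate to the boundary, so the boundary
    values tend to 0 in the containing space.\<close>
  have b2: "norm (b l) <= exp (kk t) * inverse (real (Suc n))" if l: "l >= M n" for l n
  proof (rule tendsto_le)
  show "((%r. norm (gs l (phi (of_real r * cis t)))) \<longlongrightarrow> norm (b l)) (at_left 1)"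
  unfolding b_def using elim(2) by (intro tendsto_norm has_nt_limit_radial) auto
  show "((%r. exp (pois kk (of_real r * cis t)) * inverse (real (Suc n))) \<longlongrightarrow> exp (kk t) * inverse (real (Suc n))) (at_left 1)"
  by (intro tendsto_mult tendsto_exp tendsto_const has_nt_limit_radial[OF elim(4)]) simp
  show "\<forall>\<^sub>F r in at_left 1. norm (gs l (phi (of_real r * cis t))) <= exp (pois kk (of_real r * cis t)) * inverse (real (Suc n))"
  by (rule eventually_at_leftI[of 0]) (auto intro!: in1[OF l] simp: norm_mult simp del: of_nat_Suc)
  qed simp
  have b0: "b ----> 0"
  proof (rule LIMSEQ_I)
  fix e :: real assume e: "e > 0"
  obtain n where n: "inverse (real (Suc n)) < e / exp (kk t)" using reals_Archimedean[of "e / exp (kk t)"] e by auto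
  have "norm (b l) < e" if "l >= M n" for l
  proof -
  have "exp (kk t) * inverse (real (Suc n)) < e" using n by (simp add: field_simps)
  then show ?thesis using b2[OF that] by linarith
  qed
  then show "EX no. ALL n>=no. norm (b n - 0) < e" by auto
  qed
  define u where "u = phi (cis t)"
  have u: "u : frontier Omega" using elim(3) by (simp add: u_def good_def)
  have bp: "b l : points (bspace X u)" for l using bDelta inter_subset[OF u] by blast
  \<comment> \<open>The boundary values are also Cauchy in the boundary space at this point. By
    continuity of the injective embedding, their limit there must be the limit in the containing
    space, which is 0.\<close>
  obtain y where y: "y : points (bspace X u)" "(%n. nrm (bspace X u) (b n - y)) ----> 0"
  proof (rule banach_space_on_limit[OF space_banach[OF u], of b])
  show "EX M. ALL l>=M. ALL m>=M. nrm (bspace X u) (b l - b m) < e" if e: "e > 0" for e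
  proof -
  obtain N where "ALL l>=N. ALL m>=N. gnorm (gs l - gs m) < e" using C[OF e] by blast
  then show ?thesis using dl unfolding bnorm_def u_def[symmetric] by (meson le_less_trans)
  qed
  qed (use bp in auto)
  obtain K where K: "!!x. x : points (bspace X u) ==> norm x <= K * nrm (bspace X u) x"
  using space_embeds[OF u] by blast
  have sub: "complex_vector.subspace (points (bspace X u))" unfolding u_def by (rule bnorm_props(5)[OF elim(3)])
  have "(%n. b n - y) ----> 0"
  proof (rule Lim_null_comparison)
  show "\<forall>\<^sub>F n in sequentially. norm (b n - y) <= K * nrm (bspace X u) (b n - y)"
  using K complex_vector.subspace_diff[OF sub bp y(1)] by (auto intro: always_eventually)
  show "(%n. K * nrm (bspace X u) (b n - y)) ----> 0" using tendsto_mult[OF tendsto_const y(2), of K] by simp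
  qed
  moreover have "(%n. b n - y) ----> 0 - y" by (intro tendsto_diff b0 tendsto_const)
  ultimately have "0 - y = 0" using LIMSEQ_unique by blast
  then have bl: "(%m. bnorm t (b m)) ----> 0" using y(2) by (simp add: bnorm_def u_def)
  show ?case
  proof (intro allI impI)
  fix n l assume l: "M n <= l"
  have "bnorm t (b l) <= inverse (real (Suc n)) + 0"
  proof (rule tendsto_lowerbound)
  show "(%m. inverse (real (Suc n)) + bnorm t (b m)) ----> inverse (real (Suc n)) + 0"
  by (intro tendsto_add tendsto_const bl)
  show "\<forall>\<^sub>F m in sequentially. bnorm t (b l) <= inverse (real (Suc n)) + bnorm t (b m)"
  proof (rule eventually_sequentiallyI[of "M n"])
  fix m assume m: "M n <= m"
  have "bnorm t ((b l - b m) + b m) <= bnorm t (b l - b m) + bnorm t (b m)"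
  by (intro bnorm_add elim(3) Delta_diff bDelta)
  then show "bnorm t (b l) <= inverse (real (Suc n)) + bnorm t (b m)" using dl[of l m] M[OF l m] by simp
  qed
  qed simp
  then show "bnorm t (bval (gs l) t) <= inverse (real (Suc n))" by (simp add: b_def)
  qed
 qed
 have small: "gnorm (gs l) <= inverse (real (Suc n))" if l: "l >= M n" for l n
  by (rule GXI(2)[OF GX_G0[OF gs]]) (use main l in "auto elim!: eventually_mono")
 show ?thesis
 proof (rule LIMSEQ_I)
  fix e :: real assume e: "e > 0"
  obtain n where n: "inverse (real (Suc n)) < e" using reals_Archimedean e by blast
  then show "EX no. ALL n>=no. norm (gnorm (gs n) - 0) < e"
  using small gnorm_nonneg[OF gs] by (intro exI[of _ "M n"]) force
 qed
qed

abbreviation "FX == points (F_space X)"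
abbreviation "fnorm == nrm (F_space X)"
abbreviation "repr == represents X"

lemma FX_iff: "f : FX \<longleftrightarrow> (EX gs. repr gs f)" by (simp add: F_space_def)

lemma repr_GX: "repr gs f ==> gs m : GX"
 and repr_cauchy: "repr gs f ==> e > 0 ==> EX M. ALL l>=M. ALL m>=M. gnorm (gs l - gs m) < e"
 and repr_lim: "repr gs f ==> z : Omega ==> (%m. gs m z) ----> f z" by (simp_all add: represents_def)

lemma reprI:
 assumes "!!m. gs m : GX" "!!e. e > 0 ==> EX M. ALL l>=M. ALL m>=M. gnorm (gs l - gs m) < e"
  "!!w. cmod w < 1 ==> (%m. gs m (phi w)) ----> f (phi w)" shows "repr gs f"
 unfolding represents_def using assms(1,2) assms(3)[OF psi_ball] by auto

lemma repr_norm_convergent: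
 assumes "repr gs f" shows "convergent (%m. gnorm (gs m))" unfolding Cauchy_convergent_iff[symmetric]
proof (rule CauchyI)
 fix e :: real assume "e > 0"
 then obtain M where M: "!!l m. l >= M ==> m >= M ==> gnorm (gs l - gs m) < e" using repr_cauchy[OF assms] by blast
 show "EX M. ALL m>=M. ALL n>=M. norm (gnorm (gs m) - gnorm (gs n)) < e"
 proof (intro exI[of _ M] allI impI)
  fix m n assume "M <= m" "M <= n"
  then show "norm (gnorm (gs m) - gnorm (gs n)) < e"
  using M[of m n] gnorm_triangle[OF repr_GX[OF assms] repr_GX[OF assms], of m n] by simp
 qed
qed

lemma repr_sum_cauchy:
 assumes "repr gs f" "repr hs f'" "e > 0"
 shows "EX M. ALL l>=M. ALL m>=M. gnorm (gs l - gs m) + gnorm (hs l - hs m) < e"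
proof -
 obtain M1 where M1: "!!l m. l >= M1 ==> m >= M1 ==> gnorm (gs l - gs m) < e / 2"
  using repr_cauchy[OF assms(1), of "e / 2"] assms(3) by auto
 obtain M2 where M2: "!!l m. l >= M2 ==> m >= M2 ==> gnorm (hs l - hs m) < e / 2"
  using repr_cauchy[OF assms(2), of "e / 2"] assms(3) by auto
 show ?thesis
 proof (intro exI[of _ "max M1 M2"] allI impI)
  fix l m assume "max M1 M2 <= l" "max M1 M2 <= m"
  then show "gnorm (gs l - gs m) + gnorm (hs l - hs m) < e" using M1[of l m] M2[of l m] by simp
 qed
qed

lemma repr_add:
 assumes "repr gs f" "repr hs h" shows "repr (%m. gs m + hs m) (f + h)"
proof (rule reprI)
 show "gs m + hs m : GX" for m by (rule GX_plus(1)[OF repr_GX[OF assms(1)] repr_GX[OF assms(2)]])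
 fix e :: real assume "e > 0"
 then obtain M where M: "!!l m. l >= M ==> m >= M ==> gnorm (gs l - gs m) + gnorm (hs l - hs m) < e"
  using repr_sum_cauchy[OF assms] by meson
 have "gnorm ((gs l + hs l) - (gs m + hs m)) <= gnorm (gs l - gs m) + gnorm (hs l - hs m)" for l m
 proof -
  have "(gs l + hs l) - (gs m + hs m) = (gs l - gs m) + (hs l - hs m)" by simp
  then show ?thesis by (metis GX_plus(2) GX_minus(1) repr_GX assms)
 qed
 then show "EX M. ALL l>=M. ALL m>=M. gnorm ((gs l + hs l) - (gs m + hs m)) < e" using M le_less_trans by blast
next
 fix w :: complex assume "cmod w < 1"
 then show "(%m. (gs m + hs m) (phi w)) ----> (f + h) (phi w)"
  using tendsto_add[OF repr_lim[OF assms(1)] repr_lim[OF assms(2)]] by simp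
qed

lemma GX_mult_diff:
 assumes q: "q : smirnov" "AE t in arc. cmod (bdry q t) <= C" and g: "g : GX" "g' : GX"
 shows "gnorm ((%z. q (psi z) *C g z) - (%z. q (psi z) *C g' z)) <= C * gnorm (g - g')"
 by (rule GX_mult(2)[OF q GX_minus(1)[OF g]]) (simp add: complex_vector.scale_right_diff_distrib)

lemma repr_mult:
 assumes q: "q : smirnov" "AE t in arc. cmod (bdry q t) <= C" and f: "repr gs f"
 shows "repr (%m z. q (psi z) *C gs m z) (%z. q (psi z) *C f z)"
proof (rule reprI)
 note G = repr_GX[OF f]
 show "(%z. q (psi z) *C gs m z) : GX" for m by (rule GX_mult(1)[OF q G[of m]]) simp
 fix e :: real assume e: "e > 0"
 have C1: "0 < \<bar>C\<bar> + 1" by simp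
 obtain M where M: "!!l m. l >= M ==> m >= M ==> gnorm (gs l - gs m) < e / (\<bar>C\<bar> + 1)"
  using repr_cauchy[OF f, of "e / (\<bar>C\<bar> + 1)"] e by auto
 have "gnorm ((%z. q (psi z) *C gs l z) - (%z. q (psi z) *C gs m z)) < e" if "l >= M" "m >= M" for l m
 proof -
  have "C * gnorm (gs l - gs m) <= (\<bar>C\<bar> + 1) * gnorm (gs l - gs m)"
  by (intro mult_right_mono gnorm_nonneg GX_minus G) auto
  also have "... < (\<bar>C\<bar> + 1) * (e / (\<bar>C\<bar> + 1))" using M[OF that] C1 by (intro mult_strict_left_mono) auto
  finally show ?thesis using GX_mult_diff[OF q G G, of l m] C1 by simp
 qed
 then show "EX M. ALL l>=M. ALL m>=M. gnorm ((%z. q (psi z) *C gs l z) - (%z. q (psi z) *C gs m z)) < e" by blast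
next
 fix w :: complex assume w: "cmod w < 1"
 have "bounded_linear (%x::'a. q w *C x)" by (rule bounded_linear_intro[where K="cmod (q w)"])
  (simp_all add: scaleC_add_right norm_scaleC mult.commute scaleC_of_real[symmetric] scaleC_scaleC)
 from bounded_linear.tendsto[OF this repr_lim[OF f conf_in[OF w]]]
 show "(%m. q (psi (phi w)) *C gs m (phi w)) ----> q (psi (phi w)) *C f (phi w)" using w by simp
qed

lemma repr_scale:
 assumes "repr gs f" shows "repr (%m. a *C gs m) (a *C f)"
 using repr_mult[OF smirnov_const[of a] _ assms, of "cmod a"]
 by (simp add: nt_limit_eqI[OF has_nt_limit_const] scaleC_fun_def)

lemma repr_diff:
 assumes "repr gs f" "repr hs h" shows "repr (%m. gs m - hs m) (f - h)"
 using repr_add[OF assms(1) repr_scale[OF assms(2), of "-1"]] by simp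

lemma repr_const: "g : GX ==> repr (%_. g) g"
proof (rule reprI)
 assume g: "g : GX"
 have "gnorm (0 *C g) = 0" using GX_scaleC(2)[OF g, of 0] by simp
 then show "EX M. ALL l>=M. ALL m>=M. gnorm (g - g) < e" if "e > 0" for e using that by simp
qed auto

text \<open>The difference of two representing sequences represents 0, so its norms tend to 0 by
  \<open>cauchy_null\<close>; the infimum in the norm is thus taken over a single value.\<close>

lemma fnorm_repr:
 assumes "repr gs f" shows "(%m. gnorm (gs m)) ----> fnorm f"
proof -
 obtain L where L: "(%m. gnorm (gs m)) ----> L" using repr_norm_convergent[OF assms] by (auto simp: convergent_def)
 have "r = L" if hs: "repr hs f" "(%m. gnorm (hs m)) ----> r" for hs r
 proof -
  have d: "repr (%m. gs m - hs m) (f - f)" by (rule repr_diff[OF assms hs(1)])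
  have "(%m. gnorm (gs m - hs m)) ----> 0"
  proof (rule cauchy_null)
  show "(%m. (gs m - hs m) (phi w)) ----> 0" if "cmod w < 1" for w using repr_lim[OF d conf_in[OF that]] by simp
  qed (use repr_GX[OF d] repr_cauchy[OF d] in auto)
  then have "(%m. gnorm (gs m) - gnorm (hs m)) ----> 0" by (rule Lim_null_comparison[rotated])
  (use gnorm_triangle[OF repr_GX[OF assms] repr_GX[OF hs(1)]] in "auto intro: always_eventually")
  then show "r = L" using LIMSEQ_unique[OF tendsto_diff[OF L hs(2)]] by fastforce
 qed
 then have "{r. EX gs. repr gs f & (%m. gnorm (gs m)) ----> r} = {L}" using assms L by blast
 then show ?thesis using L by (simp add: F_space_def)
qed

lemma GX_FX: "g : GX ==> g : FX" and fnorm_GX: "g : GX ==> fnorm g = gnorm g"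
 using repr_const fnorm_repr[OF repr_const] LIMSEQ_unique[OF _ tendsto_const] by (auto simp: FX_iff)

lemma fnorm_nonneg: assumes "f : FX" shows "0 <= fnorm f"
proof -
 obtain gs where gs: "repr gs f" using assms by (auto simp: FX_iff)
 show ?thesis by (rule tendsto_lowerbound[OF fnorm_repr[OF gs]]) (use gnorm_nonneg[OF repr_GX[OF gs]] in auto)
qed

lemma FX_add:
 assumes "f : FX" "h : FX" shows "f + h : FX" "fnorm (f + h) <= fnorm f + fnorm h"
proof -
 obtain gs hs where g: "repr gs f" "repr hs h" using assms by (auto simp: FX_iff)
 show "f + h : FX" using repr_add[OF g] by (auto simp: FX_iff)
 show "fnorm (f + h) <= fnorm f + fnorm h"
 proof (rule tendsto_le[OF _ tendsto_add[OF fnorm_repr[OF g(1)] fnorm_repr[OF g(2)]] fnorm_repr[OF repr_add[OF g]]])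
  show "\<forall>\<^sub>F m in sequentially. gnorm (gs m + hs m) <= gnorm (gs m) + gnorm (hs m)"
  by (intro always_eventually allI GX_plus repr_GX[OF g(1)] repr_GX[OF g(2)])
 qed simp
qed

lemma FX_mult:
 assumes q: "q : smirnov" "AE t in arc. cmod (bdry q t) <= C" and f: "f : FX"
 shows "(%z. q (psi z) *C f z) : FX" "fnorm (%z. q (psi z) *C f z) <= C * fnorm f"
proof -
 obtain gs where g: "repr gs f" using f by (auto simp: FX_iff)
 note r = repr_mult[OF q g]
 show "(%z. q (psi z) *C f z) : FX" using r by (auto simp: FX_iff)
 show "fnorm (%z. q (psi z) *C f z) <= C * fnorm f"
 proof (rule tendsto_le[OF _ tendsto_mult[OF tendsto_const fnorm_repr[OF g]] fnorm_repr[OF r]])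
  show "\<forall>\<^sub>F m in sequentially. gnorm (%z. q (psi z) *C gs m z) <= C * gnorm (gs m)"
  by (intro always_eventually allI GX_mult(2)[OF q repr_GX[OF g]]) simp
 qed simp
qed

lemma FX_scale:
 assumes "f : FX" shows "a *C f : FX" "fnorm (a *C f) = cmod a * fnorm f"
proof -
 obtain gs where g: "repr gs f" using assms by (auto simp: FX_iff)
 show "a *C f : FX" using repr_scale[OF g] by (auto simp: FX_iff)
 have "(%m. cmod a * gnorm (gs m)) ----> fnorm (a *C f)"
  using fnorm_repr[OF repr_scale[OF g, of a]] by (simp add: GX_scaleC(2)[OF repr_GX[OF g]])
 moreover have "(%m. cmod a * gnorm (gs m)) ----> cmod a * fnorm f"
  by (intro tendsto_mult tendsto_const fnorm_repr[OF g])
 ultimately show "fnorm (a *C f) = cmod a * fnorm f" by (rule LIMSEQ_unique)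
qed

lemma FX_diff:
 assumes "f : FX" "h : FX" shows "f - h : FX" "fnorm (f - h) <= fnorm f + fnorm h"
 using FX_add[OF assms(1) FX_scale(1)[OF assms(2), of "-1"]] FX_scale(2)[OF assms(2), of "-1"] by auto

lemma FX_eval_bound:
 assumes f: "f : FX" and w: "cmod w < 1" shows "norm (f (phi w)) <= exp (pois kk w) * fnorm f"
proof -
 obtain gs where g: "repr gs f" using f by (auto simp: FX_iff)
 show ?thesis
 proof (rule tendsto_le[OF _ tendsto_mult[OF tendsto_const fnorm_repr[OF g]] tendsto_norm[OF repr_lim[OF g conf_in[OF w]]]])
  show "\<forall>\<^sub>F m in sequentially. norm (gs m (phi w)) <= exp (pois kk w) * gnorm (gs m)"
  by (intro always_eventually allI GX_eval_bound repr_GX[OF g] w)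
 qed simp
qed

lemma GX_dense:
 assumes f: "f : FX" and e: "e > 0" obtains g where "g : GX" "fnorm (f - g) < e"
proof -
 obtain gs where g: "repr gs f" using f by (auto simp: FX_iff)
 obtain M where M: "!!l m. l >= M ==> m >= M ==> gnorm (gs l - gs m) < e / 2"
  using repr_cauchy[OF g, of "e / 2"] e by auto
 have "fnorm (f - gs M) <= e / 2"
 proof (rule tendsto_upperbound[OF fnorm_repr[OF repr_diff[OF g repr_const[OF repr_GX[OF g]]]]])
  show "\<forall>\<^sub>F m in sequentially. gnorm (gs m - gs M) <= e / 2"
  by (rule eventually_sequentiallyI[of M]) (use M in "auto intro: less_imp_le")
 qed simp
 then show ?thesis using that[of "gs M"] repr_GX[OF g] e by auto
qed

lemma repr_exists:
 assumes gs: "!!m::nat. gs m : GX" and C: "!!e. e > 0 ==> EX M. ALL l>=M. ALL m>=M. gnorm (gs l - gs m) < e"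
 shows "repr gs (%z. lim (%m. gs m z))"
proof (rule reprI[OF gs C])
 fix w :: complex assume w: "cmod w < 1"
 have "Cauchy (%m. gs m (phi w))"
 proof (rule CauchyI)
  fix e :: real assume e: "e > 0"
  obtain M where M: "!!l m. l >= M ==> m >= M ==> gnorm (gs l - gs m) < e / exp (pois kk w)"
  using C[of "e / exp (pois kk w)"] e by auto
  have "norm (gs l (phi w) - gs m (phi w)) < e" if "l >= M" "m >= M" for l m
  proof -
  have "exp (pois kk w) * gnorm (gs l - gs m) < e" using M[OF that] by (simp add: field_simps)
  then show ?thesis using GX_eval_bound[OF GX_minus(1)[OF gs gs] w, of l m] by simp
  qed
  then show "EX M. ALL m>=M. ALL n>=M. norm (gs m (phi w) - gs n (phi w)) < e" by blast
 qed
 then show "(%m. gs m (phi w)) ----> lim (%m. gs m (phi w))" by (simp add: Cauchy_convergent_iff convergent_LIMSEQ_iff)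
qed

end

subsection \<open>Taylor coefficients\<close>

lemma functional_eqI:
 fixes x y :: "'b::complex_banach"
 assumes "!!l :: 'b => complex. (!!x y. l (x + y) = l x + l y) ==> (!!a x. l (a *C x) = a * l x) ==>
  (!!x. cmod (l x) <= norm x) ==> l x = l y" shows "x = y" proof -
 obtain l :: "'b => complex" where l: "!!x y. l (x + y) = l x + l y" "!!a x. l (a *C x) = a * l x"
  "!!x. cmod (l x) <= norm x" "l (x - y) = of_real (norm (x - y))" using norming_functional[of "x - y"] by blast
 have "l (x + (-1) *C y) = l x + (-1) * l y" unfolding l(1) l(2) ..
 then have "l (x - y) = 0" using assms[OF l(1-3)] by simp
 then show ?thesis using l(4) by simp
qed

text \<open>Taylor coefficients, for scalar functions here and for vector-valued ones in
  \<open>vc\<close>. Dividing by the factorial turns Leibniz rules into Cauchy products.\<close>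

definition sc :: "nat => (complex => complex) => complex => complex" where
 "sc i u z = (deriv ^^ i) u z / fact i"

definition vc :: "nat => (complex => 'b::complex_banach) => complex => 'b" where
 "vc i f z = (1 / fact i) *\<^sub>R (vderiv ^^ i) f z"

lemma jet_eq: "jet n z f = (%i. if i < n then vc i f z else 0)" unfolding jet_def vc_def by (rule refl)

lemma sc_0 [simp]: "sc 0 u z = u z" by (simp add: sc_def)

lemma vc_0 [simp]: "vc 0 f z = f z" by (simp add: vc_def)

lemma sc_mult:
 assumes "u holomorphic_on S" "v holomorphic_on S" "open S" "z : S"
 shows "sc n (%w. u w * v w) z = (SUM k<=n. sc k u z * sc (n - k) v z)"
proof -
 have "of_nat (n choose k) * a * b / fact n = a / fact k * (b / fact (n - k))" if "k <= n" for k and a b :: complex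
  using that by (simp add: binomial_fact field_simps)
 then show ?thesis
  unfolding sc_def higher_deriv_mult[OF assms] sum_divide_distrib by (intro sum.cong) (auto simp: atMost_atLeast0)
qed

lemma sc_cong:
 assumes "u holomorphic_on S" "open S" "z : S" "!!w. w : S ==> u w = v w" shows "sc i u z = sc i v z" unfolding sc_def
 using higher_deriv_transform_within_open[of u S v z i] holomorphic_transform[OF assms(1), of v] assms by auto

lemma sc_add:
 assumes "u holomorphic_on S" "v holomorphic_on S" "open S" "z : S" shows "sc n (%w. u w + v w) z = sc n u z + sc n v z"
 unfolding sc_def using higher_deriv_add[OF assms] by (simp add: add_divide_distrib)

lemma sc_const: "sc i (%_. c) z = (if i = 0 then c else 0)" by (simp add: sc_def higher_deriv_const)

lemma sc_cmult:
 assumes "u holomorphic_on S" "open S" "z : S" shows "sc n (%w. c * u w) z = c * sc n u z"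
 unfolding sc_def using higher_deriv_cmult[OF assms(1,3,2)] by simp

lemma sc_power_vanish:
 assumes b: "b holomorphic_on S" "b z = 0" and r: "r holomorphic_on S" and S: "open S" "z : S" and "i < n"
 shows "sc i (%w. b w ^ n * r w) z = 0" using \<open>i < n\<close>
proof (induction n arbitrary: i)
 case (Suc n)
 have "sc i (%w. b w ^ Suc n * r w) z = sc i (%w. b w * (b w ^ n * r w)) z" by (simp add: mult.assoc)
 also have "... = (SUM k<=i. sc k b z * sc (i - k) (%w. b w ^ n * r w) z)"
  by (rule sc_mult) (use b r S in "auto intro!: holomorphic_intros")
 also have "... = 0"
 proof (rule sum.neutral, rule ballI)
  fix k assume "k : {..i}"
  then show "sc k b z * sc (i - k) (%w. b w ^ n * r w) z = 0" using Suc b(2) by (cases k) auto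
 qed
 finally show ?case .
qed simp

lemma scaleR_complex_scaleC: "r *\<^sub>R (x :: 'b::complex_banach) = complex_of_real r *C x"
 by (simp add: scaleC_of_real)

lemma bounded_multiplier:
 assumes "disc_hol q" "!!w. cmod w < 1 ==> cmod (q w) <= M" shows "q : smirnov" "AE t in arc. cmod (bdry q t) <= M"
proof -
 show s: "q : smirnov" by (rule smirnov_bounded[OF assms])
 show "AE t in arc. cmod (bdry q t) <= M" using smirnov_nt_limit[OF s]
 proof eventually_elim
  case (elim t)
  show ?case
  proof (rule tendsto_upperbound[OF tendsto_norm[OF has_nt_limit_radial[OF elim norm_cis]]])
  show "\<forall>\<^sub>F r in at_left 1. cmod (q (of_real r * cis t)) <= M"
  by (rule eventually_at_leftI[of 0]) (auto intro!: assms simp: norm_mult)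
  qed simp
 qed
qed

lemma entire_bounded_on_disc:
 assumes "q holomorphic_on UNIV" obtains M where "0 <= M" "!!w. cmod w < 1 ==> cmod (q w) <= M"
proof -
 have "compact (q ` cball 0 1)"
  by (intro compact_continuous_image holomorphic_on_imp_continuous_on holomorphic_on_subset[OF assms]) auto
 then obtain B where B: "!!w. w : cball 0 1 ==> cmod (q w) <= B" using compact_imp_bounded bounded_iff by (metis imageI)
 have "cmod (q w) <= \<bar>B\<bar>" if "cmod w < 1" for w using B[of w] that by (auto intro: order_trans[of _ B])
 then show ?thesis using that[of "\<bar>B\<bar>"] by auto
qed

context interpolation_family
begin

text \<open>\<open>vderiv\<close> is a choice, so differentiability of every order has to be
  recorded separately. Bounded functionals then commute with \<open>vderiv\<close> and reduce
  identities to the scalar case.\<close>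

definition vholo :: "(complex => 'a) => bool" where
 "vholo f \<longleftrightarrow> (ALL i. ALL w:Omega. ((vderiv ^^ i) f has_derivative (%h. h *C (vderiv ^^ Suc i) f w)) (at w))"

lemma comp_psi_holomorphic: "disc_hol f ==> (%z. f (psi z)) holomorphic_on Omega"
 using holomorphic_on_compose_gen[OF psi_holomorphic, of f "ball 0 1"] by (simp add: o_def image_subset_iff)

lemma vholo_functional:
 assumes f: "vholo f" and l: "!!x y. l (x + y) = l x + l y" "!!a x. l (a *C x) = a * l x" "!!x. cmod (l x) <= norm x"
  and w: "w : Omega" shows "(deriv ^^ i) (%w. l (f w)) w = l ((vderiv ^^ i) f w)"
proof -
 have bl: "bounded_linear l" by (rule bounded_linear_functional[OF l])
 have D: "((%w. l ((vderiv ^^ i) f w)) has_field_derivative l ((vderiv ^^ Suc i) f w)) (at w)" if "w : Omega" for i w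
 proof -
  have "((%w. l ((vderiv ^^ i) f w)) has_derivative (%h. l (h *C (vderiv ^^ Suc i) f w))) (at w)"
  using f that unfolding vholo_def by (intro bounded_linear.has_derivative[OF bl]) blast
  then show ?thesis by (simp add: has_field_derivative_def l(2) mult.commute[of _ "l _"])
 qed
 show ?thesis using w
 proof (induction i arbitrary: w)
  case (Suc i)
  have "((deriv ^^ i) (%w. l (f w)) has_field_derivative l ((vderiv ^^ Suc i) f w)) (at w)"
  by (rule has_field_derivative_transform_within_open[OF D[OF Suc.prems] open_region Suc.prems])
  (simp add: Suc.IH)
  then show ?case by (simp add: DERIV_imp_deriv)
 qed simp
qed

lemma vholo_functional_holomorphic:
 assumes f: "vholo f" and l: "!!x y. l (x + y) = l x + l y" "!!a x. l (a *C x) = a * l x" "!!x. cmod (l x) <= norm x"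
 shows "(%w. l (f w)) holomorphic_on Omega"
proof -
 have bl: "bounded_linear l" by (rule bounded_linear_functional[OF l])
 have "((%w. l (f w)) has_field_derivative l (vderiv f w)) (at w)" if "w : Omega" for w
 proof -
  have "(f has_derivative (%h. h *C vderiv f w)) (at w)"
  using f that unfolding vholo_def by (auto dest: spec[of _ 0])
  from bounded_linear.has_derivative[OF bl this]
  show ?thesis by (simp add: has_field_derivative_def l(2) mult.commute[of _ "l _"])
 qed
 then show ?thesis unfolding holomorphic_on_open[OF open_region] by blast
qed

lemma vholo_functional_sc:
 assumes f: "vholo f" and l: "!!x y. l (x + y) = l x + l y" "!!a x. l (a *C x) = a * l x" "!!x. cmod (l x) <= norm x"
  and w: "w : Omega" shows "l (vc i f w) = sc i (%w. l (f w)) w"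
 using vholo_functional[OF assms, of i] by (simp add: vc_def sc_def scaleR_complex_scaleC l(2))

lemma vc_mult:
 assumes f: "vholo f" and h: "vholo h" and q: "q holomorphic_on Omega"
  and eq: "!!w. w : Omega ==> h w = q w *C f w" and z: "z : Omega"
 shows "vc n h z = (SUM k<=n. sc k q z *C vc (n - k) f z)"
proof (rule functional_eqI)
 fix l :: "'a => complex"
 assume l: "!!x y. l (x + y) = l x + l y" "!!a x. l (a *C x) = a * l x" "!!x. cmod (l x) <= norm x"
 interpret bounded_linear l by (rule bounded_linear_functional[OF l])
 have "l (vc n h z) = sc n (%w. l (h w)) z" by (rule vholo_functional_sc[OF h l z])
 also have "... = sc n (%w. q w * l (f w)) z"
  by (rule sc_cong[OF vholo_functional_holomorphic[OF h l] open_region z]) (simp add: eq l(2))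
 also have "... = (SUM k<=n. sc k q z * sc (n - k) (%w. l (f w)) z)"
  by (rule sc_mult[OF q vholo_functional_holomorphic[OF f l] open_region z])
 also have "... = l (SUM k<=n. sc k q z *C vc (n - k) f z)" by (simp add: sum l(2) vholo_functional_sc[OF f l z])
 finally show "l (vc n h z) = l (SUM k<=n. sc k q z *C vc (n - k) f z)" .
qed

lemma vc_add:
 assumes "vholo f" "vholo g" "vholo (f + g)" "z : Omega" shows "vc n (f + g) z = vc n f z + vc n g z"
proof (rule functional_eqI)
 fix l :: "'a => complex"
 assume l: "!!x y. l (x + y) = l x + l y" "!!a x. l (a *C x) = a * l x" "!!x. cmod (l x) <= norm x"
 show "l (vc n (f + g) z) = l (vc n f z + vc n g z)"
  using sc_add[OF vholo_functional_holomorphic[OF assms(1) l] vholo_functional_holomorphic[OF assms(2) l] open_region assms(4)]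
  by (simp add: vholo_functional_sc[OF _ l] assms l(1))
qed

lemma vc_scale:
 assumes "vholo f" "vholo (a *C f)" "z : Omega" shows "vc n (a *C f) z = a *C vc n f z"
proof -
 have "vc n (a *C f) z = (SUM k<=n. sc k (%_. a) z *C vc (n - k) f z)"
  by (rule vc_mult) (use assms in "auto simp: scaleC_fun_def")
 also have "... = (SUM k<=n. if k = 0 then a *C vc (n - k) f z else 0)" by (intro sum.cong) (auto simp: sc_const)
 finally show ?thesis by (simp add: sum.delta')
qed

lemma vc_diff:
 assumes "vholo f" "vholo g" "vholo (f - g)" "z : Omega" shows "vc n (f - g) z = vc n f z - vc n g z"
 using vc_add[of "f - g" g z n] assms by (simp add: algebra_simps)

lemma comb_rep_vderiv:
 assumes g: "comb_rep g n c x" and w: "w : Omega"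
 shows "(vderiv ^^ i) g w = (SUM j<n. (deriv ^^ i) (%z. c j (psi z)) w *C x j)"
  and "((vderiv ^^ i) g has_derivative (%h. h *C (SUM j<n. (deriv ^^ Suc i) (%z. c j (psi z)) w *C x j))) (at w)"
proof -
 define S where "S i w = (SUM j<n. (deriv ^^ i) (%z. c j (psi z)) w *C x j)" for i w
 have ch: "(%z. c j (psi z)) holomorphic_on Omega" if "j < n" for j
  by (rule comp_psi_holomorphic[OF smirnov_holomorphic[OF comb_repD(1)[OF g that]]])
 have D: "(S i has_derivative (%h. h *C S (Suc i) w)) (at w)" if w: "w : Omega" for i w
 proof -
  have "((%w. SUM j<n. (deriv ^^ i) (%z. c j (psi z)) w *C x j) has_derivative
  (%h. SUM j<n. ((deriv ^^ Suc i) (%z. c j (psi z)) w * h) *C x j)) (at w)"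
  proof (intro has_derivative_sum bounded_linear.has_derivative[OF bounded_linear_scaleC_left])
  fix j assume "j : {..<n}"
  then have "(deriv ^^ i) (%z. c j (psi z)) holomorphic_on Omega"
  using ch open_region by (intro holomorphic_higher_deriv) auto
  from holomorphic_derivI[OF this open_region w]
  show "((deriv ^^ i) (%z. c j (psi z)) has_derivative (*) ((deriv ^^ Suc i) (%z. c j (psi z)) w)) (at w)"
  by (simp add: has_field_derivative_def)
  qed
  moreover have "(SUM j<n. ((deriv ^^ Suc i) (%z. c j (psi z)) w * h) *C x j) = h *C S (Suc i) w" for h
  by (simp add: S_def complex_vector.scale_sum_right scaleC_scaleC mult.commute)
  ultimately show ?thesis by (simp add: S_def[abs_def])
 qed
 have eq: "(vderiv ^^ i) g w = S i w" if "w : Omega" for i w using that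
 proof (induction i arbitrary: w)
  case 0
  then show ?case using comb_repD(3)[OF g, of "psi w"] by (simp add: S_def)
 next
  case (Suc i)
  have "((vderiv ^^ i) g has_derivative (%h. h *C S (Suc i) w)) (at w)"
  by (rule has_derivative_transform_within_open[OF D[OF Suc.prems] open_region Suc.prems]) (simp add: Suc.IH)
  then show ?case by (simp add: vderiv_eqI)
 qed
 show "(vderiv ^^ i) g w = (SUM j<n. (deriv ^^ i) (%z. c j (psi z)) w *C x j)"
  using eq[OF w] by (simp add: S_def)
 have "((vderiv ^^ i) g has_derivative (%h. h *C S (Suc i) w)) (at w)"
  by (rule has_derivative_transform_within_open[OF D[OF w] open_region w]) (simp add: eq)
 then show "((vderiv ^^ i) g has_derivative (%h. h *C (SUM j<n. (deriv ^^ Suc i) (%z. c j (psi z)) w *C x j))) (at w)"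
  by (simp only: S_def)
qed

lemma G0_vholo: "g : G0 ==> vholo g" unfolding vholo_def
proof (intro allI ballI)
 fix i w assume "g : G0" and w: "w : Omega"
 then obtain n c x where g: "comb_rep g n c x" using G0E by blast
 show "((vderiv ^^ i) g has_derivative (%h. h *C (vderiv ^^ Suc i) g w)) (at w)"
  using comb_rep_vderiv(2)[OF g w, of i] comb_rep_vderiv(1)[OF g w, of "Suc i"] by simp
qed

lemma comb_rep_vc:
 assumes g: "comb_rep g n c x" and w: "w : Omega" shows "vc i g w = (SUM j<n. sc i (%z. c j (psi z)) w *C x j)"
 unfolding vc_def sc_def comb_rep_vderiv(1)[OF g w]
 by (simp add: scaleR_complex_scaleC complex_vector.scale_sum_right scaleC_scaleC)

text \<open>Cauchy estimates on circles of one fixed radius about all points near \<open>z\<close>,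
  applied after a norming functional. The uniformity in \<open>y\<close> is what allows Cauchy
  sequences of simple functions to be differentiated termwise.\<close>

lemma local_derivative_bound:
 assumes z: "z : Omega" obtains rho K where "rho > 0" "ball z rho \<subseteq> Omega"
  "!!g y i. g : GX ==> y : ball z rho ==> norm ((vderiv ^^ i) g y) <= K i * gnorm g"
proof -
 obtain e where e: "e > 0" "cball z e \<subseteq> Omega" using open_region z open_contains_cball by blast
 define rho where "rho = e / 2"
 \<comment> \<open>The Poisson integral is continuous as the real part of the holomorphic function
   \<open>herg kk\<close>, hence bounded on the compact disc.\<close>
 have "continuous_on Omega (%y. exp (pois kk (psi y)))"
 proof -
  have "continuous_on Omega (%y. exp (Re (herg kk (psi y))))"
  by (intro continuous_intros holomorphic_on_imp_continuous_on comp_psi_holomorphic herg_holomorphic kk_integrable)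
  then show ?thesis by (rule continuous_on_eq) (simp add: Re_herg kk_integrable)
 qed
 then have "compact ((%y. exp (pois kk (psi y))) ` cball z e)"
  using e by (intro compact_continuous_image) (auto intro: continuous_on_subset)
 then obtain B where B: "!!y. y : cball z e ==> norm (exp (pois kk (psi y))) <= B"
  using compact_imp_bounded bounded_iff by (metis imageI)
 have bd: "norm ((vderiv ^^ i) g y) <= (fact i * B / rho ^ i) * gnorm g" if g: "g : GX" and y: "y : ball z rho" for g y i
 proof -
  have sub: "cball y rho \<subseteq> cball z e"
  using y unfolding rho_def by (auto simp: dist_commute) (smt (verit) dist_triangle field_sum_of_halves)
  have "y : cball y rho" using e by (simp add: rho_def)
  then have yOmega: "y : Omega" using sub e by blast
  obtain l :: "'a => complex" where l: "!!x y. l (x + y) = l x + l y" "!!a x. l (a *C x) = a * l x"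
  "!!x. cmod (l x) <= norm x" "l ((vderiv ^^ i) g y) = of_real (norm ((vderiv ^^ i) g y))"
  using norming_functional[of "(vderiv ^^ i) g y"] by blast
  note vg = G0_vholo[OF GX_G0[OF g]]
  have hol: "(%w. l (g w)) holomorphic_on Omega" by (rule vholo_functional_holomorphic[OF vg l(1-3)])
  have "cmod ((deriv ^^ i) (%w. l (g w)) y) <= fact i * (B * gnorm g) / rho ^ i"
  proof (rule Cauchy_inequality)
  have sub2: "cball y rho \<subseteq> Omega" using sub e by blast
  show "(%w. l (g w)) holomorphic_on ball y rho"
  by (rule holomorphic_on_subset[OF hol]) (use sub2 ball_subset_cball[of y rho] in blast)
  show "continuous_on (cball y rho) (%w. l (g w))"
  by (rule holomorphic_on_imp_continuous_on[OF holomorphic_on_subset[OF hol sub2]])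
  show "0 < rho" using e by (simp add: rho_def)
  fix u assume "cmod (y - u) = rho"
  then have u: "u : cball z e" using sub by (auto simp: dist_norm)
  then have uOmega: "u : Omega" using e by auto
  have "cmod (l (g u)) <= norm (g (phi (psi u)))" using l(3)[of "g u"] uOmega by simp
  also have "... <= exp (pois kk (psi u)) * gnorm g" by (rule GX_eval_bound[OF g]) (use uOmega in simp)
  also have "... <= B * gnorm g" using B[OF u] gnorm_nonneg[OF g] by (intro mult_right_mono) auto
  finally show "cmod (l (g u)) <= B * gnorm g" .
  qed
  then show ?thesis using l(4) vholo_functional[OF vg l(1-3) yOmega, of i] by simp
 qed
 show ?thesis by (rule that[of rho "%i. fact i * B / rho ^ i"]) (use e bd in "auto simp: rho_def")
qed

text \<open>Induction on the order: by \<open>local_derivative_bound\<close> the next derivatives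
  are uniformly Cauchy near each point, so \<open>has_derivative_sequence\<close> differentiates the
  limit.\<close>

lemma repr_vderiv:
 assumes gs: "repr gs f" and z: "z : Omega" shows "(%m. (vderiv ^^ i) (gs m) z) ----> (vderiv ^^ i) f z"
  and "((vderiv ^^ i) f has_derivative (%h. h *C (vderiv ^^ Suc i) f z)) (at z)"
proof -
 note G = repr_GX[OF gs]
 have vd: "((vderiv ^^ i) (gs n) has_derivative (%h. h *C (vderiv ^^ Suc i) (gs n) x)) (at x)" if "x : Omega" for i n x
  using G0_vholo[OF GX_G0[OF G[of n]]] that by (auto simp: vholo_def)
 have step: "((vderiv ^^ i) f has_derivative (%h. h *C (vderiv ^^ Suc i) f z)) (at z) &
  (%m. (vderiv ^^ Suc i) (gs m) z) ----> (vderiv ^^ Suc i) f z"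
  if IH: "!!w. w : Omega ==> (%m. (vderiv ^^ i) (gs m) w) ----> (vderiv ^^ i) f w" and z: "z : Omega" for i z
 proof -
  obtain rho K where rho: "rho > 0" "ball z rho \<subseteq> Omega"
  and K: "!!g y i. g : GX ==> y : ball z rho ==> norm ((vderiv ^^ i) g y) <= K i * gnorm g"
  using local_derivative_bound[OF z] by metis
  define D where "D m x = (vderiv ^^ Suc i) (gs m) x" for m x
  have Dd: "norm (D l x - D m x) <= K (Suc i) * gnorm (gs l - gs m)" if x: "x : ball z rho" for l m x
  proof -
  have xOmega: "x : Omega" using x rho by auto
  have vh: "vholo (gs l)" "vholo (gs m)" "vholo (gs l - gs m)" by (intro G0_vholo GX_G0 GX_minus G)+
  have "vc (Suc i) (gs l - gs m) x = vc (Suc i) (gs l) x - vc (Suc i) (gs m) x" by (rule vc_diff[OF vh xOmega])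
  then have "(vderiv ^^ Suc i) (gs l - gs m) x = D l x - D m x"
  unfolding vc_def D_def scaleR_diff_right[symmetric] by (simp del: funpow.simps fact_Suc)
  then show ?thesis using K[OF GX_minus(1)[OF G G] x, of "Suc i" l m] by simp
  qed
  have ev: "EX M. ALL l>=M. ALL m>=M. ALL x:ball z rho. norm (D l x - D m x) <= e" if e: "e > 0" for e
  proof -
  obtain M where M: "!!l m. l >= M ==> m >= M ==> gnorm (gs l - gs m) < e / (\<bar>K (Suc i)\<bar> + 1)"
  using repr_cauchy[OF gs, of "e / (\<bar>K (Suc i)\<bar> + 1)"] e by auto
  have "norm (D l x - D m x) <= e" if "l >= M" "m >= M" "x : ball z rho" for l m x
  proof -
  have "K (Suc i) * gnorm (gs l - gs m) <= (\<bar>K (Suc i)\<bar> + 1) * gnorm (gs l - gs m)"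
  by (intro mult_right_mono gnorm_nonneg GX_minus G) auto
  also have "... <= (\<bar>K (Suc i)\<bar> + 1) * (e / (\<bar>K (Suc i)\<bar> + 1))"
  using M[OF that(1,2)] by (intro mult_left_mono) auto
  finally show ?thesis using Dd[OF that(3), of l m] by simp
  qed
  then show ?thesis by blast
  qed
  define D' where "D' x = lim (%m. D m x)" for x
  have lim: "(%m. D m x) ----> D' x" if x: "x : ball z rho" for x
  proof -
  have "Cauchy (%m. D m x)"
  proof (rule CauchyI)
  fix e :: real assume "e > 0"
  then obtain M where "ALL l>=M. ALL m>=M. ALL x:ball z rho. norm (D l x - D m x) <= e / 2" using ev[of "e / 2"] by auto
  then have "ALL l>=M. ALL m>=M. norm (D l x - D m x) < e" using x \<open>e > 0\<close> by (auto intro: le_less_trans[of _ "e / 2"])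
  then show "EX M. ALL m>=M. ALL n>=M. norm (D m x - D n x) < e" by blast
  qed
  then show ?thesis by (simp add: D'_def Cauchy_convergent_iff convergent_LIMSEQ_iff)
  qed
  have zz: "z : ball z rho" using rho by simp
  have "EX g. ALL x:ball z rho. (%n. (vderiv ^^ i) (gs n) x) ----> g x & (g has_derivative (%h. h *C D' x)) (at x within ball z rho)"
  proof (rule has_derivative_sequence[where f="%n. (vderiv ^^ i) (gs n)" and f'="%n x h. h *C D n x"
  and g'="%x h. h *C D' x", OF _ _ _ zz IH[OF z]])
  show "convex (ball z rho)" by simp
  show "((vderiv ^^ i) (gs n) has_derivative (%h. h *C D n x)) (at x within ball z rho)" if "x : ball z rho" for n x
  unfolding D_def by (rule has_derivative_at_withinI[OF vd]) (use that rho in auto)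
  fix e :: real assume e: "e > 0"
  then obtain M where M: "ALL l>=M. ALL m>=M. ALL x:ball z rho. norm (D l x - D m x) <= e" using ev by blast
  show "\<forall>\<^sub>F n in sequentially. ALL x:ball z rho. ALL h. norm (h *C D n x - h *C D' x) <= e * norm h"
  proof (rule eventually_sequentiallyI[of M], intro ballI allI)
  fix n x and h :: complex assume n: "M <= n" and x: "x : ball z rho"
  have "norm (D n x - D' x) <= e"
  proof (rule tendsto_upperbound[OF tendsto_norm[OF tendsto_diff[OF tendsto_const lim[OF x]]]])
  show "\<forall>\<^sub>F m in sequentially. norm (D n x - D m x) <= e"
  by (rule eventually_sequentiallyI[of M]) (use M n x in auto)
  qed simp
  then show "norm (h *C D n x - h *C D' x) <= e * norm h"
  by (simp add: norm_scaleC mult.commute[of e] mult_left_mono flip: complex_vector.scale_right_diff_distrib)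
  qed
  qed
  then obtain g where g: "!!x. x : ball z rho ==> (%n. (vderiv ^^ i) (gs n) x) ----> g x"
  "!!x. x : ball z rho ==> (g has_derivative (%h. h *C D' x)) (at x within ball z rho)" by blast
  have ge: "g x = (vderiv ^^ i) f x" if "x : ball z rho" for x using LIMSEQ_unique[OF g(1)[OF that] IH] that rho by auto
  have "(g has_derivative (%h. h *C D' z)) (at z)" using g(2)[OF zz] at_within_open[OF zz open_ball] by simp
  then have d: "((vderiv ^^ i) f has_derivative (%h. h *C D' z)) (at z)"
  by (rule has_derivative_transform_within_open[OF _ open_ball zz]) (rule ge)
  then have "(vderiv ^^ Suc i) f z = D' z" by (simp add: vderiv_eqI)
  then show ?thesis using d lim[OF zz] by (simp add: D_def)
 qed
 have conv: "(%m. (vderiv ^^ i) (gs m) w) ----> (vderiv ^^ i) f w" if "w : Omega" for w i using that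
 proof (induction i arbitrary: w)
  case 0 then show ?case using repr_lim[OF gs] by simp
 next
  case (Suc i) then show ?case using step[OF Suc.IH] by blast
 qed
 show "(%m. (vderiv ^^ i) (gs m) z) ----> (vderiv ^^ i) f z" by (rule conv[OF z])
 show "((vderiv ^^ i) f has_derivative (%h. h *C (vderiv ^^ Suc i) f z)) (at z)" using step[OF conv z] by blast
qed

lemma FX_vholo: "f : FX ==> vholo f" using repr_vderiv(2) unfolding FX_iff vholo_def by blast

lemma FX_vc_bound:
 assumes z: "z : Omega" obtains K where "!!f. f : FX ==> norm (vc i f z) <= K * fnorm f"
proof -
 obtain rho K where rho: "rho > 0" "ball z rho \<subseteq> Omega"
  and K: "!!g y i. g : GX ==> y : ball z rho ==> norm ((vderiv ^^ i) g y) <= K i * gnorm g"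
  using local_derivative_bound[OF z] by metis
 have "norm (vc i f z) <= (1 / fact i * K i) * fnorm f" if f: "f : FX" for f
 proof -
  obtain gs where gs: "repr gs f" using f by (auto simp: FX_iff)
  have "norm ((vderiv ^^ i) f z) <= K i * fnorm f"
  proof (rule tendsto_le[OF _ tendsto_mult[OF tendsto_const fnorm_repr[OF gs]] tendsto_norm[OF repr_vderiv(1)[OF gs z]]])
  show "\<forall>\<^sub>F m in sequentially. norm ((vderiv ^^ i) (gs m) z) <= K i * gnorm (gs m)"
  by (intro always_eventually allI K repr_GX[OF gs]) (use rho in simp)
  qed simp
  then show ?thesis by (simp add: vc_def divide_right_mono)
 qed
 then show ?thesis using that by blast
qed

lemma FX_cong:
 assumes "f : FX" "!!z. z : Omega ==> f' z = f z" shows "f' : FX" "fnorm f' = fnorm f"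
proof -
 obtain gs where gs: "repr gs f" using assms(1) by (auto simp: FX_iff)
 then have "repr gs f'" using assms(2) by (simp add: represents_def)
 then show "f' : FX" "fnorm f' = fnorm f" using LIMSEQ_unique[OF fnorm_repr fnorm_repr[OF gs]] by (auto simp: FX_iff)
qed

end

subsection \<open>Normed spaces given by carriers\<close>

lemma normed_space_onD:
 assumes "normed_space_on V" shows "complex_vector.subspace (points V)" "x : points V ==> 0 <= nrm V x"
  "x : points V ==> nrm V x = 0 \<longleftrightarrow> x = 0" "x : points V ==> nrm V (a *C x) = cmod a * nrm V x"
  "x : points V ==> y : points V ==> nrm V (x + y) <= nrm V x + nrm V y"
 using assms unfolding normed_space_on_def by auto

lemma dual_pointsD:
 assumes "f : points (dual_space V)"
 shows "x : points V ==> y : points V ==> f (x + y) = f x + f y" "x : points V ==> f (a *C x) = a * f x"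
  "x ~: points V ==> f x = 0"
 using assms by (auto simp: dual_space_def bounded_operator_def linear_between_def scaleC_complex_def)

lemma dual_pointsI:
 assumes "!!x y. x : points V ==> y : points V ==> f (x + y) = f x + f y"
  "!!x a. x : points V ==> f (a *C x) = a * f x" "!!x. x ~: points V ==> f x = 0"
  "!!x. x : points V ==> cmod (f x) <= C * nrm V x" shows "f : points (dual_space V)"
 using assms(1-3) exI[of "%C. ALL x:points V. cmod (f x) <= C * nrm V x" C] assms(4)
 by (auto simp: dual_space_def bounded_operator_def linear_between_def scaleC_complex_def)

lemma dual_norm:
 assumes V: "normed_space_on V" and f: "f : points (dual_space V)"
 shows "0 <= nrm (dual_space V) f" "x : points V ==> cmod (f x) <= nrm (dual_space V) f * nrm V x"
  "0 <= C ==> (!!x. x : points V ==> cmod (f x) <= C * nrm V x) ==> nrm (dual_space V) f <= C"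
proof -
 note N = normed_space_onD[OF V]
 note L = dual_pointsD[OF f]
 define S where "S = {cmod (f x) | x. x : points V & nrm V x <= 1}"
 have eq: "nrm (dual_space V) f = Sup S" by (simp add: dual_space_def S_def)
 obtain K where K: "!!x. x : points V ==> cmod (f x) <= K * nrm V x"
  using f by (auto simp: dual_space_def bounded_operator_def)
 have z: "0 : points V" by (rule complex_vector.subspace_0[OF N(1)])
 have f0: "f 0 = 0" using L(2)[OF z, of 0] by simp
 have "0 : S" unfolding S_def using z f0 N(3)[OF z] by (intro CollectI exI[of _ 0]) auto
 have bdd: "bdd_above S"
 proof (rule bdd_aboveI[of _ "\<bar>K\<bar>"])
  fix s assume "s : S"
  then obtain x where x: "s = cmod (f x)" "x : points V" "nrm V x <= 1" by (auto simp: S_def)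
  have "s <= \<bar>K\<bar> * nrm V x" using K[OF x(2)] mult_right_mono[OF abs_ge_self[of K] N(2)[OF x(2)]] by (simp add: x(1))
  also have "... <= \<bar>K\<bar> * 1" using x(3) by (intro mult_left_mono) auto
  finally show "s <= \<bar>K\<bar>" by simp
 qed
 show n0: "0 <= nrm (dual_space V) f" unfolding eq by (rule cSup_upper[OF \<open>0 : S\<close> bdd])
 show "cmod (f x) <= nrm (dual_space V) f * nrm V x" if x: "x : points V"
 proof (cases "nrm V x = 0")
  case True
  then show ?thesis using K[OF x] by simp
 next
  case False
  then have p: "0 < nrm V x" using N(2)[OF x] by simp
  define y where "y = of_real (1 / nrm V x) *C x"
  have y: "y : points V" unfolding y_def by (rule complex_vector.subspace_scale[OF N(1) x])
  have "nrm V y = 1" unfolding y_def N(4)[OF x] using p by (simp add: norm_divide)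
  then have "cmod (f y) : S" using y by (auto simp: S_def)
  then have "cmod (f y) <= Sup S" by (rule cSup_upper[OF _ bdd])
  moreover have "cmod (f y) = cmod (f x) / nrm V x"
  unfolding y_def L(2)[OF x] using p by (simp add: norm_mult norm_divide)
  ultimately show ?thesis unfolding eq using p by (simp add: divide_le_eq)
 qed
 assume C: "0 <= C" "!!x. x : points V ==> cmod (f x) <= C * nrm V x"
 show "nrm (dual_space V) f <= C" unfolding eq
 proof (rule cSup_least)
  show "S ~= {}" using \<open>0 : S\<close> by blast
  fix s assume "s : S"
  then obtain x where x: "s = cmod (f x)" "x : points V" "nrm V x <= 1" by (auto simp: S_def)
  show "s <= C" using C(2)[OF x(2)] x mult_left_mono[OF x(3) C(1)] by simp
 qed
qed

lemma normed_space_on_dual: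
 assumes V: "normed_space_on V" shows "normed_space_on (dual_space V)"
proof -
 note N = normed_space_onD[OF V]
 have add: "f + g : points (dual_space V)" "nrm (dual_space V) (f + g) <= nrm (dual_space V) f + nrm (dual_space V) g"
  if f: "f : points (dual_space V)" and g: "g : points (dual_space V)" for f g
 proof -
  have b: "cmod ((f + g) x) <= (nrm (dual_space V) f + nrm (dual_space V) g) * nrm V x" if "x : points V" for x
  using dual_norm(2)[OF V f that] dual_norm(2)[OF V g that] norm_triangle_ineq[of "f x" "g x"]
  by (simp add: distrib_right)
  show fg: "f + g : points (dual_space V)"
  by (rule dual_pointsI[OF _ _ _ b]) (auto simp: dual_pointsD[OF f] dual_pointsD[OF g] distrib_left)
  show "nrm (dual_space V) (f + g) <= nrm (dual_space V) f + nrm (dual_space V) g"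
  by (rule dual_norm(3)[OF V fg _ b]) (intro add_nonneg_nonneg dual_norm(1) V f g)
 qed
 have sc: "a *C f : points (dual_space V)" "nrm (dual_space V) (a *C f) <= cmod a * nrm (dual_space V) f"
  if f: "f : points (dual_space V)" for a f
 proof -
  have b: "cmod ((a *C f) x) <= (cmod a * nrm (dual_space V) f) * nrm V x" if "x : points V" for x
  using mult_left_mono[OF dual_norm(2)[OF V f that], of "cmod a"]
  by (simp add: scaleC_fun_def scaleC_complex_def norm_mult mult.assoc)
  show af: "a *C f : points (dual_space V)" by (rule dual_pointsI[OF _ _ _ b])
  (auto simp: dual_pointsD[OF f] scaleC_fun_def scaleC_complex_def distrib_left)
  show "nrm (dual_space V) (a *C f) <= cmod a * nrm (dual_space V) f"
  by (rule dual_norm(3)[OF V af _ b]) (intro mult_nonneg_nonneg norm_ge_zero dual_norm(1) V f)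
 qed
 have z: "0 : points (dual_space V)" by (rule dual_pointsI[of _ _ 0]) auto
 have sceq: "nrm (dual_space V) (a *C f) = cmod a * nrm (dual_space V) f" if f: "f : points (dual_space V)" for a f
 proof (cases "a = 0")
  case True
  then show ?thesis using sc[OF f, of 0] dual_norm(1)[OF V z] by auto
 next
  case False
  have "nrm (dual_space V) (inverse a *C (a *C f)) <= cmod (inverse a) * nrm (dual_space V) (a *C f)"
  by (rule sc(2)[OF sc(1)[OF f]])
  then show ?thesis using sc(2)[OF f, of a] False
  by (simp add: scaleC_scaleC scaleC_one norm_inverse) (simp add: field_simps)
 qed
 have "nrm (dual_space V) f = 0 \<longleftrightarrow> f = 0" if f: "f : points (dual_space V)" for f
 proof
  assume "nrm (dual_space V) f = 0"
  then have "f x = 0" for x using dual_norm(2)[OF V f, of x] dual_pointsD(3)[OF f, of x] by (cases "x : points V") auto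
  then show "f = 0" by (simp add: fun_eq_iff)
 next
  assume "f = 0"
  then show "nrm (dual_space V) f = 0" using sceq[OF z, of 0] by simp
 qed
 then show ?thesis unfolding normed_space_on_def complex_vector.subspace_def
  by (intro conjI ballI allI) (simp_all add: add sc(1) sceq z dual_norm(1)[OF V])
qed

lemma lipschitz_continuous_map:
 assumes V: "Metric_space V d" and W: "Metric_space W d'" and f: "f ` V \<subseteq> W"
  and C: "!!x y. x : V ==> y : V ==> d' (f x) (f y) <= C * d x y"
 shows "continuous_map (Metric_space.mtopology V d) (Metric_space.mtopology W d') f"
 unfolding Metric_space.metric_continuous_map[OF V W]
proof (intro conjI ballI allI impI f)
 fix x and e :: real assume x: "x : V" and e: "0 < e"
 show "EX delta>0. ALL y. y : V & d x y < delta --> d' (f x) (f y) < e"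
 proof (intro exI[of _ "e / (\<bar>C\<bar> + 1)"] conjI allI impI)
  fix y assume y: "y : V & d x y < e / (\<bar>C\<bar> + 1)"
  have "d' (f x) (f y) <= C * d x y" using C x y by blast
  also have "... <= (\<bar>C\<bar> + 1) * d x y" by (intro mult_right_mono Metric_space.nonneg[OF V]) auto
  also have "... < e" using y by (simp add: field_simps)
  finally show "d' (f x) (f y) < e" .
 qed (use e in auto)
qed

lemma linear_homeomorphismI:
 assumes V: "normed_space_on V" and W: "normed_space_on W" and lin: "linear_between V W f"
  and C: "!!x. x : points V ==> nrm W (f x) <= C * nrm V x" and D: "!!x. x : points V ==> nrm V x <= D * nrm W (f x)"
  and onto: "points W \<subseteq> f ` points V" shows "linear_homeomorphism V W f"
proof -
 note NV = normed_space_onD[OF V] and NW = normed_space_onD[OF W]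
 interpret VM: Metric_space "points V" "norm_dist V" by (rule Metric_space_norm_dist[OF V])
 interpret WM: Metric_space "points W" "norm_dist W" by (rule Metric_space_norm_dist[OF W])
 have fW: "f x : points W" if "x : points V" for x using lin that by (auto simp: linear_between_def)
 have fdiff: "f (x - y) = f x - f y" if "x : points V" "y : points V" for x y
 proof -
  have "f (x + (-1) *C y) = f x + f ((-1) *C y)" "f ((-1) *C y) = (-1) *C f y"
  using lin that complex_vector.subspace_scale[OF NV(1) that(2), of "-1"] unfolding linear_between_def by blast+
  then show ?thesis by simp
 qed
 have dV: "x - y : points V" if "x : points V" "y : points V" for x y
  by (rule complex_vector.subspace_diff[OF NV(1) that])
 have d1: "norm_dist W (f x) (f y) <= C * norm_dist V x y" if "x : points V" "y : points V" for x y
  using C[OF dV[OF that]] that by (simp add: norm_dist_def fW fdiff)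
 have d2: "norm_dist V x y <= D * norm_dist W (f x) (f y)" if "x : points V" "y : points V" for x y
  using D[OF dV[OF that]] that by (simp add: norm_dist_def fW fdiff)
 have inj: "inj_on f (points V)"
 proof (rule inj_onI)
  fix x y assume xy: "x : points V" "y : points V" "f x = f y"
  then have "norm_dist V x y <= 0" using d2[of x y] by (simp add: WM.mdist_zero fW)
  then show "x = y" using xy VM.zero[of x y] VM.nonneg[of x y] by simp
 qed
 have img: "f ` points V = points W" using fW onto by auto
 define g where "g = inv_into (points V) f"
 have gf: "g (f x) = x" if "x : points V" for x unfolding g_def by (rule inv_into_f_f[OF inj that])
 have gV: "g y : points V" and fg: "f (g y) = y" if "y : points W" for y
  using that img unfolding g_def by (auto intro: inv_into_into f_inv_into_f)
 have cf: "continuous_map VM.mtopology WM.mtopology f"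
  by (rule lipschitz_continuous_map[OF VM.Metric_space_axioms WM.Metric_space_axioms]) (use fW d1 in auto)
 have "norm_dist V (g x) (g y) <= D * norm_dist W x y" if "x : points W" "y : points W" for x y
  using d2[OF gV gV] fg that by metis
 then have cg: "continuous_map WM.mtopology VM.mtopology g"
  by (intro lipschitz_continuous_map[OF WM.Metric_space_axioms VM.Metric_space_axioms]) (use gV in auto)
 have "homeomorphic_maps VM.mtopology WM.mtopology f g" unfolding homeomorphic_maps_def using cf cg gf fg by simp
 then have "homeomorphic_map (norm_topology V) (norm_topology W) f"
  unfolding norm_topology_def by (rule homeomorphic_maps_imp_map)
 then show ?thesis using V W lin by (simp add: linear_homeomorphism_def)
qed

subsection \<open>Division and density\<close>

lemma holomorphic_factor:
 assumes "disc_hol R" "cmod a < 1" "R a = 0" obtains R1 where "disc_hol R1" "!!w. R w = (w - a) * R1 w"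
proof -
 define R1 where "R1 w = (if w = a then deriv R a else R w / (w - a))" for w
 have "disc_hol R1" by (rule pole_theorem_open_0[OF assms(1)]) (use assms in "auto simp: R1_def")
 moreover have "R w = (w - a) * R1 w" for w using assms(3) by (simp add: R1_def)
 ultimately show ?thesis using that by blast
qed

lemma sc_shift_power: "sc i (%w. (w - z) ^ j) z = (if i = j then 1 else 0)"
proof -
 have b: "sc k (%w. w - z) z = (if k = 1 then 1 else 0)" for k
 proof (cases k)
  case (Suc m)
  have "deriv (%w. w - z) = (%_. 1)" by (rule ext) (auto intro!: DERIV_imp_deriv derivative_eq_intros)
  then have "(deriv ^^ Suc m) (%w. w - z) z = (deriv ^^ m) (%_. 1) z" by (simp only: funpow_Suc_right o_apply)
  then show ?thesis using Suc by (simp add: sc_def higher_deriv_const del: funpow.simps)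
 qed simp
 show ?thesis
 proof (induction j arbitrary: i)
  case 0 then show ?case by (simp add: sc_const)
 next
  case (Suc j)
  have "sc i (%w. (w - z) ^ Suc j) z = (SUM k<=i. sc k (%w. w - z) z * sc (i - k) (%w. (w - z) ^ j) z)"
  unfolding power_Suc by (rule sc_mult[of _ UNIV]) (auto intro!: holomorphic_intros)
  also have "... = (SUM k<=i. if k = 1 then (if i - 1 = j then 1 else 0) else 0)"
  by (intro sum.cong refl) (auto simp: b Suc)
  also have "... = (if i = Suc j then 1 else 0)" by (cases i) (auto simp: sum.delta)
  finally show ?case .
 qed
qed

context interpolation_family
begin

lemma comp_conf_holomorphic: "r holomorphic_on Omega ==> disc_hol (%w. r (phi w))"
 using holomorphic_on_compose_gen[OF conf_holomorphic, of r Omega] conf_image by (simp add: o_def)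

text \<open>On an unbounded region \<open>u\<close> need not be a bounded multiplier. Repeated
  division in the disc produces a polynomial in \<open>psi w - psi z\<close> with the same jet at
  \<open>z\<close>, and an entire function of \<open>psi w\<close> is bounded.\<close>

lemma taylor_multiplier:
 assumes u: "u holomorphic_on Omega" and z: "z : Omega"
 obtains q r where "q holomorphic_on UNIV" "r holomorphic_on Omega"
  "!!w. w : Omega ==> u w = q (psi w) + (psi w - psi z) ^ n * r w"
proof -
 have "EX q r. q holomorphic_on UNIV & r holomorphic_on Omega & (ALL w:Omega. u w = q (psi w) + (psi w - psi z) ^ n * r w)"
 proof (induction n)
  case 0
  show ?case by (rule exI[of _ "%_. 0"], rule exI[of _ u]) (use u in auto)
 next
  case (Suc n)
  then obtain q r where q: "q holomorphic_on UNIV" and r: "r holomorphic_on Omega"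
  and e: "!!w. w : Omega ==> u w = q (psi w) + (psi w - psi z) ^ n * r w" by blast
  have "disc_hol (%w. r (phi w) - r z)" by (intro holomorphic_intros comp_conf_holomorphic r)
  then obtain R1 where R1: "disc_hol R1" "!!w. r (phi w) - r z = (w - psi z) * R1 w"
  by (rule holomorphic_factor[of _ "psi z"]) (use z in auto)
  show ?case
  proof (intro exI conjI ballI)
  show "(%w. q w + (w - psi z) ^ n * r z) holomorphic_on UNIV" by (intro holomorphic_intros q)
  show "(%w. R1 (psi w)) holomorphic_on Omega" by (rule comp_psi_holomorphic[OF R1(1)])
  fix w assume w: "w : Omega"
  have "r w = r z + (psi w - psi z) * R1 (psi w)" using R1(2)[of "psi w"] w by (simp add: algebra_simps)
  then show "u w = (q (psi w) + (psi w - psi z) ^ n * r z) + (psi w - psi z) ^ Suc n * R1 (psi w)"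
  unfolding e[OF w] by (simp only: \<open>r w = _\<close>) (simp add: algebra_simps)
  qed
 qed
 then show ?thesis using that by blast
qed

lemma beta_holomorphic: "(%w. psi w - a) holomorphic_on Omega" by (intro holomorphic_intros psi_holomorphic)

lemma taylor_multiplier_sc:
 assumes "u holomorphic_on Omega" "z : Omega"
 obtains q where "q holomorphic_on UNIV" "!!i. i < n ==> sc i (%w. q (psi w)) z = sc i u z"
  "EX r. r holomorphic_on Omega & (ALL w:Omega. u w = q (psi w) + (psi w - psi z) ^ n * r w)"
proof -
 obtain q r where q: "q holomorphic_on UNIV" and r: "r holomorphic_on Omega"
  and e: "!!w. w : Omega ==> u w = q (psi w) + (psi w - psi z) ^ n * r w"
  using taylor_multiplier[OF assms, of n] by blast
 have qh: "(%w. q (psi w)) holomorphic_on Omega" by (rule comp_psi_holomorphic[OF holomorphic_on_subset[OF q]]) simp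
 have rh: "(%w. (psi w - psi z) ^ n * r w) holomorphic_on Omega" by (intro holomorphic_intros psi_holomorphic r)
 have "sc i u z = sc i (%w. q (psi w)) z" if "i < n" for i
 proof -
  have "sc i u z = sc i (%w. q (psi w) + (psi w - psi z) ^ n * r w) z"
  by (rule sc_cong[OF assms(1) open_region assms(2) e])
  also have "... = sc i (%w. q (psi w)) z + sc i (%w. (psi w - psi z) ^ n * r w) z"
  by (rule sc_add[OF qh rh open_region assms(2)])
  also have "sc i (%w. (psi w - psi z) ^ n * r w) z = 0"
  by (rule sc_power_vanish[OF beta_holomorphic _ r open_region assms(2) that]) simp
  finally show ?thesis by simp
 qed
 then show ?thesis using that[OF q] r e by auto
qed

lemma vc_power_vanish:
 assumes "vholo f" "vholo h" "!!w. w : Omega ==> h w = (psi w - psi z) ^ n *C f w" "z : Omega" "i < n"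
 shows "vc i h z = 0"
proof -
 have "(%w. (psi w - psi z) ^ n) holomorphic_on Omega" by (intro holomorphic_intros psi_holomorphic)
 then have "vc i h z = (SUM k<=i. sc k (%w. (psi w - psi z) ^ n) z *C vc (i - k) f z)"
  using assms by (intro vc_mult) auto
 also have "... = 0"
 proof (rule sum.neutral, rule ballI)
  fix k assume "k : {..i}"
  then have "k < n" using assms(5) by simp
  then have "sc k (%w. (psi w - psi z) ^ n * 1) z = 0"
  by (intro sc_power_vanish[OF beta_holomorphic _ _ open_region assms(4)]) auto
  then show "sc k (%w. (psi w - psi z) ^ n) z *C vc (i - k) f z = 0" by simp
 qed
 finally show ?thesis .
qed

text \<open>The vectors \<open>x j\<close> need not be independent, so the single coefficients need
  not vanish at \<open>psi z\<close>. Subtracting their values there subtracts 0 in total, and each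
  difference is divisible.\<close>

lemma G0_div:
 assumes g: "g : G0" and z: "z : Omega" "g z = 0"
 obtains g' where "g' : G0" "!!w. cmod w < 1 ==> g (phi w) = (w - psi z) *C g' (phi w)"
proof -
 obtain n c x where g: "comb_rep g n c x" by (rule G0E[OF g])
 note r = comb_repD[OF g]
 have a: "cmod (psi z) < 1" using z by simp
 have "EX d. d : smirnov & (ALL w. cmod w < 1 --> c j w - c j (psi z) = (w - psi z) * d w)" if "j < n" for j
 proof -
  have "(%w. c j w - c j (psi z)) : smirnov" by (intro smirnov_diff smirnov_const r that)
  then obtain d where "d : smirnov" "!!w. cmod w < 1 ==> c j w - c j (psi z) = (w - psi z) * d w"
  by (rule smirnov_div[OF _ a]) auto
  then show ?thesis by blast
 qed
 then obtain d where d: "!!j. j < n ==> d j : smirnov"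
  "!!j w. j < n ==> cmod w < 1 ==> c j w - c j (psi z) = (w - psi z) * d j w" by metis
 have "(%v. SUM j<n. d j (psi v) *C x j) : G0" by (rule G0I[of n d x]) (use d r in auto)
 moreover have "g (phi w) = (w - psi z) *C (SUM j<n. d j (psi (phi w)) *C x j)" if w: "cmod w < 1" for w
 proof -
  have "(SUM j<n. c j (psi z) *C x j) = 0" using r(3)[OF a] z by simp
  then have "g (phi w) = (SUM j<n. c j w *C x j) - (SUM j<n. c j (psi z) *C x j)" using r(3)[OF w] by simp
  also have "... = (SUM j<n. (c j w - c j (psi z)) *C x j)"
  by (simp add: complex_vector.scale_left_diff_distrib sum_subtractf)
  also have "... = (w - psi z) *C (SUM j<n. d j (psi (phi w)) *C x j)"
  using d(2) w by (simp add: complex_vector.scale_sum_right scaleC_scaleC)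
  finally show ?thesis .
 qed
 ultimately show ?thesis using that by blast
qed

lemma smirnov_shift: "(%w. w - a) : smirnov" by (rule smirnov_bounded[of _ "1 + cmod a"])
  (auto intro!: holomorphic_intros intro: order_trans[OF norm_triangle_ineq4])

lemma nt_limit_shift: "bdry (%w. w - a) t = cis t - a"
 by (rule nt_limit_eqI[OF has_nt_limit_isCont[where f="%w. w - a"]]) (auto intro!: continuous_intros)

text \<open>On the circle \<open>|cis t - psi z| >= 1 - |psi z|\<close>, so the division costs at
  most this constant.\<close>

lemma GX_div_norm:
 assumes g: "g : GX" "g' : G0" and z: "z : Omega"
  and eq: "!!w. cmod w < 1 ==> g (phi w) = (w - psi z) *C g' (phi w)"
 shows "g' : GX" "gnorm g' <= gnorm g / (1 - cmod (psi z))"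
proof -
 have b: "AE t in arc. bval g t = bdry (%w. w - psi z) t *C bval g' t"
  by (rule bval_mult[OF smirnov_shift g(2) eq])
 have a: "cmod (psi z) < 1" using z by simp
 have "AE t in arc. bnorm t (bval g' t) <= gnorm g / (1 - cmod (psi z))"
  using b gnorm_AE[OF g(1)] AE_good G0_bval[OF g(2)]
 proof eventually_elim
  case (elim t)
  have "(1 - cmod (psi z)) * bnorm t (bval g' t) <= cmod (cis t - psi z) * bnorm t (bval g' t)"
  using elim by (intro mult_right_mono cmod_cis_diff_ge bnorm_nonneg) auto
  also have "... = bnorm t (bval g t)" using elim by (simp add: nt_limit_shift bnorm_scale)
  finally show ?case using elim(2) a by (simp add: pos_le_divide_eq mult.commute)
 qed
 with GXI[OF g(2)] show "g' : GX" "gnorm g' <= gnorm g / (1 - cmod (psi z))" by auto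
qed

text \<open>Admissibility supplies simple functions vanishing at \<open>z\<close> that approximate
  \<open>f\<close>. They can be divided explicitly, and by \<open>GX_div_norm\<close> the quotients
  form a Cauchy sequence again.\<close>

lemma FX_div:
 assumes adm: "admissible X" and f: "f : FX" and z: "z : Omega" "f z = 0"
 obtains f' where "f' : FX" "!!w. w : Omega ==> f w = (psi w - psi z) *C f' w"
proof -
 have "EX g. g : GX & g z = 0 & fnorm (f - g) < inverse (real (Suc l))" for l
  using adm f z unfolding admissible_def by (metis inverse_positive_iff_positive of_nat_0_less_iff zero_less_Suc)
 then obtain g where g: "!!l. g l : GX" "!!l. g l z = 0" "!!l. fnorm (f - g l) < inverse (real (Suc l))" by metis
 have "EX g'. g' : G0 & (ALL w. cmod w < 1 --> g l (phi w) = (w - psi z) *C g' (phi w))" for l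
  using G0_div[OF GX_G0[OF g(1)] z(1) g(2)] by metis
 then obtain g' where g': "!!l. g' l : G0" "!!l w. cmod w < 1 ==> g l (phi w) = (w - psi z) *C g' l (phi w)" by metis
 have a: "0 < 1 - cmod (psi z)" using z by simp
 have G': "g' l : GX" for l by (rule GX_div_norm(1)[OF g(1) g'(1) z(1) g'(2)])
 have dn: "gnorm (g' l - g' m) <= gnorm (g l - g m) / (1 - cmod (psi z))" for l m
  by (rule GX_div_norm(2)[OF GX_minus(1)[OF g(1) g(1)] GX_G0[OF GX_minus(1)[OF G' G']] z(1)])
  (simp add: g'(2) complex_vector.scale_right_diff_distrib)
 have gd: "gnorm (g l - g m) <= inverse (real (Suc m)) + inverse (real (Suc l))" for l m
 proof -
  have fg: "f - g l : FX" for l by (intro FX_diff f GX_FX g)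
  have "fnorm (g l - g m) = gnorm (g l - g m)" by (intro fnorm_GX GX_minus g)
  moreover have "g l - g m = (f - g m) - (f - g l)" by simp
  then have "fnorm (g l - g m) <= fnorm (f - g m) + fnorm (f - g l)" using FX_diff(2)[OF fg fg] by metis
  ultimately show ?thesis using g(3)[of l] g(3)[of m] by linarith
 qed
 have C': "EX M. ALL l>=M. ALL m>=M. gnorm (g' l - g' m) < e" if e: "e > 0" for e
 proof -
  obtain M where M: "inverse (real (Suc M)) < e * (1 - cmod (psi z)) / 2"
  using reals_Archimedean[of "e * (1 - cmod (psi z)) / 2"] e a by auto
  have "gnorm (g' l - g' m) < e" if "l >= M" "m >= M" for l m
  proof -
  have "inverse (real (Suc l)) <= inverse (real (Suc M))" "inverse (real (Suc m)) <= inverse (real (Suc M))"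
  using that by (auto intro!: le_imp_inverse_le)
  then have "gnorm (g l - g m) < e * (1 - cmod (psi z))" using gd[of l m] M by linarith
  then have "gnorm (g l - g m) / (1 - cmod (psi z)) < e" using a by (simp add: pos_divide_less_eq)
  then show ?thesis using dn[of l m] by linarith
  qed
  then show ?thesis by blast
 qed
 define f' where "f' = (%w. lim (%m. g' m w))"
 have r': "repr g' f'" unfolding f'_def by (rule repr_exists[OF G' C'])
 have "f w = (psi w - psi z) *C f' w" if w: "w : Omega" for w
 proof -
  have p1: "cmod (psi w) < 1" using w by simp
  have "bounded_linear (%x::'a. (psi w - psi z) *C x)"
  by (rule bounded_linear_intro[where K="cmod (psi w - psi z)"])
  (simp_all add: scaleC_add_right norm_scaleC mult.commute scaleC_of_real[symmetric] scaleC_scaleC)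
  from bounded_linear.tendsto[OF this repr_lim[OF r' w]]
  have "(%m. (psi w - psi z) *C g' m w) ----> (psi w - psi z) *C f' w" .
  then have l1: "(%m. g m w) ----> (psi w - psi z) *C f' w" using g'(2)[OF p1] w by simp
  have "(%m. f w - g m w) ----> 0"
  proof (rule Lim_null_comparison)
  show "\<forall>\<^sub>F m in sequentially. norm (f w - g m w) <= exp (pois kk (psi w)) * inverse (real (Suc m))"
  proof (intro always_eventually allI)
  fix m
  have fg: "f - g m : FX" by (intro FX_diff f GX_FX g)
  have "norm ((f - g m) (phi (psi w))) <= exp (pois kk (psi w)) * fnorm (f - g m)" by (rule FX_eval_bound[OF fg p1])
  also have "... <= exp (pois kk (psi w)) * inverse (real (Suc m))" using g(3)[of m] by (intro mult_left_mono) auto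
  finally show "norm (f w - g m w) <= exp (pois kk (psi w)) * inverse (real (Suc m))" using w by simp
  qed
  show "(%m. exp (pois kk (psi w)) * inverse (real (Suc m))) ----> 0"
  using tendsto_mult[OF tendsto_const LIMSEQ_inverse_real_of_nat] by simp
  qed
  then have "(%m. g m w) ----> f w" using tendsto_diff[OF tendsto_const[of "f w"]] by fastforce
  then show ?thesis using l1 LIMSEQ_unique by blast
 qed
 moreover have "f' : FX" using r' by (auto simp: FX_iff)
 ultimately show ?thesis using that by blast
qed

text \<open>\<open>psi - psi z\<close> has a simple zero at \<open>z\<close>. Hence, once the lower
  coefficients of the quotient vanish, coefficient \<open>i + 1\<close> of \<open>f\<close> is a
  nonzero multiple of coefficient \<open>i\<close> of the quotient, and the division can be
  repeated.\<close>

lemma FX_div_power: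
 assumes adm: "admissible X" and f: "f : FX" and z: "z : Omega" and v: "!!i. i < n ==> vc i f z = 0"
 obtains f' where "f' : FX" "!!w. w : Omega ==> f w = (psi w - psi z) ^ n *C f' w"
proof -
 have "EX f'. f' : FX & (ALL w:Omega. f w = (psi w - psi z) ^ n *C f' w)" using f v
 proof (induction n arbitrary: f)
  case 0
  then show ?case by (auto simp: scaleC_one)
 next
  case (Suc n)
  have "f z = 0" using Suc.prems(2)[of 0] by simp
  then obtain f1 where f1: "f1 : FX" "!!w. w : Omega ==> f w = (psi w - psi z) *C f1 w"
  using FX_div[OF adm Suc.prems(1) z] by metis
  define b where "b = (%w. psi w - psi z)"
  have bh: "b holomorphic_on Omega" unfolding b_def by (rule beta_holomorphic)
  have "deriv b z = deriv psi z - 0" unfolding b_def using psi_holomorphic open_region z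
  by (subst deriv_diff) (auto intro: holomorphic_on_imp_differentiable_at)
  then have b1: "sc 1 b z ~= 0" using deriv_psi_nonzero[OF z] by (simp add: sc_def)
  have b0: "sc 0 b z = 0" by (simp add: b_def)
  have vm: "vc m f z = (SUM k<=m. sc k b z *C vc (m - k) f1 z)" for m
  by (rule vc_mult[OF FX_vholo[OF f1(1)] FX_vholo[OF Suc.prems(1)] bh _ z]) (simp add: f1(2) b_def)
  have "vc i f1 z = 0" if "i < n" for i using that
  proof (induction i rule: less_induct)
  case (less i)
  have "0 = vc (Suc i) f z" using Suc.prems(2)[of "Suc i"] less.prems by simp
  also have "... = (SUM k<=Suc i. if k = 1 then sc 1 b z *C vc i f1 z else 0)" unfolding vm
  proof (intro sum.cong refl)
  fix k assume k: "k : {..Suc i}"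
  consider "k = 0" | "k = 1" | "2 <= k" by linarith
  then show "sc k b z *C vc (Suc i - k) f1 z = (if k = 1 then sc 1 b z *C vc i f1 z else 0)"
  proof cases
  case 3
  then have "vc (Suc i - k) f1 z = 0" using k less by (intro less.IH) auto
  then show ?thesis using 3 by simp
  qed (use b0 in auto)
  qed
  also have "... = sc 1 b z *C vc i f1 z" by (simp add: sum.delta)
  finally show ?case using b1 by (metis complex_vector.scale_eq_0_iff)
  qed
  then obtain f' where "f' : FX" "ALL w:Omega. f1 w = (psi w - psi z) ^ n *C f' w" using Suc.IH[OF f1(1)] by blast
  then show ?case using f1(2) by (auto simp: scaleC_scaleC)
 qed
 then show ?thesis using that by blast
qed

lemma beta_power_multiplier:
 assumes z: "z : Omega"
 shows "(%w. (w - psi z) ^ n) : smirnov" "AE t in arc. cmod (bdry (%w. (w - psi z) ^ n) t) <= 2 ^ n"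
proof -
 have "cmod ((w - psi z) ^ n) <= 2 ^ n" if "cmod w < 1" for w
 proof -
  have "cmod (w - psi z) <= 2" using norm_triangle_ineq4[of w "psi z"] that psi_ball[OF z] by linarith
  then show ?thesis unfolding norm_power by (intro power_mono) auto
 qed
 moreover have "disc_hol (%w. (w - psi z) ^ n)" by (intro holomorphic_intros)
 ultimately show "(%w. (w - psi z) ^ n) : smirnov" "AE t in arc. cmod (bdry (%w. (w - psi z) ^ n) t) <= 2 ^ n"
  using bounded_multiplier[of "%w. (w - psi z) ^ n" "2 ^ n"] by blast+
qed

text \<open>Admissibility for jets of order \<open>n\<close>: divide by the power of
  \<open>psi - psi z\<close>, approximate the quotient, and multiply back.\<close>

lemma GX_dense_vanishing:
 assumes adm: "admissible X" and f: "f : FX" and z: "z : Omega" and v: "!!i. i < n ==> vc i f z = 0" and e: "e > 0"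
 obtains g where "g : GX" "!!i. i < n ==> vc i g z = 0" "fnorm (f - g) < e"
proof -
 obtain f' where f': "f' : FX" "!!w. w : Omega ==> f w = (psi w - psi z) ^ n *C f' w"
  using FX_div_power[OF adm f z v] by blast
 obtain g' where g': "g' : GX" "fnorm (f' - g') < e / 2 ^ n" using GX_dense[OF f'(1), of "e / 2 ^ n"] e by auto
 define g where "g = (%w. (psi w - psi z) ^ n *C g' w)"
 note m = beta_power_multiplier[OF z, of n]
 have g: "g : GX" unfolding g_def by (rule GX_mult(1)[OF m g'(1)]) simp
 have "vc i g z = 0" if "i < n" for i
  by (rule vc_power_vanish[OF G0_vholo[OF GX_G0[OF g'(1)]] G0_vholo[OF GX_G0[OF g]] _ z that]) (simp add: g_def)
 moreover have "fnorm (f - g) < e"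
 proof -
  have fg: "f' - g' : FX" by (intro FX_diff f' GX_FX g')
  have "fnorm (f - g) = fnorm (%w. (psi w - psi z) ^ n *C (f' - g') w)"
  by (rule FX_cong(2)[OF FX_mult(1)[OF m fg]]) (simp add: f'(2) g_def complex_vector.scale_right_diff_distrib)
  also have "... <= 2 ^ n * fnorm (f' - g')" by (rule FX_mult(2)[OF m fg])
  also have "... < e" using g'(2) by (simp add: field_simps)
  finally show ?thesis .
 qed
 ultimately show ?thesis using that[OF g] by blast
qed

end

subsection \<open>Quotient norms\<close>

text \<open>The common form of \<open>rochberg\<close> and \<open>rochberg_star\<close>: the
  quotient of \<open>P\<close> by the kernel of \<open>J\<close>, realised on the image of
  \<open>J\<close>.\<close>

definition quot_space :: "'v::complex_vector set => ('v => real) => ('v => 'w) => 'w::complex_vector nspace" where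
 "quot_space P N J = \<lparr>points = J ` P, nrm = (%y. Inf {N f | f. f : P & J f = y})\<rparr>"

lemma quot_le:
 assumes "!!f. f : P ==> 0 <= N f" "f : P" shows "nrm (quot_space P N J) (J f) <= N f"
proof -
 have "Inf {N g | g. g : P & J g = J f} <= N f" by (rule cInf_lower) (use assms in "auto intro!: bdd_belowI[of _ 0]")
 then show ?thesis by (simp add: quot_space_def)
qed

lemma quot_approx:
 assumes "y : J ` P" "e > 0" obtains f where "f : P" "J f = y" "N f < nrm (quot_space P N J) y + e"
proof -
 have "{N f | f. f : P & J f = y} ~= {}" using assms(1) by auto
 then have "EX s:{N f | f. f : P & J f = y}. s < Inf {N f | f. f : P & J f = y} + e"
  using assms(2) by (intro cInf_lessD) auto
 then show ?thesis using that unfolding quot_space_def by auto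
qed

text \<open>The assumption \<open>sep\<close> plays the part of closedness of the kernel: every
  nonzero coset has positive distance from 0.\<close>

lemma normed_space_on_quot:
 assumes P: "complex_vector.subspace P" and nonneg: "!!f. f : P ==> 0 <= N f"
  and add: "!!f g. f : P ==> g : P ==> N (f + g) <= N f + N g"
  and scale: "!!a f. f : P ==> N (a *C f) <= cmod a * N f"
  and Jadd: "!!f g. f : P ==> g : P ==> J (f + g) = J f + J g"
  and Jscale: "!!a f. f : P ==> J (a *C f) = a *C J f"
  and sep: "!!f. f : P ==> J f ~= 0 ==> EX e>0. ALL g:P. J g = J f --> e <= N g"
 shows "normed_space_on (quot_space P N J)"
proof -
 let ?Q = "quot_space P N J"
 have pts: "points ?Q = J ` P" by (simp add: quot_space_def)
 have PA: "f + g : P" "a *C f : P" "0 : P" if "f : P" "g : P" for f g a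
  using P that by (auto simp: complex_vector.subspace_def)
 have P0: "0 : P" using P by (auto simp: complex_vector.subspace_def)
 have J0: "J 0 = 0" using Jscale[OF P0, of 0] by simp
 have le: "nrm ?Q (J f) <= N f" if "f : P" for f by (rule quot_le[OF nonneg that])
 have nn: "0 <= nrm ?Q y" if y: "y : J ` P" for y
 proof -
  have "{N f | f. f : P & J f = y} ~= {}" using y by auto
  then show ?thesis unfolding quot_space_def using nonneg by (auto intro: cInf_greatest)
 qed
 have tri: "nrm ?Q (x + y) <= nrm ?Q x + nrm ?Q y" if xy: "x : J ` P" "y : J ` P" for x y
 proof (rule field_le_epsilon)
  fix e :: real assume "e > 0"
  then have e2: "e / 2 > 0" by simp
  obtain f where f: "f : P" "J f = x" "N f < nrm ?Q x + e / 2" by (rule quot_approx[OF xy(1) e2])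
  obtain g where g: "g : P" "J g = y" "N g < nrm ?Q y + e / 2" by (rule quot_approx[OF xy(2) e2])
  have "nrm ?Q (x + y) <= N (f + g)" using le[OF PA(1)[OF f(1) g(1)]] Jadd[OF f(1) g(1)] f(2) g(2) by simp
  then show "nrm ?Q (x + y) <= nrm ?Q x + nrm ?Q y + e" using add[OF f(1) g(1)] f(3) g(3) by linarith
 qed
 have scl: "nrm ?Q (a *C y) <= cmod a * nrm ?Q y" if y: "y : J ` P" for a y
 proof (rule field_le_epsilon)
  fix e :: real assume e: "e > 0"
  have pos: "0 < cmod a + 1" by (rule add_nonneg_pos) auto
  then have e2: "e / (cmod a + 1) > 0" using e by (rule divide_pos_pos[rotated])
  obtain f where f: "f : P" "J f = y" "N f < nrm ?Q y + e / (cmod a + 1)" by (rule quot_approx[OF y e2])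
  have "nrm ?Q (a *C y) <= N (a *C f)" using le[OF PA(2)[OF f(1) f(1)]] Jscale[OF f(1)] f(2) by simp
  also have "... <= cmod a * N f" by (rule scale[OF f(1)])
  also have "... <= cmod a * (nrm ?Q y + e / (cmod a + 1))" using f(3) by (intro mult_left_mono) auto
  also have "... = cmod a * nrm ?Q y + e * (cmod a / (cmod a + 1))" by (simp add: distrib_left)
  also have "... <= cmod a * nrm ?Q y + e * 1"
  using e pos by (intro add_left_mono mult_left_mono) (auto simp: pos_divide_le_eq)
  finally show "nrm ?Q (a *C y) <= cmod a * nrm ?Q y + e" by simp
 qed
 have sub: "complex_vector.subspace (J ` P)" unfolding complex_vector.subspace_def
 proof (intro conjI ballI allI)
  show "0 : J ` P" using P0 J0 by force
  show "x + y : J ` P" if "x : J ` P" "y : J ` P" for x y using that Jadd PA(1) by (metis (no_types) imageE imageI)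
  show "a *C x : J ` P" if "x : J ` P" for a x using that Jscale PA(2) by (metis (no_types) imageE imageI)
 qed
 have sceq: "nrm ?Q (a *C y) = cmod a * nrm ?Q y" if y: "y : J ` P" for a y
 proof (cases "a = 0")
  case True
  have "0 : J ` P" using P0 J0 by force
  then show ?thesis using scl[OF y, of 0] nn[of 0] True by simp
 next
  case False
  have "a *C y : J ` P" by (rule complex_vector.subspace_scale[OF sub y])
  from scl[OF this, of "inverse a"] have "nrm ?Q y <= nrm ?Q (a *C y) / cmod a"
  using False by (simp add: scaleC_scaleC scaleC_one norm_inverse divide_inverse mult.commute)
  then show ?thesis using scl[OF y, of a] False by (simp add: field_simps)
 qed
 have "y = 0" if y: "y : J ` P" "nrm ?Q y = 0" for y
 proof (rule ccontr)
  assume "y ~= 0"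
  then obtain e where e: "e > 0" "!!g. g : P ==> J g = y ==> e <= N g" using y(1) sep by (metis imageE)
  obtain f where "f : P" "J f = y" "N f < nrm ?Q y + e" by (rule quot_approx[OF y(1) e(1)])
  then show False using e(2) y(2) by fastforce
 qed
 moreover have "nrm ?Q 0 = 0" using sceq[of "J 0" 0] P0 J0 by force
 ultimately show ?thesis unfolding normed_space_on_def pts using sub nn sceq tri by blast
qed

context interpolation_family
begin

lemma rochberg_quot: "rochberg X n z = quot_space FX fnorm (jet n z)" by (simp add: rochberg_def quot_space_def)

abbreviation "RX n z == points (rochberg X n z)"
abbreviation "rnorm n z == nrm (rochberg X n z)"

lemma RX_eq: "RX n z = jet n z ` FX" by (simp add: rochberg_def)

lemma jet_FX_add:
 assumes "f : FX" "g : FX" "z : Omega" shows "jet n z (f + g) = jet n z f + jet n z g"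
 using vc_add[OF FX_vholo[OF assms(1)] FX_vholo[OF assms(2)] FX_vholo[OF FX_add(1)[OF assms(1,2)]] assms(3)]
 by (auto simp: jet_eq)

lemma jet_FX_scale:
 assumes "f : FX" "z : Omega" shows "jet n z (a *C f) = a *C jet n z f"
 using vc_scale[OF FX_vholo[OF assms(1)] FX_vholo[OF FX_scale(1)[OF assms(1)]] assms(2)]
 by (auto simp: jet_eq scaleC_fun_def)

lemma jet_FX_diff:
 assumes "f : FX" "g : FX" "z : Omega" shows "jet n z (f - g) = jet n z f - jet n z g"
 using vc_diff[OF FX_vholo[OF assms(1)] FX_vholo[OF assms(2)] FX_vholo[OF FX_diff(1)[OF assms(1,2)]] assms(3)]
 by (auto simp: jet_eq)

lemma jet_zero_iff: "jet n z f = 0 \<longleftrightarrow> (ALL i<n. vc i f z = 0)" by (auto simp: jet_eq fun_eq_iff)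

lemma zero_GX: "0 : GX"
proof (rule GXI(1))
 show "(0 :: complex => 'a) : G0" by (rule G0I[of 0]) auto
 have "bdry (%w. 0 :: 'a) t = 0" for t by (rule nt_limit_eqI[OF has_nt_limit_const]) simp
 then show "AE t in arc. bnorm t (bval 0 t) <= 0" using AE_good by (auto simp: bval_def bnorm_zero)
qed

lemma FX_subspace: "complex_vector.subspace FX"
 unfolding complex_vector.subspace_def using FX_add(1) FX_scale(1) GX_FX[OF zero_GX] by blast

lemma normed_space_on_rochberg:
 assumes z: "z : Omega" shows "normed_space_on (rochberg X n z)" unfolding rochberg_quot
proof (rule normed_space_on_quot)
 fix f assume f: "f : FX" and "jet n z f ~= 0"
 then obtain i where i: "i < n" "vc i f z ~= 0" by (auto simp: jet_zero_iff)
 obtain K where K: "!!f. f : FX ==> norm (vc i f z) <= K * fnorm f" using FX_vc_bound[OF z, of i] by blast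
 have "norm (vc i f z) / (\<bar>K\<bar> + 1) <= fnorm g" if g: "g : FX" "jet n z g = jet n z f" for g
 proof -
  have "vc i g z = vc i f z" using fun_cong[OF g(2), of i] i by (simp add: jet_eq)
  then have "norm (vc i f z) <= K * fnorm g" using K[OF g(1)] by simp
  also have "... <= (\<bar>K\<bar> + 1) * fnorm g" by (intro mult_right_mono fnorm_nonneg g) auto
  finally show ?thesis by (simp add: divide_le_eq mult.commute)
 qed
 moreover have "0 < norm (vc i f z) / (\<bar>K\<bar> + 1)" using i by simp
 ultimately show "EX e>0. ALL g:FX. jet n z g = jet n z f --> e <= fnorm g" by blast
qed (simp_all add: FX_subspace fnorm_nonneg FX_add(2) FX_scale(2) jet_FX_add jet_FX_scale z)

lemma rnorm_jet: "f : FX ==> rnorm n z (jet n z f) <= fnorm f"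
 unfolding rochberg_quot by (rule quot_le[OF fnorm_nonneg])

lemma rnorm_approx:
 assumes "x : RX n z" "e > 0" obtains f where "f : FX" "jet n z f = x" "fnorm f < rnorm n z x + e"
 using quot_approx[of x "jet n z" FX e fnorm] assms unfolding RX_eq rochberg_quot[symmetric] by metis

abbreviation "DX n z == dual_space (rochberg X n z)"

text \<open>The quotient norm is an infimum over the completion, whereas \<open>Theta\<close> is
  given on simple functions only. A nearly optimal representative \<open>f\<close> differs from
  \<open>g\<close> by an element with vanishing jet, which \<open>GX_dense_vanishing\<close>
  approximates by simple functions on which \<open>Theta\<close> is 0; this yields the bound in the
  quotient norm.\<close>

lemma functional_extension:
 assumes adm: "admissible X" and z: "z : Omega"
  and add: "!!f g. f : GX ==> g : GX ==> Theta (f + g) = Theta f + Theta g"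
  and scale: "!!a g. g : GX ==> Theta (a *C g) = a * Theta g"
  and bound: "!!g. g : GX ==> cmod (Theta g) <= C * gnorm g" and C: "0 <= C"
  and null: "!!g. g : GX ==> jet n z g = 0 ==> Theta g = 0"
 obtains F where "F : points (DX n z)" "!!g. g : GX ==> F (jet n z g) = Theta g"
  "!!x. x : RX n z ==> cmod (F x) <= C * rnorm n z x"
proof -
 note N = normed_space_onD[OF normed_space_on_rochberg[OF z, of n]]
 have diff: "Theta (f - g) = Theta f - Theta g" if "f : GX" "g : GX" for f g
  using add[OF GX_minus(1)[OF that] that(2)] by simp
 have bd: "cmod (Theta g) <= C * rnorm n z (jet n z g)" if g: "g : GX" for g
 proof (rule field_le_epsilon)
  fix e :: real assume "e > 0"
  \<comment> \<open>Two errors of size \<open>d\<close> occur: in the choice of \<open>f\<close> and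
    in the approximation of \<open>g - f\<close>.\<close>
  define d where "d = e / (2 * (C + 1))"
  have d: "d > 0" using \<open>e > 0\<close> C by (simp add: d_def)
  have "jet n z g : RX n z" using GX_FX[OF g] by (simp add: RX_eq)
  then obtain f where f: "f : FX" "jet n z f = jet n z g" "fnorm f < rnorm n z (jet n z g) + d"
  by (rule rnorm_approx[OF _ d])
  have gf: "g - f : FX" by (rule FX_diff(1)[OF GX_FX[OF g] f(1)])
  have "jet n z (g - f) = 0" using jet_FX_diff[OF GX_FX[OF g] f(1) z] f(2) by simp
  then obtain g0 where g0: "g0 : GX" "!!i. i < n ==> vc i g0 z = 0" "fnorm (g - f - g0) < d"
  using GX_dense_vanishing[OF adm gf z _ d, of n] by (auto simp: jet_zero_iff)
  have "cmod (Theta g) = cmod (Theta (g - g0))" using diff[OF g g0(1)] null[OF g0(1)] g0(2) by (simp add: jet_zero_iff)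
  also have "... <= C * gnorm (g - g0)" by (rule bound[OF GX_minus(1)[OF g g0(1)]])
  also have "gnorm (g - g0) = fnorm ((g - f - g0) + f)"
  using fnorm_GX[OF GX_minus(1)[OF g g0(1)]] by (simp add: algebra_simps)
  also have "C * ... <= C * (rnorm n z (jet n z g) + 2 * d)"
  using FX_add(2)[OF FX_diff(1)[OF gf GX_FX[OF g0(1)]] f(1)] g0(3) f(3) C by (intro mult_left_mono) auto
  also have "... <= C * rnorm n z (jet n z g) + e"
  using C \<open>e > 0\<close> unfolding d_def by (simp add: field_simps)
  finally show "cmod (Theta g) <= C * rnorm n z (jet n z g) + e" .
 qed
 define L where "L x = Theta (SOME g. g : GX & jet n z g = x)" for x
 have L: "L (jet n z g) = Theta g" if g: "g : GX" for g
 proof -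
  define g' where "g' = (SOME g'. g' : GX & jet n z g' = jet n z g)"
  have g': "g' : GX" "jet n z g' = jet n z g"
  using someI[of "%g'. g' : GX & jet n z g' = jet n z g" g] g unfolding g'_def by auto
  have "Theta (g' - g) = 0" using jet_FX_diff[OF GX_FX[OF g'(1)] GX_FX[OF g] z] g'(2) by (intro null GX_minus g g') simp
  then show ?thesis using diff[OF g'(1) g] by (simp add: L_def g'_def)
 qed
 let ?G = "jet n z ` GX"
 have G: "complex_vector.subspace ?G" unfolding complex_vector.subspace_def
 proof (intro conjI ballI allI)
  show "0 : ?G" using zero_GX jet_FX_scale[OF GX_FX[OF zero_GX] z, of n 0] by force
  show "x + y : ?G" if "x : ?G" "y : ?G" for x y
  using that by (auto simp: jet_FX_add[symmetric] GX_FX z intro!: imageI GX_plus(1))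
  show "a *C x : ?G" if "x : ?G" for a x
  using that by (auto simp: jet_FX_scale[symmetric] GX_FX z intro!: imageI GX_scaleC(1))
 qed
 have Ladd: "L (x + y) = L x + L y" if xy: "x : ?G" "y : ?G" for x y
 proof -
  obtain f g where f: "f : GX" "x = jet n z f" and g: "g : GX" "y = jet n z g" using xy by auto
  have "x + y = jet n z (f + g)" unfolding f g by (rule jet_FX_add[OF GX_FX[OF f(1)] GX_FX[OF g(1)] z, symmetric])
  then show ?thesis using L[OF GX_plus(1)[OF f(1) g(1)]] L[OF f(1)] L[OF g(1)] add[OF f(1) g(1)] f(2) g(2) by simp
 qed
 have Lsc: "L (a *C x) = a * L x" if x: "x : ?G" for a x
 proof -
  obtain f where f: "f : GX" "x = jet n z f" using x by auto
  have "a *C x = jet n z (a *C f)" unfolding f by (rule jet_FX_scale[OF GX_FX[OF f(1)] z, symmetric])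
  then show ?thesis using L[OF GX_scaleC(1)[OF f(1)]] L[OF f(1)] scale[OF f(1)] f(2) by simp
 qed
 have Lb: "cmod (L x) <= C * rnorm n z x" if "x : ?G" for x using that L bd by auto
 have GR: "?G \<subseteq> RX n z" using GX_FX by (auto simp: RX_eq)
 have padd: "C * rnorm n z (x + y) <= C * rnorm n z x + C * rnorm n z y" if "x : RX n z" "y : RX n z" for x y
  using mult_left_mono[OF N(5)[OF that] C] by (simp add: distrib_left)
 have psc: "C * rnorm n z (a *C x) = cmod a * (C * rnorm n z x)" if "x : RX n z" for a x
  using N(4)[OF that] by simp
 obtain F where F: "!!x y. x : RX n z ==> y : RX n z ==> F (x + y) = F x + F y"
  "!!x a. x : RX n z ==> F (a *C x) = a * F x" "!!x. x : RX n z ==> cmod (F x) <= C * rnorm n z x"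
  "!!x. x : ?G ==> F x = L x"
 proof (rule hahn_banach[where p="%x. C * rnorm n z x" and L=L, OF N(1) G GR padd psc Ladd Lsc Lb])
  fix F
  assume "!!x y. x : RX n z ==> y : RX n z ==> F (x + y) = F x + F y"
  "!!x a. x : RX n z ==> F (a *C x) = a * F x" "!!x. x : RX n z ==> cmod (F x) <= C * rnorm n z x"
  "!!x. x : ?G ==> F x = L x"
  then show thesis by (rule that)
 qed
 let ?F = "%x. if x : RX n z then F x else 0"
 show ?thesis
 proof (rule that[of ?F])
  show "?F : points (DX n z)" by (rule dual_pointsI[of _ _ C])
  (auto simp: F complex_vector.subspace_add[OF N(1)] complex_vector.subspace_scale[OF N(1)])
  show "?F (jet n z g) = Theta g" if "g : GX" for g using that F(4) L GR by auto
 qed (use F in auto)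
qed

lemma dual_eqI:
 assumes z: "z : Omega" and F: "F : points (DX n z)" and F': "F' : points (DX n z)"
  and eq: "!!g. g : GX ==> F (jet n z g) = F' (jet n z g)" shows "F = F'"
proof
 fix x
 note R = normed_space_on_rochberg[OF z, of n]
 show "F x = F' x"
 proof (cases "x : RX n z")
  case True
  then obtain f where f: "f : FX" "x = jet n z f" by (auto simp: RX_eq)
  let ?K = "nrm (DX n z) F + nrm (DX n z) F'"
  have K: "0 <= ?K" by (intro add_nonneg_nonneg dual_norm(1)[OF R] F F')
  have "cmod (F x - F' x) <= e" if e: "e > 0" for e
  proof -
  obtain g where g: "g : GX" "fnorm (f - g) < e / (?K + 1)" using GX_dense[OF f(1), of "e / (?K + 1)"] e K by auto
  note fg = FX_diff(1)[OF f(1) GX_FX[OF g(1)]]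
  define y where "y = jet n z (f - g)"
  have y: "y : RX n z" "jet n z g : RX n z" using fg GX_FX[OF g(1)] by (auto simp: RX_eq y_def)
  have x: "x = y + jet n z g" unfolding y_def using jet_FX_diff[OF f(1) GX_FX[OF g(1)] z] f(2) by simp
  have "cmod (F x - F' x) = cmod (F y - F' y)"
  unfolding x dual_pointsD(1)[OF F y] dual_pointsD(1)[OF F' y] eq[OF g(1)] by simp
  also have "... <= ?K * rnorm n z y"
  using dual_norm(2)[OF R F y(1)] dual_norm(2)[OF R F' y(1)] norm_triangle_ineq4[of "F y" "F' y"]
  by (simp add: distrib_right)
  also have "... <= ?K * (e / (?K + 1))"
  using rnorm_jet[OF fg, of n z] g(2) K unfolding y_def by (intro mult_left_mono) auto
  also have "... <= e" using K e by (simp add: field_simps)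
  finally show ?thesis .
  qed
  then have "cmod (F x - F' x) <= 0" by (rule field_le_epsilon[of _ 0, simplified])
  then show ?thesis by simp
 qed (simp add: dual_pointsD(3)[OF F] dual_pointsD(3)[OF F'])
qed

lemma GX_sum: "(!!j. j < (n::nat) ==> g j : GX) ==> (%w. SUM j<n. g j w) : GX"
 by (induction n) (use zero_GX in "auto simp: zero_fun_def intro: GX_add(1)")

section \<open>Weights, and tuples from the intersection space as jets of simple functions\<close>

definition "wt x t = log_plus (bnorm t x)"

lemma wt_integrable: "x : Delta ==> integrable arc (wt x)"
 using nrm_log_integrable by (simp add: wt_def[abs_def] bnorm_def)

lemma bnorm_le_wt: "good t ==> x : Delta ==> bnorm t x <= exp (wt x t)"
 unfolding wt_def by (intro le_exp_log_plus bnorm_nonneg)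

lemma GX_single:
 assumes x: "x : Delta" and c: "c : smirnov" and C: "AE t in arc. cmod (bdry c t) * bnorm t x <= C"
 shows "(%w. c (psi w) *C x) : GX" "gnorm (%w. c (psi w) *C x) <= C"
proof -
 have g: "(%w. c (psi w) *C x) : G0" by (rule G0I[of 1 "%_. c" "%_. x"]) (use c x in auto)
 have "AE t in arc. bval (%w. c (psi w) *C x) t = (SUM j<(1::nat). bdry c t *C x)"
  using bval_comb[of 1 "%_. c" "%w. c (psi w) *C x" "%_. x"] c by auto
 then have "AE t in arc. bnorm t (bval (%w. c (psi w) *C x) t) <= C"
  using C AE_good by eventually_elim (simp add: bnorm_scale x)
 from GXI[OF g this] show "(%w. c (psi w) *C x) : GX" "gnorm (%w. c (psi w) *C x) <= C" by auto
qed

text \<open>By this bound the product of \<open>x\<close> and its weight has norm at most 1,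
  although the boundary norm of \<open>x\<close> itself may be unbounded.\<close>

lemma outer_wt_bound:
 assumes x: "x : Delta" shows "AE t in arc. cmod (bdry (outer (wt x)) t) * bnorm t x <= 1"
 using cmod_nt_limit_outer[OF wt_integrable[OF x]] AE_good
proof eventually_elim
 case (elim t)
 then show ?case using mult_left_mono[OF bnorm_le_wt[OF elim(2) x], of "exp (- wt x t)"] by (simp add: exp_minus)
qed

text \<open>The vector \<open>x j\<close> should carry the factor \<open>(w - z) ^ j\<close> up to
  order \<open>n\<close>, but only multiples of the weight are under control. So the weight is
  multiplied by an entire function of \<open>psi w\<close> with the Taylor coefficients of
  \<open>(w - z) ^ j\<close> divided by the weight. The shape of the result is recorded because the
  pairing with the constructed dual element is computed on exactly such terms.\<close>

lemma GX_tuple_outer: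
 assumes z: "z : Omega" and x: "x : tuples n Delta" obtains q where "!!j. j < n ==> q j holomorphic_on UNIV"
  "!!j. j < n ==> (%w. q j (psi w) *C (outer (wt (x j)) (psi w) *C x j)) : GX"
  "jet n z (%w. SUM j<n. q j (psi w) *C (outer (wt (x j)) (psi w) *C x j)) = x"
proof -
 have xD: "x j : Delta" if "j < n" for j using x that by (simp add: tuples_def)
 define U where "U j = outer (wt (x j))" for j
 have Oh: "U j holomorphic_on ball 0 1" and OS: "U j : smirnov" if "j < n" for j
  unfolding U_def using wt_integrable[OF xD[OF that]] by (auto intro: outer_holomorphic smirnov_outer)
 have "EX q. q holomorphic_on UNIV & (ALL i<n. sc i (%w. q (psi w)) z = sc i (%w. (w - z) ^ j / U j (psi w)) z)"
  if j: "j < n" for j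
 proof -
  have "(%w. (w - z) ^ j / U j (psi w)) holomorphic_on Omega"
  by (intro holomorphic_intros comp_psi_holomorphic Oh j) (simp add: U_def outer_nonzero)
  then show ?thesis using taylor_multiplier_sc[OF _ z, of "%w. (w - z) ^ j / U j (psi w)" n] by metis
 qed
 then obtain q where q: "!!j. j < n ==> q j holomorphic_on UNIV"
  "!!i j. i < n ==> j < n ==> sc i (%w. q j (psi w)) z = sc i (%w. (w - z) ^ j / U j (psi w)) z" by metis
 define c where "c j w = q j w * U j w" for j w
 have g: "(%w. q j (psi w) *C (U j (psi w) *C x j)) : GX" and qS: "q j : smirnov" if j: "j < n" for j
 proof -
  obtain M where M: "0 <= M" "!!w. cmod w < 1 ==> cmod (q j w) <= M"
  by (rule entire_bounded_on_disc[OF q(1)[OF j]]) blast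
  have qh: "q j holomorphic_on ball 0 1" by (rule holomorphic_on_subset[OF q(1)[OF j]]) simp
  note m = bounded_multiplier[OF qh M(2)]
  show "q j : smirnov" by (rule m)
  have "AE t in arc. cmod (bdry (U j) t) * bnorm t (x j) <= 1" unfolding U_def by (rule outer_wt_bound[OF xD[OF j]])
  from GX_mult(1)[OF m GX_single(1)[OF xD[OF j] OS[OF j] this]]
  show "(%w. q j (psi w) *C (U j (psi w) *C x j)) : GX" by simp
 qed
 define g where "g w = (SUM j<n. q j (psi w) *C (U j (psi w) *C x j))" for w
 have gG: "g : GX" unfolding g_def[abs_def] by (rule GX_sum) (rule g)
 have "comb_rep g n c x" unfolding comb_rep_def
 proof (intro conjI allI impI)
  show "c j : smirnov" if "j < n" for j unfolding c_def[abs_def] by (rule smirnov_mult[OF qS[OF that] OS[OF that]])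
 qed (auto simp: xD g_def c_def scaleC_scaleC)
 note v = comb_rep_vc[OF this z]
 have s: "sc i (%w. c j (psi w)) z = (if i = j then 1 else 0)" if i: "i < n" and j: "j < n" for i j
 proof -
  have h1: "(%w. q j (psi w)) holomorphic_on Omega"
  by (rule comp_psi_holomorphic[OF holomorphic_on_subset[OF q(1)[OF j]]]) simp
  have h2: "(%w. U j (psi w)) holomorphic_on Omega" by (rule comp_psi_holomorphic[OF Oh[OF j]])
  have h3: "(%w. (w - z) ^ j / U j (psi w)) holomorphic_on Omega"
  by (intro holomorphic_intros h2) (simp add: U_def outer_nonzero)
  have "sc i (%w. c j (psi w)) z = (SUM k<=i. sc k (%w. q j (psi w)) z * sc (i - k) (%w. U j (psi w)) z)"
  unfolding c_def by (rule sc_mult[OF h1 h2 open_region z])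
  also have "... = (SUM k<=i. sc k (%w. (w - z) ^ j / U j (psi w)) z * sc (i - k) (%w. U j (psi w)) z)"
  using i j by (intro sum.cong refl) (simp add: q(2))
  also have "... = sc i (%w. (w - z) ^ j / U j (psi w) * U j (psi w)) z"
  by (rule sc_mult[OF h3 h2 open_region z, symmetric])
  also have "... = sc i (%w. (w - z) ^ j) z" by (simp add: U_def outer_nonzero)
  finally show ?thesis by (simp add: sc_shift_power)
 qed
 have "jet n z g = x"
 proof
  fix i
  have "vc i g z = x i" if i: "i < n"
  proof -
  have "vc i g z = (SUM j<n. (if i = j then 1 else 0) *C x j)"
  unfolding v by (intro sum.cong refl) (simp add: s i)
  also have "... = (SUM j<n. if i = j then x j else 0)" by (intro sum.cong refl) (simp add: scaleC_one)
  also have "... = x i" using i by simp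
  finally show ?thesis .
  qed
  then show "jet n z g i = x i" using x by (auto simp: jet_eq tuples_def)
 qed
 then show ?thesis using that[of q] q(1) g by (simp add: g_def[abs_def] U_def)
qed

lemma GX_tuple:
 assumes z: "z : Omega" and x: "x : tuples n Delta" obtains g where "g : GX" "jet n z g = x"
proof (rule GX_tuple_outer[OF assms])
 fix q
 assume *: "!!j. j < n ==> (%w. q j (psi w) *C (outer (wt (x j)) (psi w) *C x j)) : GX"
  and **: "jet n z (%w. SUM j<n. q j (psi w) *C (outer (wt (x j)) (psi w) *C x j)) = x"
 show thesis by (rule that[OF GX_sum **]) (rule *)
qed

lemma jet_GX_tuples:
 assumes "g : G0" "z : Omega" shows "jet n z g : tuples n Delta" "vc i g z : Delta"
proof -
 obtain m c x where g: "comb_rep g m c x" by (rule G0E[OF assms(1)])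
 show v: "vc i g z : Delta" for i unfolding comb_rep_vc[OF g assms(2)] by (rule Delta_comb) (rule comb_repD(2)[OF g])
 show "jet n z g : tuples n Delta" using v by (auto simp: jet_eq tuples_def)
qed

end

subsection \<open>The dual family\<close>

lemma nt_limit_cmod:
 assumes "has_nt_limit f (cis t) l" shows "bdry (%w. cmod (f w)) t = cmod l"
 by (rule nt_limit_eqI[OF has_nt_limit_compose[OF assms, of cmod]]) auto

lemma algebraic_dualD:
 assumes "xi : algebraic_dual D"
 shows "x : D ==> y : D ==> xi (x + y) = xi x + xi y" "x : D ==> xi (a *C x) = a * xi x" "x ~: D ==> xi x = 0"
 using assms by (auto simp: algebraic_dual_def)

lemma algebraic_dual_comb:
 fixes n :: nat
 assumes D: "complex_vector.subspace D" and xi: "xi : algebraic_dual D" and x: "!!j. j < n ==> x j : D"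
 shows "xi (SUM j<n. c j *C x j) = (SUM j<n. c j * xi (x j))" using x
proof (induction n)
 case 0
 show ?case using algebraic_dualD(2)[OF xi complex_vector.subspace_0[OF D], of 0] by simp
next
 case (Suc n)
 have "(SUM j<n. c j *C x j) : D" "c n *C x n : D"
  using Suc.prems by (auto intro!: complex_vector.subspace_sum[OF D] complex_vector.subspace_scale[OF D])
 then show ?case using Suc algebraic_dualD[OF xi] by simp
qed

lemma sc_sum:
 assumes "!!j. j < (n::nat) ==> u j holomorphic_on S" "open S" "z : S"
 shows "sc i (%w. SUM j<n. u j w) z = (SUM j<n. sc i (u j) z)" using assms
proof (induction n)
 case 0
 then show ?case by (simp add: sc_const)
next
 case (Suc n)
 have "(%w. SUM j<n. u j w) holomorphic_on S" using Suc.prems by (intro holomorphic_on_sum) auto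
 then show ?case using Suc sc_add[of "%w. SUM j<n. u j w" S "u n" z i] by simp
qed

context interpolation_family
begin

abbreviation "FS == points (Fstar_space X)"
abbreviation "hnorm == nrm (Fstar_space X)"

text \<open>The modulus is taken after the boundary limit here, but before it in
  \<open>Fstar_bound\<close>; \<open>Fstar_bound_iff\<close> compares the two.\<close>

definition "hbound h C \<longleftrightarrow> (ALL x:Delta. AE t in arc. cmod (bdry (%w. h (phi w) x) t) <= C * bnorm t x)"

lemma Fstar_bound_iff:
 assumes "!!x. x : Delta ==> (%w. h (phi w) x) : smirnov" shows "Fstar_bound X h C \<longleftrightarrow> hbound h C"
 unfolding Fstar_bound_def hbound_def
proof (rule ball_cong[OF refl])
 fix x assume "x : Delta"
 then have "AE t in arc. bdry (%w. cmod (h (phi w) x)) t = cmod (bdry (%w. h (phi w) x) t)"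
  using smirnov_nt_limit[OF assms[of x]] by (auto elim!: eventually_mono dest: nt_limit_cmod)
 then show "(AE t in arc. bdry (%w. cmod (h (phi w) x)) t <= C * nrm (bspace X (phi (cis t))) x) \<longleftrightarrow>
  (AE t in arc. cmod (bdry (%w. h (phi w) x) t) <= C * bnorm t x)" unfolding bnorm_def by (rule eventually_cong) simp
qed

lemma hbound_mono:
 assumes "hbound h C" "C <= D" shows "hbound h D" unfolding hbound_def
proof
 fix x assume x: "x : Delta"
 show "AE t in arc. cmod (bdry (%w. h (phi w) x) t) <= D * bnorm t x"
  using assms(1)[unfolded hbound_def, rule_format, OF x] AE_good
 proof eventually_elim
  case (elim t)
  then show ?case using mult_right_mono[OF assms(2) bnorm_nonneg[OF elim(2) x]] by simp
 qed
qed

lemma FSI: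
 assumes "!!w. w : Omega ==> h w : algebraic_dual Delta" "!!x. x : Delta ==> (%w. h (phi w) x) : smirnov" "0 <= C" "hbound h C"
 shows "h : FS" "hnorm h <= C"
proof -
 have b: "Fstar_bound X h D" if "C <= D" for D
  using hbound_mono[OF assms(4) that] Fstar_bound_iff[of h D] assms(2) by simp
 show "h : FS" using assms(1,2) b[of "C + 1"] assms(3) unfolding Fstar_space_def by (auto intro!: exI[of _ "C + 1"])
 show "hnorm h <= C"
 proof (rule field_le_epsilon)
  fix e :: real assume "e > 0"
  then have "C + e : {C. C > 0 & Fstar_bound X h C}" using b[of "C + e"] assms(3) by auto
  then show "hnorm h <= C + e" unfolding Fstar_space_def by (auto intro!: cInf_lower bdd_belowI[of _ 0])
 qed
qed

text \<open>The infimum defining the norm is attained: for each \<open>x\<close>, the bounds with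
  the constants \<open>hnorm h + inverse (real (Suc m))\<close> hold for all \<open>m\<close>
  outside one null set.\<close>

lemma FSD:
 assumes "h : FS"
 shows "w : Omega ==> h w : algebraic_dual Delta" "x : Delta ==> (%w. h (phi w) x) : smirnov" "0 <= hnorm h" "hbound h (hnorm h)"
proof -
 show s: "(%w. h (phi w) x) : smirnov" if "x : Delta" for x using assms that by (auto simp: Fstar_space_def)
 show "h w : algebraic_dual Delta" if "w : Omega" using assms that by (auto simp: Fstar_space_def)
 define S where "S = {C. C > 0 & hbound h C}"
 have eq: "hnorm h = Inf S" using Fstar_bound_iff[OF s] by (simp add: Fstar_space_def S_def)
 have ne: "S ~= {}" using assms Fstar_bound_iff[OF s] by (auto simp: Fstar_space_def S_def)
 show "0 <= hnorm h" unfolding eq by (rule cInf_greatest[OF ne]) (auto simp: S_def)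
 have b: "hbound h (hnorm h + inverse (real (Suc m)))" for m
 proof -
  obtain C where "C : S" "C < Inf S + inverse (real (Suc m))" using cInf_lessD[OF ne, of "Inf S + inverse (real (Suc m))"] by auto
  then show ?thesis using hbound_mono[of h C] unfolding eq S_def by simp
 qed
 show "hbound h (hnorm h)" unfolding hbound_def
 proof
  fix x assume x: "x : Delta"
  have "AE t in arc. ALL m. cmod (bdry (%w. h (phi w) x) t) <= (hnorm h + inverse (real (Suc m))) * bnorm t x"
  using b x unfolding hbound_def AE_all_countable by blast
  then show "AE t in arc. cmod (bdry (%w. h (phi w) x) t) <= hnorm h * bnorm t x"
  proof eventually_elim
  case (elim t)
  have "(%m. (hnorm h + inverse (real (Suc m))) * bnorm t x) ----> (hnorm h + 0) * bnorm t x"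
  by (intro tendsto_intros LIMSEQ_inverse_real_of_nat)
  then show ?case using LIMSEQ_le_const[of _ "hnorm h * bnorm t x"] elim by auto
  qed
 qed
qed

lemma FS_add:
 assumes h: "h : FS" and h': "h' : FS" shows "h + h' : FS" "hnorm (h + h') <= hnorm h + hnorm h'"
proof -
 have s: "(%w. (h + h') (phi w) x) : smirnov" if "x : Delta" for x
  using smirnov_add[OF FSD(2)[OF h that] FSD(2)[OF h' that]] by simp
 have a: "(h + h') w : algebraic_dual Delta" if "w : Omega" for w
  using FSD(1)[OF h that] FSD(1)[OF h' that] by (auto simp: algebraic_dual_def algebra_simps)
 have "hbound (h + h') (hnorm h + hnorm h')" unfolding hbound_def
 proof
  fix x assume x: "x : Delta"
  show "AE t in arc. cmod (bdry (%w. (h + h') (phi w) x) t) <= (hnorm h + hnorm h') * bnorm t x"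
  using FSD(4)[OF h, unfolded hbound_def, rule_format, OF x] FSD(4)[OF h', unfolded hbound_def, rule_format, OF x]
  smirnov_nt_limit[OF FSD(2)[OF h x]] smirnov_nt_limit[OF FSD(2)[OF h' x]]
  proof eventually_elim
  case (elim t)
  have "bdry (%w. (h + h') (phi w) x) t = bdry (%w. h (phi w) x) t + bdry (%w. h' (phi w) x) t"
  using nt_limit_eqI[OF has_nt_limit_add[OF elim(3,4)]] by simp
  then show ?case using norm_triangle_mono[OF elim(1,2)] by (simp add: distrib_right)
  qed
 qed
 then show "h + h' : FS" "hnorm (h + h') <= hnorm h + hnorm h'"
  using FSI[of "h + h'" "hnorm h + hnorm h'"] a s FSD(3)[OF h] FSD(3)[OF h'] by simp_all
qed

lemma FS_mult:
 assumes q: "q : smirnov" "AE t in arc. cmod (bdry q t) <= C" "0 <= C" and h: "h : FS"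
 shows "(%w x. q (psi w) * h w x) : FS" "hnorm (%w x. q (psi w) * h w x) <= C * hnorm h"
proof -
 let ?h = "%w x. q (psi w) * h w x"
 have s: "(%w. ?h (phi w) x) : smirnov" if "x : Delta" for x
  by (rule smirnov_cong[OF smirnov_mult[OF q(1) FSD(2)[OF h that]]]) simp
 have a: "?h w : algebraic_dual Delta" if "w : Omega" for w
  using FSD(1)[OF h that] by (auto simp: algebraic_dual_def algebra_simps)
 have "hbound ?h (C * hnorm h)" unfolding hbound_def
 proof
  fix x assume x: "x : Delta"
  show "AE t in arc. cmod (bdry (%w. ?h (phi w) x) t) <= C * hnorm h * bnorm t x"
  using FSD(4)[OF h, unfolded hbound_def, rule_format, OF x] q(2)
  smirnov_nt_limit[OF q(1)] smirnov_nt_limit[OF FSD(2)[OF h x]]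
  proof eventually_elim
  case (elim t)
  have "bdry (%w. ?h (phi w) x) t = bdry (%w. q w * h (phi w) x) t" by (rule nt_limit_cong) simp
  also have "... = bdry q t * bdry (%w. h (phi w) x) t" using nt_limit_eqI[OF has_nt_limit_mult[OF elim(3,4)]] by simp
  finally show ?case using mult_mono[OF elim(2,1) q(3)] by (simp add: norm_mult mult.assoc)
  qed
 qed
 then show "?h : FS" "hnorm ?h <= C * hnorm h" using FSI[of ?h "C * hnorm h"] a s FSD(3)[OF h] q(3) by simp_all
qed

lemma FS_scale:
 assumes h: "h : FS" shows "a *C h : FS" "hnorm (a *C h) <= cmod a * hnorm h"
proof -
 have "AE t in arc. cmod (bdry (%_. a) t) <= cmod a" by (simp add: nt_limit_eqI[OF has_nt_limit_const])
 note FS_mult[OF smirnov_const this norm_ge_zero h]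
 moreover have "(%w x. a * h w x) = a *C h" by (simp add: fun_eq_iff scaleC_fun_def scaleC_complex_def)
 ultimately show "a *C h : FS" "hnorm (a *C h) <= cmod a * hnorm h" by auto
qed

text \<open>The bound for fixed vectors passes to vectors depending on the boundary point, because the coefficients
  range over a separable space.\<close>

lemma FS_pairing:
 assumes h: "h : FS" and g: "g : G0" shows "(%w. h (phi w) (g (phi w))) : smirnov"
  "AE t in arc. cmod (bdry (%w. h (phi w) (g (phi w))) t) <= hnorm h * bnorm t (bval g t)"
proof -
 obtain n c x where r: "comb_rep g n c x" by (rule G0E[OF g])
 note R = comb_repD[OF r]
 define e where "e j w = h (phi w) (x j)" for j w
 have e: "e j : smirnov" if "j < n" for j unfolding e_def[abs_def] by (rule FSD(2)[OF h R(2)[OF that]])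
 have eq: "h (phi w) (g (phi w)) = (SUM j<n. c j w * e j w)" if "cmod w < 1" for w unfolding R(3)[OF that] e_def
  by (rule algebraic_dual_comb[OF inter_subspace FSD(1)[OF h] R(2)]) (simp_all add: that)
 show "(%w. h (phi w) (g (phi w))) : smirnov"
  by (rule smirnov_cong[of "%w. SUM j<n. c j w * e j w"]) (auto simp: eq intro!: smirnov_sum smirnov_mult R(1) e)
 obtain D :: "(nat => complex) set" where D: "countable D"
  "!!U. open U ==> U ~= {} ==> EX d:D. d : U" using countable_dense_setE by blast
 have xd: "(SUM j<n. d j *C x j) : Delta" for d by (rule Delta_comb) (rule R(2))
 have "AE t in arc. cmod (bdry (%w. h (phi w) (SUM j<n. d j *C x j)) t) <= hnorm h * bnorm t (SUM j<n. d j *C x j)" for d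
  using FSD(4)[OF h] xd unfolding hbound_def by blast
 \<comment> \<open>One null set serves all constant coefficients from the countable dense
   set.\<close>
 then have A: "AE t in arc. ALL d:D. cmod (bdry (%w. h (phi w) (SUM j<n. d j *C x j)) t) <= hnorm h * bnorm t (SUM j<n. d j *C x j)"
  using D(1) by (simp add: AE_ball_countable)
 have B: "AE t in arc. ALL j<n. has_nt_limit (c j) (cis t) (bdry (c j) t) & has_nt_limit (e j) (cis t) (bdry (e j) t)"
  by (rule AE_all_less) (intro AE_conjI smirnov_nt_limit R(1) e)
 have E: "AE t in arc. bval g t = (SUM j<n. bdry (c j) t *C x j)" using bval_comb[of n c g x] R by auto
 show "AE t in arc. cmod (bdry (%w. h (phi w) (g (phi w))) t) <= hnorm h * bnorm t (bval g t)" using A B E AE_good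
 proof eventually_elim
  case (elim t)
  define c' where "c' j = bdry (c j) t" for j
  define e' where "e' j = bdry (e j) t" for j
  have lim: "has_nt_limit (%w. SUM j<n. u j w * e j w) (cis t) (SUM j<n. u' j * e' j)"
  if "!!j. j < n ==> has_nt_limit (u j) (cis t) (u' j)" for u u'
  using has_nt_limit_comb[of n "%j w. u j w * e j w" "cis t" "%j. u' j * e' j" "%_. 1 :: complex"] that elim(2)
  by (simp add: scaleC_complex_def e'_def has_nt_limit_mult)
  have l1: "bdry (%w. h (phi w) (g (phi w))) t = (SUM j<n. c' j * e' j)"
  proof -
  have "bdry (%w. h (phi w) (g (phi w))) t = bdry (%w. SUM j<n. c j w * e j w) t" by (rule nt_limit_cong) (simp add: eq)
  also have "... = (SUM j<n. c' j * e' j)" by (rule nt_limit_eqI[OF lim]) (use elim(2) in "auto simp: c'_def")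
  finally show ?thesis .
  qed
  have l2: "bdry (%w. h (phi w) (SUM j<n. d j *C x j)) t = (SUM j<n. d j * e' j)" for d
  proof -
  have "bdry (%w. h (phi w) (SUM j<n. d j *C x j)) t = bdry (%w. SUM j<n. d j * e j w) t" by (rule nt_limit_cong)
  (simp add: e_def algebraic_dual_comb[OF inter_subspace FSD(1)[OF h] R(2)])
  also have "... = (SUM j<n. d j * e' j)" by (rule nt_limit_eqI[OF lim]) (auto intro: has_nt_limit_const)
  finally show ?thesis .
  qed
  have "cmod (SUM j<n. c' j * e' j) <= hnorm h * bnorm t (SUM j<n. c' j *C x j)"
  proof (rule field_le_epsilon)
  fix s :: real assume "s > 0"
  then obtain d where d: "d : D" "(SUM j<n. cmod (c' j - d j) * (cmod (e' j) + hnorm h * bnorm t (x j))) < s"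
  using dense_close[where D=D and n=n and c=c' and k="%j. cmod (e' j) + hnorm h * bnorm t (x j)", OF D(2)] by blast
  have "cmod (SUM j<n. c' j * e' j) <= cmod (SUM j<n. d j * e' j) + cmod (SUM j<n. (c' j - d j) * e' j)"
  using norm_triangle_ineq[of "SUM j<n. d j * e' j" "SUM j<n. (c' j - d j) * e' j"]
  by (simp add: sum.distrib[symmetric] algebra_simps)
  also have "cmod (SUM j<n. (c' j - d j) * e' j) <= (SUM j<n. cmod (c' j - d j) * cmod (e' j))"
  by (rule order_trans[OF norm_sum]) (simp add: norm_mult)
  also have "cmod (SUM j<n. d j * e' j) <= hnorm h * bnorm t (SUM j<n. d j *C x j)"
  using elim(1) d(1) by (simp add: l2)
  also have "... <= hnorm h * (bnorm t (SUM j<n. c' j *C x j) + (SUM j<n. cmod (d j - c' j) * bnorm t (x j)))"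
  by (intro mult_left_mono bnorm_comb_diff elim FSD(3) h R(2))
  finally have "cmod (SUM j<n. c' j * e' j) <= hnorm h * bnorm t (SUM j<n. c' j *C x j)
  + (SUM j<n. cmod (c' j - d j) * (cmod (e' j) + hnorm h * bnorm t (x j)))"
  by (simp add: distrib_left sum.distrib sum_distrib_left norm_minus_commute mult.left_commute)
  then show "cmod (SUM j<n. c' j * e' j) <= hnorm h * bnorm t (SUM j<n. c' j *C x j) + s" using d(2) by simp
  qed
  then show ?case using elim(3) by (simp add: l1 c'_def)
 qed
qed

lemma FS_pairing_le:
 assumes h: "h : FS" and g: "g : GX" and w: "w : Omega" shows "cmod (h w (g w)) <= hnorm h * gnorm g"
proof -
 have "AE t in arc. cmod (bdry (%w. h (phi w) (g (phi w))) t) <= hnorm h * gnorm g"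
  using FS_pairing(2)[OF h GX_G0[OF g]] gnorm_AE[OF g] by eventually_elim (meson FSD(3) h mult_left_mono order_trans)
 from smirnov_le[OF FS_pairing(1)[OF h GX_G0[OF g]] this psi_ball[OF w]] show ?thesis using w by simp
qed

lemma comp_conf_smirnov_holomorphic:
 assumes "(%w. u (phi w)) : smirnov" shows "u holomorphic_on Omega"
 using comp_psi_holomorphic[OF smirnov_holomorphic[OF assms]] by (rule holomorphic_transform) simp

lemma FS_pairing_holomorphic:
 "h : FS ==> g : G0 ==> (%w. h w (g w)) holomorphic_on Omega"
 "h : FS ==> x : Delta ==> (%w. h w x) holomorphic_on Omega"
 by (intro comp_conf_smirnov_holomorphic FS_pairing(1) FSD(2); assumption)+

text \<open>The Taylor coefficients of the pairing depend on the jets of \<open>h\<close> and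
  \<open>g\<close> only, which is why the pairing descends to the quotient spaces.\<close>

lemma FS_leibniz:
 assumes h: "h : FS" and g: "g : G0" and z: "z : Omega"
 shows "sc i (%w. h w (g w)) z = (SUM k<=i. sc k (%w. h w (vc (i - k) g z)) z)"
proof -
 obtain n c x where r: "comb_rep g n c x" by (rule G0E[OF g])
 note R = comb_repD[OF r]
 have ch: "(%w. c j (psi w)) holomorphic_on Omega" if "j < n" for j
  by (rule comp_psi_holomorphic[OF smirnov_holomorphic[OF R(1)[OF that]]])
 have hh: "(%w. h w (x j)) holomorphic_on Omega" if "j < n" for j by (rule FS_pairing_holomorphic(2)[OF h R(2)[OF that]])
 have eq: "h w (g w) = (SUM j<n. c j (psi w) * h w (x j))" if w: "w : Omega" for w
  using R(3)[OF psi_ball[OF w]] algebraic_dual_comb[OF inter_subspace FSD(1)[OF h w] R(2), of n "%j. j" "%j. c j (psi w)"] w by simp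
 have "sc i (%w. h w (g w)) z = sc i (%w. SUM j<n. c j (psi w) * h w (x j)) z"
  by (rule sc_cong[OF FS_pairing_holomorphic(1)[OF h g] open_region z eq])
 also have "... = (SUM j<n. sc i (%w. h w (x j) * c j (psi w)) z)"
  by (subst sc_sum[OF _ open_region z]) (auto intro!: holomorphic_intros ch hh simp: mult.commute)
 also have "... = (SUM j<n. SUM k<=i. sc (i - k) (%w. c j (psi w)) z * sc k (%w. h w (x j)) z)"
  by (intro sum.cong refl) (simp add: sc_mult[OF hh ch open_region z] mult.commute)
 also have "... = (SUM k<=i. SUM j<n. sc (i - k) (%w. c j (psi w)) z * sc k (%w. h w (x j)) z)" by (rule sum.swap)
 also have "... = (SUM k<=i. sc k (%w. h w (vc (i - k) g z)) z)"
 proof (intro sum.cong refl)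
  fix k
  define a where "a j = sc (i - k) (%w. c j (psi w)) z" for j
  have "sc k (%w. h w (vc (i - k) g z)) z = sc k (%w. SUM j<n. a j * h w (x j)) z"
  proof (rule sc_cong[OF FS_pairing_holomorphic(2)[OF h jet_GX_tuples(2)[OF g z]] open_region z])
  fix w assume w: "w : Omega"
  show "h w (vc (i - k) g z) = (SUM j<n. a j * h w (x j))"
  unfolding comb_rep_vc[OF r z] a_def by (rule algebraic_dual_comb[OF inter_subspace FSD(1)[OF h w] R(2)])
  qed
  also have "... = (SUM j<n. a j * sc k (%w. h w (x j)) z)"
  by (subst sc_sum[OF _ open_region z]) (auto intro!: holomorphic_intros hh sum.cong sc_cmult[OF hh open_region z])
  finally show "(SUM j<n. sc (i - k) (%w. c j (psi w)) z * sc k (%w. h w (x j)) z) = sc k (%w. h w (vc (i - k) g z)) z"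
  by (simp add: a_def)
 qed
 finally show ?thesis .
qed

lemma sc_cauchy_bound:
 assumes z: "z : Omega"
 obtains K where "0 <= K" "!!u B. u holomorphic_on Omega ==> (!!w. w : Omega ==> cmod (u w) <= B) ==> cmod (sc i u z) <= K * B"
proof -
 obtain r where r: "r > 0" "cball z r \<subseteq> Omega" using open_region z open_contains_cball by blast
 have "cmod (sc i u z) <= 1 / r ^ i * B" if u: "u holomorphic_on Omega" "!!w. w : Omega ==> cmod (u w) <= B" for u B
 proof -
  have "cmod ((deriv ^^ i) u z) <= fact i * B / r ^ i"
  proof (rule Cauchy_inequality[OF _ _ r(1)])
  show "u holomorphic_on ball z r" using u(1) r(2) by (meson ball_subset_cball holomorphic_on_subset subset_trans)
  show "continuous_on (cball z r) u" using u(1) r(2) by (meson holomorphic_on_imp_continuous_on holomorphic_on_subset)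
  show "cmod (u x) <= B" if "cmod (z - x) = r" for x using that r by (intro u(2)) (auto simp: dist_norm subset_iff)
  qed
  then show ?thesis by (simp add: sc_def norm_divide field_simps)
 qed
 then show ?thesis using that[of "1 / r ^ i"] r by simp
qed

lemma weak_jet_eq: "weak_jet n z h = (%i x. if i < n then sc i (%w. h w x) z else 0)"
 by (auto simp: weak_jet_def sc_def fun_eq_iff)

lemma FS_sc_outside:
 assumes "h : FS" "z : Omega" "x ~: Delta" shows "sc i (%w. h w x) z = 0" "(%w. h w x) holomorphic_on Omega"
proof -
 have z: "h w x = 0" if "w : Omega" for w by (rule algebraic_dualD(3)[OF FSD(1)[OF assms(1) that] assms(3)])
 show hol: "(%w. h w x) holomorphic_on Omega" by (rule holomorphic_transform[of "%_. 0"]) (auto simp: z)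
 show "sc i (%w. h w x) z = 0" using sc_cong[OF hol open_region assms(2) z, of i] by (simp add: sc_const)
qed

lemma FS_hol: "h : FS ==> z : Omega ==> (%w. h w x) holomorphic_on Omega"
 using FS_sc_outside(2) FS_pairing_holomorphic(2) by blast

lemma weak_jet_linear:
 assumes "h : FS" "z : Omega" shows "h' : FS ==> weak_jet n z (h + h') = weak_jet n z h + weak_jet n z h'"
  "weak_jet n z (a *C h) = a *C weak_jet n z h"
 using sc_add[OF FS_hol FS_hol open_region] sc_cmult[OF FS_hol open_region] assms
 by (auto simp: weak_jet_eq fun_eq_iff scaleC_fun_def scaleC_complex_def)

lemma pairing_coefficient_bound:
 assumes z: "z : Omega"
 obtains K where "0 <= K" "!!h g. h : FS ==> g : GX ==> cmod (sc i (%w. h w (g w)) z) <= K * hnorm h * gnorm g"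
proof -
 obtain K where K: "0 <= K" "!!u B. u holomorphic_on Omega ==> (!!w. w : Omega ==> cmod (u w) <= B) ==> cmod (sc i u z) <= K * B"
  using sc_cauchy_bound[OF z] by blast
 have "cmod (sc i (%w. h w (g w)) z) <= K * (hnorm h * gnorm g)" if h: "h : FS" and g: "g : GX" for h g
  by (rule K(2)[OF FS_pairing_holomorphic(1)[OF h GX_G0[OF g]] FS_pairing_le[OF h g]])
 then show ?thesis using that[OF K(1)] by (simp add: mult.assoc)
qed

text \<open>A constant \<open>x\<close> need not have finite norm, so it is realised as the value at
  \<open>z\<close> of a simple function \<open>g\<close> whose further coefficients up to order
  \<open>i\<close> vanish; coefficient \<open>i\<close> of the pairing with \<open>g\<close> is then
  the one with \<open>x\<close>.\<close>

lemma FS_coefficient_bound: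
 assumes z: "z : Omega" and x: "x : Delta" obtains K where "!!h. h : FS ==> cmod (sc i (%w. h w x) z) <= K * hnorm h"
proof -
 have "(%k. if k = 0 then x else 0) : tuples (Suc i) Delta"
  using x complex_vector.subspace_0[OF inter_subspace] by (auto simp: tuples_def)
 then obtain g where g: "g : GX" "jet (Suc i) z g = (%k. if k = 0 then x else 0)" by (rule GX_tuple[OF z])
 have v: "vc k g z = (if k = 0 then x else 0)" if "k <= i" for k using fun_cong[OF g(2), of k] that by (simp add: jet_eq split: if_splits)
 obtain K where K: "!!h g. h : FS ==> g : GX ==> cmod (sc i (%w. h w (g w)) z) <= K * hnorm h * gnorm g"
  using pairing_coefficient_bound[OF z] by blast
 have "cmod (sc i (%w. h w x) z) <= (K * gnorm g) * hnorm h" if h: "h : FS" for h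
 proof -
  have h0: "sc k (%w. h w 0) z = 0" for k
  proof -
  have "h w 0 = 0" if "w : Omega" for w
  using algebraic_dualD(2)[OF FSD(1)[OF h that] complex_vector.subspace_0[OF inter_subspace], of 0] by simp
  from sc_cong[OF FS_hol[OF h z] open_region z this] show ?thesis by (simp add: sc_const)
  qed
  have "sc i (%w. h w (g w)) z = (SUM k<=i. if k = i then sc i (%w. h w x) z else 0)"
  unfolding FS_leibniz[OF h GX_G0[OF g(1)] z] by (intro sum.cong refl) (auto simp: v h0)
  then show ?thesis using K[OF h g(1)] by (simp add: mult_ac)
 qed
 then show ?thesis by (rule that)
qed

lemma rochberg_star_quot: "rochberg_star X n z = quot_space FS hnorm (weak_jet n z)"
 by (simp add: rochberg_star_def quot_space_def)

abbreviation "SX n z == points (rochberg_star X n z)"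
abbreviation "snorm n z == nrm (rochberg_star X n z)"

lemma SX_eq: "SX n z = weak_jet n z ` FS" by (simp add: rochberg_star_def)

lemma zero_FS: "0 : FS" by (rule FSI(1)[of _ 0])
  (use smirnov_const[of 0] in "auto simp: algebraic_dual_def hbound_def nt_limit_eqI[OF has_nt_limit_const]")

lemma normed_space_on_star:
 assumes z: "z : Omega" shows "normed_space_on (rochberg_star X n z)" unfolding rochberg_star_quot
proof (rule normed_space_on_quot)
 show "complex_vector.subspace FS" unfolding complex_vector.subspace_def using FS_add(1) FS_scale(1) zero_FS by blast
 fix h assume h: "h : FS" and "weak_jet n z h ~= 0"
 then obtain i x where i: "i < n" "sc i (%w. h w x) z ~= 0" by (auto simp: weak_jet_eq fun_eq_iff split: if_splits)
 then have x: "x : Delta" using FS_sc_outside(1)[OF h z] by blast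
 obtain K where K: "!!h. h : FS ==> cmod (sc i (%w. h w x) z) <= K * hnorm h" using FS_coefficient_bound[OF z x] by blast
 have "cmod (sc i (%w. h w x) z) / (\<bar>K\<bar> + 1) <= hnorm h'" if h': "h' : FS" "weak_jet n z h' = weak_jet n z h" for h'
 proof -
  have "sc i (%w. h' w x) z = sc i (%w. h w x) z" using fun_cong[OF fun_cong[OF h'(2)], of i x] i by (simp add: weak_jet_eq)
  then have "cmod (sc i (%w. h w x) z) <= K * hnorm h'" using K[OF h'(1)] by simp
  also have "... <= (\<bar>K\<bar> + 1) * hnorm h'" by (intro mult_right_mono FSD(3) h') auto
  finally show ?thesis by (simp add: divide_le_eq mult.commute)
 qed
 moreover have "0 < cmod (sc i (%w. h w x) z) / (\<bar>K\<bar> + 1)" using i by simp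
 ultimately show "EX e>0. ALL h':FS. weak_jet n z h' = weak_jet n z h --> e <= hnorm h'" by blast
qed (simp_all add: FSD(3) FS_add(2) FS_scale(2) weak_jet_linear z)

lemma snorm_jet: "h : FS ==> snorm n z (weak_jet n z h) <= hnorm h"
 unfolding rochberg_star_quot by (rule quot_le[OF FSD(3)])

lemma snorm_approx:
 assumes "xi : SX n z" "e > 0" obtains h where "h : FS" "weak_jet n z h = xi" "hnorm h < snorm n z xi + e"
 using quot_approx[of xi "weak_jet n z" FS e hnorm] assms unfolding SX_eq rochberg_star_quot[symmetric] by metis

text \<open>The reversal of indices in the pairing is that of a Cauchy product: by
  \<open>FS_leibniz\<close> the sum is a single Taylor coefficient of a scalar function.\<close>

lemma weak_jet_pairing:
 assumes "h : FS" "g : G0" "z : Omega" "n >= 1"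
 shows "(SUM j<n. weak_jet n z h j (jet n z g (n - j - 1))) = sc (n - 1) (%w. h w (g w)) z"
proof -
 have "weak_jet n z h j (jet n z g (n - j - 1)) = sc j (%w. h w (vc (n - 1 - j) g z)) z" if "j <= n - 1" for j
 proof -
  have "j < n" "n - j - 1 < n" "n - j - 1 = n - 1 - j" using that assms(4) by auto
  then show ?thesis by (simp only: weak_jet_eq jet_eq if_True)
 qed
 moreover have "{..<n} = {..n - 1}" using assms(4) by auto
 ultimately show ?thesis unfolding FS_leibniz[OF assms(1-3)] by (intro sum.cong) auto
qed

section \<open>Existence, uniqueness and boundedness of the duality maps\<close>

lemma extends_pairing_iff:
 assumes h: "h : FS" and z: "z : Omega" and n: "n >= 1"
 shows "extends_pairing X n z (weak_jet n z h) F \<longleftrightarrow> F : points (DX n z) &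
  (ALL g:GX. F (jet n z g) = sc (n - 1) (%w. h w (g w)) z)" proof assume "extends_pairing X n z (weak_jet n z h) F"
 then show "F : points (DX n z) & (ALL g:GX. F (jet n z g) = sc (n - 1) (%w. h w (g w)) z)"
  unfolding extends_pairing_def using weak_jet_pairing[OF h GX_G0 z n] jet_GX_tuples(1)[OF GX_G0 z] by metis
next
 assume F: "F : points (DX n z) & (ALL g:GX. F (jet n z g) = sc (n - 1) (%w. h w (g w)) z)"
 have "F x = (SUM j<n. weak_jet n z h j (x (n - j - 1)))" if x: "x : tuples n Delta" for x
 proof -
  obtain g where g: "g : GX" "jet n z g = x" by (rule GX_tuple[OF z x])
  then show ?thesis using F weak_jet_pairing[OF h GX_G0[OF g(1)] z n] by auto
 qed
 then show "extends_pairing X n z (weak_jet n z h) F" using F by (simp add: extends_pairing_def)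
qed

text \<open>Coefficient \<open>n - 1\<close> of the pairing is bounded in the norm of
  \<open>g\<close> and depends only on the jet of \<open>g\<close>, so
  \<open>functional_extension\<close> applies; the constant comes from Cauchy's estimate at
  \<open>z\<close> and is the same for all \<open>h\<close>.\<close>

lemma pairing_extension:
 assumes adm: "admissible X" and z: "z : Omega" and n: "n >= 1"
 obtains K where "0 <= K" "!!h. h : FS ==> EX F. extends_pairing X n z (weak_jet n z h) F &
  (ALL x:RX n z. cmod (F x) <= K * hnorm h * rnorm n z x)" proof -
 obtain K where K: "0 <= K" "!!h g. h : FS ==> g : GX ==> cmod (sc (n - 1) (%w. h w (g w)) z) <= K * hnorm h * gnorm g"
  using pairing_coefficient_bound[OF z] by blast
 have "EX F. extends_pairing X n z (weak_jet n z h) F & (ALL x:RX n z. cmod (F x) <= K * hnorm h * rnorm n z x)"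
  if h: "h : FS" for h
 proof -
 let ?T = "%g. sc (n - 1) (%w. h w (g w)) z"
 have T: "?T g = (SUM j<n. weak_jet n z h j (jet n z g (n - j - 1)))" if "g : GX" for g
  by (rule weak_jet_pairing[OF h GX_G0[OF that] z n, symmetric])
 have hol: "(%w. h w (g w)) holomorphic_on Omega" if "g : GX" for g by (rule FS_pairing_holomorphic(1)[OF h GX_G0[OF that]])
 have in_Delta: "g w : Delta" if "g : GX" "w : Omega" for g w using jet_GX_tuples(2)[OF GX_G0[OF that(1)] that(2), of 0] by simp
 have a1: "?T (f + g) = ?T f + ?T g" if "f : GX" "g : GX" for f g
 proof -
  have "?T (f + g) = sc (n - 1) (%w. h w (f w) + h w (g w)) z"
  by (rule sc_cong[OF hol[OF GX_plus(1)[OF that]] open_region z])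
  (simp add: algebraic_dualD(1)[OF FSD(1)[OF h]] in_Delta that)
  then show ?thesis by (simp add: sc_add[OF hol hol open_region z] that)
 qed
 have a2: "?T (a *C g) = a * ?T g" if "g : GX" for a g
 proof -
  have "?T (a *C g) = sc (n - 1) (%w. a * h w (g w)) z"
  by (rule sc_cong[OF hol[OF GX_scaleC(1)[OF that]] open_region z])
  (simp add: algebraic_dualD(2)[OF FSD(1)[OF h]] in_Delta that scaleC_fun_def)
  then show ?thesis by (simp add: sc_cmult[OF hol open_region z] that)
 qed
 have a3: "?T g = 0" if g: "g : GX" "jet n z g = 0" for g
  using T[OF zero_GX] T[OF g(1)] a2[OF zero_GX, of 0] jet_FX_scale[OF GX_FX[OF zero_GX] z, of n 0] g(2) by simp
 have C: "0 <= K * hnorm h" using K(1) FSD(3)[OF h] by simp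
 show ?thesis
 proof (rule functional_extension[where Theta="?T" and C="K * hnorm h" and n=n, OF adm z a1 a2 K(2)[OF h] C a3])
  fix F assume "F : points (DX n z)" "!!g. g : GX ==> F (jet n z g) = ?T g"
  and "!!x. x : RX n z ==> cmod (F x) <= K * hnorm h * rnorm n z x"
  then show ?thesis using extends_pairing_iff[OF h z n, of F] by blast
 qed
qed
 then show ?thesis using that K(1) by blast
qed

lemma extends_pairing_unique:
 assumes z: "z : Omega" and n: "n >= 1" and xi: "xi : SX n z"
  and F: "extends_pairing X n z xi F" "extends_pairing X n z xi F'" shows "F = F'"
proof -
 obtain h where h: "h : FS" "xi = weak_jet n z h" using xi by (auto simp: SX_eq)
 show ?thesis using F extends_pairing_iff[OF h(1) z n] h(2) by (intro dual_eqI[OF z]) auto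
qed

lemma duality_map:
 assumes adm: "admissible X" and z: "z : Omega" and n: "n >= 1" and xi: "xi : SX n z"
 shows "EX! F. extends_pairing X n z xi F" "extends_pairing X n z xi (duality_map X n z xi)"
proof -
 obtain F where "extends_pairing X n z xi F" using pairing_extension[OF adm z n] xi unfolding SX_eq by (metis imageE)
 then show ex: "EX! F. extends_pairing X n z xi F" using extends_pairing_unique[OF z n xi] by blast
 show "extends_pairing X n z xi (duality_map X n z xi)" unfolding duality_map_def by (rule theI'[OF ex])
qed

lemma duality_map_eqI:
 assumes "admissible X" "z : Omega" "n >= 1" "xi : SX n z" "extends_pairing X n z xi F" shows "duality_map X n z xi = F"
 using duality_map[OF assms(1-4)] assms(5) by blast

lemma duality_map_bounded:
 assumes adm: "admissible X" and z: "z : Omega" and n: "n >= 1"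
 obtains C where "!!xi. xi : SX n z ==> nrm (DX n z) (duality_map X n z xi) <= C * snorm n z xi"
proof -
 obtain K where K: "0 <= K" "!!h. h : FS ==> EX F. extends_pairing X n z (weak_jet n z h) F &
  (ALL x:RX n z. cmod (F x) <= K * hnorm h * rnorm n z x)" using pairing_extension[OF adm z n] by blast
 have "nrm (DX n z) (duality_map X n z xi) <= K * snorm n z xi" if xi: "xi : SX n z" for xi
 proof (rule field_le_epsilon)
  fix e :: real assume e: "e > 0"
  then have d: "e / (K + 1) > 0" using K(1) by simp
  obtain h where h: "h : FS" "weak_jet n z h = xi" "hnorm h < snorm n z xi + e / (K + 1)" by (rule snorm_approx[OF xi d])
  obtain F where F: "extends_pairing X n z xi F" "!!x. x : RX n z ==> cmod (F x) <= K * hnorm h * rnorm n z x"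
  using K(2)[OF h(1)] h(2) by blast
  have "nrm (DX n z) F <= K * hnorm h" using F(1) FSD(3)[OF h(1)] K(1)
  by (intro dual_norm(3)[OF normed_space_on_rochberg[OF z] _ _ F(2)]) (auto simp: extends_pairing_def)
  also have "... <= K * (snorm n z xi + e / (K + 1))" using h(3) K(1) by (intro mult_left_mono) auto
  also have "... <= K * snorm n z xi + e" using K(1) e by (simp add: field_simps)
  finally show "nrm (DX n z) (duality_map X n z xi) <= K * snorm n z xi + e"
  using duality_map_eqI[OF adm z n xi F(1)] by simp
 qed
 then show ?thesis by (rule that)
qed

end

subsection \<open>Integral bounds for functionals on the Rochberg spaces\<close>

lemma sc_sum_cmult:
 assumes "!!j. j < (n::nat) ==> u j holomorphic_on S" "open S" "z : S"
 shows "sc i (%w. SUM j<n. c j * u j w) z = (SUM j<n. c j * sc i (u j) z)"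
proof -
 have "sc i (%w. SUM j<n. c j * u j w) z = (SUM j<n. sc i (%w. c j * u j w) z)"
  by (rule sc_sum[OF _ assms(2,3)]) (intro holomorphic_intros assms(1))
 also have "... = (SUM j<n. c j * sc i (u j) z)" by (intro sum.cong refl sc_cmult[OF _ assms(2,3)] assms(1)) simp
 finally show ?thesis .
qed

lemma sc_poly: "sc i (%w. SUM j<n. c j * (w - a) ^ j) a = (if i < n then c i else 0)"
proof -
 have "sc i (%w. SUM j<n. c j * (w - a) ^ j) a = (SUM j<n. c j * sc i (%w. (w - a) ^ j) a)"
  by (rule sc_sum_cmult[of _ _ UNIV]) (auto intro!: holomorphic_intros)
 also have "... = (SUM j<n. if i = j then c j else 0)" by (intro sum.cong refl) (simp add: sc_shift_power)
 finally show ?thesis by simp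
qed

lemma disc_taylor:
 assumes f: "disc_hol f" and a: "cmod a < 1"
 obtains R where "disc_hol R" "!!w. f w = (SUM j<n. sc j f a * (w - a) ^ j) + (w - a) ^ n * R w"
proof -
 have "EX R. disc_hol R & (ALL w. f w = (SUM j<n. sc j f a * (w - a) ^ j) + (w - a) ^ n * R w)"
 proof (induction n)
  case 0
  then show ?case by (intro exI[of _ f]) (use f in auto)
 next
  case (Suc n)
  then obtain R where R: "disc_hol R" "!!w. f w = (SUM j<n. sc j f a * (w - a) ^ j) + (w - a) ^ n * R w" by blast
  have a': "a : ball 0 1" using a by simp
  have "sc n f a = sc n (%w. (SUM j<n. sc j f a * (w - a) ^ j) + (w - a) ^ n * R w) a"
  by (rule sc_cong[OF f open_ball a' R(2)])
  also have "... = sc n (%w. SUM j<n. sc j f a * (w - a) ^ j) a + sc n (%w. (w - a) ^ n * R w) a"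
  by (rule sc_add[OF _ _ open_ball a']) (intro holomorphic_intros R(1))+
  also have "sc n (%w. (w - a) ^ n * R w) a = (SUM k<=n. sc k (%w. (w - a) ^ n) a * sc (n - k) R a)"
  by (rule sc_mult[OF _ R(1) open_ball a']) (intro holomorphic_intros)
  also have "... = (SUM k<=n. if k = n then R a else 0)" by (intro sum.cong refl) (simp add: sc_shift_power)
  finally have Ra: "R a = sc n f a" by (simp add: sc_poly)
  have "disc_hol (%w. R w - R a)" by (intro holomorphic_intros R(1))
  then obtain R1 where R1: "disc_hol R1" "!!w. R w - R a = (w - a) * R1 w" by (rule holomorphic_factor[OF _ a]) auto
  have "f w = (SUM j<Suc n. sc j f a * (w - a) ^ j) + (w - a) ^ Suc n * R1 w" for w
  proof -
  have Rw: "R w = sc n f a + (w - a) * R1 w" using R1(2)[of w] Ra by (metis add_diff_cancel_left' add.commute diff_add_cancel)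
  show ?thesis unfolding R(2)[of w] Rw by (simp add: algebra_simps)
  qed
  then show ?case using R1(1) by blast
 qed
 then show ?thesis using that by blast
qed

context interpolation_family
begin

lemma taylor_at:
 assumes f: "disc_hol f" and z: "z : Omega" and k: "k < n"
 shows "sc k (%w. f (psi w)) z = sc k (%w. SUM j<n. sc j f (psi z) * (psi w - psi z) ^ j) z"
proof -
 obtain R where R: "disc_hol R" "!!w. f w = (SUM j<n. sc j f (psi z) * (w - psi z) ^ j) + (w - psi z) ^ n * R w"
  using disc_taylor[OF f psi_ball[OF z], of n] by blast
 have Rh: "(%w. R (psi w)) holomorphic_on Omega" by (rule comp_psi_holomorphic[OF R(1)])
 have "sc k (%w. f (psi w)) z = sc k (%w. (SUM j<n. sc j f (psi z) * (psi w - psi z) ^ j) + (psi w - psi z) ^ n * R (psi w)) z"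
  by (rule sc_cong[OF comp_psi_holomorphic[OF f] open_region z]) (rule R(2))
 also have "... = sc k (%w. SUM j<n. sc j f (psi z) * (psi w - psi z) ^ j) z + sc k (%w. (psi w - psi z) ^ n * R (psi w)) z"
  by (rule sc_add[OF _ _ open_region z]) (intro holomorphic_intros psi_holomorphic Rh)+
 also have "sc k (%w. (psi w - psi z) ^ n * R (psi w)) z = 0"
  by (rule sc_power_vanish[OF beta_holomorphic _ Rh open_region z k]) simp
 finally show ?thesis by simp
qed

lemma jet_mult_cong:
 assumes v: "vholo f" "vholo h" "vholo h'" and p: "p holomorphic_on Omega" "q holomorphic_on Omega" and z: "z : Omega"
  and h: "!!w. w : Omega ==> h w = p w *C f w" "!!w. w : Omega ==> h' w = q w *C f w"
  and pq: "!!k. k < n ==> sc k p z = sc k q z" shows "jet n z h = jet n z h'"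
proof -
 have "vc i h z = vc i h' z" if "i < n" for i
 proof -
  have "vc i h z = (SUM k<=i. sc k p z *C vc (i - k) f z)" by (rule vc_mult[OF v(1,2) p(1) h(1) z])
  also have "... = (SUM k<=i. sc k q z *C vc (i - k) f z)" using that by (intro sum.cong refl) (simp add: pq)
  also have "... = vc i h' z" by (rule vc_mult[OF v(1,3) p(2) h(2) z, symmetric])
  finally show ?thesis .
 qed
 then show ?thesis by (auto simp: jet_eq)
qed

lemma jet_functional:
 assumes z: "z : Omega" and F: "F : points (DX n z)"
 shows "g : GX ==> h : GX ==> F (jet n z (g + h)) = F (jet n z g) + F (jet n z h)"
  "g : GX ==> F (jet n z (a *C g)) = a * F (jet n z g)"
  "g : GX ==> cmod (F (jet n z g)) <= nrm (DX n z) F * gnorm g"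
proof -
 note R = normed_space_on_rochberg[OF z, of n]
 have pt: "jet n z g : RX n z" if "g : GX" for g using GX_FX[OF that] by (simp add: RX_eq)
 show "F (jet n z (g + h)) = F (jet n z g) + F (jet n z h)" if "g : GX" "h : GX"
  using that by (simp add: jet_FX_add GX_FX z dual_pointsD(1)[OF F] pt)
 show "F (jet n z (a *C g)) = a * F (jet n z g)" if "g : GX"
  using that by (simp add: jet_FX_scale GX_FX z dual_pointsD(2)[OF F] pt)
 show "cmod (F (jet n z g)) <= nrm (DX n z) F * gnorm g" if g: "g : GX"
  using dual_norm(2)[OF R F pt[OF g]] mult_left_mono[OF rnorm_jet[OF GX_FX[OF g], of n z] dual_norm(1)[OF R F]]
  by (simp add: fnorm_GX[OF g])
qed

lemma jet_functional_sum:
 assumes z: "z : Omega" and F: "F : points (DX n z)" and g: "!!j. j < (m::nat) ==> g j : GX"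
 shows "(%w. SUM j<m. c j *C g j w) : GX" "F (jet n z (%w. SUM j<m. c j *C g j w)) = (SUM j<m. c j * F (jet n z (g j)))"
proof -
 show G: "(%w. SUM j<m. c j *C g j w) : GX" using g by (intro GX_sum GX_scale(1)) auto
 show "F (jet n z (%w. SUM j<m. c j *C g j w)) = (SUM j<m. c j * F (jet n z (g j)))" using g
 proof (induction m)
  case 0
  show ?case using jet_functional(2)[OF z F zero_GX, of 0] by (simp add: zero_fun_def)
 next
  case (Suc m)
  have "(%w. SUM j<m. c j *C g j w) : GX" using Suc.prems by (intro GX_sum GX_scale(1)) auto
  moreover have "(%w. SUM j<Suc m. c j *C g j w) = (%w. SUM j<m. c j *C g j w) + c m *C g m"
  by (simp add: fun_eq_iff scaleC_fun_def)
  ultimately show ?case using Suc jet_functional(1)[OF z F _ GX_scaleC(1)] jet_functional(2)[OF z F] by simp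
 qed
qed

text \<open>Modulo functions vanishing to order \<open>n\<close> at \<open>z\<close>, multiplication
  by \<open>q\<close> only sees the Taylor polynomial of \<open>q\<close> at
  \<open>psi z\<close>.\<close>

lemma functional_taylor:
 assumes z: "z : Omega" and F: "F : points (DX n z)" and f: "f : GX" and g: "g : GX"
  and q: "disc_hol q" and gf: "!!w. w : Omega ==> g w = q (psi w) *C f w"
 shows "(%w. (psi w - psi z) ^ j *C f w) : GX" "gnorm (%w. (psi w - psi z) ^ j *C f w) <= 2 ^ j * gnorm f"
  "F (jet n z g) = (SUM j<n. sc j q (psi z) * F (jet n z (%w. (psi w - psi z) ^ j *C f w)))"
proof -
 define b where "b j w = (psi w - psi z) ^ j *C f w" for j w
 have *: "b j (phi w) = (w - psi z) ^ j *C f (phi w)" if "cmod w < 1" for j w using that by (simp add: b_def)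
 have b: "b j : GX" "gnorm (b j) <= 2 ^ j * gnorm f" for j
  using GX_mult[OF beta_power_multiplier[OF z] f, of "b j" j] * by auto
 then show "(%w. (psi w - psi z) ^ j *C f w) : GX" "gnorm (%w. (psi w - psi z) ^ j *C f w) <= 2 ^ j * gnorm f"
  unfolding b_def[abs_def] by auto
 note S = jet_functional_sum[where m=n and g=b and c="%j. sc j q (psi z)", OF z F b(1)]
 have "jet n z g = jet n z (%w. SUM j<n. sc j q (psi z) *C b j w)"
 proof (rule jet_mult_cong[OF G0_vholo[OF GX_G0[OF f]] G0_vholo[OF GX_G0[OF g]] G0_vholo[OF GX_G0[OF S(1)]] _ _ z])
  show "(%w. q (psi w)) holomorphic_on Omega" by (rule comp_psi_holomorphic[OF q])
  show "(%w. SUM j<n. sc j q (psi z) * (psi w - psi z) ^ j) holomorphic_on Omega" by (intro holomorphic_intros psi_holomorphic)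
  show "(SUM j<n. sc j q (psi z) *C b j w) = (SUM j<n. sc j q (psi z) * (psi w - psi z) ^ j) *C f w" for w
  by (simp add: b_def complex_vector.scale_sum_left scaleC_scaleC)
  show "sc k (%w. q (psi w)) z = sc k (%w. SUM j<n. sc j q (psi z) * (psi w - psi z) ^ j) z" if "k < n" for k
  by (rule taylor_at[OF q z that])
 qed (use gf in auto)
 then show "F (jet n z g) = (SUM j<n. sc j q (psi z) * F (jet n z (%w. (psi w - psi z) ^ j *C f w)))"
  using S(2) by (simp add: b_def[abs_def])
qed

text \<open>The constants of \<open>coefficient_le_integral\<close> at \<open>psi z\<close>, each
  times the norm bound \<open>2 ^ j\<close> of the multiplier
  \<open>(psi w - psi z) ^ j\<close>.\<close>

definition "jet_const n z = (SUM j<n. (2 / (1 - cmod (psi z))) ^ (j + 1) * 2 ^ j)"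

lemma jet_const_nonneg: "z : Omega ==> 0 <= jet_const n z"
 unfolding jet_const_def using less_imp_le[OF psi_ball[of z]] by (intro sum_nonneg mult_nonneg_nonneg zero_le_power) auto

lemma bnorm_bval_integrable:
 assumes "g : GX" shows "integrable arc (%t. bnorm t (bval g t))"
proof (rule arc.integrable_const_bound[of _ "gnorm g"])
 show "AE t in arc. norm (bnorm t (bval g t)) <= gnorm g" using gnorm_AE[OF assms] AE_good G0_bval[OF GX_G0[OF assms]]
  by eventually_elim (simp add: bnorm_nonneg)
qed (rule bnorm_bval_measurable[OF GX_G0[OF assms]])

text \<open>Dividing by an outer function with the boundary modulus of \<open>g\<close> leaves a function of norm at most one, and
  only the first Taylor coefficients of the outer function, which are controlled by its mean, enter the jet.\<close>

lemma functional_L1_bound: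
 assumes z: "z : Omega" and F: "F : points (DX n z)" and g: "g : GX"
 shows "cmod (F (jet n z g)) <= jet_const n z * nrm (DX n z) F * (LINT t|arc. bnorm t (bval g t))"
proof -
 define N where "N = nrm (DX n z) F"
 have N: "0 <= N" unfolding N_def by (rule dual_norm(1)[OF normed_space_on_rochberg[OF z] F])
 define I where "I = (LINT t|arc. bnorm t (bval g t))"
 note Ii = bnorm_bval_integrable[OF g]
 note A = jet_const_nonneg[OF z, of n]
 have main: "cmod (F (jet n z g)) <= jet_const n z * N * (2 * pi * e + I)" if e: "e > 0" for e
 proof -
  define M where "M = gnorm g + e"
  have M: "e <= M" using gnorm_nonneg[OF g] by (simp add: M_def)
  \<comment> \<open>The boundary norm of \<open>g\<close>, clamped so that \<open>ln v\<close> is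
    bounded; almost everywhere \<open>v\<close> dominates the boundary norm and exceeds it by at
    most \<open>e\<close>.\<close>
  define v where "v t = max e (min M (bnorm t (bval g t)))" for t
  have ve: "e <= v t" "v t <= M" for t using M by (auto simp: v_def)
  have vm: "arc_meas v" unfolding v_def[abs_def] using bnorm_bval_measurable[OF GX_G0[OF g]] by measurable
  have vp: "0 < v t" for t using ve(1)[of t] e by simp
  have vg: "AE t in arc. bnorm t (bval g t) <= v t & v t <= e + bnorm t (bval g t)"
  using gnorm_AE[OF g] AE_good G0_bval[OF GX_G0[OF g]]
  proof eventually_elim
  case (elim t)
  then have "0 <= bnorm t (bval g t)" by (simp add: bnorm_nonneg)
  then show ?case using elim(1) e by (auto simp: v_def M_def)
  qed
  \<comment> \<open>With this sign \<open>outer u\<close> has boundary modulus \<open>v\<close>; its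
    inverse is the multiplier \<open>q\<close>.\<close>
  define u where "u t = - ln (v t)" for t
  have ui: "integrable arc u"
  proof (rule arc.integrable_const_bound[of _ "\<bar>ln e\<bar> + \<bar>ln M\<bar>"])
  have "\<bar>u t\<bar> <= \<bar>ln e\<bar> + \<bar>ln M\<bar>" for t
  proof -
  have "ln e <= ln (v t)" "ln (v t) <= ln M" using ve[of t] e vp[of t] by auto
  then show ?thesis unfolding u_def by arith
  qed
  then show "AE t in arc. norm (u t) <= \<bar>ln e\<bar> + \<bar>ln M\<bar>" by simp
  show "arc_meas u" unfolding u_def[abs_def] using vm by measurable
  qed
  have vi: "integrable arc v"
  by (rule arc.integrable_const_bound[of _ M]) (use ve vp vm in "auto intro!: AE_I2 simp: less_imp_le")
  have O1: "AE t in arc. cmod (bdry (outer u) t) <= v t"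
  using cmod_nt_limit_outer[OF ui] by eventually_elim (simp add: u_def vp)
  have Ob: "cmod (outer u w) <= M" if "cmod w < 1" for w by (rule smirnov_le[OF smirnov_outer[OF ui] _ that])
  (use O1 in eventually_elim, use ve(2) in "blast intro: order_trans")
  define q where "q = outer (%t. - u t)"
  have ui': "integrable arc (%t. - u t)" using ui by simp
  have qS: "q : smirnov" unfolding q_def by (rule smirnov_outer[OF ui'])
  define f where "f w = q (psi w) *C g w" for w
  have fe: "f (phi w) = q w *C g (phi w)" if "cmod w < 1" for w using that by (simp add: f_def)
  have fG0: "f : G0" by (rule G0_mult[OF qS GX_G0[OF g] fe])
  have bf: "AE t in arc. bval f t = bdry q t *C bval g t" by (rule bval_mult[OF qS GX_G0[OF g]]) (rule fe)
  have fb: "AE t in arc. bnorm t (bval f t) <= 1"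
  using bf cmod_nt_limit_outer[OF ui'] vg AE_good G0_bval[OF GX_G0[OF g]]
  proof eventually_elim
  case (elim t)
  then have "bnorm t (bval f t) = bnorm t (bval g t) / v t"
  by (simp add: f_def bnorm_scale q_def u_def exp_minus vp divide_inverse mult.commute)
  then show ?case using elim(3) vp[of t] by simp
  qed
  note f = GXI[OF fG0 fb]
  have gf: "g w = outer u (psi w) *C f w" if w: "w : Omega" for w
  using inverse_outer[OF psi_ball[OF w], of u] outer_nonzero[of u "psi w"]
  by (simp add: f_def q_def scaleC_scaleC scaleC_one field_simps)
  define b where "b j w = (psi w - psi z) ^ j *C f w" for j w
  define c where "c j = sc j (outer u) (psi z)" for j
  note T = functional_taylor[OF z F f(1) g outer_holomorphic[OF ui] gf]
  have b: "b j : GX" "gnorm (b j) <= 2 ^ j" for j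
  using T(1)[of j] order_trans[OF T(2)[of j] mult_left_mono[OF f(2), of "2 ^ j"]] by (simp_all add: b_def[abs_def])
  have "cmod (F (jet n z g)) = cmod (SUM j<n. c j * F (jet n z (b j)))" using T(3) by (simp add: b_def[abs_def] c_def)
  also have "... <= (SUM j<n. cmod (c j) * cmod (F (jet n z (b j))))"
  by (rule order_trans[OF norm_sum]) (simp add: norm_mult)
  also have "... <= (SUM j<n. ((2 / (1 - cmod (psi z))) ^ (j + 1) * (LINT t|arc. v t)) * (N * 2 ^ j))"
  proof (intro sum_mono mult_mono)
  fix j
  show "cmod (c j) <= (2 / (1 - cmod (psi z))) ^ (j + 1) * (LINT t|arc. v t)"
  unfolding c_def sc_def by (rule coefficient_le_integral[OF outer_holomorphic[OF ui] Ob vi O1 psi_ball[OF z]])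
  show "cmod (F (jet n z (b j))) <= N * 2 ^ j"
  using jet_functional(3)[OF z F b(1)[of j]] mult_left_mono[OF b(2)[of j] N] by (simp add: N_def)
  show "0 <= (2 / (1 - cmod (psi z))) ^ (j + 1) * (LINT t|arc. v t)"
  using vp psi_ball[OF z] by (intro mult_nonneg_nonneg zero_le_power integral_nonneg_AE) (auto simp: less_imp_le)
  qed auto
  also have "... = jet_const n z * N * (LINT t|arc. v t)"
  unfolding jet_const_def sum_distrib_right by (intro sum.cong refl) (simp add: mult_ac)
  also have "... <= jet_const n z * N * (LINT t|arc. e + bnorm t (bval g t))"
  using A N Ii vg by (intro mult_left_mono integral_mono_AE vi) (auto elim: eventually_mono)
  also have "(LINT t|arc. e + bnorm t (bval g t)) = 2 * pi * e + I" using Ii measure_arc by (simp add: I_def)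
  finally show ?thesis .
 qed
 show ?thesis unfolding N_def[symmetric] I_def[symmetric]
 proof (rule field_le_epsilon)
  fix s :: real assume s: "s > 0"
  define P where "P = jet_const n z * N"
  have P: "0 <= P" using A N by (simp add: P_def)
  define d where "d = s / (2 * pi * (P + 1))"
  have d: "d > 0" using s P by (simp add: d_def add_nonneg_pos)
  have "2 * pi * d = s / (P + 1)" by (simp add: d_def)
  then have "P * (2 * pi * d) = P * s / (P + 1)" by simp
  also have "... <= s" using P s by (simp add: pos_divide_le_eq distrib_left mult.commute)
  finally have "P * (2 * pi * d) <= s" .
  then show "cmod (F (jet n z g)) <= jet_const n z * N * I + s"
  using main[OF d] by (simp add: P_def[symmetric] distrib_left)
 qed
qed

text \<open>The domain of the Hahn-Banach extension. It consists of functions rather than classes,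
  so the integral is only a seminorm on it, and identities between its elements are used almost
  everywhere.\<close>

definition LX :: "(real => 'a) set" where
 "LX = {v. integrable arc (%t. bnorm t (v t)) & (EX (m::nat) c x. (ALL j<m. c j : borel_measurable arc & x j : Delta) &
  (AE t in arc. v t = (SUM j<m. c j t *C x j)))}"

lemma LX_integrable: "v : LX ==> integrable arc (%t. bnorm t (v t))" by (simp add: LX_def)

lemma LX_AE: assumes "v : LX" shows "AE t in arc. v t : Delta"
proof -
 obtain m :: nat and c x where *: "!!j. j < m ==> x j : Delta" "AE t in arc. v t = (SUM j<m. c j t *C x j)"
  using assms by (auto simp: LX_def)
 from *(2) show ?thesis by eventually_elim (use *(1) in "auto intro: Delta_comb")
qed

lemma LXI:
 fixes m :: nat
 assumes c: "!!j. j < m ==> c j : borel_measurable arc" "!!j. j < m ==> x j : Delta"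
  and v: "AE t in arc. v t = (SUM j<m. c j t *C x j)"
  and B: "integrable arc B" "AE t in arc. bnorm t (v t) <= B t" shows "v : LX"
proof -
 have m: "arc_meas (%t. bnorm t (v t))" by (rule arc_measurable_AE_real[OF bnorm_measurable[OF c]]) (use v in auto)
 have "integrable arc (%t. bnorm t (v t))"
 proof (rule Bochner_Integration.integrable_bound[OF B(1) m])
  show "AE t in arc. norm (bnorm t (v t)) <= norm (B t)" using B(2) v AE_good
  proof eventually_elim
  case (elim t)
  have "0 <= bnorm t (v t)" unfolding elim(2) by (intro bnorm_nonneg elim(3) Delta_comb c(2))
  then show ?case using elim(1) by simp
  qed
 qed
 then show ?thesis unfolding LX_def mem_Collect_eq using c v by (intro conjI exI[of _ m] exI[of _ c] exI[of _ x]) auto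
qed

lemma LX_add:
 assumes v: "v : LX" and w: "w : LX"
 shows "v + w : LX" "(LINT t|arc. bnorm t ((v + w) t)) <= (LINT t|arc. bnorm t (v t)) + (LINT t|arc. bnorm t (w t))"
proof -
 obtain n :: nat and c x where v': "!!j. j < n ==> c j : borel_measurable arc" "!!j. j < n ==> x j : Delta"
  "AE t in arc. v t = (SUM j<n. c j t *C x j)" using v by (auto simp: LX_def)
 obtain m :: nat and d y where w': "!!j. j < m ==> d j : borel_measurable arc" "!!j. j < m ==> y j : Delta"
  "AE t in arc. w t = (SUM j<m. d j t *C y j)" using w by (auto simp: LX_def)
 have b: "AE t in arc. bnorm t ((v + w) t) <= bnorm t (v t) + bnorm t (w t)"
  using LX_AE[OF v] LX_AE[OF w] AE_good by eventually_elim (simp add: bnorm_add)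
 show vw: "v + w : LX"
 proof (rule LXI[of "n + m" "%j. if j < n then c j else d (j - n)" "%j. if j < n then x j else y (j - n)"])
  show "AE t in arc. (v + w) t = (SUM j<n + m. (if j < n then c j else d (j - n)) t *C (if j < n then x j else y (j - n)))"
  using v'(3) w'(3)
  proof eventually_elim
  case (elim t)
  have "(SUM j<n + m. (if j < n then c j else d (j - n)) t *C (if j < n then x j else y (j - n)))
  = (SUM j<n. c j t *C x j) + (SUM j<m. d j t *C y j)" by (induction m) (simp_all add: add.assoc)
  then show ?case using elim by simp
  qed
 qed (use v' w' b LX_integrable[OF v] LX_integrable[OF w] in auto)
 show "(LINT t|arc. bnorm t ((v + w) t)) <= (LINT t|arc. bnorm t (v t)) + (LINT t|arc. bnorm t (w t))"
  using integral_mono_AE[OF LX_integrable[OF vw] Bochner_Integration.integrable_add[OF LX_integrable[OF v] LX_integrable[OF w]] b]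
  by (simp add: LX_integrable v w)
qed

lemma LX_scale:
 assumes v: "v : LX" shows "a *C v : LX" "(LINT t|arc. bnorm t ((a *C v) t)) = cmod a * (LINT t|arc. bnorm t (v t))"
proof -
 obtain n :: nat and c x where v': "!!j. j < n ==> c j : borel_measurable arc" "!!j. j < n ==> x j : Delta"
  "AE t in arc. v t = (SUM j<n. c j t *C x j)" using v by (auto simp: LX_def)
 have b: "AE t in arc. bnorm t ((a *C v) t) = cmod a * bnorm t (v t)"
  using LX_AE[OF v] AE_good by eventually_elim (simp add: bnorm_scale scaleC_fun_def)
 show av: "a *C v : LX"
 proof (rule LXI[of n "%j t. a * c j t" x])
  show "AE t in arc. (a *C v) t = (SUM j<n. (a * c j t) *C x j)"
  using v'(3) by eventually_elim (simp add: scaleC_fun_def complex_vector.scale_sum_right scaleC_scaleC)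
  show "AE t in arc. bnorm t ((a *C v) t) <= cmod a * bnorm t (v t)" using b by eventually_elim simp
 qed (use v' LX_integrable[OF v] in auto)
 have "(LINT t|arc. bnorm t ((a *C v) t)) = (LINT t|arc. cmod a * bnorm t (v t))"
  by (rule integral_cong_AE) (use b LX_integrable[OF av] LX_integrable[OF v] in auto)
 then show "(LINT t|arc. bnorm t ((a *C v) t)) = cmod a * (LINT t|arc. bnorm t (v t))" by simp
qed

lemma LX_zero: "0 : LX"
 by (rule LXI[of 0 "%_ _. 0" "%_. 0" _ "%_. 0"]) (use AE_good in "auto simp: bnorm_zero elim: eventually_mono")

lemma bval_LX:
 assumes g: "g : GX" and v: "AE t in arc. v t = bval g t"
 shows "v : LX" "(LINT t|arc. bnorm t (v t)) = (LINT t|arc. bnorm t (bval g t))"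
proof -
 obtain n c x where r: "comb_rep g n c x" by (rule G0E[OF GX_G0[OF g]])
 note R = comb_repD[OF r]
 show vL: "v : LX"
 proof (rule LXI[of n "%j t. bdry (c j) t" x])
  show "AE t in arc. v t = (SUM j<n. bdry (c j) t *C x j)" using v bval_comb[of n c g x] R by auto
  show "AE t in arc. bnorm t (v t) <= bnorm t (bval g t)" using v by eventually_elim simp
 qed (use R smirnov_measurable bnorm_bval_integrable[OF g] in auto)
 show "(LINT t|arc. bnorm t (v t)) = (LINT t|arc. bnorm t (bval g t))"
  by (rule integral_cong_AE) (use v LX_integrable[OF vL] bnorm_bval_integrable[OF g] in auto)
qed

text \<open>\<open>functional_L1_bound\<close> is used twice: it shows that the functional depends
  only on boundary values almost everywhere, and it is the domination required by
  Hahn-Banach.\<close>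

lemma L1_extension:
 assumes z: "z : Omega" and F: "F : points (DX n z)"
 obtains E where "!!v w. v : LX ==> w : LX ==> E (v + w) = E v + E w" "!!a v. v : LX ==> E (a *C v) = a * E v"
  "!!v. v : LX ==> cmod (E v) <= jet_const n z * nrm (DX n z) F * (LINT t|arc. bnorm t (v t))"
  "!!g v. g : GX ==> AE t in arc. v t = bval g t ==> E v = F (jet n z g)"
proof -
 define K where "K = jet_const n z * nrm (DX n z) F"
 have K: "0 <= K" unfolding K_def using jet_const_nonneg[OF z] dual_norm(1)[OF normed_space_on_rochberg[OF z] F] by simp
 define p where "p v = K * (LINT t|arc. bnorm t (v t))" for v
 define G where "G = {v. EX g:GX. AE t in arc. v t = bval g t}"
 define L where "L v = F (jet n z (SOME g. g : GX & (AE t in arc. v t = bval g t)))" for v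
 have L: "L v = F (jet n z g)" if g: "g : GX" "AE t in arc. v t = bval g t" for g v
 proof -
  define g' where "g' = (SOME g. g : GX & (AE t in arc. v t = bval g t))"
  have g': "g' : GX" "AE t in arc. v t = bval g' t"
  using someI[of "%g. g : GX & (AE t in arc. v t = bval g t)" g] g unfolding g'_def by auto
  note d = GX_minus(1)[OF g'(1) g(1)]
  have "AE t in arc. bnorm t (bval (g' - g) t) = 0"
  using bval_diff[OF GX_G0[OF g'(1)] GX_G0[OF g(1)]] g(2) g'(2) AE_good
  by eventually_elim (simp add: fun_diff_def bnorm_zero)
  then have "(LINT t|arc. bnorm t (bval (g' - g) t)) = 0"
  using integral_cong_AE[of "%t. bnorm t (bval (g' - g) t)" arc "%_. 0"] bnorm_bval_integrable[OF d] by auto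
  then have "F (jet n z (g' - g)) = 0" using functional_L1_bound[OF z F d] by simp
  then show ?thesis using jet_functional(1)[OF z F d g(1)] by (simp add: L_def g'_def)
 qed
 have GI: "v + w : G" "L (v + w) = L v + L w" if "v : G" "w : G" for v w
 proof -
  obtain f g where f: "f : GX" "AE t in arc. v t = bval f t" and g: "g : GX" "AE t in arc. w t = bval g t"
  using \<open>v : G\<close> \<open>w : G\<close> by (auto simp: G_def)
  have fg: "AE t in arc. (v + w) t = bval (f + g) t"
  using bval_add[OF GX_G0[OF f(1)] GX_G0[OF g(1)]] f(2) g(2) by eventually_elim (simp add: plus_fun_def)
  show "v + w : G" using GX_plus(1)[OF f(1) g(1)] fg by (auto simp: G_def)
  show "L (v + w) = L v + L w"
  using L[of "f + g" "v + w", OF GX_plus(1)[OF f(1) g(1)] fg] L[OF f] L[OF g] jet_functional(1)[OF z F f(1) g(1)] by simp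
 qed
 have GS: "a *C v : G" "L (a *C v) = a * L v" if "v : G" for a v
 proof -
  obtain f where f: "f : GX" "AE t in arc. v t = bval f t" using \<open>v : G\<close> by (auto simp: G_def)
  have af: "AE t in arc. (a *C v) t = bval (a *C f) t"
  using bval_scale[OF GX_G0[OF f(1)], of a] f(2) by eventually_elim (simp add: scaleC_fun_def)
  show "a *C v : G" using GX_scaleC(1)[OF f(1)] af by (auto simp: G_def)
  show "L (a *C v) = a * L v"
  using L[of "a *C f" "a *C v", OF GX_scaleC(1)[OF f(1)] af] L[OF f] jet_functional(2)[OF z F f(1)] by simp
 qed
 have G0: "0 : G"
 proof -
  have "bdry (%w. 0 :: 'a) t = 0" for t by (rule nt_limit_eqI[OF has_nt_limit_const]) simp
  then have "AE t in arc. (0 :: real => 'a) t = bval 0 t" by (simp add: bval_def)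
  then show ?thesis using zero_GX unfolding G_def by blast
 qed
 have VS: "complex_vector.subspace LX" "complex_vector.subspace G"
  unfolding complex_vector.subspace_def using LX_add(1) LX_scale(1) LX_zero GI(1) GS(1) G0 by blast+
 have GL: "G \<subseteq> LX" using bval_LX(1) by (auto simp: G_def)
 have Lb: "cmod (L v) <= p v" if "v : G" for v
 proof -
  obtain f where f: "f : GX" "AE t in arc. v t = bval f t" using \<open>v : G\<close> by (auto simp: G_def)
  show ?thesis using functional_L1_bound[OF z F f(1)] L[OF f] bval_LX(2)[OF f] by (simp add: p_def K_def)
 qed
 have padd: "p (v + w) <= p v + p w" if "v : LX" "w : LX" for v w
  unfolding p_def using mult_left_mono[OF LX_add(2)[OF that] K] by (simp add: distrib_left)
 have psc: "p (a *C v) = cmod a * p v" if "v : LX" for a v unfolding p_def using LX_scale(2)[OF that] by simp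
 show ?thesis
 proof (rule hahn_banach[where p=p and L=L, OF VS GL padd psc GI(2) GS(2) Lb])
  fix E assume E: "!!x y. x : LX ==> y : LX ==> E (x + y) = E x + E y" "!!x a. x : LX ==> E (a *C x) = a * E x"
  "!!x. x : LX ==> cmod (E x) <= p x" "!!x. x : G ==> E x = L x"
  show ?thesis
  proof (rule that[of E])
  show "E v = F (jet n z g)" if "g : GX" "AE t in arc. v t = bval g t" for g v
  using E(4)[of v] L[OF that] that by (auto simp: G_def)
  qed (use E in "auto simp: p_def K_def")
 qed
qed

end

subsection \<open>Representation of functionals\<close>

lemma smirnov_nt_mult:
 assumes "f : smirnov" "g : smirnov" shows "AE t in arc. bdry (%w. f w * g w) t = bdry f t * bdry g t"
 using smirnov_nt_limit[OF assms(1)] smirnov_nt_limit[OF assms(2)]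
 by eventually_elim (rule nt_limit_eqI[OF has_nt_limit_mult], auto)

lemma nt_limit_shift_power: "bdry (%w. (w - a) ^ k) t = (cis t - a) ^ k"
 by (rule nt_limit_eqI[OF has_nt_limit_isCont[where f="%w. (w - a) ^ k"]]) (auto intro!: continuous_intros)

lemma cauchy_kernel_split:
 fixes x y :: complex
 assumes "x ~= y" shows "x ^ n / (x - y) = (SUM i<n. y ^ (n - Suc i) * x ^ i) + y ^ n * (1 / (x - y))"
proof -
 have d: "x ^ n - y ^ n = (x - y) * (SUM i<n. y ^ (n - Suc i) * x ^ i)" by (rule power_diff_sumr2)
 have "x ^ n / (x - y) = (y ^ n + (x ^ n - y ^ n)) / (x - y)" by simp
 also have "... = (y ^ n + (x - y) * (SUM i<n. y ^ (n - Suc i) * x ^ i)) / (x - y)" by (simp only: d)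
 also have "... = (SUM i<n. y ^ (n - Suc i) * x ^ i) + y ^ n * (1 / (x - y))"
  using assms by (simp add: add_divide_distrib)
 finally show ?thesis .
qed

text \<open>The Cauchy kernel and \<open>cnj (cis t)\<close> times the Poisson kernel differ by the
  boundary value of a function holomorphic in the disc, a term which \<open>e_null\<close> will
  annihilate.\<close>

lemma poisson_cauchy_kernel:
 assumes "cmod zeta < 1"
 shows "1 / (cis t - zeta) = cnj (cis t) * of_real (PK zeta t) - cnj zeta / (1 - cnj zeta * cis t)"
proof -
 define x where "x = cis t"
 have x: "x * cnj x = 1" using complex_norm_square[of x] by (simp add: x_def)
 have n: "x - zeta ~= 0" using cis_neq_in_ball[OF assms, of t] by (simp add: x_def)
 have d: "1 - cnj zeta * x = x * cnj (x - zeta)" using x by (simp add: algebra_simps)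
 have d0: "x ~= 0" "cnj x ~= 0" by (simp_all add: x_def)
 have n': "cnj (x - zeta) ~= 0" using n by (metis complex_cnj_zero_iff)
 have P: "of_real (PK zeta t) = (1 - zeta * cnj zeta) / ((x - zeta) * cnj (x - zeta))"
  unfolding PK_def x_def[symmetric] of_real_divide of_real_diff of_real_1 complex_norm_square by simp
 have "cnj x * of_real (PK zeta t) - cnj zeta / (1 - cnj zeta * x)
  = cnj x * (1 - zeta * cnj zeta) / ((x - zeta) * cnj (x - zeta)) - cnj zeta * cnj x / cnj (x - zeta)"
  unfolding d P divide_inverse inverse_mult_distrib inverse_unique[OF x] by (simp only: mult.assoc)
 also have "... = cnj x * (1 - zeta * cnj zeta - cnj zeta * (x - zeta)) / ((x - zeta) * cnj (x - zeta))"
  using n n' by (simp add: divide_simps) (simp add: algebra_simps)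
 also have "1 - zeta * cnj zeta - cnj zeta * (x - zeta) = x * cnj (x - zeta)" using x by (simp add: algebra_simps)
 also have "cnj x * (x * cnj (x - zeta)) / ((x - zeta) * cnj (x - zeta)) = 1 / (x - zeta)"
  using x n n' by (simp add: mult.assoc[symmetric] mult.commute[of "cnj x"])
 finally show ?thesis by (simp add: x_def)
qed

lemma nt_limit_le:
 assumes f: "has_nt_limit f (cis t) l" and r: "has_nt_limit r (cis t) (m :: real)"
  and le: "!!w. cmod w < 1 ==> cmod (f w) <= C * r w" shows "cmod l <= C * m"
proof (rule tendsto_le[of "at_left (1 :: real)"])
 show "((%s. cmod (f (of_real s * cis t))) \<longlongrightarrow> cmod l) (at_left 1)"
  by (intro tendsto_norm has_nt_limit_radial[OF f]) simp
 show "((%s. C * r (of_real s * cis t)) \<longlongrightarrow> C * m) (at_left 1)"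
  by (intro tendsto_mult tendsto_const has_nt_limit_radial[OF r]) simp
 have "eventually (%s::real. 0 < s & s < 1) (at_left 1)" by (rule eventually_at_leftI[of 0]) auto
 then show "\<forall>\<^sub>F s in at_left 1. cmod (f (of_real s * cis t)) <= C * r (of_real s * cis t)"
  by eventually_elim (rule le, simp add: norm_mult)
qed simp

context interpolation_family
begin

text \<open>For \<open>x\<close> in \<open>Delta\<close>, the scalar factors \<open>f\<close> for
  which \<open>%t. f t *C x\<close> belongs to \<open>LX\<close>.\<close>

definition "L1x x f \<longleftrightarrow> f : borel_measurable arc & integrable arc (%t. cmod (f t) * bnorm t x)"

lemma bnorm_vector_measurable: "x : Delta ==> arc_meas (%t. bnorm t x)" unfolding bnorm_def by (rule nrm_measurable)

lemma L1x_LX: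
 assumes x: "x : Delta" and f: "L1x x f"
 shows "(%t. f t *C x) : LX" "(LINT t|arc. bnorm t (f t *C x)) = (LINT t|arc. cmod (f t) * bnorm t x)"
proof -
 have b: "AE t in arc. bnorm t (f t *C x) = cmod (f t) * bnorm t x"
  using AE_good by eventually_elim (simp add: bnorm_scale x)
 show L: "(%t. f t *C x) : LX"
 proof (rule LXI[of 1 "%_. f" "%_. x" _ "%t. cmod (f t) * bnorm t x"])
  show "AE t in arc. bnorm t (f t *C x) <= cmod (f t) * bnorm t x" using b by eventually_elim simp
 qed (use f x in "auto simp: L1x_def")
 show "(LINT t|arc. bnorm t (f t *C x)) = (LINT t|arc. cmod (f t) * bnorm t x)"
  by (rule integral_cong_AE) (use LX_integrable[OF L] f b in "auto simp: L1x_def")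
qed

lemma L1x_boundI:
 assumes x: "x : Delta" and f: "arc_meas f" and B: "integrable arc B" "AE t in arc. cmod (f t) * bnorm t x <= B t"
 shows "L1x x f"
proof -
 have m: "arc_meas (%t. cmod (f t) * bnorm t x)" using f bnorm_vector_measurable[OF x] by measurable
 have "integrable arc (%t. cmod (f t) * bnorm t x)"
 proof (rule Bochner_Integration.integrable_bound[OF B(1) m])
  show "AE t in arc. norm (cmod (f t) * bnorm t x) <= norm (B t)" using B(2) AE_good
  proof eventually_elim
  case (elim t)
  have "0 <= cmod (f t) * bnorm t x" by (intro mult_nonneg_nonneg norm_ge_zero bnorm_nonneg elim(2) x)
  then show ?case using elim(1) by simp
  qed
 qed
 then show ?thesis using f by (simp add: L1x_def)
qed

lemma L1x_mult:
 assumes x: "x : Delta" and f: "L1x x f" and g: "arc_meas g" "!!t. cmod (g t) <= M" shows "L1x x (%t. g t * f t)"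
proof (rule L1x_boundI[OF x])
 show "arc_meas (%t. g t * f t)" using f g by (auto simp: L1x_def)
 show "integrable arc (%t. M * (cmod (f t) * bnorm t x))" using f by (simp add: L1x_def)
 show "AE t in arc. cmod (g t * f t) * bnorm t x <= M * (cmod (f t) * bnorm t x)" using AE_good
 proof eventually_elim
  case (elim t)
  have "cmod (g t) * (cmod (f t) * bnorm t x) <= M * (cmod (f t) * bnorm t x)"
  by (intro mult_right_mono g(2) mult_nonneg_nonneg norm_ge_zero bnorm_nonneg elim x)
  then show ?case by (simp add: norm_mult mult.assoc)
 qed
qed

lemma L1x_add:
 assumes x: "x : Delta" and f: "L1x x f" "L1x x g" shows "L1x x (%t. f t + g t)"
proof (rule L1x_boundI[OF x, of _ "%t. cmod (f t) * bnorm t x + cmod (g t) * bnorm t x"])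
 show "AE t in arc. cmod (f t + g t) * bnorm t x <= cmod (f t) * bnorm t x + cmod (g t) * bnorm t x" using AE_good
 proof eventually_elim
  case (elim t)
  have "cmod (f t + g t) * bnorm t x <= (cmod (f t) + cmod (g t)) * bnorm t x"
  by (intro mult_right_mono norm_triangle_ineq bnorm_nonneg elim x)
  then show ?case by (simp add: distrib_right)
 qed
qed (use f in "auto simp: L1x_def")

lemma L1x_cmult: "x : Delta ==> L1x x f ==> L1x x (%t. c * f t)" by (rule L1x_mult[of _ _ "%_. c" "cmod c"]) auto

text \<open>The weights \<open>U\<close> for which \<open>%w. U (psi w) *C x\<close> is a simple
  function of finite norm.\<close>

definition "wadm U x \<longleftrightarrow> x : Delta & U : smirnov & (EX B. AE t in arc. cmod (bdry U t) * bnorm t x <= B)"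

lemma wadm_wt: "x : Delta ==> wadm (outer (wt x)) x"
 unfolding wadm_def using outer_wt_bound smirnov_outer[OF wt_integrable] by blast

lemma wadm_mult:
 assumes U: "wadm U x" and V: "V : smirnov" "AE t in arc. cmod (bdry V t) <= M" shows "wadm (%w. V w * U w) x"
proof -
 obtain B where B: "AE t in arc. cmod (bdry U t) * bnorm t x <= B" using U by (auto simp: wadm_def)
 have x: "x : Delta" and US: "U : smirnov" using U by (auto simp: wadm_def)
 have "AE t in arc. cmod (bdry (%w. V w * U w) t) * bnorm t x <= \<bar>M\<bar> * \<bar>B\<bar>"
  using smirnov_nt_mult[OF V(1) US] B V(2) AE_good
 proof eventually_elim
  case (elim t)
  have "cmod (bdry V t) * (cmod (bdry U t) * bnorm t x) <= \<bar>M\<bar> * \<bar>B\<bar>"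
  using elim x by (intro mult_mono) (auto simp: bnorm_nonneg)
  then show ?case using elim(1) by (simp add: norm_mult mult.assoc)
 qed
 then show ?thesis using x smirnov_mult[OF V(1) US] by (auto simp: wadm_def)
qed

lemma wadm_L1x: "wadm U x ==> L1x x (%t. bdry U t)"
 unfolding wadm_def by (auto intro: L1x_boundI[where B="%_. _"] smirnov_measurable)

text \<open>The Cauchy transform of a functional \<open>e\<close> which extends \<open>F\<close> from the jets of \<open>\<G>\<close> to an \<open>L\<^sup>1\<close> space of
  boundary functions. Since \<open>e\<close> annihilates the functions vanishing to order \<open>n\<close>, the Cauchy kernel may be
  replaced by the Poisson kernel, which gives the bound on the boundary.\<close>

context
 fixes z n F e K
 assumes z: "z : Omega" and F: "F : points (DX n z)" and K: "0 <= K"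
  and e_add: "!!f g x. x : Delta ==> L1x x f ==> L1x x g ==> e (%t. f t + g t) x = e f x + e g x"
  and e_cmult: "!!c f x. x : Delta ==> L1x x f ==> e (%t. c * f t) x = c * e f x"
  and e_bound: "!!f x. x : Delta ==> L1x x f ==> cmod (e f x) <= K * (LINT t|arc. cmod (f t) * bnorm t x)"
  and e_vadd: "!!f x y. x : Delta ==> y : Delta ==> L1x x f ==> L1x y f ==> e f (x + y) = e f x + e f y"
  and e_vscale: "!!c f x. x : Delta ==> L1x x f ==> e f (c *C x) = c * e f x"
  and e_jet: "!!f g x. x : Delta ==> g : GX ==> AE t in arc. f t *C x = bval g t ==> e f x = F (jet n z g)"
begin

lemma e_cong:
 assumes x: "x : Delta" and f: "L1x x f" "L1x x g" and eq: "AE t in arc. f t = g t" shows "e f x = e g x"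
proof -
 note d = L1x_add[OF x f(1) L1x_cmult[OF x f(2), of "-1"]]
 have "(LINT t|arc. cmod (f t + (-1) * g t) * bnorm t x) = (LINT t|arc. 0)"
 proof (rule integral_cong_AE)
  show "AE t in arc. cmod (f t + (-1) * g t) * bnorm t x = 0" using eq by eventually_elim simp
 qed (use d in "auto simp: L1x_def")
 then have "e (%t. f t + (-1) * g t) x = 0" using e_bound[OF x d] by simp
 then show ?thesis using e_add[OF x f(1) L1x_cmult[OF x f(2), of "-1"]] e_cmult[OF x f(2), of "-1"] by simp
qed

lemma e_sum:
 assumes x: "x : Delta" and f: "!!i. i < (m::nat) ==> L1x x (f i)"
 shows "L1x x (%t. SUM i<m. c i * f i t)" "e (%t. SUM i<m. c i * f i t) x = (SUM i<m. c i * e (f i) x)"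
proof -
 have "L1x x (%t. SUM i<m. c i * f i t) & e (%t. SUM i<m. c i * f i t) x = (SUM i<m. c i * e (f i) x)" using f
 proof (induction m)
  case 0
  have z: "L1x x (%_. 0)" by (simp add: L1x_def)
  then show ?case using e_cmult[OF x z, of 0] by simp
 next
  case (Suc m)
  then have IH: "L1x x (%t. SUM i<m. c i * f i t)" "e (%t. SUM i<m. c i * f i t) x = (SUM i<m. c i * e (f i) x)" by auto
  show ?case using L1x_add[OF x IH(1) L1x_cmult[OF x Suc.prems]] e_add[OF x IH(1) L1x_cmult[OF x Suc.prems]]
  e_cmult[OF x Suc.prems] IH(2) by simp
 qed
 then show "L1x x (%t. SUM i<m. c i * f i t)" "e (%t. SUM i<m. c i * f i t) x = (SUM i<m. c i * e (f i) x)" by auto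
qed

lemma e_power:
 assumes U: "wadm U x" shows "(%w. (psi w - psi z) ^ k *C (U (psi w) *C x)) : GX"
  "e (%t. (cis t - psi z) ^ k * bdry U t) x = F (jet n z (%w. (psi w - psi z) ^ k *C (U (psi w) *C x)))"
proof -
 have x: "x : Delta" and US: "U : smirnov" using U by (auto simp: wadm_def)
 obtain B where B: "AE t in arc. cmod (bdry U t) * bnorm t x <= B" using U by (auto simp: wadm_def)
 define g where "g w = U (psi w) *C x" for w
 define h where "h w = (psi w - psi z) ^ k *C g w" for w
 have g: "g : GX" unfolding g_def[abs_def] by (rule GX_single(1)[OF x US B])
 have hg: "h (phi w) = (w - psi z) ^ k *C g (phi w)" if "cmod w < 1" for w using that by (simp add: h_def)
 have h: "h : GX" using GX_mult(1)[OF beta_power_multiplier[OF z] g, of h k] hg by simp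
 then show "(%w. (psi w - psi z) ^ k *C (U (psi w) *C x)) : GX" by (simp add: h_def[abs_def] g_def)
 have "AE t in arc. bval g t = bdry U t *C x" using bval_comb[of 1 "%_. U" g "%_. x"] US by (auto simp: g_def)
 moreover have "AE t in arc. bval h t = bdry (%w. (w - psi z) ^ k) t *C bval g t"
  using bval_mult[OF beta_power_multiplier(1)[OF z] GX_G0[OF g], of h k] hg by simp
 ultimately have "AE t in arc. ((cis t - psi z) ^ k * bdry U t) *C x = bval h t"
  by eventually_elim (simp add: nt_limit_shift_power scaleC_scaleC)
 from e_jet[OF x h this]
 show "e (%t. (cis t - psi z) ^ k * bdry U t) x = F (jet n z (%w. (psi w - psi z) ^ k *C (U (psi w) *C x)))"
  by (simp add: h_def[abs_def] g_def)
qed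

text \<open>The corresponding simple function is divisible by \<open>(psi w - psi z) ^ n\<close>, so
  its jet at \<open>z\<close> is 0.\<close>

lemma e_null:
 assumes U: "wadm U x" shows "e (%t. (cis t - psi z) ^ n * bdry U t) x = 0"
proof -
 have g: "(%w. U (psi w) *C x) : GX" using e_power(1)[OF U, of 0] by (simp add: scaleC_one)
 have "vc i (%w. (psi w - psi z) ^ n *C (U (psi w) *C x)) z = 0" if "i < n" for i
  by (rule vc_power_vanish[OF G0_vholo[OF GX_G0[OF g]] G0_vholo[OF GX_G0[OF e_power(1)[OF U]]] refl z that])
 then have "jet n z (%w. (psi w - psi z) ^ n *C (U (psi w) *C x)) = 0" by (simp add: jet_zero_iff)
 moreover have "jet n z (0 :: complex => 'a) = 0" using jet_FX_scale[OF GX_FX[OF zero_GX] z, of n 0] by simp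
 ultimately show ?thesis using e_power(2)[OF U, of n] jet_functional(2)[OF z F zero_GX, of 0] by simp
qed

lemma shift_power_le: "cmod ((cis t - psi z) ^ k) <= 2 ^ k"
proof -
 have "cmod (cis t - psi z) <= 2" using norm_triangle_ineq4[of "cis t" "psi z"] less_imp_le[OF psi_ball[OF z]] by simp
 then show ?thesis unfolding norm_power by (intro power_mono) auto
qed

lemma continuous_circle:
 "continuous_on UNIV (%t. (cis t - a) ^ k)" "cmod zeta < 1 ==> continuous_on UNIV (%t. 1 / (cis t - zeta))"
 using cis_neq_in_ball[of zeta] by (auto intro!: continuous_intros continuous_on_cis)

lemma resolvent_le: "cmod zeta < 1 ==> cmod (1 / (cis t - zeta)) <= 1 / (1 - cmod zeta)"
 using cmod_cis_diff_ge[of zeta t] by (simp add: norm_divide frac_le)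

text \<open>The factor \<open>(cis t - psi z) ^ n\<close> in front of the Cauchy kernel makes
  \<open>e_null\<close> applicable to bounded holomorphic perturbations of the kernel.\<close>

definition "tr U x zeta = e (%t. (cis t - psi z) ^ n / (cis t - zeta) * bdry U t) x"

lemma L1x_kernel:
 assumes U: "wadm U x" and zeta: "cmod zeta < 1" shows "L1x x (%t. (cis t - psi z) ^ k * bdry U t)"
  "L1x x (%t. 1 / (cis t - zeta) * bdry U t)"
  "L1x x (%t. (cis t - psi z) ^ k / (cis t - zeta) * bdry U t)"
proof -
 have x: "x : Delta" using U by (simp add: wadm_def)
 note p = arc_measurable_continuous[OF continuous_circle(1)]
 show *: "L1x x (%t. 1 / (cis t - zeta) * bdry U t)"
  by (rule L1x_mult[OF x wadm_L1x[OF U] arc_measurable_continuous[OF continuous_circle(2)[OF zeta]] resolvent_le[OF zeta]])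
 show "L1x x (%t. (cis t - psi z) ^ k * bdry U t)" by (rule L1x_mult[OF x wadm_L1x[OF U] p shift_power_le])
 show "L1x x (%t. (cis t - psi z) ^ k / (cis t - zeta) * bdry U t)" using L1x_mult[OF x * p shift_power_le] by simp
qed

text \<open>By \<open>cauchy_kernel_split\<close> the transform is a polynomial in
  \<open>w - psi z\<close>, with the moments \<open>E i\<close> as coefficients in reversed order,
  plus \<open>(w - psi z) ^ n\<close> times a holomorphic function. The moments are values of
  \<open>F\<close> on jets by \<open>e_power\<close>.\<close>

lemma tr_taylor:
 assumes U: "wadm U x" shows "tr U x holomorphic_on ball 0 1"
  "m < n ==> sc m (tr U x) (psi z) = F (jet n z (%w. (psi w - psi z) ^ (n - 1 - m) *C (U (psi w) *C x)))"
proof -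
 have x: "x : Delta" using U by (simp add: wadm_def)
 obtain B where B: "AE t in arc. cmod (bdry U t) * bnorm t x <= B" using U by (auto simp: wadm_def)
 define R where "R zeta = e (%t. 1 / (cis t - zeta) * bdry U t) x" for zeta
 define T where "T f = e (%t. f t * bdry U t) x" for f
 define I where "I = (LINT t|arc. cmod (bdry U t) * bnorm t x)"
 have bddc: "EX M. ALL t:{0..2*pi}. cmod (f t) <= M" if "continuous_on UNIV f" for f :: "real => complex"
 proof -
  have "bounded (f ` {0..2*pi})"
  by (rule compact_imp_bounded[OF compact_continuous_image]) (use that continuous_on_subset in auto)
  then show ?thesis by (auto simp: bounded_iff)
 qed
 have L: "L1x x (%t. f t * bdry U t)" if f: "continuous_on UNIV f" for f
 proof -
  obtain M where M: "!!t. t : {0..2*pi} ==> cmod (f t) <= M" using bddc[OF f] by blast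
  show ?thesis
  proof (rule L1x_boundI[OF x, of _ "%_. M * \<bar>B\<bar>"])
  show "arc_meas (%t. f t * bdry U t)" using arc_measurable_continuous[OF f] wadm_L1x[OF U] by (auto simp: L1x_def)
  have "AE t in arc. t : {0..2*pi}" using AE_space[of arc] by (simp add: space_restrict_space)
  then show "AE t in arc. cmod (f t * bdry U t) * bnorm t x <= M * \<bar>B\<bar>" using B AE_good
  proof eventually_elim
  case (elim t)
  have "cmod (f t) * (cmod (bdry U t) * bnorm t x) <= M * \<bar>B\<bar>"
  using M[OF elim(1)] elim(2) norm_ge_zero[of "f t"]
  by (intro mult_mono mult_nonneg_nonneg norm_ge_zero bnorm_nonneg elim(3) x) linarith+
  then show ?case by (simp add: norm_mult mult.assoc)
  qed
  qed simp
 qed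
 have Tadd: "T (%t. f t + g t) = T f + T g" if "continuous_on UNIV f" "continuous_on UNIV g" for f g
  using e_add[OF x L[OF that(1)] L[OF that(2)]] by (simp add: T_def distrib_right)
 have Tsc: "T (%t. c * f t) = c * T f" if "continuous_on UNIV f" for f c
  using e_cmult[OF x L[OF that], of c] by (simp add: T_def mult.assoc)
 have Tb: "cmod (T f) <= (K * I) * s" if f: "continuous_on UNIV f" "!!t. cmod (f t) <= s" for f s
 proof -
  have "cmod (T f) <= K * (LINT t|arc. cmod (f t * bdry U t) * bnorm t x)"
  unfolding T_def by (rule e_bound[OF x L[OF f(1)]])
  also have "... <= K * (LINT t|arc. s * (cmod (bdry U t) * bnorm t x))"
  proof (intro mult_left_mono K integral_mono_AE)
  show "AE t in arc. cmod (f t * bdry U t) * bnorm t x <= s * (cmod (bdry U t) * bnorm t x)" using AE_good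
  proof eventually_elim
  case (elim t)
  have "cmod (f t) * (cmod (bdry U t) * bnorm t x) <= s * (cmod (bdry U t) * bnorm t x)"
  by (intro mult_right_mono f(2) mult_nonneg_nonneg norm_ge_zero bnorm_nonneg elim x)
  then show ?case by (simp add: norm_mult mult.assoc)
  qed
  qed (use L[OF f(1)] wadm_L1x[OF U] in "auto simp: L1x_def")
  finally show ?thesis by (simp add: I_def mult_ac)
 qed
 have "(%m. T (%t. 1 / (cis t - 0) ^ (m + 1)) * (w - 0) ^ m) sums R w" if "w : ball 0 1" for w
 proof -
  have "(%m. T (%t. 1 / (cis t - 0) ^ (m + 1)) * (w - 0) ^ m) sums T (%t. 1 / (cis t - w))"
  by (rule cauchy_functional_sums[of T, OF Tadd Tsc Tb]) (use that in auto)
  then show ?thesis by (simp add: T_def R_def)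
 qed
 then have Rh: "disc_hol R" by (rule power_series_holomorphic)
 define E where "E i = e (%t. (cis t - psi z) ^ i * bdry U t) x" for i
 have eq: "(SUM i<n. E i * (w - psi z) ^ (n - Suc i)) + (w - psi z) ^ n * R w = tr U x w" if w: "w : ball 0 1" for w
 proof -
  have w': "cmod w < 1" using w by simp
  note S = e_sum[of x n "%i t. (cis t - psi z) ^ i * bdry U t" "%i. (w - psi z) ^ (n - Suc i)", OF x L1x_kernel(1)[OF U w']]
  have "tr U x w = e (%t. (SUM i<n. (w - psi z) ^ (n - Suc i) * ((cis t - psi z) ^ i * bdry U t))
  + (w - psi z) ^ n * (1 / (cis t - w) * bdry U t)) x" unfolding tr_def
  proof (rule arg_cong[where f="%f. e f x"], rule ext)
  fix t
  have "cis t - psi z ~= w - psi z" using cis_neq_in_ball[OF w'] by simp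
  from cauchy_kernel_split[OF this, of n]
  have k: "(cis t - psi z) ^ n / (cis t - w) = (SUM i<n. (w - psi z) ^ (n - Suc i) * (cis t - psi z) ^ i)
  + (w - psi z) ^ n * (1 / (cis t - w))" by simp show "(cis t - psi z) ^ n / (cis t - w) * bdry U t =
  (SUM i<n. (w - psi z) ^ (n - Suc i) * ((cis t - psi z) ^ i * bdry U t))
  + (w - psi z) ^ n * (1 / (cis t - w) * bdry U t)"
  unfolding k by (simp only: distrib_right sum_distrib_right mult.assoc)
  qed
  also have "... = (SUM i<n. (w - psi z) ^ (n - Suc i) * E i) + (w - psi z) ^ n * R w"
  using e_add[OF x S(1) L1x_cmult[OF x L1x_kernel(2)[OF U w']]] S(2) e_cmult[OF x L1x_kernel(2)[OF U w']]
  by (simp only: E_def R_def)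
  finally show ?thesis by (simp add: mult.commute)
 qed
 have hol: "disc_hol (%w. (SUM i<n. E i * (w - psi z) ^ (n - Suc i)))"
  "disc_hol (%w. (w - psi z) ^ n * R w)" by (intro holomorphic_intros Rh)+
 have a: "psi z : ball 0 1" using z by simp
 have hol': "disc_hol (%w. (SUM i<n. E i * (w - psi z) ^ (n - Suc i)) + (w - psi z) ^ n * R w)"
  by (intro holomorphic_on_add hol)
 show "tr U x holomorphic_on ball 0 1" by (rule holomorphic_transform[OF hol' eq])
 assume m: "m < n"
 have "sc m (tr U x) (psi z) = sc m (%w. (SUM i<n. E i * (w - psi z) ^ (n - Suc i)) + (w - psi z) ^ n * R w) (psi z)"
  by (rule sc_cong[OF hol' open_ball a eq, symmetric])
 also have "... = sc m (%w. SUM i<n. E i * (w - psi z) ^ (n - Suc i)) (psi z) + sc m (%w. (w - psi z) ^ n * R w) (psi z)"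
  by (rule sc_add[OF hol open_ball a])
 also have "sc m (%w. (w - psi z) ^ n * R w) (psi z) = 0"
  by (rule sc_power_vanish[OF _ _ Rh open_ball a m]) (auto intro!: holomorphic_intros)
 also have "sc m (%w. SUM i<n. E i * (w - psi z) ^ (n - Suc i)) (psi z) = (SUM i<n. E i * sc m (%w. (w - psi z) ^ (n - Suc i)) (psi z))"
  by (rule sc_sum_cmult[of _ _ UNIV]) (auto intro!: holomorphic_intros)
 also have "... = (SUM i<n. if i = n - 1 - m then E i else 0)"
  using m by (intro sum.cong refl) (auto simp: sc_shift_power)
 also have "... = E (n - 1 - m)" using m by simp
 finally show "sc m (tr U x) (psi z) = F (jet n z (%w. (psi w - psi z) ^ (n - 1 - m) *C (U (psi w) *C x)))"
  using e_power(2)[OF U, of "n - 1 - m"] by (simp add: E_def)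
qed

text \<open>By \<open>poisson_cauchy_kernel\<close> the Cauchy kernel may be replaced by
  \<open>cnj (cis t)\<close> times the Poisson kernel: the remaining term is the boundary value of
  the bounded function \<open>V\<close>, and \<open>e_null\<close> removes it. Positivity of the
  Poisson kernel then turns the integral bound for \<open>e\<close> into a Poisson integral.\<close>

lemma tr_le:
 assumes U: "wadm U x" and zeta: "cmod zeta < 1"
 shows "cmod (tr U x zeta) <= (K * 2 ^ n * (2 * pi)) * pois (%t. cmod (bdry U t) * bnorm t x) zeta"
proof -
 have x: "x : Delta" and US: "U : smirnov" using U by (auto simp: wadm_def)
 define V where "V w = cnj zeta / (1 - cnj zeta * w)" for w
 have V0: "1 - cmod zeta <= cmod (1 - cnj zeta * w)" if "cmod w <= 1" for w
  using norm_triangle_ineq2[of 1 "cnj zeta * w"] mult_left_mono[OF that, of "cmod zeta"] by (simp add: norm_mult)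
 have V1: "1 - cnj zeta * w ~= 0" if "cmod w <= 1" for w using V0[OF that] zeta by auto
 have V: "V : smirnov" "AE t in arc. cmod (bdry V t) <= cmod zeta / (1 - cmod zeta)"
 proof -
  have h: "disc_hol V" unfolding V_def by (intro holomorphic_intros) (use V1 in auto)
  have b: "cmod (V w) <= cmod zeta / (1 - cmod zeta)" if "cmod w < 1" for w
  unfolding V_def norm_divide using V0[of w] that zeta by (intro frac_le) auto
  show "V : smirnov" "AE t in arc. cmod (bdry V t) <= cmod zeta / (1 - cmod zeta)"
  using bounded_multiplier[OF h b] by auto
 qed
 have Vn: "bdry V t = V (cis t)" for t
  by (rule nt_limit_eqI[OF has_nt_limit_isCont]) (use V1[of "cis t"] in "auto simp: V_def intro!: continuous_intros")
 note VU = wadm_mult[OF U V]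
 define f where "f t = ((cis t - psi z) ^ n * (cnj (cis t) * of_real (PK zeta t))) * bdry U t" for t
 have fb: "cmod ((cis t - psi z) ^ n * (cnj (cis t) * of_real (PK zeta t))) <= 2 ^ n * PK zeta t" for t
  using mult_right_mono[OF shift_power_le[of t n] less_imp_le[OF PK_pos[OF zeta, of t]]] PK_pos[OF zeta, of t] by (simp add: norm_mult)
 have fL: "L1x x f" unfolding f_def
 proof (rule L1x_mult[OF x wadm_L1x[OF U]])
  show "arc_meas (%t. (cis t - psi z) ^ n * (cnj (cis t) * of_real (PK zeta t)))"
  by (intro arc_measurable_continuous continuous_intros continuous_on_cis continuous_on_PK zeta)
  show "cmod ((cis t - psi z) ^ n * (cnj (cis t) * of_real (PK zeta t))) <= 2 ^ n * (2 / (1 - cmod zeta))" for t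
  by (rule order_trans[OF fb]) (intro mult_left_mono PK_le zeta, simp)
 qed
 have Lz: "L1x x (%t. (cis t - psi z) ^ n * bdry (%w. V w * U w) t)" by (rule L1x_kernel(1)[OF VU zeta])
 have "tr U x zeta = e (%t. f t + (-1) * ((cis t - psi z) ^ n * bdry (%w. V w * U w) t)) x" unfolding tr_def
 proof (rule e_cong[OF x L1x_kernel(3)[OF U zeta] L1x_add[OF x fL L1x_cmult[OF x Lz]]])
  show "AE t in arc. (cis t - psi z) ^ n / (cis t - zeta) * bdry U t =
  f t + - 1 * ((cis t - psi z) ^ n * bdry (%w. V w * U w) t)" using smirnov_nt_mult[OF V(1) US] proof eventually_elim
  case (elim t)
  have "(cis t - psi z) ^ n / (cis t - zeta) = (cis t - psi z) ^ n * (1 / (cis t - zeta))" by simp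
  also have "... = (cis t - psi z) ^ n * (cnj (cis t) * of_real (PK zeta t)) - (cis t - psi z) ^ n * V (cis t)"
  unfolding poisson_cauchy_kernel[OF zeta] V_def by (rule right_diff_distrib)
  finally show ?case unfolding elim Vn f_def by (simp only: left_diff_distrib mult.assoc) simp
  qed
 qed
 also have "... = e f x" unfolding e_add[OF x fL L1x_cmult[OF x Lz]] e_cmult[OF x Lz] e_null[OF VU] by simp
 finally have "cmod (tr U x zeta) <= K * (LINT t|arc. cmod (f t) * bnorm t x)" using e_bound[OF x fL] by simp
 also have "... <= K * (LINT t|arc. 2 ^ n * (PK zeta t * (cmod (bdry U t) * bnorm t x)))"
 proof (intro mult_left_mono K integral_mono_AE)
  show "AE t in arc. cmod (f t) * bnorm t x <= 2 ^ n * (PK zeta t * (cmod (bdry U t) * bnorm t x))" using AE_good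
  proof eventually_elim
  case (elim t)
  have "cmod ((cis t - psi z) ^ n * (cnj (cis t) * of_real (PK zeta t))) * (cmod (bdry U t) * bnorm t x)
  <= 2 ^ n * PK zeta t * (cmod (bdry U t) * bnorm t x)"
  by (intro mult_right_mono fb mult_nonneg_nonneg norm_ge_zero bnorm_nonneg elim x)
  then show ?case by (simp only: f_def norm_mult mult.assoc)
  qed
  show "integrable arc (%t. 2 ^ n * (PK zeta t * (cmod (bdry U t) * bnorm t x)))"
  using integrable_PK[OF zeta] wadm_L1x[OF U] by (simp add: L1x_def)
 qed (use fL in "simp add: L1x_def")
 also have "... = (K * 2 ^ n * (2 * pi)) * pois (%t. cmod (bdry U t) * bnorm t x) zeta" by (simp add: pois_def)
 finally show ?thesis .
qed

text \<open>The difference of the boundary value of \<open>V\<close> and \<open>V zeta\<close> is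
  divisible by \<open>cis t - zeta\<close>, which cancels the Cauchy kernel and leaves a term
  annihilated by \<open>e_null\<close>. So changing the weight multiplies the transform by the same
  factor, and the quotient of transform and weight is unaffected.\<close>

lemma tr_mult:
 assumes U: "wadm U x" and V: "V : smirnov" "AE t in arc. cmod (bdry V t) <= 1" and zeta: "cmod zeta < 1"
 shows "tr (%w. V w * U w) x zeta = V zeta * tr U x zeta"
proof -
 have x: "x : Delta" and US: "U : smirnov" using U by (auto simp: wadm_def)
 have "(%w. V w - V zeta) : smirnov" by (intro smirnov_diff V smirnov_const)
 then obtain D where D: "D : smirnov" "!!w. cmod w < 1 ==> V w - V zeta = (w - zeta) * D w"
  by (rule smirnov_div[OF _ zeta]) auto
 have Dn: "AE t in arc. bdry V t - V zeta = (cis t - zeta) * bdry D t"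
  using smirnov_nt_limit[OF D(1)] smirnov_nt_limit[OF V(1)]
 proof eventually_elim
  case (elim t)
  have "has_nt_limit (%w. (w - zeta) * D w + V zeta) (cis t) ((cis t - zeta) * bdry D t + V zeta)"
  by (intro has_nt_limit_add has_nt_limit_mult has_nt_limit_const elim has_nt_limit_isCont) (auto intro!: continuous_intros)
  moreover have "bdry V t = bdry (%w. (w - zeta) * D w + V zeta) t"
  by (rule nt_limit_cong) (use D(2) in "auto simp: diff_eq_eq")
  ultimately show ?case by (simp add: nt_limit_eqI)
 qed
 \<comment> \<open>The divisor is at least \<open>1 - |zeta|\<close> on the circle, so
   \<open>D\<close> has bounded boundary values and \<open>D * U\<close> is again an admissible
   weight.\<close>
 have "AE t in arc. cmod (bdry D t) <= 2 / (1 - cmod zeta)" using Dn V(2)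
 proof eventually_elim
  case (elim t)
  have "(1 - cmod zeta) * cmod (bdry D t) <= cmod (cis t - zeta) * cmod (bdry D t)"
  by (intro mult_right_mono cmod_cis_diff_ge zeta) simp
  also have "... = cmod (bdry V t - V zeta)" by (simp add: elim(1) norm_mult)
  also have "... <= 2" using norm_triangle_ineq4[of "bdry V t" "V zeta"] elim(2) smirnov_le[OF V zeta] by linarith
  finally show ?case using zeta by (simp add: pos_le_divide_eq mult.commute)
 qed
 note DU = wadm_mult[OF U D(1) this]
 note VU = wadm_mult[OF U V]
 note L = L1x_kernel(3)[OF U zeta, of n] and LD = L1x_kernel(1)[OF DU zeta, of n] and LV = L1x_kernel(3)[OF VU zeta, of n]
 have "tr (%w. V w * U w) x zeta = e (%t. (cis t - psi z) ^ n * bdry (%w. D w * U w) t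
  + V zeta * ((cis t - psi z) ^ n / (cis t - zeta) * bdry U t)) x" unfolding tr_def
 proof (rule e_cong[OF x LV L1x_add[OF x LD L1x_cmult[OF x L]]])
  show "AE t in arc. (cis t - psi z) ^ n / (cis t - zeta) * bdry (%w. V w * U w) t =
  (cis t - psi z) ^ n * bdry (%w. D w * U w) t + V zeta * ((cis t - psi z) ^ n / (cis t - zeta) * bdry U t)"
  using Dn smirnov_nt_mult[OF V(1) US] smirnov_nt_mult[OF D(1) US]
  proof eventually_elim
  case (elim t)
  have n: "cis t - zeta ~= 0" using cis_neq_in_ball[OF zeta] by simp
  have v: "bdry V t = (cis t - zeta) * bdry D t + V zeta" using elim(1) by (simp add: diff_eq_eq)
  show ?case unfolding elim(2,3) v using n by (simp add: field_simps)
  qed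
 qed
 also have "... = V zeta * tr U x zeta"
  unfolding e_add[OF x LD L1x_cmult[OF x L]] e_cmult[OF x L] e_null[OF DU] tr_def by simp
 finally show ?thesis .
qed

text \<open>The candidate for the element of the dual family. Dividing by the weight undoes its
  insertion, and by \<open>hh_eq\<close> multiples of the weight give the same value.\<close>

definition "hh w x = (if x : Delta then tr (outer (wt x)) x (psi w) / outer (wt x) (psi w) else 0)"

lemma outer_wt_le:
 assumes x: "x : Delta" shows "outer (wt x) : smirnov & (AE t in arc. cmod (bdry (outer (wt x)) t) <= 1)"
proof
 show "AE t in arc. cmod (bdry (outer (wt x)) t) <= 1"
  using cmod_nt_limit_outer[OF wt_integrable[OF x]] by eventually_elim (simp add: wt_def log_plus_nonneg)
qed (rule smirnov_outer[OF wt_integrable[OF x]])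

lemma smirnov_mult_le:
 assumes "U : smirnov & (AE t in arc. cmod (bdry U t) <= 1)" "V : smirnov & (AE t in arc. cmod (bdry V t) <= 1)"
 shows "(%w. U w * V w) : smirnov & (AE t in arc. cmod (bdry (%w. U w * V w) t) <= 1)"
proof
 note UV = assms[THEN conjunct1]
 show "AE t in arc. cmod (bdry (%w. U w * V w) t) <= 1"
  using smirnov_nt_mult[OF UV] assms[THEN conjunct2] by eventually_elim (simp add: norm_mult mult_le_one)
 show "(%w. U w * V w) : smirnov" by (rule smirnov_mult[OF UV])
qed

lemma hh_eq:
 assumes x: "x : Delta" and V: "V : smirnov & (AE t in arc. cmod (bdry V t) <= 1)" and w: "w : Omega" "V (psi w) ~= 0"
  and P: "!!v. P v = V v * outer (wt x) v" shows "hh w x = tr P x (psi w) / P (psi w)" "wadm P x"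
proof -
 have P': "P = (%v. V v * outer (wt x) v)" by (rule ext) (rule P)
 show "hh w x = tr P x (psi w) / P (psi w)"
  unfolding P' using tr_mult[OF wadm_wt[OF x], of V "psi w"] V w x by (simp add: hh_def)
 show "wadm P x" unfolding P' using wadm_mult[OF wadm_wt[OF x]] V by blast
qed

text \<open>Each vector comes with its own weight. Linearity is checked with the product of all
  weights involved as a common weight, where it is linearity of \<open>e\<close> in the
  vector.\<close>

lemma hh_dual:
 assumes w: "w : Omega" shows "hh w : algebraic_dual Delta" unfolding algebraic_dual_def
proof (intro CollectI conjI ballI allI impI)
 note n = outer_nonzero[of _ "psi w"] and sm = outer_wt_le and b = psi_ball[OF w]
 show "hh w x = 0" if "x ~: Delta" for x using that by (simp add: hh_def)
 fix x assume x: "x : Delta"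
 show "hh w (x + y) = hh w x + hh w y" if y: "y : Delta" for y
 proof -
  define P where "P v = outer (wt x) v * outer (wt y) v * outer (wt (x + y)) v" for v
  note xy = Delta_add[OF x y]
  have 1: "hh w x = tr P x (psi w) / P (psi w)" "wadm P x"
  using hh_eq[OF x smirnov_mult_le[OF sm[OF y] sm[OF xy]] w, of P] n by (auto simp: P_def mult_ac)
  have 2: "hh w y = tr P y (psi w) / P (psi w)" "wadm P y"
  using hh_eq[OF y smirnov_mult_le[OF sm[OF x] sm[OF xy]] w, of P] n by (auto simp: P_def mult_ac)
  have 3: "hh w (x + y) = tr P (x + y) (psi w) / P (psi w)"
  using hh_eq(1)[OF xy smirnov_mult_le[OF sm[OF x] sm[OF y]] w, of P] n by (auto simp: P_def mult_ac)
  have "tr P (x + y) (psi w) = tr P x (psi w) + tr P y (psi w)"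
  unfolding tr_def by (rule e_vadd[OF x y L1x_kernel(3)[OF 1(2) b] L1x_kernel(3)[OF 2(2) b]])
  then show ?thesis by (simp add: 1 2 3 add_divide_distrib)
 qed
 show "hh w (c *C x) = c * hh w x" for c
 proof -
  define P where "P v = outer (wt x) v * outer (wt (c *C x)) v" for v
  note cx = Delta_scale[OF x, of c]
  have 1: "hh w x = tr P x (psi w) / P (psi w)" "wadm P x"
  using hh_eq[OF x sm[OF cx] w, of P] n by (auto simp: P_def mult_ac)
  have 2: "hh w (c *C x) = tr P (c *C x) (psi w) / P (psi w)"
  using hh_eq(1)[OF cx sm[OF x] w, of P] n by (auto simp: P_def mult_ac)
  have "tr P (c *C x) (psi w) = c * tr P x (psi w)"
  unfolding tr_def by (rule e_vscale[OF x L1x_kernel(3)[OF 1(2) b]])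
  then show ?thesis by (simp add: 1 2)
 qed
qed

text \<open>The transform is bounded by \<open>tr_le\<close> and the normalisation of the weight,
  hence in the Smirnov class. At the boundary the Poisson integral in \<open>tr_le\<close> tends to
  \<open>exp (- wt x t) * bnorm t x\<close>, and dividing by the weight removes the
  exponential.\<close>

lemma hh_FS: "hh : FS" "hnorm hh <= K * 2 ^ n * (2 * pi)"
proof -
 let ?C = "K * 2 ^ n * (2 * pi)"
 have C: "0 <= ?C" using K by simp
 have main: "(%w. hh (phi w) x) : smirnov & (AE t in arc. cmod (bdry (%w. hh (phi w) x) t) <= ?C * bnorm t x)"
  if x: "x : Delta" for x
 proof -
  let ?U = "outer (wt x)" and ?V = "outer (%t. - wt x t)"
  define r where "r t = cmod (bdry ?U t) * bnorm t x" for t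
  note wi = wt_integrable[OF x]
  have wi': "integrable arc (%t. - wt x t)" using wi by simp
  have ri: "integrable arc r" using wadm_L1x[OF wadm_wt[OF x]] by (simp add: L1x_def r_def[abs_def])
  have le: "cmod (tr ?U x w) <= ?C * pois r w" if "cmod w < 1" for w
  using tr_le[OF wadm_wt[OF x] that] by (simp add: r_def[abs_def])
  have "cmod (tr ?U x w) <= ?C * 1" if w: "cmod w < 1" for w
  proof -
  have "pois r w <= pois (%_. 1) w" by (rule pois_mono_AE[OF w ri]) (use outer_wt_bound[OF x] in "auto simp: r_def")
  then have "pois r w <= 1" by (simp add: pois_const[OF w])
  then show ?thesis by (intro order_trans[OF le[OF w]] mult_left_mono C)
  qed
  then have trS: "tr ?U x : smirnov" by (rule smirnov_bounded[OF tr_taylor(1)[OF wadm_wt[OF x]]])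
  have VS: "?V : smirnov" by (rule smirnov_outer[OF wi'])
  have eq: "hh (phi w) x = tr ?U x w * ?V w" if "cmod w < 1" for w
  using inverse_outer[OF that, of "wt x"] that x by (simp add: hh_def divide_inverse)
  have S: "(%w. hh (phi w) x) : smirnov" by (rule smirnov_cong[OF smirnov_mult[OF trS VS]]) (simp add: eq)
  have "AE t in arc. cmod (bdry (%w. hh (phi w) x) t) <= ?C * bnorm t x"
  using smirnov_nt_mult[OF trS VS] smirnov_nt_limit[OF trS] pois_nt_limit[OF ri]
  cmod_nt_limit_outer[OF wi] cmod_nt_limit_outer[OF wi']
  proof eventually_elim
  case (elim t)
  have "bdry (%w. hh (phi w) x) t = bdry (%w. tr ?U x w * ?V w) t" by (rule nt_limit_cong) (simp add: eq)
  then have "cmod (bdry (%w. hh (phi w) x) t) = cmod (bdry (tr ?U x) t) * exp (wt x t)"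
  using elim by (simp add: norm_mult)
  also have "... <= (?C * r t) * exp (wt x t)" by (intro mult_right_mono nt_limit_le[OF elim(2,3) le]) auto
  also have "... = ?C * bnorm t x" using elim(4) by (simp add: r_def exp_minus)
  finally show ?case .
  qed
  then show ?thesis using S by blast
 qed
 show "hh : FS" "hnorm hh <= ?C" using FSI[of hh ?C] hh_dual main C by (auto simp: hbound_def)
qed

text \<open>The reversed order of the coefficients in \<open>tr_taylor\<close> is exactly that of
  the Cauchy product, so coefficient \<open>n - 1\<close> is the sum given by
  \<open>functional_taylor\<close>.\<close>

lemma hh_pairing_single:
 assumes n: "n >= 1" and x: "x : Delta" and q: "q holomorphic_on UNIV"
  and g: "(%w. q (psi w) *C (outer (wt x) (psi w) *C x)) : GX"
 shows "sc (n - 1) (%w. q w * tr (outer (wt x)) x w) (psi z) = F (jet n z (%w. q (psi w) *C (outer (wt x) (psi w) *C x)))"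
proof -
 let ?f = "%w. outer (wt x) (psi w) *C x"
 note U = wadm_wt[OF x]
 have f: "?f : GX" using e_power(1)[OF U, of 0] by (simp add: scaleC_one)
 have qh: "disc_hol q" by (rule holomorphic_on_subset[OF q]) simp
 have a: "psi z : ball 0 1" using z by simp
 have "sc (n - 1) (%w. q w * tr (outer (wt x)) x w) (psi z)
  = (SUM k<=n - 1. sc k q (psi z) * sc (n - 1 - k) (tr (outer (wt x)) x) (psi z))"
  by (rule sc_mult[OF qh tr_taylor(1)[OF U] open_ball a])
 also have "... = (SUM k<n. sc k q (psi z) * F (jet n z (%w. (psi w - psi z) ^ k *C ?f w)))"
 proof (rule sum.cong)
  show "{..n - 1} = {..<n}" using n by auto
  fix k assume "k : {..<n}"
  then have "n - 1 - k < n" "n - 1 - (n - 1 - k) = k" by auto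
  then show "sc k q (psi z) * sc (n - 1 - k) (tr (outer (wt x)) x) (psi z)
  = sc k q (psi z) * F (jet n z (%w. (psi w - psi z) ^ k *C ?f w))" by (simp add: tr_taylor(2)[OF U]) qed
 also have "... = F (jet n z (%w. q (psi w) *C ?f w))" by (rule functional_taylor(3)[OF z F f g qh refl, symmetric])
 finally show ?thesis .
qed

lemma hh_pairing_tuple:
 assumes n: "n >= 1" and x: "!!j. j < n ==> x j : Delta" and q: "!!j. j < n ==> q j holomorphic_on UNIV"
  and g: "!!j. j < n ==> (%w. q j (psi w) *C (outer (wt (x j)) (psi w) *C x j)) : GX"
  and g0: "!!w. g0 w = (SUM j<n. q j (psi w) *C (outer (wt (x j)) (psi w) *C x j))"
 shows "sc (n - 1) (%w. hh (phi w) (g0 (phi w))) (psi z) = F (jet n z g0)"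
proof -
 have a: "psi z : ball 0 1" using z by simp
 have hol: "disc_hol (%w. q j w * tr (outer (wt (x j))) (x j) w)" if "j < n" for j
  by (intro holomorphic_intros tr_taylor(1) wadm_wt x that holomorphic_on_subset[OF q]) simp
 \<comment> \<open>The weight carried by each term cancels the one in the denominator of
   \<open>hh\<close>.\<close>
 have eq: "(SUM j<n. q j w * tr (outer (wt (x j))) (x j) w) = hh (phi w) (g0 (phi w))" if w: "w : ball 0 1" for w
 proof -
  have "g0 (phi w) = (SUM j<n. (q j w * outer (wt (x j)) w) *C x j)" using w by (simp add: g0 scaleC_scaleC)
  then have "hh (phi w) (g0 (phi w)) = (SUM j<n. (q j w * outer (wt (x j)) w) * hh (phi w) (x j))"
  using algebraic_dual_comb[OF inter_subspace hh_dual x, of "phi w" n "%j. j" "%j. q j w * outer (wt (x j)) w"] w by simp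
  also have "... = (SUM j<n. q j w * tr (outer (wt (x j))) (x j) w)"
  using w by (intro sum.cong refl) (simp add: hh_def x outer_nonzero)
  finally show ?thesis by simp
 qed
 have "sc (n - 1) (%w. hh (phi w) (g0 (phi w))) (psi z) = sc (n - 1) (%w. SUM j<n. q j w * tr (outer (wt (x j))) (x j) w) (psi z)"
  by (rule sc_cong[symmetric, OF _ open_ball a eq]) (intro holomorphic_on_sum hol, simp)
 also have "... = (SUM j<n. sc (n - 1) (%w. q j w * tr (outer (wt (x j))) (x j) w) (psi z))"
  by (rule sc_sum[OF hol open_ball a])
 also have "... = (SUM j<n. F (jet n z (%w. q j (psi w) *C (outer (wt (x j)) (psi w) *C x j))))"
  by (intro sum.cong refl hh_pairing_single n x q g) simp_all
 also have "... = F (jet n z g0)"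
  using jet_functional_sum(2)[where m=n and c="%_. 1", OF z F g] by (simp add: scaleC_one g0[abs_def])
 finally show ?thesis .
qed

end

lemma beta_power_coefficient:
 assumes z: "z : Omega" shows "sc m (%w. (psi w - psi z) ^ m) z ~= 0"
proof (induction m)
 case (Suc m)
 let ?b = "%w. psi w - psi z"
 have "deriv ?b z = deriv psi z - 0"
  using psi_holomorphic open_region z by (subst deriv_diff) (auto intro: holomorphic_on_imp_differentiable_at)
 then have b1: "sc 1 ?b z ~= 0" using deriv_psi_nonzero[OF z] by (simp add: sc_def)
 have "sc (Suc m) (%w. ?b w ^ Suc m) z = (SUM k<=Suc m. sc k ?b z * sc (Suc m - k) (%w. ?b w ^ m) z)"
  unfolding power_Suc by (rule sc_mult[OF beta_holomorphic _ open_region z]) (intro holomorphic_intros psi_holomorphic)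
 also have "... = (SUM k<=Suc m. if k = 1 then sc 1 ?b z * sc m (%w. ?b w ^ m) z else 0)"
 proof (intro sum.cong refl)
  fix k assume k: "k : {..Suc m}"
  consider "k = 0" | "k = 1" | "2 <= k" by linarith
  then show "sc k ?b z * sc (Suc m - k) (%w. ?b w ^ m) z = (if k = 1 then sc 1 ?b z * sc m (%w. ?b w ^ m) z else 0)"
  proof cases
  case 3
  have "sc (Suc m - k) (%w. ?b w ^ m * 1) z = 0"
  by (rule sc_power_vanish[OF beta_holomorphic _ holomorphic_on_const open_region z]) (use 3 k in auto)
  then show ?thesis using 3 by simp
  qed auto
 qed
 also have "... = sc 1 ?b z * sc m (%w. ?b w ^ m) z" by (simp add: sum.delta)
 finally show ?case using b1 Suc by simp
qed simp

text \<open>In terms of residues, \<open>p \<circ> psi\<close> is a Taylor polynomial of \<open>psi' \<cdot> ((w - z) / (psi w - psi z))\<^sup>n\<close>.\<close>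

lemma coordinate_change:
 assumes z: "z : Omega" and n: "n >= 1" obtains p where "p holomorphic_on UNIV"
  "!!u. u holomorphic_on Omega ==> sc (n - 1) (%w. p (psi w) * u w) z = sc (n - 1) (%w. u (phi w)) (psi z)"
proof -
 define a where "a = psi z"
 have a: "a : ball 0 1" using z by (simp add: a_def)
 \<comment> \<open>The contribution of the \<open>m\<close>-th power of the coordinate
   \<open>psi w - a\<close> to coefficient \<open>n - 1\<close> in the variable
   \<open>w\<close>.\<close>
 define l where "l m = sc (n - 1) (%w. (psi w - a) ^ m) z" for m
 \<comment> \<open>Listing the numbers \<open>l m\<close> in reversed order makes coefficient
   \<open>n - 1\<close> of \<open>H (psi w)\<close> at \<open>z\<close> equal to that of
   \<open>H * L\<close> at \<open>a\<close>.\<close>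
 define L where "L w = (SUM i<n. l (n - 1 - i) * (w - a) ^ i)" for w
 have Lh: "L holomorphic_on S" for S unfolding L_def[abs_def] by (intro holomorphic_intros)
 have scL: "sc i L a = l (n - 1 - i)" if "i < n" for i using that by (simp add: L_def[abs_def] sc_poly)
 define S where "S = {w. L w ~= 0}"
 have S: "open S" unfolding S_def by (intro open_Collect_neq holomorphic_on_imp_continuous_on Lh continuous_on_const)
 have aS: "a : S" using scL[of 0] n beta_power_coefficient[OF z, of "n - 1"] by (simp add: S_def l_def a_def)
 have ih: "(%w. 1 / L w) holomorphic_on S" by (intro holomorphic_intros Lh) (simp add: S_def)
 \<comment> \<open>The Taylor polynomial of \<open>1 / L\<close>, which exists since
   \<open>L a = l (n - 1)\<close> is not 0 by \<open>beta_power_coefficient\<close>; it makes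
   \<open>L * p\<close> equal to 1 up to order \<open>n\<close>.\<close>
 define p where "p w = (SUM i<n. sc i (%w. 1 / L w) a * (w - a) ^ i)" for w
 have ph: "p holomorphic_on T" for T unfolding p_def[abs_def] by (intro holomorphic_intros)
 have scp: "sc i p a = sc i (%w. 1 / L w) a" if "i < n" for i using that by (simp add: p_def[abs_def] sc_poly)
 have Lp: "sc i (%w. L w * p w) a = (if i = 0 then 1 else 0)" if i: "i < n" for i
 proof -
  have "sc i (%w. L w * p w) a = (SUM k<=i. sc k L a * sc (i - k) (%w. 1 / L w) a)"
  unfolding sc_mult[OF Lh ph S aS] using i by (intro sum.cong refl) (simp add: scp)
  also have "... = sc i (%w. L w * (1 / L w)) a" by (rule sc_mult[OF Lh ih S aS, symmetric])
  also have "... = sc i (%_. 1) a" by (rule sc_cong[OF holomorphic_on_mult[OF Lh ih] S aS]) (simp add: S_def)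
  finally show ?thesis by (simp add: sc_const)
 qed
 have "sc (n - 1) (%w. p (psi w) * u w) z = sc (n - 1) (%w. u (phi w)) (psi z)" if u: "u holomorphic_on Omega" for u
 proof -
  define G where "G w = u (phi w)" for w
  have Gh: "disc_hol G" unfolding G_def[abs_def] by (rule comp_conf_holomorphic[OF u])
  define H where "H w = p w * G w" for w
  have Hh: "disc_hol H" unfolding H_def[abs_def] by (intro holomorphic_intros ph Gh)
  have "sc (n - 1) (%w. H (psi w)) z = sc (n - 1) (%w. p (psi w) * u w) z"
  by (rule sc_cong[OF comp_psi_holomorphic[OF Hh] open_region z]) (simp add: H_def G_def)
  then have "sc (n - 1) (%w. p (psi w) * u w) z = sc (n - 1) (%w. SUM j<n. sc j H a * (psi w - a) ^ j) z"
  using taylor_at[OF Hh z, of "n - 1" n] n by (simp add: a_def)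
  also have "... = (SUM j<n. sc j H a * l j)"
  unfolding l_def by (rule sc_sum_cmult[OF _ open_region z]) (intro holomorphic_intros psi_holomorphic)
  also have "... = (SUM j<=n - 1. sc j H a * sc (n - 1 - j) L a)" by (rule sum.cong) (use n in "auto simp: scL")
  also have "... = sc (n - 1) (%w. H w * L w) a" by (rule sc_mult[OF Hh Lh open_ball a, symmetric])
  also have "(%w. H w * L w) = (%w. (L w * p w) * G w)" by (simp add: H_def mult_ac)
  also have "sc (n - 1) ... a = (SUM k<=n - 1. sc k (%w. L w * p w) a * sc (n - 1 - k) G a)"
  by (rule sc_mult[OF holomorphic_on_mult[OF Lh ph] Gh open_ball a])
  also have "... = (SUM k<=n - 1. if k = 0 then sc (n - 1) G a else 0)" using n by (intro sum.cong refl) (auto simp: Lp)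
  finally show ?thesis by (simp add: G_def[abs_def] a_def)
 qed
 then show ?thesis using that[of p] ph by blast
qed

text \<open>\<open>hh\<close> represents \<open>F\<close> through coefficients in the disc variable,
  and multiplication by \<open>p (psi w)\<close> moves them to the variable of the region. It
  suffices to test on the functions of \<open>GX_tuple_outer\<close>, which realise all jets of
  simple functions. The constant is uniform in \<open>F\<close>, as the continuity of the inverse
  duality map requires.\<close>

lemma functional_representation:
 assumes z: "z : Omega" and n: "n >= 1" obtains C where "!!F. F : points (DX n z) ==>
  EX h:FS. hnorm h <= C * nrm (DX n z) F & extends_pairing X n z (weak_jet n z h) F" proof -
 obtain p where p: "p holomorphic_on UNIV"
  "!!u. u holomorphic_on Omega ==> sc (n - 1) (%w. p (psi w) * u w) z = sc (n - 1) (%w. u (phi w)) (psi z)"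
  using coordinate_change[OF assms] by blast
 obtain M where M: "0 <= M" "!!w. cmod w < 1 ==> cmod (p w) <= M" using entire_bounded_on_disc[OF p(1)] by blast
 have ph: "disc_hol p" by (rule holomorphic_on_subset[OF p(1)]) simp
 note pm = bounded_multiplier[OF ph M(2)]
 define C where "C = M * (jet_const n z * 2 ^ n * (2 * pi))"
 have "EX h:FS. hnorm h <= C * nrm (DX n z) F & extends_pairing X n z (weak_jet n z h) F"
  if F: "F : points (DX n z)" for F
 proof -
  define N where "N = nrm (DX n z) F"
  define K where "K = jet_const n z * N"
  have K: "0 <= K"
  unfolding K_def N_def using jet_const_nonneg[OF z] dual_norm(1)[OF normed_space_on_rochberg[OF z] F] by simp
  obtain E where E: "!!v w. v : LX ==> w : LX ==> E (v + w) = E v + E w" "!!a v. v : LX ==> E (a *C v) = a * E v"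
  "!!v. v : LX ==> cmod (E v) <= K * (LINT t|arc. bnorm t (v t))"
  "!!g v. g : GX ==> AE t in arc. v t = bval g t ==> E v = F (jet n z g)"
  unfolding K_def N_def by (rule L1_extension[OF z F]) blast
  define e where "e f x = E (%t. f t *C x)" for f x
  have e1: "e (%t. f t + g t) x = e f x + e g x" if "x : Delta" "L1x x f" "L1x x g" for f g x
  using E(1)[OF L1x_LX(1)[OF that(1,2)] L1x_LX(1)[OF that(1,3)]] by (simp add: e_def plus_fun_def scaleC_add_left)
  have e2: "e (%t. c * f t) x = c * e f x" if "x : Delta" "L1x x f" for c f x
  using E(2)[OF L1x_LX(1)[OF that], of c] by (simp add: e_def scaleC_fun_def scaleC_scaleC)
  have e3: "cmod (e f x) <= K * (LINT t|arc. cmod (f t) * bnorm t x)" if "x : Delta" "L1x x f" for f x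
  using E(3)[OF L1x_LX(1)[OF that]] L1x_LX(2)[OF that] by (simp add: e_def)
  have e4: "e f (x + y) = e f x + e f y" if "x : Delta" "y : Delta" "L1x x f" "L1x y f" for f x y
  using E(1)[OF L1x_LX(1)[OF that(1,3)] L1x_LX(1)[OF that(2,4)]] by (simp add: e_def plus_fun_def scaleC_add_right)
  have e5: "e f (c *C x) = c * e f x" if "x : Delta" "L1x x f" for c f x
  using E(2)[OF L1x_LX(1)[OF that], of c] by (simp add: e_def scaleC_fun_def scaleC_scaleC mult.commute)
  have e6: "e f x = F (jet n z g)" if "x : Delta" "g : GX" "AE t in arc. f t *C x = bval g t" for f g x
  unfolding e_def by (rule E(4)[OF that(2,3)])
  define h0 where "h0 = hh z n e"
  note h0 = hh_FS[OF z F K e1 e2 e3 e4 e5 e6, folded h0_def]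
  define h where "h w x = p (psi w) * h0 w x" for w x
  note h = FS_mult[OF pm M(1) h0(1), folded h_def[abs_def]]
  have "sc (n - 1) (%w. h w (g w)) z = F (jet n z g)" if g: "g : GX" for g
  proof -
  define x where "x = jet n z g"
  have x: "x : tuples n Delta" unfolding x_def by (rule jet_GX_tuples(1)[OF GX_G0[OF g] z])
  obtain q where q: "!!j. j < n ==> q j holomorphic_on UNIV"
  "!!j. j < n ==> (%w. q j (psi w) *C (outer (wt (x j)) (psi w) *C x j)) : GX"
  "jet n z (%w. SUM j<n. q j (psi w) *C (outer (wt (x j)) (psi w) *C x j)) = x"
  using GX_tuple_outer[OF z x] by blast
  define g0 where "g0 w = (SUM j<n. q j (psi w) *C (outer (wt (x j)) (psi w) *C x j))" for w
  have g0: "g0 : GX" unfolding g0_def[abs_def] by (rule GX_sum) (rule q(2))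
  have jg: "jet n z g = jet n z g0" using q(3) by (simp add: g0_def[abs_def] x_def)
  have xD: "x j : Delta" if "j < n" for j using x that by (simp add: tuples_def)
  have "sc (n - 1) (%w. h w (g w)) z = sc (n - 1) (%w. h w (g0 w)) z"
  using trans[OF weak_jet_pairing[OF h(1) GX_G0[OF g] z n, symmetric, unfolded jg] weak_jet_pairing[OF h(1) GX_G0[OF g0] z n]] .
  also have "... = sc (n - 1) (%w. h0 (phi w) (g0 (phi w))) (psi z)"
  unfolding h_def by (rule p(2)[OF FS_pairing_holomorphic(1)[OF h0(1) GX_G0[OF g0]]])
  also have "... = F (jet n z g0)"
  unfolding h0_def by (rule hh_pairing_tuple[OF z F K e1 e2 e3 e4 e5 e6 n xD q(1,2) g0_def])
  finally show ?thesis by (simp add: jg)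
  qed
  then have "extends_pairing X n z (weak_jet n z h) F" by (simp add: extends_pairing_iff[OF h(1) z n] F)
  moreover have "hnorm h <= C * N"
  proof -
  have "M * hnorm h0 <= M * (K * 2 ^ n * (2 * pi))" by (rule mult_left_mono[OF h0(2) M(1)])
  also have "... = C * N" by (simp only: C_def K_def mult_ac)
  finally show ?thesis using h(2) by linarith
  qed
  ultimately show ?thesis using h(1) unfolding N_def by blast
 qed
 then show ?thesis by (rule that)
qed

end

subsection \<open>The diagram\<close>

lemma bounded_operatorI:
 assumes "!!x. x : points V ==> f x : points W" "!!x y. x : points V ==> y : points V ==> f (x + y) = f x + f y"
  "!!a x. x : points V ==> f (a *C x) = a *C f x" "!!x. x : points V ==> nrm W (f x) <= C * nrm V x"
 shows "bounded_operator V W f" unfolding bounded_operator_def linear_between_def using assms by blast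

lemma adjoint_bounded:
 assumes V: "normed_space_on V" and W: "normed_space_on W" and A: "bounded_operator V W A"
 shows "bounded_operator (dual_space W) (dual_space V) (banach_adjoint V A)"
proof -
 note N = normed_space_onD[OF V]
 have L: "A x : points W" "y : points V ==> A (x + y) = A x + A y" "A (a *C x) = a *C A x" if "x : points V" for x y a
  using A that by (auto simp: bounded_operator_def linear_between_def)
 obtain C where C: "!!x. x : points V ==> nrm W (A x) <= C * nrm V x" using A by (auto simp: bounded_operator_def)
 have b: "cmod (banach_adjoint V A F x) <= (\<bar>C\<bar> * nrm (dual_space W) F) * nrm V x"
  if F: "F : points (dual_space W)" and x: "x : points V" for F x
 proof -
  have "cmod (F (A x)) <= nrm (dual_space W) F * nrm W (A x)" by (rule dual_norm(2)[OF W F L(1)[OF x]])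
  also have "... <= nrm (dual_space W) F * (\<bar>C\<bar> * nrm V x)"
  by (intro mult_left_mono order_trans[OF C[OF x]] mult_right_mono N(2) x dual_norm(1)[OF W F]) simp
  finally show ?thesis using x by (simp add: banach_adjoint_def mult_ac)
 qed
 have mem: "banach_adjoint V A F : points (dual_space V)" if F: "F : points (dual_space W)" for F
  by (rule dual_pointsI[OF _ _ _ b[OF F]])
  (simp_all add: banach_adjoint_def L dual_pointsD[OF F] complex_vector.subspace_add[OF N(1)] complex_vector.subspace_scale[OF N(1)])
 show ?thesis
 proof (rule bounded_operatorI[of _ _ _ "\<bar>C\<bar>"])
  show "nrm (dual_space V) (banach_adjoint V A F) <= \<bar>C\<bar> * nrm (dual_space W) F" if F: "F : points (dual_space W)" for F
  by (rule dual_norm(3)[OF V mem[OF F] _ b[OF F]]) (simp add: dual_norm(1)[OF W F])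
  show "banach_adjoint V A F : points (dual_space V)" if "F : points (dual_space W)" for F by (rule mem[OF that])
 qed (auto simp: banach_adjoint_def fun_eq_iff scaleC_fun_def scaleC_complex_def)
qed

lemma quot_bound:
 assumes N: "!!f. f : P ==> 0 <= N f" and y: "y : J ` P" and M: "0 <= M" and c: "!!f. f : P ==> J f = y ==> c <= M * N f"
 shows "c <= M * nrm (quot_space P N J) y"
proof (rule field_le_epsilon)
 fix e :: real assume e: "e > 0"
 then have e': "e / (M + 1) > 0" using M by simp
 obtain f where f: "f : P" "J f = y" "N f < nrm (quot_space P N J) y + e / (M + 1)" by (rule quot_approx[OF y e'])
 have "c <= M * (nrm (quot_space P N J) y + e / (M + 1))"
  by (rule order_trans[OF c[OF f(1,2)]]) (intro mult_left_mono M less_imp_le[OF f(3)])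
 also have "... <= M * nrm (quot_space P N J) y + e" using M e by (simp add: field_simps)
 finally show "c <= M * nrm (quot_space P N J) y + e" .
qed

lemma append_zeros_linear:
 fixes x y :: "nat => 'b::complex_vector"
 shows "append_zeros k (x + y) = append_zeros k x + append_zeros k y" "append_zeros k (a *C x) = a *C append_zeros k x"
  "last_coords k (x + y) = last_coords k x + last_coords k y" "last_coords k (a *C x) = a *C last_coords k x"
 by (auto simp: append_zeros_def last_coords_def fun_eq_iff scaleC_fun_def)

lemma last_append: "last_coords k (append_zeros k x) = (%_. 0)" by (auto simp: append_zeros_def last_coords_def)

lemma sum_shift_zeros: "(SUM j<n + (k::nat). if j < k then 0 else f (j - k)) = (SUM j<n. f j :: complex)"
 by (induction n) auto

context interpolation_family
begin

lemma SX_zero: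
 assumes xi: "xi : SX n z" and z: "z : Omega" shows "xi j 0 = 0"
proof -
 obtain h where h: "h : FS" "xi = weak_jet n z h" using xi by (auto simp: SX_eq)
 have "h w 0 = 0" if "w : Omega" for w using algebraic_dualD(2)[OF FSD(1)[OF h(1) that] Delta_0, of 0] by simp
 from sc_cong[OF FS_hol[OF h(1) z] open_region z this] show ?thesis by (simp add: h(2) weak_jet_eq sc_const)
qed

text \<open>A tuple whose only nonzero entry is \<open>x\<close> in place \<open>n - i - 1\<close>
  reads off \<open>xi i x\<close>.\<close>

lemma extends_pairing_inj:
 assumes z: "z : Omega" and xi: "xi : SX n z" "eta : SX n z" and F: "extends_pairing X n z xi F" "extends_pairing X n z eta F"
 shows "xi = eta"
proof (intro ext)
 fix i x
 obtain h h' where h: "h : FS" "xi = weak_jet n z h" "h' : FS" "eta = weak_jet n z h'" using xi by (auto simp: SX_eq)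
 show "xi i x = eta i x"
 proof (cases "i < n & x : Delta")
  case True
  define y where "y = (%l. if l = n - i - 1 then x else 0)"
  have y: "y : tuples n Delta" using True Delta_0 by (auto simp: tuples_def y_def)
  have "(SUM j<n. zeta j (y (n - j - 1))) = zeta i x" if "zeta : SX n z" for zeta
  proof -
  have "(SUM j<n. zeta j (y (n - j - 1))) = (SUM j<n. if j = i then zeta i x else 0)"
  using True by (intro sum.cong refl) (auto simp: y_def SX_zero[OF that z])
  then show ?thesis using True by simp
  qed
  then show ?thesis using F y xi unfolding extends_pairing_def by metis
 next
  case False
  then show ?thesis using FS_sc_outside(1)[OF h(1) z] FS_sc_outside(1)[OF h(3) z] by (auto simp: h weak_jet_eq)
 qed
qed

lemma duality_linear_homeomorphism:
 assumes adm: "admissible X" and z: "z : Omega" and n: "n >= 1"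
 shows "linear_homeomorphism (rochberg_star X n z) (DX n z) (duality_map X n z)"
proof -
 let ?T = "duality_map X n z"
 note S = normed_space_on_star[OF z, of n] and D = normed_space_on_dual[OF normed_space_on_rochberg[OF z, of n]]
 note NS = normed_space_onD[OF S] and ND = normed_space_onD[OF D]
 note ex = duality_map(2)[OF adm z n]
 have mem: "?T xi : points (DX n z)" if "xi : SX n z" for xi using ex[OF that] by (simp add: extends_pairing_def)
 obtain C where C: "!!xi. xi : SX n z ==> nrm (DX n z) (?T xi) <= C * snorm n z xi"
  by (rule duality_map_bounded[OF adm z n]) blast
 obtain C' where C': "!!F. F : points (DX n z) ==>
  EX h:FS. hnorm h <= C' * nrm (DX n z) F & extends_pairing X n z (weak_jet n z h) F"
  by (rule functional_representation[OF z n]) blast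
 have add: "?T (xi + eta) = ?T xi + ?T eta" if "xi : SX n z" "eta : SX n z" for xi eta
  by (rule duality_map_eqI[OF adm z n])
  (use that ex[OF that(1)] ex[OF that(2)] complex_vector.subspace_add[OF NS(1)] complex_vector.subspace_add[OF ND(1)]
  in "auto simp: extends_pairing_def sum.distrib")
 have scale: "?T (a *C xi) = a *C ?T xi" if "xi : SX n z" for a xi by (rule duality_map_eqI[OF adm z n])
  (use that ex[OF that] complex_vector.subspace_scale[OF NS(1)] complex_vector.subspace_scale[OF ND(1)]
  in "auto simp: extends_pairing_def scaleC_fun_def scaleC_complex_def sum_distrib_left")
 show ?thesis
 proof (rule linear_homeomorphismI[OF S D _ C])
  show "linear_between (rochberg_star X n z) (DX n z) ?T" unfolding linear_between_def using mem add scale by blast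
  show "snorm n z xi <= C' * nrm (DX n z) (?T xi)" if xi: "xi : SX n z" for xi
  proof -
  obtain h where h: "h : FS" "hnorm h <= C' * nrm (DX n z) (?T xi)" "extends_pairing X n z (weak_jet n z h) (?T xi)"
  using C'[OF mem[OF xi]] by blast
  have "weak_jet n z h = xi" by (rule extends_pairing_inj[OF z _ xi h(3) ex[OF xi]]) (use h(1) in "auto simp: SX_eq")
  then show ?thesis using snorm_jet[OF h(1), of n z] h(2) by simp
  qed
  show "points (DX n z) \<subseteq> ?T ` SX n z"
  proof
  fix F assume "F : points (DX n z)"
  then obtain h where h: "h : FS" "extends_pairing X n z (weak_jet n z h) F" using C' by blast
  have m: "weak_jet n z h : SX n z" using h(1) by (simp add: SX_eq)
  show "F : ?T ` SX n z" using duality_map_eqI[OF adm z n m h(2)] m by blast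
  qed
 qed
qed

section \<open>Shifts and projections of jets as bounded operators\<close>

lemma shift_multiplier:
 assumes z: "z : Omega" and u: "u holomorphic_on Omega"
 obtains q M where "q : smirnov" "AE t in arc. cmod (bdry q t) <= M" "0 <= M"
  "(%w. q (psi w)) holomorphic_on Omega" "!!i. i < m ==> sc i (%w. q (psi w)) z = sc i u z"
proof -
 obtain q where q: "q holomorphic_on UNIV" "!!i. i < m ==> sc i (%w. q (psi w)) z = sc i u z"
  using taylor_multiplier_sc[OF u z, of m] by metis
 have qh: "disc_hol q" by (rule holomorphic_on_subset[OF q(1)]) simp
 obtain M where M: "0 <= M" "!!w. cmod w < 1 ==> cmod (q w) <= M" by (rule entire_bounded_on_disc[OF q(1)]) blast
 show ?thesis by (rule that[OF bounded_multiplier[OF qh M(2)] M(1) comp_psi_holomorphic[OF qh] q(2)])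
qed

lemma shift_sum:
 fixes f :: "nat => 'b::complex_vector"
 shows "(SUM j<=i. (if j = n then 1 else 0) *C f (i - j)) = (if i < n then 0 else f (i - n))"
proof -
 have "(SUM j<=i. (if j = n then 1 else 0) *C f (i - j)) = (SUM j<=i. if j = n then f (i - n) else 0)"
  by (intro sum.cong refl) (simp add: scaleC_one)
 then show ?thesis by simp
qed

text \<open>Appending \<open>n\<close> zeros to a jet is multiplication of a representative by
  \<open>(w - z) ^ n\<close>, for which a bounded multiplier with the same Taylor coefficients is
  substituted.\<close>

lemma append_zeros_rochberg:
 assumes z: "z : Omega" shows "bounded_operator (rochberg X k z) (rochberg X (n + k) z) (append_zeros n)"
proof -
 obtain q M where q: "q : smirnov" "AE t in arc. cmod (bdry q t) <= M" "0 <= M"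
  "(%w. q (psi w)) holomorphic_on Omega" "!!i. i < n + k ==> sc i (%w. q (psi w)) z = sc i (%w. (w - z) ^ n) z"
  by (rule shift_multiplier[OF z, of "%w. (w - z) ^ n" "n + k"]) (auto intro!: holomorphic_intros)
 have eq: "append_zeros n (jet k z f) = jet (n + k) z (%w. q (psi w) *C f w)" if f: "f : FX" for f
 proof
  fix i
  have "vc i (%w. q (psi w) *C f w) z = (if i < n then 0 else vc (i - n) f z)" if i: "i < n + k"
  proof -
  have "vc i (%w. q (psi w) *C f w) z = (SUM j<=i. sc j (%w. q (psi w)) z *C vc (i - j) f z)"
  by (rule vc_mult[OF FX_vholo[OF f] FX_vholo[OF FX_mult(1)[OF q(1,2) f]] q(4) refl z])
  also have "... = (SUM j<=i. (if j = n then 1 else 0) *C vc (i - j) f z)"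
  using i by (intro sum.cong refl) (simp add: q(5) sc_shift_power)
  also have "... = (if i < n then 0 else vc (i - n) f z)" by (rule shift_sum[where f="%j. vc j f z"])
  finally show ?thesis .
  qed
  then show "append_zeros n (jet k z f) i = jet (n + k) z (%w. q (psi w) *C f w) i"
  by (auto simp: append_zeros_def jet_eq)
 qed
 show ?thesis
 proof (rule bounded_operatorI[of _ _ _ M])
  fix x assume x: "x : RX k z"
  then show "append_zeros n x : RX (n + k) z" using eq FX_mult(1)[OF q(1,2)] by (auto simp: RX_eq)
  show "rnorm (n + k) z (append_zeros n x) <= M * rnorm k z x" unfolding rochberg_quot[of k]
  proof (rule quot_bound[OF fnorm_nonneg _ q(3)])
  show "x : jet k z ` FX" using x by (simp add: RX_eq)
  show "rnorm (n + k) z (append_zeros n x) <= M * fnorm f" if "f : FX" "jet k z f = x" for f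
  using rnorm_jet[OF FX_mult(1)[OF q(1,2) that(1)], of "n + k" z] FX_mult(2)[OF q(1,2) that(1)] eq[OF that(1)] that(2) by simp
  qed
 qed (simp_all add: append_zeros_linear)
qed

lemma last_coords_jet: "last_coords n (jet (n + k) z f) = jet n z f" by (auto simp: last_coords_def jet_eq)

lemma last_coords_rochberg:
 "bounded_operator (rochberg X (n + k) z) (rochberg X n z) (last_coords n)"
proof (rule bounded_operatorI[of _ _ _ 1])
 fix x assume x: "x : RX (n + k) z"
 then show "last_coords n x : RX n z" by (auto simp: RX_eq last_coords_jet)
 show "rnorm n z (last_coords n x) <= 1 * rnorm (n + k) z x" unfolding rochberg_quot[of "n + k"]
 proof (rule quot_bound[OF fnorm_nonneg])
  show "x : jet (n + k) z ` FX" using x by (simp add: RX_eq)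
  show "rnorm n z (last_coords n x) <= 1 * fnorm f" if "f : FX" "jet (n + k) z f = x" for f
  using rnorm_jet[OF that(1), of n z] that(2)[symmetric] by (simp add: last_coords_jet)
 qed simp_all
qed (simp_all add: append_zeros_linear)

lemma append_zeros_star:
 assumes z: "z : Omega" shows "bounded_operator (rochberg_star X n z) (rochberg_star X (n + k) z) (append_zeros k)"
proof -
 obtain q M where q: "q : smirnov" "AE t in arc. cmod (bdry q t) <= M" "0 <= M"
  "(%w. q (psi w)) holomorphic_on Omega" "!!i. i < n + k ==> sc i (%w. q (psi w)) z = sc i (%w. (w - z) ^ k) z"
  by (rule shift_multiplier[OF z, of "%w. (w - z) ^ k" "n + k"]) (auto intro!: holomorphic_intros)
 have eq: "append_zeros k (weak_jet n z h) = weak_jet (n + k) z (%w x. q (psi w) * h w x)" if h: "h : FS" for h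
 proof (intro ext)
  fix i x
  have "sc i (%w. q (psi w) * h w x) z = (if i < k then 0 else sc (i - k) (%w. h w x) z)" if i: "i < n + k"
  proof -
  have "sc i (%w. q (psi w) * h w x) z = (SUM j<=i. sc j (%w. q (psi w)) z * sc (i - j) (%w. h w x) z)"
  by (rule sc_mult[OF q(4) FS_hol[OF h z] open_region z])
  also have "... = (SUM j<=i. (if j = k then 1 else 0) *C sc (i - j) (%w. h w x) z)"
  using i by (intro sum.cong refl) (simp add: q(5) sc_shift_power scaleC_complex_def)
  also have "... = (if i < k then 0 else sc (i - k) (%w. h w x) z)"
  by (rule shift_sum[where f="%j. sc j (%w. h w x) z"])
  finally show ?thesis .
  qed
  then show "append_zeros k (weak_jet n z h) i x = weak_jet (n + k) z (%w x. q (psi w) * h w x) i x"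
  by (auto simp: append_zeros_def weak_jet_eq)
 qed
 show ?thesis
 proof (rule bounded_operatorI[of _ _ _ M])
  fix xi assume xi: "xi : SX n z"
  then show "append_zeros k xi : SX (n + k) z" using eq FS_mult(1)[OF q(1-3)] by (auto simp: SX_eq)
  show "snorm (n + k) z (append_zeros k xi) <= M * snorm n z xi" unfolding rochberg_star_quot[of n]
  proof (rule quot_bound[OF FSD(3) _ q(3)])
  show "xi : weak_jet n z ` FS" using xi by (simp add: SX_eq)
  show "snorm (n + k) z (append_zeros k xi) <= M * hnorm h" if "h : FS" "weak_jet n z h = xi" for h
  using snorm_jet[OF FS_mult(1)[OF q(1-3) that(1)], of "n + k" z] FS_mult(2)[OF q(1-3) that(1)] eq[OF that(1)] that(2) by simp
  qed
 qed (simp_all add: append_zeros_linear)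
qed

lemma last_coords_weak_jet: "last_coords k (weak_jet (n + k) z h) = weak_jet k z h"
 by (auto simp: last_coords_def weak_jet_eq fun_eq_iff)

lemma last_coords_star:
 "bounded_operator (rochberg_star X (n + k) z) (rochberg_star X k z) (last_coords k)"
proof (rule bounded_operatorI[of _ _ _ 1])
 fix xi assume xi: "xi : SX (n + k) z"
 then show "last_coords k xi : SX k z" by (auto simp: SX_eq last_coords_weak_jet)
 show "snorm k z (last_coords k xi) <= 1 * snorm (n + k) z xi" unfolding rochberg_star_quot[of "n + k"]
 proof (rule quot_bound[OF FSD(3)])
  show "xi : weak_jet (n + k) z ` FS" using xi by (simp add: SX_eq)
  show "snorm k z (last_coords k xi) <= 1 * hnorm h" if "h : FS" "weak_jet (n + k) z h = xi" for h
  using snorm_jet[OF that(1), of k z] that(2)[symmetric] by (simp add: last_coords_weak_jet)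
 qed simp_all
qed (simp_all add: append_zeros_linear)

text \<open>Division by \<open>(psi w - psi z) ^ n\<close> gives \<open>d\<close>. To return to the
  shift in the variable \<open>w\<close>, \<open>d\<close> is multiplied by a bounded function with
  the first \<open>k\<close> Taylor coefficients of
  \<open>((psi w - psi z) / (w - z)) ^ n\<close>.\<close>

lemma jet_kernel:
 assumes adm: "admissible X" and f: "f : FX" and z: "z : Omega" and v: "jet n z f = 0"
 obtains f' where "f' : FX" "jet (n + k) z f = append_zeros n (jet k z f')"
proof -
 have v': "vc i f z = 0" if "i < n" for i using v that by (simp add: jet_zero_iff)
 obtain d where d: "d : FX" "!!w. w : Omega ==> f w = (psi w - psi z) ^ n *C d w"
  using FX_div_power[OF adm f z v'] by blast
 let ?b = "%w. (psi w - psi z) ^ n"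
 have bh: "?b holomorphic_on Omega" by (intro holomorphic_intros psi_holomorphic)
 have b0: "sc j ?b z = 0" if "j < n" for j
  using sc_power_vanish[OF beta_holomorphic[of "psi z"] _ holomorphic_on_const[of 1] open_region z that] by simp
 obtain q M where q: "q : smirnov" "AE t in arc. cmod (bdry q t) <= M" "0 <= M"
  "(%w. q (psi w)) holomorphic_on Omega" "!!i. i < k ==> sc i (%w. q (psi w)) z = sc i (%w. SUM l<k. sc (n + l) ?b z * (w - z) ^ l) z"
  by (rule shift_multiplier[OF z, of "%w. SUM l<k. sc (n + l) ?b z * (w - z) ^ l" k]) (auto intro!: holomorphic_intros)
 define f' where "f' w = q (psi w) *C d w" for w
 have f': "f' : FX" unfolding f'_def[abs_def] by (rule FX_mult(1)[OF q(1,2) d(1)])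
 have "vc (n + i) f z = vc i f' z" if i: "i < k" for i
 proof -
  have "vc (n + i) f z = (SUM j<=n + i. sc j ?b z *C vc (n + i - j) d z)"
  by (rule vc_mult[OF FX_vholo[OF d(1)] FX_vholo[OF f] bh d(2) z])
  also have "... = (SUM j:{n..n + i}. sc j ?b z *C vc (n + i - j) d z)"
  by (rule sum.mono_neutral_right) (auto simp: b0)
  also have "... = (SUM l<=i. sc (n + l) ?b z *C vc (i - l) d z)"
  by (rule sum.reindex_bij_witness[of _ "%l. n + l" "%j. j - n"]) (auto simp: add.commute)
  also have "... = (SUM l<=i. sc l (%w. q (psi w)) z *C vc (i - l) d z)"
  using i by (intro sum.cong refl) (simp add: q(5) sc_poly)
  also have "... = vc i f' z"
  by (rule vc_mult[OF FX_vholo[OF d(1)] FX_vholo[OF f'] q(4) _ z, symmetric]) (simp add: f'_def)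
  finally show ?thesis .
 qed
 then have "jet (n + k) z f i = append_zeros n (jet k z f') i" for i
 proof (cases "i < n")
  case False
  then have "i = n + (i - n)" by simp
  then show ?thesis using \<open>!!i. i < k ==> vc (n + i) f z = vc i f' z\<close>[of "i - n"] False
  by (auto simp: append_zeros_def jet_eq)
 qed (simp add: append_zeros_def jet_eq v')
 then show ?thesis using that[OF f'] by blast
qed

text \<open>By \<open>jet_kernel\<close> the functional \<open>G\<close> vanishes on jets whose
  coordinates of index below \<open>n\<close> are 0, so it factors through jets of order
  \<open>n\<close>; the quotient norm makes the factor bounded.\<close>

lemma kernel_adjoint:
 assumes adm: "admissible X" and z: "z : Omega" and G: "G : points (DX (n + k) z)"
  and null: "banach_adjoint (rochberg X k z) (append_zeros n) G = 0"
 obtains F where "F : points (DX n z)" "banach_adjoint (rochberg X (n + k) z) (last_coords n) F = G"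
proof -
 note R = normed_space_on_rochberg[OF z]
 have pt: "jet m z f : RX m z" if "f : FX" for m f using that by (simp add: RX_eq)
 have G0: "G (jet (n + k) z f) = 0" if f: "f : FX" "jet n z f = 0" for f
 proof -
  obtain f' where f': "f' : FX" "jet (n + k) z f = append_zeros n (jet k z f')" by (rule jet_kernel[OF adm f(1) z f(2)])
  show ?thesis using fun_cong[OF null, of "jet k z f'"] pt[OF f'(1), of k] f'(2) by (simp add: banach_adjoint_def)
 qed
 \<comment> \<open>An arbitrary section of the jet map; the vanishing of \<open>G\<close> on the
   kernel makes \<open>F\<close> independent of it.\<close>
 define s where "s y = (SOME f. f : FX & jet n z f = y)" for y
 define F where "F y = (if y : RX n z then G (jet (n + k) z (s y)) else 0)" for y
 have F: "F (jet n z f) = G (jet (n + k) z f)" if f: "f : FX" for f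
 proof -
  define g where "g = s (jet n z f)"
  have g: "g : FX" "jet n z g = jet n z f"
  using someI[of "%g. g : FX & jet n z g = jet n z f" f] f unfolding g_def s_def by auto
  have "jet (n + k) z g = jet (n + k) z (g - f) + jet (n + k) z f" using jet_FX_diff[OF g(1) f z] by simp
  then have "G (jet (n + k) z g) = G (jet (n + k) z (g - f)) + G (jet (n + k) z f)"
  using dual_pointsD(1)[OF G pt[OF FX_diff(1)[OF g(1) f]] pt[OF f]] by simp
  also have "G (jet (n + k) z (g - f)) = 0" by (rule G0[OF FX_diff(1)[OF g(1) f]]) (simp add: jet_FX_diff[OF g(1) f z] g(2))
  finally show ?thesis using pt[OF f, of n] by (simp add: F_def g_def)
 qed
 have rep: "EX f:FX. y = jet n z f" if "y : RX n z" for y using that by (auto simp: RX_eq)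
 have "F : points (DX n z)"
 proof (rule dual_pointsI[of _ _ "nrm (DX (n + k) z) G"])
  show "F (x + y) = F x + F y" if xy: "x : RX n z" "y : RX n z" for x y
  proof -
  obtain f g where f: "f : FX" "x = jet n z f" and g: "g : FX" "y = jet n z g" using rep xy by metis
  have "F (jet n z (f + g)) = G (jet (n + k) z (f + g))" by (rule F[OF FX_add(1)[OF f(1) g(1)]])
  also have "... = G (jet (n + k) z f) + G (jet (n + k) z g)"
  unfolding jet_FX_add[OF f(1) g(1) z] by (rule dual_pointsD(1)[OF G pt[OF f(1)] pt[OF g(1)]])
  finally show ?thesis by (simp add: f g F jet_FX_add[OF f(1) g(1) z])
  qed
  show "F (a *C x) = a * F x" if x: "x : RX n z" for x a
  proof -
  obtain f where f: "f : FX" "x = jet n z f" using rep x by metis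
  have "F (jet n z (a *C f)) = G (jet (n + k) z (a *C f))" by (rule F[OF FX_scale(1)[OF f(1)]])
  also have "... = a * G (jet (n + k) z f)"
  unfolding jet_FX_scale[OF f(1) z] by (rule dual_pointsD(2)[OF G pt[OF f(1)]])
  finally show ?thesis by (simp add: f F jet_FX_scale[OF f(1) z])
  qed
  show "cmod (F x) <= nrm (DX (n + k) z) G * rnorm n z x" if x: "x : RX n z" for x unfolding rochberg_quot[of n]
  proof (rule quot_bound[OF fnorm_nonneg _ dual_norm(1)[OF R G]])
  show "x : jet n z ` FX" using x by (simp add: RX_eq)
  show "cmod (F x) <= nrm (DX (n + k) z) G * fnorm f" if f: "f : FX" "jet n z f = x" for f
  using dual_norm(2)[OF R G pt[OF f(1)]] mult_left_mono[OF rnorm_jet[OF f(1), of "n + k" z] dual_norm(1)[OF R G]] F[OF f(1)] f(2)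
  by simp
  qed
 qed (simp add: F_def)
 moreover have "banach_adjoint (rochberg X (n + k) z) (last_coords n) F = G"
 proof
  fix x
  show "banach_adjoint (rochberg X (n + k) z) (last_coords n) F x = G x"
  proof (cases "x : RX (n + k) z")
  case True
  then obtain f where "f : FX" "x = jet (n + k) z f" by (auto simp: RX_eq)
  then show ?thesis using True by (simp add: banach_adjoint_def last_coords_jet F)
  qed (simp add: banach_adjoint_def dual_pointsD(3)[OF G])
 qed
 ultimately show ?thesis by (rule that)
qed

lemma tuples_RX: "z : Omega ==> x : tuples n Delta ==> x : RX n z"
 using GX_tuple GX_FX unfolding RX_eq by (metis imageI)

lemma square_append:
 assumes adm: "admissible X" and z: "z : Omega" and n: "n >= 1" and xi: "xi : SX n z"
 shows "duality_map X (n + k) z (append_zeros k xi) = banach_adjoint (rochberg X (n + k) z) (last_coords n) (duality_map X n z xi)"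
proof (rule duality_map_eqI[OF adm z])
 note R = normed_space_on_rochberg[OF z]
 define T where "T = duality_map X n z xi"
 have T: "extends_pairing X n z xi T" unfolding T_def by (rule duality_map(2)[OF adm z n xi])
 show "append_zeros k xi : SX (n + k) z"
  using append_zeros_star[OF z, of n k] xi by (auto simp: bounded_operator_def linear_between_def)
 have "banach_adjoint (rochberg X (n + k) z) (last_coords n) T : points (DX (n + k) z)"
  using adjoint_bounded[OF R R last_coords_rochberg[of n k z]] T
  by (auto simp: bounded_operator_def linear_between_def extends_pairing_def)
 moreover have "banach_adjoint (rochberg X (n + k) z) (last_coords n) T x = (SUM j<n + k. append_zeros k xi j (x (n + k - j - 1)))"
  if x: "x : tuples (n + k) Delta" for x
 proof -
  have "last_coords n x : tuples n Delta" using x by (auto simp: tuples_def last_coords_def)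
  then have "T (last_coords n x) = (SUM j<n. xi j (last_coords n x (n - j - 1)))" using T by (simp add: extends_pairing_def)
  also have "... = (SUM j<n. xi j (x (n - j - 1)))" by (intro sum.cong refl) (auto simp: last_coords_def)
  also have "... = (SUM j<n + k. if j < k then 0 else xi (j - k) (x (n - (j - k) - 1)))" by (rule sum_shift_zeros[symmetric])
  also have "... = (SUM j<n + k. append_zeros k xi j (x (n + k - j - 1)))"
  by (intro sum.cong refl) (auto simp: append_zeros_def)
  finally show ?thesis using tuples_RX[OF z x] by (simp add: banach_adjoint_def)
 qed
 ultimately show "extends_pairing X (n + k) z (append_zeros k xi) (banach_adjoint (rochberg X (n + k) z) (last_coords n) (duality_map X n z xi))"
  unfolding T_def[symmetric] extends_pairing_def by blast
qed (use n in simp)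

lemma square_last:
 assumes adm: "admissible X" and z: "z : Omega" and k: "k >= 1" and xi: "xi : SX (n + k) z"
 shows "duality_map X k z (last_coords k xi) = banach_adjoint (rochberg X k z) (append_zeros n) (duality_map X (n + k) z xi)"
proof (rule duality_map_eqI[OF adm z k])
 note R = normed_space_on_rochberg[OF z]
 define T where "T = duality_map X (n + k) z xi"
 have T: "extends_pairing X (n + k) z xi T" unfolding T_def by (rule duality_map(2)[OF adm z _ xi]) (use k in simp)
 show "last_coords k xi : SX k z"
  using last_coords_star[of n k z] xi by (auto simp: bounded_operator_def linear_between_def)
 have "banach_adjoint (rochberg X k z) (append_zeros n) T : points (DX k z)"
  using adjoint_bounded[OF R R append_zeros_rochberg[OF z, of k n]] T
  by (auto simp: bounded_operator_def linear_between_def extends_pairing_def)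
 moreover have "banach_adjoint (rochberg X k z) (append_zeros n) T x = (SUM j<k. last_coords k xi j (x (k - j - 1)))"
  if x: "x : tuples k Delta" for x
 proof -
  have "append_zeros n x : tuples (n + k) Delta" using x Delta_0 by (auto simp: tuples_def append_zeros_def)
  then have "T (append_zeros n x) = (SUM j<n + k. xi j (append_zeros n x (n + k - j - 1)))" using T by (simp add: extends_pairing_def)
  \<comment> \<open>For \<open>j >= k\<close> the index \<open>n + k - j - 1\<close> is below
    \<open>n\<close>, so the entry is one of the appended zeros.\<close>
  also have "... = (SUM j<k. xi j (append_zeros n x (n + k - j - 1)))"
  by (rule sum.mono_neutral_right) (auto simp: append_zeros_def SX_zero[OF xi z])
  also have "... = (SUM j<k. last_coords k xi j (x (k - j - 1)))"
  by (intro sum.cong refl) (auto simp: append_zeros_def last_coords_def)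
  finally show ?thesis using tuples_RX[OF z x] by (simp add: banach_adjoint_def)
 qed
 ultimately show "extends_pairing X k z (last_coords k xi) (banach_adjoint (rochberg X k z) (append_zeros n) (duality_map X (n + k) z xi))"
  unfolding T_def[symmetric] extends_pairing_def by blast
qed

lemma duality_bij:
 assumes "admissible X" "z : Omega" "n >= 1" shows "F : points (DX n z) ==> EX xi:SX n z. duality_map X n z xi = F"
  "xi : SX n z ==> eta : SX n z ==> duality_map X n z xi = duality_map X n z eta ==> xi = eta"
  "xi : SX n z ==> duality_map X n z xi : points (DX n z)"
proof -
 show "EX xi:SX n z. duality_map X n z xi = F" if F: "F : points (DX n z)"
 proof -
  obtain h where h: "h : FS" "extends_pairing X n z (weak_jet n z h) F"
  using functional_representation[OF assms(2,3)] F by metis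
  then show ?thesis using duality_map_eqI[OF assms _ h(2)] by (auto simp: SX_eq)
 qed
 show "xi = eta" if "xi : SX n z" "eta : SX n z" "duality_map X n z xi = duality_map X n z eta"
  using extends_pairing_inj[OF assms(2) that(1,2) duality_map(2)[OF assms that(1)]] duality_map(2)[OF assms that(2)] that(3) by simp
 show "duality_map X n z xi : points (DX n z)" if "xi : SX n z"
  using duality_map(2)[OF assms that] by (simp add: extends_pairing_def)
qed

text \<open>Surjectivity of the second arrow comes from the dual family: a functional of order
  \<open>k\<close> is given by the jet of some \<open>h\<close>, and by \<open>square_last\<close>
  the functional of the longer jet of the same \<open>h\<close> is a preimage.\<close>

lemma bottom_row_exact:
 assumes adm: "admissible X" and z: "z : Omega" and k: "k >= 1"
 shows "short_exact (DX n z) (banach_adjoint (rochberg X (n + k) z) (last_coords n)) (DX (n + k) z)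
  (banach_adjoint (rochberg X k z) (append_zeros n)) (DX k z)" proof - note R = normed_space_on_rochberg[OF z]
 let ?P = "banach_adjoint (rochberg X (n + k) z) (last_coords n)" and ?I = "banach_adjoint (rochberg X k z) (append_zeros n)"
 have P: "bounded_operator (DX n z) (DX (n + k) z) ?P" by (rule adjoint_bounded[OF R R last_coords_rochberg])
 have I: "bounded_operator (DX (n + k) z) (DX k z) ?I" by (rule adjoint_bounded[OF R R append_zeros_rochberg[OF z]])
 have inj: "inj_on ?P (points (DX n z))"
 proof (rule inj_onI, rule ext)
  fix F F' x assume F: "F : points (DX n z)" "F' : points (DX n z)" "?P F = ?P F'"
  show "F x = F' x"
  proof (cases "x : RX n z")
  case True
  then obtain f where f: "f : FX" "x = jet n z f" by (auto simp: RX_eq)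
  then show ?thesis using fun_cong[OF F(3), of "jet (n + k) z f"] by (simp add: banach_adjoint_def RX_eq last_coords_jet)
  qed (simp add: dual_pointsD(3)[OF F(1)] dual_pointsD(3)[OF F(2)])
 qed
 have "?I (?P F) = 0" if F: "F : points (DX n z)" for F
 proof
  fix y
  have F0: "F (%_. 0) = 0"
  using dual_pointsD(2)[OF F complex_vector.subspace_0[OF normed_space_onD(1)[OF R]], of 0] by (simp add: zero_fun_def)
  have "append_zeros n y : RX (n + k) z" if "y : RX k z"
  using append_zeros_rochberg[OF z, of k n] that by (auto simp: bounded_operator_def linear_between_def)
  then show "?I (?P F) y = 0 y" by (simp add: banach_adjoint_def last_append F0)
 qed
 moreover have "G : ?P ` points (DX n z)" if "G : points (DX (n + k) z)" "?I G = 0" for G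
  by (rule kernel_adjoint[OF adm z that]) blast
 ultimately have ker: "?P ` points (DX n z) = {G : points (DX (n + k) z). ?I G = 0}"
  using P unfolding bounded_operator_def linear_between_def by blast
 have "points (DX k z) \<subseteq> ?I ` points (DX (n + k) z)"
 proof
  fix F assume "F : points (DX k z)"
  then obtain xi where xi: "xi : SX k z" "duality_map X k z xi = F" using duality_bij(1)[OF adm z k] by blast
  obtain h where h: "h : FS" "xi = weak_jet k z h" using xi(1) by (auto simp: SX_eq)
  have m: "weak_jet (n + k) z h : SX (n + k) z" using h(1) by (simp add: SX_eq)
  have "F = ?I (duality_map X (n + k) z (weak_jet (n + k) z h))"
  using square_last[OF adm z k m] xi(2) h(2) by (simp add: last_coords_weak_jet)
  then show "F : ?I ` points (DX (n + k) z)" using duality_bij(3)[OF adm z _ m] k by simp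
 qed
 then have "?I ` points (DX (n + k) z) = points (DX k z)" using I by (auto simp: bounded_operator_def linear_between_def)
 then show ?thesis using P I inj ker by (simp add: short_exact_def)
qed

text \<open>The kernel of the second arrow is found by a diagram chase: by
  \<open>square_last\<close> the functional of such an element lies in the kernel of the lower row,
  so it comes from a functional of order \<open>n\<close>, and the element representing the latter
  is the preimage by \<open>square_append\<close> and injectivity.\<close>

lemma top_row_exact:
 assumes adm: "admissible X" and z: "z : Omega" and n: "n >= 1" and k: "k >= 1"
 shows "short_exact (rochberg_star X n z) (append_zeros k) (rochberg_star X (n + k) z) (last_coords k) (rochberg_star X k z)"
proof -
 note A = append_zeros_star[OF z, of n k] and L = last_coords_star[of n k z]
 have nk: "n + k >= 1" using n by simp
 have inj: "inj_on (append_zeros k) (SX n z)"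
 proof (rule inj_onI, rule ext)
  fix xi eta i assume "append_zeros k xi = append_zeros k eta"
  from fun_cong[OF this, of "i + k"] show "xi i = eta i" by (simp add: append_zeros_def)
 qed
 have A': "append_zeros k xi : SX (n + k) z" if "xi : SX n z" for xi
  using A that by (auto simp: bounded_operator_def linear_between_def)
 have "eta : append_zeros k ` SX n z" if eta: "eta : SX (n + k) z" "last_coords k eta = 0" for eta
 proof -
  let ?G = "duality_map X (n + k) z eta"
  have "0 : SX k z" by (rule complex_vector.subspace_0[OF normed_space_onD(1)[OF normed_space_on_star[OF z]]])
  moreover have "extends_pairing X k z 0 0"
  using complex_vector.subspace_0[OF normed_space_onD(1)[OF normed_space_on_dual[OF normed_space_on_rochberg[OF z]]]]
  by (auto simp: extends_pairing_def)
  ultimately have "duality_map X k z 0 = 0" by (rule duality_map_eqI[OF adm z k])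
  then have "banach_adjoint (rochberg X k z) (append_zeros n) ?G = 0" using square_last[OF adm z k eta(1)] eta(2) by simp
  then obtain F where F: "F : points (DX n z)" "banach_adjoint (rochberg X (n + k) z) (last_coords n) F = ?G"
  by (rule kernel_adjoint[OF adm z duality_bij(3)[OF adm z nk eta(1)]])
  obtain xi where xi: "xi : SX n z" "duality_map X n z xi = F" using duality_bij(1)[OF adm z n F(1)] by blast
  have "append_zeros k xi = eta"
  by (rule duality_bij(2)[OF adm z nk A'[OF xi(1)] eta(1)]) (use square_append[OF adm z n xi(1)] F(2) xi(2) in simp)
  then show ?thesis using xi(1) by blast
 qed
 moreover have "last_coords k (append_zeros k xi) = 0" for xi :: "nat => 'a => complex"
  by (simp add: last_append zero_fun_def)
 ultimately have ker: "append_zeros k ` SX n z = {eta : SX (n + k) z. last_coords k eta = 0}" using A' by auto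
 have "last_coords k ` SX (n + k) z = SX k z" unfolding SX_eq image_image last_coords_weak_jet ..
 then show ?thesis using A L inj ker by (simp add: short_exact_def)
qed

end

theorem theorem5p4:
  fixes X :: "'a::complex_banach interp_family" and n k :: nat and z :: complex
  assumes "interpolation_family X"
    and "admissible X"
    and "n \<ge> 1" and "k \<ge> 1"
    and "z \<in> region X"
  shows
    \<comment> \<open>the vertical maps are well defined\<close>
    "(\<forall>m\<in>{n, n + k, k}. \<forall>\<xi>\<in>points (rochberg_star X m z). \<exists>!\<psi>. extends_pairing X m z \<xi> \<psi>) \<and>
     \<comment> \<open>the vertical maps are linear homeomorphisms\<close>
     (\<forall>m\<in>{n, n + k, k}.
        linear_homeomorphism (rochberg_star X m z) (dual_space (rochberg X m z)) (duality_map X m z)) \<and>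
     \<comment> \<open>the rows are exact\<close>
     short_exact
       (rochberg_star X n z) (append_zeros k) (rochberg_star X (n + k) z) (last_coords k)
       (rochberg_star X k z) \<and>
     short_exact
       (dual_space (rochberg X n z)) (banach_adjoint (rochberg X (n + k) z) (last_coords n))
       (dual_space (rochberg X (n + k) z)) (banach_adjoint (rochberg X k z) (append_zeros n))
       (dual_space (rochberg X k z)) \<and>
     \<comment> \<open>the squares commute\<close>
     (\<forall>\<xi>\<in>points (rochberg_star X n z).
        duality_map X (n + k) z (append_zeros k \<xi>) =
          banach_adjoint (rochberg X (n + k) z) (last_coords n) (duality_map X n z \<xi>)) \<and>
     (\<forall>\<xi>\<in>points (rochberg_star X (n + k) z).
        duality_map X k z (last_coords k \<xi>) =
          banach_adjoint (rochberg X k z) (append_zeros n) (duality_map X (n + k) z \<xi>))"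
proof -
  interpret interpolation_family X by (rule assms(1))
  note adm = assms(2) and z = assms(5) and n = assms(3) and k = assms(4)
  have m: "m \<ge> 1" if "m \<in> {n, n + k, k}" for m using that n k by auto
  show ?thesis
    by (intro conjI ballI duality_map(1)[OF adm z m] duality_linear_homeomorphism[OF adm z m]
        top_row_exact[OF adm z n k] bottom_row_exact[OF adm z k] square_append[OF adm z n] square_last[OF adm z k])
qed

end
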